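(* Let $\mathfrak A$ be the AF algebra of the Pascal triangle with memory, and for irrational $\theta\in(0,1)$ let $\mathfrak F_\theta$ be the Effros–Shen algebra of $\theta$; for integers $q,q'\ge 1$ let $\mathfrak A_{(q,q')}$ be the AF algebra defined in the context; let $\widetilde{\mathbb K}=\mathbb C I+\mathbb K$ be the unitized compact operators on a separable infinite-dimensional Hilbert space. Then: (i) For each irrational $\theta\in(0,1)$ there is a primitive ideal $I_\theta$ of $\mathfrak A$ such that $\mathfrak A/I_\theta\cong\mathfrak F_\theta$. (ii) For each rational $\theta=\frac pq\in(0,1)$ in lowest terms, with $\overline p\in\{1,\dots,q-1\}$ denoting the multiplicative inverse of $p$ modulo $q$, there are primitive ideals $I_\theta,I_\theta^+,I_\theta^-$ of $\mathfrak A$ such that $\mathfrak A/I_\theta\cong M_q(\mathbb C)$, $\mathfrak A/I_\theta^-\cong\mathfrak A_{(q,\overline p)}$ and $\mathfrak A/I_\theta^+\cong\mathfrak A_{(q,q-\overline p)}$. (iii) There are primitive ideals $I_0,I_0^+,I_1,I_1^-$ of $\mathfrak A$ such that $\mathfrak A/I_0\cong\mathfrak A/I_1\cong\mathbb C$ and $\mathfrak A/I_0^+\cong\mathfrak A/I_1^-\cong\widetilde{\mathbb K}$.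
   Context: The Pascal triangle with memory $\mathcal G$ is the graph with vertices $(n,k)$, $n\ge 0$, $0\le k\le 2^n$ (floor $n$), with a single edge joining $(n,k)$ to $(n+1,\ell)$ exactly when $|2k-\ell|\le 1$, and no other edges. Integers $q(n,k)$ are defined by $q(n,0)=q(n,2^n)=1$, $q(n+1,2k)=q(n,k)$ for $0\le k\le 2^n$, and $q(n+1,2k+1)=q(n,k)+q(n,k+1)$ for $0\le k<2^n$. The AF algebra $\mathfrak A=\varinjlim\mathfrak A_n$ is the inductive limit with $\mathfrak A_n=\bigoplus_{0\le k\le 2^n}M_{q(n,k)}(\mathbb C)$ and unital embeddings $\mathfrak A_n\hookrightarrow\mathfrak A_{n+1}$ given by regarding $\mathcal G$ as a Bratteli diagram (multiplicity one for each edge). Effros–Shen algebra: for irrational $\theta\in(0,1)$ with continued fraction $\theta=[a_1,a_2,\dots]=\cfrac{1}{a_1+\cfrac1{a_2+\cdots}}$, $a_i\ge1$, put $q_{-1}=0$, $q_0=1$, $q_n=a_nq_{n-1}+q_{n-2}$. Then $\mathfrak F_\theta=\varinjlim F_n$, where $F_0=\mathbb C$, $F_n=M_{q_n}(\mathbb C)\oplus M_{q_{n-1}}(\mathbb C)$ for $n\ge1$, the embedding $F_0\to F_1$ is unital, and the unital embedding $F_{n-1}\to F_n$ ($n\ge 2$) has multiplicity $a_n$ from $M_{q_{n-1}}$ to $M_{q_n}$, multiplicity $1$ from $M_{q_{n-2}}$ to $M_{q_n}$, multiplicity $1$ from $M_{q_{n-1}}$ to the second summand $M_{q_{n-1}}$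 of $F_n$, and multiplicity $0$ from $M_{q_{n-2}}$ to that second summand. For integers $q,q'\ge1$, $\mathfrak A_{(q,q')}$ is the inductive limit of $M_q(\mathbb C)\oplus M_{q'+nq}(\mathbb C)$, $n\ge0$, with connecting maps $(x,y)\mapsto(x,\operatorname{diag}(x,y))$. (For $q=q'=1$ this is the unitization $\widetilde{\mathbb K}$ of the compacts.) *)

theory Defs
  imports
    "HOL-Analysis.Analysis"
    "HOL-Algebra.QuotRing"
    "HOL-Number_Theory.Cong"
    "Jordan_Normal_Form.Schur_Decomposition"
    "Jordan_Normal_Form.VS_Connect"
begin

section \<open>Complex star-algebras with a norm\<close>

record 'a star_alg = "(complex, 'a) module" +
  star :: "'a \<Rightarrow> 'a"
  nrm :: "'a \<Rightarrow> real"

text \<open>Homomorphisms are unital, because \<open>ring_hom\<close> preserves \<open>\<one>\<close>.\<close>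

definition star_hom :: "'a star_alg \<Rightarrow> 'b star_alg \<Rightarrow> ('a \<Rightarrow> 'b) set" where
  "star_hom A B = {h \<in> Ring.ring_hom A B.
     (\<forall>c. \<forall>x\<in>carrier A. h (c \<odot>\<^bsub>A\<^esub> x) = c \<odot>\<^bsub>B\<^esub> h x) \<and>
     (\<forall>x\<in>carrier A. h (star A x) = star B (h x))}"

text \<open>For C*-algebras a bijective star-homomorphism is automatically isometric, so the norm
  does not occur here.\<close>

definition star_isomorphic :: "'a star_alg \<Rightarrow> 'b star_alg \<Rightarrow> bool" (infix "\<simeq>\<^sub>*" 50) where
  "A \<simeq>\<^sub>* B \<longleftrightarrow> (\<exists>h\<in>star_hom A B. bij_betw h (carrier A) (carrier B))"

text \<open>The unions in \<open>smult\<close> and \<open>star\<close> are over the representatives of a coset;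
  for a closed ideal (which is self-adjoint) all representatives give the same coset.\<close>

definition star_quot :: "'a star_alg \<Rightarrow> 'a set \<Rightarrow> 'a set star_alg" where
  "star_quot A I = \<lparr>
     carrier = carrier (A Quot I),
     mult = mult (A Quot I),
     one = one (A Quot I),
     zero = zero (A Quot I),
     add = add (A Quot I),
     smult = (\<lambda>c X. \<Union>x\<in>X. I +>\<^bsub>A\<^esub> (c \<odot>\<^bsub>A\<^esub> x)),
     star = (\<lambda>X. \<Union>x\<in>X. I +>\<^bsub>A\<^esub> (star A x)),
     nrm = (\<lambda>X. INF x\<in>X. nrm A x)\<rparr>"

definition complex_alg :: "complex star_alg" where
  "complex_alg = \<lparr>carrier = UNIV, mult = (*), one = 1, zero = 0, add = (+),
     smult = (*), star = cnj, nrm = cmod\<rparr>"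


section \<open>Inductive limits\<close>

definition bounded_prod :: "(nat \<Rightarrow> 'a star_alg) \<Rightarrow> (nat \<Rightarrow> 'a) star_alg" where
  "bounded_prod A = \<lparr>
     carrier = {x. (\<forall>n. x n \<in> carrier (A n)) \<and> bdd_above (range (\<lambda>n. nrm (A n) (x n)))},
     mult = (\<lambda>x y n. x n \<otimes>\<^bsub>A n\<^esub> y n),
     one = (\<lambda>n. \<one>\<^bsub>A n\<^esub>),
     zero = (\<lambda>n. \<zero>\<^bsub>A n\<^esub>),
     add = (\<lambda>x y n. x n \<oplus>\<^bsub>A n\<^esub> y n),
     smult = (\<lambda>c x n. c \<odot>\<^bsub>A n\<^esub> x n),
     star = (\<lambda>x n. star (A n) (x n)),
     nrm = (\<lambda>x. SUP n. nrm (A n) (x n))\<rparr>"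

definition null_seqs :: "(nat \<Rightarrow> 'a star_alg) \<Rightarrow> (nat \<Rightarrow> 'a) set" where
  "null_seqs A = {x \<in> carrier (bounded_prod A). (\<lambda>n. nrm (A n) (x n)) \<longlonglongrightarrow> 0}"

definition threads :: "(nat \<Rightarrow> 'a star_alg) \<Rightarrow> (nat \<Rightarrow> 'a \<Rightarrow> 'a) \<Rightarrow> (nat \<Rightarrow> 'a) set" where
  "threads A \<phi> = {x \<in> carrier (bounded_prod A). \<exists>N. \<forall>n\<ge>N. x (Suc n) = \<phi> n (x n)}"

text \<open>The standard model of the C*-algebraic inductive limit of
  \<open>A 0 \<rightarrow> A 1 \<rightarrow> \<dots>\<close> with connecting maps \<open>\<phi> n : A n \<rightarrow> A (Suc n)\<close>: the closure, in bounded
  sequences modulo null sequences, of the algebra of eventually coherent sequences.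
  The quotient norm there is the limes superior of the norms, so every \<open>A n\<close> with injective
  connecting maps embeds isometrically, and the union of the images is dense.\<close>

definition cstar_limit ::
    "(nat \<Rightarrow> 'a star_alg) \<Rightarrow> (nat \<Rightarrow> 'a \<Rightarrow> 'a) \<Rightarrow> (nat \<Rightarrow> 'a) set star_alg" where
  "cstar_limit A \<phi> = (let Q = star_quot (bounded_prod A) (null_seqs A) in
     Q\<lparr>carrier := {X \<in> carrier Q. \<forall>\<epsilon>>0. \<exists>x\<in>threads A \<phi>.
        nrm Q (X \<ominus>\<^bsub>Q\<^esub> (null_seqs A +>\<^bsub>bounded_prod A\<^esub> x)) < \<epsilon>}\<rparr>)"


section \<open>Matrix algebras and Bratteli diagrams\<close>

definition l2_norm :: "complex vec \<Rightarrow> real" where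
  "l2_norm v = sqrt (\<Sum>i<dim_vec v. (cmod (v $ i))\<^sup>2)"

definition op_norm :: "complex mat \<Rightarrow> real" where
  "op_norm A = (SUP v\<in>{v \<in> carrier_vec (dim_col A). l2_norm v \<le> 1}. l2_norm (A *\<^sub>v v))"

definition matrix_alg :: "nat \<Rightarrow> complex mat star_alg" where
  "matrix_alg d = \<lparr>carrier = carrier_mat d d, mult = (*), one = 1\<^sub>m d, zero = 0\<^sub>m d d, add = (+),
     smult = (\<cdot>\<^sub>m), star = mat_adjoint, nrm = op_norm\<rparr>"

text \<open>The direct sum of the full matrix algebras whose sizes are listed in \<open>ds\<close>.\<close>

definition multimatrix_alg :: "nat list \<Rightarrow> complex mat list star_alg" where
  "multimatrix_alg ds = \<lparr>
     carrier = {xs. list_all2 (\<lambda>x d. x \<in> carrier_mat d d) xs ds},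
     mult = map2 (*),
     one = map (\<lambda>d. 1\<^sub>m d) ds,
     zero = map (\<lambda>d. 0\<^sub>m d d) ds,
     add = map2 (+),
     smult = (\<lambda>c. map (\<lambda>x. c \<cdot>\<^sub>m x)),
     star = map mat_adjoint,
     nrm = (\<lambda>xs. Max (op_norm ` set xs))\<rparr>"

text \<open>\<open>dims B n\<close> lists the matrix sizes at floor \<open>n\<close>; \<open>edges B n k l\<close> is the number of edges
  from vertex \<open>k\<close> of floor \<open>n\<close> to vertex \<open>l\<close> of floor \<open>n + 1\<close>.\<close>

record bratteli =
  dims :: "nat \<Rightarrow> nat list"
  edges :: "nat \<Rightarrow> nat \<Rightarrow> nat \<Rightarrow> nat"

definition bratteli_unital :: "bratteli \<Rightarrow> bool" where
  "bratteli_unital B \<longleftrightarrow> (\<forall>n. \<forall>l<length (dims B (Suc n)).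
     dims B (Suc n) ! l = (\<Sum>k<length (dims B n). edges B n k l * dims B n ! k))"

text \<open>Summand \<open>l\<close> of the image is block diagonal, with \<open>edges B n k l\<close> copies of \<open>xs ! k\<close>, in
  the order of increasing \<open>k\<close>. Any other choice of unital embeddings with the same multiplicities
  is unitarily equivalent to this one and gives an isomorphic limit.\<close>

definition bratteli_map :: "bratteli \<Rightarrow> nat \<Rightarrow> complex mat list \<Rightarrow> complex mat list" where
  "bratteli_map B n xs =
     map (\<lambda>l. diag_block_mat
            (concat (map (\<lambda>k. replicate (edges B n k l) (xs ! k)) [0..<length (dims B n)])))
       [0..<length (dims B (Suc n))]"

definition af_algebra :: "bratteli \<Rightarrow> (nat \<Rightarrow> complex mat list) set star_alg" where
  "af_algebra B = cstar_limit (\<lambda>n. multimatrix_alg (dims B n)) (bratteli_map B)"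


fun pascal_q :: "nat \<Rightarrow> nat \<Rightarrow> nat" where
  "pascal_q 0 k = 1"
| "pascal_q (Suc n) l =
     (if even l then pascal_q n (l div 2)
      else pascal_q n (l div 2) + pascal_q n (l div 2 + 1))"

definition pascal_diagram :: bratteli where
  "pascal_diagram = \<lparr>
     dims = (\<lambda>n. map (pascal_q n) [0..<2 ^ n + 1]),
     edges = (\<lambda>n k l. if \<bar>2 * int k - int l\<bar> \<le> 1 then 1 else 0)\<rparr>"

lemma pascal_unital: "bratteli_unital pascal_diagram"
  unfolding bratteli_unital_def
proof (intro allI impI)
  fix n l assume l: "l < length (dims pascal_diagram (Suc n))"
  define S where "S = {k. k < 2 ^ n + 1 \<and> \<bar>2 * int k - int l\<bar> \<le> 1}"
  have "l \<le> 2 * 2 ^ n" using l by (simp add: pascal_diagram_def)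
  then have S: "S = (if even l then {l div 2} else {l div 2, l div 2 + 1})"
    unfolding S_def by (auto elim!: evenE oddE)
  have "(\<Sum>k<length (dims pascal_diagram n). edges pascal_diagram n k l * dims pascal_diagram n ! k)
      = (\<Sum>k<2 ^ n + 1. if \<bar>2 * int k - int l\<bar> \<le> 1 then pascal_q n k else 0)"
    by (rule sum.cong) (auto simp: pascal_diagram_def nth_append less_Suc_eq simp del: upt_Suc)
  also have "\<dots> = (\<Sum>k\<in>S. pascal_q n k)"
    unfolding S_def by (subst sum.inter_filter[symmetric]) (auto simp: lessThan_def)
  also have "\<dots> = dims pascal_diagram (Suc n) ! l"
    using l unfolding S by (simp add: pascal_diagram_def nth_append less_Suc_eq del: upt_Suc)
  finally show "dims pascal_diagram (Suc n) ! l
      = (\<Sum>k<length (dims pascal_diagram n). edges pascal_diagram n k l * dims pascal_diagram n ! k)"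
    by simp
qed

definition pascal_algebra :: "(nat \<Rightarrow> complex mat list) set star_alg" where
  "pascal_algebra = af_algebra pascal_diagram"

lemma pascal_q_boundary: "pascal_q n 0 = 1" "pascal_q n (2 ^ n) = 1"
  by (induction n) auto

lemma pascal_q_rec:
  "pascal_q (Suc n) (2 * k) = pascal_q n k"
  "pascal_q (Suc n) (2 * k + 1) = pascal_q n k + pascal_q n (k + 1)"
  by simp_all


text \<open>\<open>cf_digit \<theta> n\<close> is the \<open>n\<close>-th partial quotient \<open>a\<^sub>n\<close>, for \<open>n \<ge> 1\<close>, of
  \<open>\<theta> = [a\<^sub>1, a\<^sub>2, \<dots>]\<close>; see \<open>cf_digit_pos\<close> and \<open>cf_digit_converges\<close> below. The value at \<open>0\<close> is
  irrelevant.\<close>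

definition cf_digit :: "real \<Rightarrow> nat \<Rightarrow> nat" where
  "cf_digit \<theta> n = nat \<lfloor>1 / (((\<lambda>x. frac (1 / x)) ^^ (n - 1)) \<theta>)\<rfloor>"

text \<open>\<open>cf_value a i n\<close> is the finite continued fraction \<open>[a\<^sub>i, a\<^sub>i\<^sub>+\<^sub>1, \<dots>]\<close> with \<open>n\<close> entries.\<close>

fun cf_value :: "(nat \<Rightarrow> nat) \<Rightarrow> nat \<Rightarrow> nat \<Rightarrow> real" where
  "cf_value a i 0 = 0"
| "cf_value a i (Suc n) = 1 / (real (a i) + cf_value a (Suc i) n)"

fun cf_denom :: "(nat \<Rightarrow> nat) \<Rightarrow> nat \<Rightarrow> nat" where
  "cf_denom a 0 = 1"
| "cf_denom a (Suc 0) = a 1"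
| "cf_denom a (Suc (Suc n)) = a (Suc (Suc n)) * cf_denom a (Suc n) + cf_denom a n"

lemma gauss_orbit:
  fixes \<theta> :: real
  assumes "0 < \<theta>" "\<theta> < 1" "\<theta> \<notin> \<rat>"
  defines "r \<equiv> \<lambda>n. ((\<lambda>x. frac (1 / x)) ^^ n) \<theta>"
  shows "0 < r n \<and> r n < 1 \<and> r n \<notin> \<rat>"
proof (induction n)
  case 0
  then show ?case using assms by simp
next
  case (Suc n)
  have "1 / r n \<notin> \<rat>"
    using Suc Rats_inverse[of "1 / r n"] by auto
  then have irr: "frac (1 / r n) \<notin> \<rat>"
    unfolding frac_def using Rats_add[of "1 / r n - of_int \<lfloor>1 / r n\<rfloor>" "of_int \<lfloor>1 / r n\<rfloor>"] by auto
  then have "frac (1 / r n) \<noteq> 0" by (metis Rats_0)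
  then have "0 < frac (1 / r n)" using frac_ge_0[of "1 / r n"] by linarith
  with irr frac_lt_1 show ?case by (simp add: r_def)
qed

lemma cf_digit_pos:
  assumes "0 < \<theta>" "\<theta> < 1" "\<theta> \<notin> \<rat>"
  shows "1 \<le> cf_digit \<theta> n"
proof -
  define x where "x = ((\<lambda>x. frac (1 / x)) ^^ (n - 1)) \<theta>"
  have "0 < x" "x < 1" unfolding x_def using gauss_orbit[OF assms] by auto
  then have "1 \<le> \<lfloor>1 / x\<rfloor>" by (simp add: le_floor_iff)
  then show ?thesis unfolding cf_digit_def x_def[symmetric] by linarith
qed

lemma cf_digit_converges:
  assumes "0 < \<theta>" "\<theta> < 1" "\<theta> \<notin> \<rat>"
  shows "cf_value (cf_digit \<theta>) 1 \<longlonglongrightarrow> \<theta>"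
proof -
  define r where "r = (\<lambda>n. ((\<lambda>x. frac (1 / x)) ^^ n) \<theta>)"
  define a where "a = cf_digit \<theta>"
  have r: "0 < r n" "r n < 1" for n
    unfolding r_def using gauss_orbit[OF assms] by auto
  have a: "1 \<le> real (a n)" for n
    using cf_digit_pos[OF assms, of n] unfolding a_def by simp
  have r_rec: "r n = 1 / (real (a (Suc n)) + r (Suc n))" for n
  proof -
    have "0 \<le> \<lfloor>1 / r n\<rfloor>" using r[of n] by simp
    then have "real (a (Suc n)) + r (Suc n) = 1 / r n"
      unfolding a_def cf_digit_def r_def by (simp add: frac_def)
    then show ?thesis by simp
  qed
  have val_nonneg: "0 \<le> cf_value a i n" for i n
    by (induction n arbitrary: i) (auto simp: add_nonneg_nonneg)
  have contraction: "\<bar>1 / (c + 1 / (d + x)) - 1 / (c + 1 / (d + y))\<bar> \<le> \<bar>x - y\<bar> / 4"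
    if "1 \<le> c" "1 \<le> d" "0 \<le> x" "0 \<le> y" for c d x y :: real
  proof -
    define u v where "u = c * (d + x) + 1" and "v = c * (d + y) + 1"
    have "1 * 1 \<le> c * (d + x)" "1 * 1 \<le> c * (d + y)"
      using that by (intro mult_mono; simp)+
    then have uv: "2 \<le> u" "2 \<le> v" by (auto simp: u_def v_def)
    then have "2 * 2 \<le> u * v" by (intro mult_mono) auto
    moreover have "1 / (c + 1 / (d + x)) = (d + x) / u" "1 / (c + 1 / (d + y)) = (d + y) / v"
      using that uv by (auto simp: u_def v_def field_simps)
    moreover have "(d + x) / u - (d + y) / v = (x - y) / (u * v)"
      using uv by (simp add: diff_frac_eq) (simp add: u_def v_def algebra_simps)
    ultimately have "\<bar>1 / (c + 1 / (d + x)) - 1 / (c + 1 / (d + y))\<bar> = \<bar>x - y\<bar> / (u * v)"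
      and "4 \<le> u * v"
      using uv by (auto simp: abs_mult)
    then show ?thesis
      using frac_le[of "\<bar>x - y\<bar>" "\<bar>x - y\<bar>" 4 "u * v"] by simp
  qed
  have bound: "\<bar>cf_value a (Suc i) n - r i\<bar> \<le> 2 * (1 / 2) ^ n" for n i
  proof (induction n arbitrary: i rule: induct_nat_012)
    case 0
    then show ?case using r[of i] by simp
  next
    case 1
    have "0 \<le> cf_value a (Suc i) (Suc 0)" "cf_value a (Suc i) (Suc 0) \<le> 1"
      using a[of "Suc i"] by auto
    then have "\<bar>cf_value a (Suc i) (Suc 0) - r i\<bar> \<le> 1" using r[of i] by linarith
    then show ?case by simp
  next
    case (ge2 n)
    have "\<bar>cf_value a (Suc i) (Suc (Suc n)) - r i\<bar> \<le> \<bar>cf_value a (Suc (Suc (Suc i))) n - r (Suc (Suc i))\<bar> / 4"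
      using contraction[OF a a val_nonneg, of "r (Suc (Suc i))" "Suc i" "Suc (Suc i)"]
        r_rec[of i] r_rec[of "Suc i"] r[of "Suc (Suc i)"] by simp
    also have "\<dots> \<le> 2 * (1 / 2) ^ n / 4"
      using ge2(1)[of "Suc (Suc i)"] by simp
    finally show ?case by simp
  qed
  have lim: "(\<lambda>n. 2 * (1 / 2) ^ n :: real) \<longlonglongrightarrow> 0"
    by (rule tendsto_mult_right_zero) (rule LIMSEQ_realpow_zero; simp)
  have "(\<lambda>n. cf_value a 1 n - r 0) \<longlonglongrightarrow> 0"
    by (rule Lim_null_comparison[OF _ lim], rule always_eventually)
       (use bound[of 0] in \<open>simp only: real_norm_def One_nat_def, blast\<close>)
  then show ?thesis
    by (simp add: LIM_zero_iff a_def r_def)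
qed

definition effros_shen_diagram :: "real \<Rightarrow> bratteli" where
  "effros_shen_diagram \<theta> = (let a = cf_digit \<theta> in \<lparr>
     dims = (\<lambda>n. case n of 0 \<Rightarrow> [1] | Suc m \<Rightarrow> [cf_denom a (Suc m), cf_denom a m]),
     edges = (\<lambda>n k l. if l = 0 then (if k = 0 then a (Suc n) else 1)
                      else (if k = 0 then 1 else 0))\<rparr>)"

lemma effros_shen_unital: "bratteli_unital (effros_shen_diagram \<theta>)"
  unfolding bratteli_unital_def effros_shen_diagram_def Let_def
  by (auto simp: less_Suc_eq numeral_2_eq_2 split: nat.splits)

definition effros_shen :: "real \<Rightarrow> (nat \<Rightarrow> complex mat list) set star_alg" where
  "effros_shen \<theta> = af_algebra (effros_shen_diagram \<theta>)"


text \<open>The diagram of \<open>\<AA>\<^sub>(\<^sub>q\<^sub>,\<^sub>q\<^sub>'\<^sub>)\<close>: with these multiplicities \<open>bratteli_map\<close> is exactly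
  \<open>(x, y) \<mapsto> (x, diag(x, y))\<close>.\<close>

definition pair_diagram :: "nat \<Rightarrow> nat \<Rightarrow> bratteli" where
  "pair_diagram q q' = \<lparr>
     dims = (\<lambda>n. [q, q' + n * q]),
     edges = (\<lambda>n k l. if k = 1 \<and> l = 0 then 0 else 1)\<rparr>"

lemma pair_unital: "bratteli_unital (pair_diagram q q')"
  unfolding bratteli_unital_def pair_diagram_def
  by (auto simp: less_Suc_eq numeral_2_eq_2)

definition pair_algebra :: "nat \<Rightarrow> nat \<Rightarrow> (nat \<Rightarrow> complex mat list) set star_alg" where
  "pair_algebra q q' = af_algebra (pair_diagram q q')"


section \<open>Hilbert spaces and operators\<close>

text \<open>The fields \<open>mult\<close> and \<open>one\<close> inherited from rings play no role for vector spaces.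
  The inner product is linear in its second argument.\<close>

record 'h hilbert = "(complex, 'h) module" +
  ip :: "'h \<Rightarrow> 'h \<Rightarrow> complex"

definition hnorm :: "'h hilbert \<Rightarrow> 'h \<Rightarrow> real" where
  "hnorm H x = sqrt (Re (ip H x x))"

text \<open>The locale \<open>Metric_space\<close> requires symmetry and nonnegativity also outside the carrier.\<close>

definition hdist :: "'h hilbert \<Rightarrow> 'h \<Rightarrow> 'h \<Rightarrow> real" where
  "hdist H x y = (if x \<in> carrier H \<and> y \<in> carrier H then hnorm H (x \<ominus>\<^bsub>H\<^esub> y) else 0)"

abbreviation htopology :: "'h hilbert \<Rightarrow> 'h topology" where
  "htopology H \<equiv> Metric_space.mtopology (carrier H) (hdist H)"

locale hilbert_space = vectorspace class_ring H for H :: "'h hilbert" +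
  assumes ip_add: "\<lbrakk>x \<in> carrier H; y \<in> carrier H; z \<in> carrier H\<rbrakk>
      \<Longrightarrow> ip H x (y \<oplus>\<^bsub>H\<^esub> z) = ip H x y + ip H x z"
    and ip_smult: "\<lbrakk>x \<in> carrier H; y \<in> carrier H\<rbrakk> \<Longrightarrow> ip H x (c \<odot>\<^bsub>H\<^esub> y) = c * ip H x y"
    and ip_cnj: "\<lbrakk>x \<in> carrier H; y \<in> carrier H\<rbrakk> \<Longrightarrow> ip H y x = cnj (ip H x y)"
    and ip_pos: "\<lbrakk>x \<in> carrier H; x \<noteq> \<zero>\<^bsub>H\<^esub>\<rbrakk> \<Longrightarrow> 0 < Re (ip H x x)"
    and complete: "Metric_space.mcomplete (carrier H) (hdist H)"

text \<open>Operators are represented by functions that are \<open>extensional\<close> on the carrier, so that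
  equality of operators is equality of functions.\<close>

definition bounded_operators :: "'h hilbert \<Rightarrow> ('h \<Rightarrow> 'h) set" where
  "bounded_operators H = {T \<in> extensional (carrier H) \<inter> LinearCombinations.module_hom class_ring H H.
     \<exists>C. \<forall>x\<in>carrier H. hnorm H (T x) \<le> C * hnorm H x}"

definition adjoint_op :: "'h hilbert \<Rightarrow> ('h \<Rightarrow> 'h) \<Rightarrow> ('h \<Rightarrow> 'h)" where
  "adjoint_op H T = (THE S. S \<in> bounded_operators H \<and>
     (\<forall>x\<in>carrier H. \<forall>y\<in>carrier H. ip H (S x) y = ip H x (T y)))"

definition operator_alg :: "'h hilbert \<Rightarrow> ('h \<Rightarrow> 'h) star_alg" where
  "operator_alg H = \<lparr>
     carrier = bounded_operators H,
     mult = compose (carrier H),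
     one = (\<lambda>x\<in>carrier H. x),
     zero = (\<lambda>x\<in>carrier H. \<zero>\<^bsub>H\<^esub>),
     add = (\<lambda>S T. \<lambda>x\<in>carrier H. S x \<oplus>\<^bsub>H\<^esub> T x),
     smult = (\<lambda>c T. \<lambda>x\<in>carrier H. c \<odot>\<^bsub>H\<^esub> T x),
     star = adjoint_op H,
     nrm = (\<lambda>T. SUP x\<in>{x \<in> carrier H. hnorm H x \<le> 1}. hnorm H (T x))\<rparr>"

definition compact_operators :: "'h hilbert \<Rightarrow> ('h \<Rightarrow> 'h) set" where
  "compact_operators H = {T \<in> bounded_operators H.
     compactin (htopology H) (htopology H closure_of (T ` {x \<in> carrier H. hnorm H x \<le> 1}))}"

definition unitized_compacts :: "'h hilbert \<Rightarrow> ('h \<Rightarrow> 'h) star_alg" where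
  "unitized_compacts H = (operator_alg H)\<lparr>carrier :=
     {c \<odot>\<^bsub>operator_alg H\<^esub> \<one>\<^bsub>operator_alg H\<^esub> \<oplus>\<^bsub>operator_alg H\<^esub> T | c T. T \<in> compact_operators H}\<rparr>"


section \<open>Primitive ideals\<close>

definition irreducible_rep :: "'a star_alg \<Rightarrow> 'h hilbert \<Rightarrow> ('a \<Rightarrow> 'h \<Rightarrow> 'h) \<Rightarrow> bool" where
  "irreducible_rep A H \<pi> \<longleftrightarrow> hilbert_space H \<and> carrier H \<noteq> {\<zero>\<^bsub>H\<^esub>} \<and>
     \<pi> \<in> star_hom A (operator_alg H) \<and>
     (\<forall>W. VectorSpace.subspace class_ring W H \<and> closedin (htopology H) W \<and>
          (\<forall>a\<in>carrier A. \<forall>w\<in>W. \<pi> a w \<in> W) \<longrightarrow> W = {\<zero>\<^bsub>H\<^esub>} \<or> W = carrier H)"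

text \<open>Taking the underlying set of the Hilbert space inside the type of the algebra is no
  restriction: an irreducible representation of a C*-algebra is algebraically cyclic (Kadison), so
  its space is in bijection with a set of representatives of a quotient of the algebra.\<close>

definition primitive_ideal :: "'a star_alg \<Rightarrow> 'a set \<Rightarrow> bool" where
  "primitive_ideal A I \<longleftrightarrow> (\<exists>(H :: 'a hilbert) \<pi>.
     irreducible_rep A H \<pi> \<and> I = a_kernel A (operator_alg H) \<pi>)"

end

theory Submission
  imports Defs "HOL-Algebra.Subrings"
begin

text \<open>Between two neighbouring vertices of the Pascal diagram the next floor inserts a vertex whose size is the
  sum of theirs, and every coprime pair occurs as a neighbouring pair. Following a pair of neighbours
  down the diagram and discarding all other vertices gives a quotient of \<open>pascal_algebra\<close>: if the same
  vertex of the pair is kept for ever, the quotient is some \<open>pair_algebra q q'\<close>; if the kept vertex changes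
  after \<open>a\<^sub>1, a\<^sub>2, \<dots>\<close> steps, it is the Effros-Shen algebra of \<open>[a\<^sub>1, a\<^sub>2, \<dots>]\<close>. The restriction maps intertwine the
  connecting maps after permuting bases, and elements lift without increase of the norm, which makes the map of
  limits surjective.

  An ideal is primitive if the quotient has a faithful irreducible representation. In all cases it is the limit of
  the identity representations of a sequence of full matrix summands, each of which is embedded as the upper left
  corner of the next. The stationary summand of \<open>pair_algebra q q'\<close> yields \<open>M\<^sub>q\<close>, and the other representation of
  \<open>pair_algebra 1 1\<close> has the scalars plus the compact operators as its image, because a compact operator is the
  norm limit of its finite sections.\<close>

section \<open>Kernels of star-homomorphisms\<close>

text \<open>Two facts of C*-theory are bypassed: that the range of a star-homomorphism is closed,
  and that an injective one is isometric. The first is replaced by liftings that do not increase the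
  norm: a preimage of a limit element is built by successive corrections whose sizes form a
  geometric series. The second is replaced by an inequality: one step down the diagram, every
  summand of a level occurs inside the summand that is represented, so nothing is lost in norm. All
  limits are computed on sequences that are Cauchy along the connecting maps instead of on cosets.
  Primitivity is defined by Hilbert spaces inside the type of the algebra, while the compact
  operators live on an arbitrary given space; so the representation that makes the kernel primitive
  and the map that identifies the quotient are kept apart, and only their kernels are compared. That
  coprime pairs occur as neighbours is the subtractive Euclidean algorithm run along the
  diagram.\<close>

lemma star_homI:
  assumes "\<And>x. x \<in> carrier A \<Longrightarrow> h x \<in> carrier B"
    and "\<And>x y. x \<in> carrier A \<Longrightarrow> y \<in> carrier A \<Longrightarrow> h (x \<otimes>\<^bsub>A\<^esub> y) = h x \<otimes>\<^bsub>B\<^esub> h y"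
    and "\<And>x y. x \<in> carrier A \<Longrightarrow> y \<in> carrier A \<Longrightarrow> h (x \<oplus>\<^bsub>A\<^esub> y) = h x \<oplus>\<^bsub>B\<^esub> h y"
    and "h \<one>\<^bsub>A\<^esub> = \<one>\<^bsub>B\<^esub>"
    and "\<And>c x. x \<in> carrier A \<Longrightarrow> h (c \<odot>\<^bsub>A\<^esub> x) = c \<odot>\<^bsub>B\<^esub> h x"
    and "\<And>x. x \<in> carrier A \<Longrightarrow> h (star A x) = star B (h x)"
  shows "h \<in> star_hom A B"
  using assms unfolding star_hom_def by (auto intro!: ring_hom_memI)

lemma star_homD:
  assumes "h \<in> star_hom A B"
  shows star_hom_ring_hom: "h \<in> Ring.ring_hom A B"
    and star_hom_closed: "x \<in> carrier A \<Longrightarrow> h x \<in> carrier B"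
    and star_hom_mult: "x \<in> carrier A \<Longrightarrow> y \<in> carrier A \<Longrightarrow> h (x \<otimes>\<^bsub>A\<^esub> y) = h x \<otimes>\<^bsub>B\<^esub> h y"
    and star_hom_add: "x \<in> carrier A \<Longrightarrow> y \<in> carrier A \<Longrightarrow> h (x \<oplus>\<^bsub>A\<^esub> y) = h x \<oplus>\<^bsub>B\<^esub> h y"
    and star_hom_one: "h \<one>\<^bsub>A\<^esub> = \<one>\<^bsub>B\<^esub>"
    and star_hom_smult: "x \<in> carrier A \<Longrightarrow> h (c \<odot>\<^bsub>A\<^esub> x) = c \<odot>\<^bsub>B\<^esub> h x"
    and star_hom_star: "x \<in> carrier A \<Longrightarrow> h (star A x) = star B (h x)"
  using assms unfolding star_hom_def Ring.ring_hom_def by auto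

lemma star_hom_comp:
  assumes "h \<in> star_hom A B" "k \<in> star_hom B C"
  shows "k \<circ> h \<in> star_hom A C"
  by (rule star_homI) (simp_all add: star_homD[OF assms(1)] star_homD[OF assms(2)])

lemma star_isomorphic_trans:
  assumes "A \<simeq>\<^sub>* B" "B \<simeq>\<^sub>* C"
  shows "A \<simeq>\<^sub>* C"
  using assms star_hom_comp bij_betw_trans unfolding star_isomorphic_def by blast

text \<open>Additivity of scalar multiplication and of the star is what makes the operations of
  \<open>star_quot\<close> independent of the representative.\<close>

locale star_algebra = ring A for A :: "'a star_alg" (structure) +
  assumes smult_closed [simp]: "x \<in> carrier A \<Longrightarrow> c \<odot>\<^bsub>A\<^esub> x \<in> carrier A"
    and star_closed [simp]: "x \<in> carrier A \<Longrightarrow> star A x \<in> carrier A"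
    and smult_add: "x \<in> carrier A \<Longrightarrow> y \<in> carrier A \<Longrightarrow> c \<odot>\<^bsub>A\<^esub> (x \<oplus> y) = c \<odot>\<^bsub>A\<^esub> x \<oplus> c \<odot>\<^bsub>A\<^esub> y"
    and star_add: "x \<in> carrier A \<Longrightarrow> y \<in> carrier A \<Longrightarrow> star A (x \<oplus> y) = star A x \<oplus> star A y"
begin

text \<open>Stated with a single instance of additivity, so that it applies to scalar multiplication
  and to the star alike.\<close>

lemma additive_zero:
  assumes "f \<zero> \<in> carrier A" "f (\<zero> \<oplus> \<zero>) = f \<zero> \<oplus> f \<zero>"
  shows "f \<zero> = \<zero>"
  using assms by (metis add.r_cancel_one r_zero zero_closed)

lemma smult_zero [simp]: "c \<odot>\<^bsub>A\<^esub> \<zero> = \<zero>"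
  by (rule additive_zero) (simp_all only: smult_closed smult_add zero_closed)

lemma star_zero [simp]: "star A \<zero> = \<zero>"
  by (rule additive_zero) (simp_all only: star_closed star_add zero_closed)

lemma smult_minus:
  assumes "x \<in> carrier A" "y \<in> carrier A"
  shows "c \<odot>\<^bsub>A\<^esub> (x \<ominus> y) = c \<odot>\<^bsub>A\<^esub> x \<ominus> c \<odot>\<^bsub>A\<^esub> y"
proof -
  have "c \<odot>\<^bsub>A\<^esub> y \<oplus> c \<odot>\<^bsub>A\<^esub> (\<ominus> y) = \<zero>"
    using assms by (simp add: smult_add[symmetric] r_neg)
  then have "c \<odot>\<^bsub>A\<^esub> (\<ominus> y) = \<ominus> (c \<odot>\<^bsub>A\<^esub> y)"
    using assms by (metis add.inv_closed minus_equality a_comm smult_closed)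
  then show ?thesis using assms by (simp add: minus_eq smult_add)
qed

lemma star_minus:
  assumes "x \<in> carrier A" "y \<in> carrier A"
  shows "star A (x \<ominus> y) = star A x \<ominus> star A y"
proof -
  have "star A y \<oplus> star A (\<ominus> y) = \<zero>"
    using assms by (simp add: star_add[symmetric] r_neg)
  then have "star A (\<ominus> y) = \<ominus> (star A y)"
    using assms by (metis add.inv_closed minus_equality a_comm star_closed)
  then show ?thesis using assms by (simp add: minus_eq star_add)
qed

end

text \<open>The target is not known to be a ring beforehand: all algebras below inherit their axioms from
  surjective images.\<close>

lemma ring_hom_image_ring:
  assumes A: "ring A" and h: "h \<in> Ring.ring_hom A B"
    and surj: "h ` carrier A = carrier B" and zero: "h \<zero>\<^bsub>A\<^esub> = \<zero>\<^bsub>B\<^esub>"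
  shows "ring B"
proof -
  interpret A: ring A by (rule A)
  have pre: "\<exists>a\<in>carrier A. b = h a" if "b \<in> carrier B" for b
    using that surj by auto
  have cl: "\<And>x. x \<in> carrier A \<Longrightarrow> h x \<in> carrier B"
    using surj by auto
  have mult: "\<And>x y. x \<in> carrier A \<Longrightarrow> y \<in> carrier A \<Longrightarrow> h x \<otimes>\<^bsub>B\<^esub> h y = h (x \<otimes>\<^bsub>A\<^esub> y)"
    and add: "\<And>x y. x \<in> carrier A \<Longrightarrow> y \<in> carrier A \<Longrightarrow> h x \<oplus>\<^bsub>B\<^esub> h y = h (x \<oplus>\<^bsub>A\<^esub> y)"
    and one: "\<one>\<^bsub>B\<^esub> = h \<one>\<^bsub>A\<^esub>"
    using h by (auto simp: Ring.ring_hom_def)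
  show ?thesis
  proof (rule ringI)
    show "abelian_group B"
    proof (rule abelian_groupI)
      fix x assume "x \<in> carrier B"
      then obtain a where a: "a \<in> carrier A" "x = h a" using pre by auto
      then show "\<exists>y\<in>carrier B. y \<oplus>\<^bsub>B\<^esub> x = \<zero>\<^bsub>B\<^esub>"
        by (intro bexI[of _ "h (\<ominus>\<^bsub>A\<^esub> a)"]) (simp_all add: add cl A.l_neg zero)
    next
      fix x y assume "x \<in> carrier B" "y \<in> carrier B"
      then show "x \<oplus>\<^bsub>B\<^esub> y = y \<oplus>\<^bsub>B\<^esub> x"
        by (auto dest!: pre simp: add) (metis A.a_comm)
    qed (auto dest!: pre simp: cl add zero[symmetric] A.a_assoc)
    show "Group.monoid B"
      by (rule monoidI) (auto dest!: pre simp: cl mult one A.m_assoc)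
  qed (auto dest!: pre simp: cl mult add A.l_distr A.r_distr)
qed

lemma star_hom_image_algebra:
  assumes A: "star_algebra A" and h: "h \<in> star_hom A B"
    and surj: "h ` carrier A = carrier B" and zero: "h \<zero>\<^bsub>A\<^esub> = \<zero>\<^bsub>B\<^esub>"
  shows "star_algebra B"
proof -
  interpret A: star_algebra A by (rule A)
  interpret B: ring B
    by (rule ring_hom_image_ring[OF A.ring_axioms star_hom_ring_hom[OF h] surj zero])
  have pre: "\<exists>a\<in>carrier A. b = h a" if "b \<in> carrier B" for b
    using that surj by auto
  note H = star_homD[OF h]
  show ?thesis
    by unfold_locales
      (auto dest!: pre simp: H(2) H(4)[symmetric] H(6,7)[symmetric] A.smult_add A.star_add)
qed

lemma star_quot_simps:
  "carrier (star_quot A I) = carrier (A Quot I)"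
  "mult (star_quot A I) = mult (A Quot I)"
  "one (star_quot A I) = one (A Quot I)"
  "zero (star_quot A I) = zero (A Quot I)"
  "add (star_quot A I) = add (A Quot I)"
  "smult (star_quot A I) = (\<lambda>c X. \<Union>x\<in>X. I +>\<^bsub>A\<^esub> (c \<odot>\<^bsub>A\<^esub> x))"
  "star (star_quot A I) = (\<lambda>X. \<Union>x\<in>X. I +>\<^bsub>A\<^esub> (star A x))"
  "nrm (star_quot A I) = (\<lambda>X. INF x\<in>X. nrm A x)"
  by (simp_all add: star_quot_def)

locale star_ideal = ideal I A + star_algebra A for I and A :: "'a star_alg" (structure) +
  assumes smult_ideal: "x \<in> I \<Longrightarrow> c \<odot>\<^bsub>A\<^esub> x \<in> I"
    and star_ideal: "x \<in> I \<Longrightarrow> star A x \<in> I"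
begin

lemma coset_eq: "x \<in> carrier A \<Longrightarrow> y \<in> carrier A \<Longrightarrow> I +> x = I +> y \<longleftrightarrow> x \<ominus> y \<in> I"
  using quotient_eq_iff_same_a_r_cos[OF is_ideal] by simp

lemma coset_self: "x \<in> carrier A \<Longrightarrow> x \<in> I +> x"
  by (rule a_rcos_self)

lemma coset_memD:
  assumes "y \<in> I +> x" "x \<in> carrier A"
  shows "y \<in> carrier A" "y \<ominus> x \<in> I"
proof -
  show *: "y \<in> carrier A"
    using assms a_elemrcos_carrier by blast
  show "y \<ominus> x \<in> I"
    using assms * a_rcos_module_minus[OF ring_axioms assms(2) *] by simp
qed

text \<open>Two representatives differ by an element of the ideal, hence so do their multiples up to
  a coset. The union in \<open>star_quot\<close> is therefore a union of equal sets over a nonempty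
  index set; the same argument serves the star.\<close>

lemma coset_smult:
  assumes "x \<in> carrier A"
  shows "c \<odot>\<^bsub>star_quot A I\<^esub> (I +> x) = I +> (c \<odot>\<^bsub>A\<^esub> x)"
proof -
  have "I +> (c \<odot>\<^bsub>A\<^esub> y) = I +> (c \<odot>\<^bsub>A\<^esub> x)" if "y \<in> I +> x" for y
    using coset_memD[OF that assms] assms smult_ideal[of "y \<ominus> x" c]
    by (simp add: coset_eq smult_minus)
  then have "(\<Union>y\<in>I +> x. I +> (c \<odot>\<^bsub>A\<^esub> y)) = (\<Union>y\<in>I +> x. I +> (c \<odot>\<^bsub>A\<^esub> x))"
    by (intro SUP_cong refl)
  moreover have "I +> x \<noteq> {}" using coset_self[OF assms] by blast
  ultimately show ?thesis unfolding star_quot_simps(6) by simp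
qed

lemma coset_star:
  assumes "x \<in> carrier A"
  shows "star (star_quot A I) (I +> x) = I +> (star A x)"
proof -
  have "I +> (star A y) = I +> (star A x)" if "y \<in> I +> x" for y
    using coset_memD[OF that assms] assms star_ideal[of "y \<ominus> x"]
    by (simp add: coset_eq star_minus)
  then have "(\<Union>y\<in>I +> x. I +> (star A y)) = (\<Union>y\<in>I +> x. I +> (star A x))"
    by (intro SUP_cong refl)
  moreover have "I +> x \<noteq> {}" using coset_self[OF assms] by blast
  ultimately show ?thesis unfolding star_quot_simps(7) by simp
qed

lemma quot_map_hom: "(+>) I \<in> star_hom A (star_quot A I)"
proof -
  have closed: "I +> x \<in> carrier (star_quot A I)" if "x \<in> carrier A" for x
    unfolding star_quot_simps(1) using that by (rule ring_hom_closed[OF rcos_ring_hom])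
  have mult: "I +> (x \<otimes> y) = (I +> x) \<otimes>\<^bsub>star_quot A I\<^esub> (I +> y)"
    if "x \<in> carrier A" "y \<in> carrier A" for x y
    unfolding star_quot_simps(2) using that by (rule ring_hom_mult[OF rcos_ring_hom])
  have add: "I +> (x \<oplus> y) = (I +> x) \<oplus>\<^bsub>star_quot A I\<^esub> (I +> y)"
    if "x \<in> carrier A" "y \<in> carrier A" for x y
    unfolding star_quot_simps(5) using that by (rule ring_hom_add[OF rcos_ring_hom])
  have one: "I +> \<one> = \<one>\<^bsub>star_quot A I\<^esub>"
    unfolding star_quot_simps(3) by (rule ring_hom_one[OF rcos_ring_hom])
  show ?thesis
    by (rule star_homI) (simp_all only: closed mult add one coset_smult coset_star)
qed

lemma coset_surj: "(+>) I ` carrier A = carrier (star_quot A I)"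
  unfolding star_quot_simps FactRing_simps by (simp only: partial_object.simps monoid.simps) blast

lemma coset_zero: "I +> \<zero> = I"
  using a_coset_add_zero a_subset by simp

end

lemma ring_hom_ring_of_surj:
  assumes A: "star_algebra A" and h: "h \<in> star_hom A B"
    and surj: "h ` carrier A = carrier B" and zero: "h \<zero>\<^bsub>A\<^esub> = \<zero>\<^bsub>B\<^esub>"
  shows "ring_hom_ring A B h"
  by (rule ring_hom_ringI2[OF star_algebra.axioms(1)[OF A]
        ring_hom_image_ring[OF star_algebra.axioms(1)[OF A] star_hom_ring_hom[OF h] surj zero]
        star_hom_ring_hom[OF h]])

text \<open>First isomorphism theorem. The ring isomorphism comes from
  \<open>FactRing_iso_set\<close>; evaluating it on a coset as the common value of \<open>h\<close>
  shows that it also respects scalars and the star.\<close>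

theorem star_quot_kernel_isomorphic:
  assumes A: "star_algebra A" and h: "h \<in> star_hom A B"
    and surj: "h ` carrier A = carrier B" and zero: "h \<zero>\<^bsub>A\<^esub> = \<zero>\<^bsub>B\<^esub>"
  shows "star_quot A (a_kernel A B h) \<simeq>\<^sub>* B"
proof -
  interpret A: star_algebra A by (rule A)
  interpret B: star_algebra B by (rule star_hom_image_algebra[OF assms])
  interpret R: ring_hom_ring A B h by (rule ring_hom_ring_of_surj[OF assms])
  define I where "I = a_kernel A B h"
  have I: "x \<in> I \<longleftrightarrow> x \<in> carrier A \<and> h x = \<zero>\<^bsub>B\<^esub>" for x
    unfolding I_def a_kernel_def' by blast
  interpret I: ideal I A unfolding I_def by (rule R.kernel_is_ideal)
  interpret I: star_ideal I A
    by unfold_locales (auto simp: I star_homD[OF h])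
  define f where "f = (\<lambda>X. the_elem (h ` X))"
  have f: "f \<in> ring_iso (A Quot I) B"
    unfolding f_def I_def by (rule R.FactRing_iso_set[OF surj])
  have fx: "f (I +>\<^bsub>A\<^esub> x) = h x" if "x \<in> carrier A" for x
  proof -
    have "h y = h x" if "y \<in> I +>\<^bsub>A\<^esub> x" for y
    proof -
      note y = I.coset_memD[OF that \<open>x \<in> carrier A\<close>]
      have "(y \<ominus>\<^bsub>A\<^esub> x) \<oplus>\<^bsub>A\<^esub> x = y"
        using y(1) \<open>x \<in> carrier A\<close> by (simp add: A.minus_eq A.a_assoc A.l_neg)
      then have "h y = h (y \<ominus>\<^bsub>A\<^esub> x) \<oplus>\<^bsub>B\<^esub> h x"
        using star_hom_add[OF h, of "y \<ominus>\<^bsub>A\<^esub> x" x] y(1) \<open>x \<in> carrier A\<close> by simp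
      then show ?thesis
        using y(2) star_hom_closed[OF h \<open>x \<in> carrier A\<close>] I by simp
    qed
    then have "h ` (I +>\<^bsub>A\<^esub> x) = (\<lambda>_. h x) ` (I +>\<^bsub>A\<^esub> x)"
      by (rule image_cong[OF refl])
    also have "\<dots> = {h x}" by (rule image_constant[OF I.coset_self[OF that]])
    finally show ?thesis unfolding f_def by (simp only: the_elem_eq)
  qed
  have rep: "\<exists>x\<in>carrier A. X = I +>\<^bsub>A\<^esub> x" if "X \<in> carrier (A Quot I)" for X
    using that unfolding I.coset_surj[symmetric, unfolded star_quot_simps(1)] by blast
  have f_closed: "f X \<in> carrier B" if "X \<in> carrier (A Quot I)" for X
    using rep[OF that] fx star_hom_closed[OF h] by force
  have f_hom: "f \<in> Ring.ring_hom (A Quot I) B"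
    using f unfolding ring_iso_def by blast
  have "f \<in> star_hom (star_quot A I) B"
  proof (rule star_homI)
    fix c X assume X: "X \<in> carrier (star_quot A I)"
    then obtain x where x: "x \<in> carrier A" "X = I +>\<^bsub>A\<^esub> x"
      using rep unfolding star_quot_simps by blast
    show "f (c \<odot>\<^bsub>star_quot A I\<^esub> X) = c \<odot>\<^bsub>B\<^esub> f X"
      unfolding x(2) I.coset_smult[OF x(1)] using x(1) by (simp add: fx star_homD[OF h])
    show "f (star (star_quot A I) X) = star B (f X)"
      unfolding x(2) I.coset_star[OF x(1)] using x(1) by (simp add: fx star_homD[OF h])
    show "f X \<in> carrier B"
      using X f_closed unfolding star_quot_simps by blast
    fix Y assume Y: "Y \<in> carrier (star_quot A I)"
    show "f (X \<otimes>\<^bsub>star_quot A I\<^esub> Y) = f X \<otimes>\<^bsub>B\<^esub> f Y"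
      "f (X \<oplus>\<^bsub>star_quot A I\<^esub> Y) = f X \<oplus>\<^bsub>B\<^esub> f Y"
      using X Y unfolding star_quot_simps
      by (rule ring_hom_mult[OF f_hom], rule ring_hom_add[OF f_hom])
  next
    show "f \<one>\<^bsub>star_quot A I\<^esub> = \<one>\<^bsub>B\<^esub>"
      unfolding star_quot_simps by (rule ring_hom_one[OF f_hom])
  qed
  moreover have "bij_betw f (carrier (star_quot A I)) (carrier B)"
    using f unfolding ring_iso_def star_quot_simps by blast
  ultimately show ?thesis unfolding star_isomorphic_def I_def by blast
qed

section \<open>The algebra of Cauchy sequences of an inductive system\<close>

lemma star_hom_zero:
  assumes "ring A" "ring B" "h \<in> star_hom A B"
  shows "h \<zero>\<^bsub>A\<^esub> = \<zero>\<^bsub>B\<^esub>"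
  by (rule ring_hom_zero[OF star_hom_ring_hom[OF assms(3)] assms(1,2)])

lemma star_hom_minus:
  assumes "ring A" "ring B" "h \<in> star_hom A B" "x \<in> carrier A" "y \<in> carrier A"
  shows "h (x \<ominus>\<^bsub>A\<^esub> y) = h x \<ominus>\<^bsub>B\<^esub> h y"
proof -
  interpret ring_hom_ring A B h
    by (rule ring_hom_ringI2[OF assms(1,2) star_hom_ring_hom[OF assms(3)]])
  show ?thesis using assms(4,5) by (simp add: a_minus_def)
qed

text \<open>These inequalities keep bounded, null and Cauchy sequences stable under the
  operations.\<close>

locale normed_star_algebra = star_algebra +
  assumes nrm_nonneg: "x \<in> carrier A \<Longrightarrow> 0 \<le> nrm A x"
    and nrm_zero: "nrm A \<zero> = 0"
    and nrm_add: "x \<in> carrier A \<Longrightarrow> y \<in> carrier A \<Longrightarrow> nrm A (x \<oplus> y) \<le> nrm A x + nrm A y"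
    and nrm_uminus: "x \<in> carrier A \<Longrightarrow> nrm A (\<ominus> x) = nrm A x"
    and nrm_mult: "x \<in> carrier A \<Longrightarrow> y \<in> carrier A \<Longrightarrow> nrm A (x \<otimes> y) \<le> nrm A x * nrm A y"
    and nrm_smult: "x \<in> carrier A \<Longrightarrow> nrm A (c \<odot>\<^bsub>A\<^esub> x) \<le> cmod c * nrm A x"
    and nrm_star: "x \<in> carrier A \<Longrightarrow> nrm A (star A x) \<le> nrm A x"
begin

lemma nrm_minus_le: "x \<in> carrier A \<Longrightarrow> y \<in> carrier A \<Longrightarrow> nrm A (x \<ominus> y) \<le> nrm A x + nrm A y"
  using nrm_add[of x "\<ominus> y"] nrm_uminus[of y] by (simp add: minus_eq)

lemma minus_split:
  assumes "x \<in> carrier A" "y \<in> carrier A" "z \<in> carrier A"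
  shows "x \<ominus> z = (x \<ominus> y) \<oplus> (y \<ominus> z)"
proof -
  have "(x \<ominus> y) \<oplus> (y \<ominus> z) = x \<oplus> ((\<ominus> y \<oplus> y) \<oplus> \<ominus> z)"
    using assms by (simp only: minus_eq a_assoc a_inv_closed a_closed)
  then show ?thesis using assms by (simp add: l_neg minus_eq)
qed

lemma nrm_triangle:
  assumes "x \<in> carrier A" "y \<in> carrier A" "z \<in> carrier A"
  shows "nrm A (x \<ominus> z) \<le> nrm A (x \<ominus> y) + nrm A (y \<ominus> z)"
  unfolding minus_split[OF assms] using assms by (intro nrm_add minus_closed)

lemma nrm_minus_commute:
  assumes "x \<in> carrier A" "y \<in> carrier A"
  shows "nrm A (x \<ominus> y) = nrm A (y \<ominus> x)"
proof -
  have "\<ominus> (x \<ominus> y) = y \<ominus> x"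
    using assms by (simp add: minus_eq minus_add a_comm)
  then show ?thesis using nrm_uminus[of "x \<ominus> y"] assms by simp
qed

lemma minus_self: "x \<in> carrier A \<Longrightarrow> x \<ominus> x = \<zero>"
  by (simp add: minus_eq r_neg)

lemma minus_add_cancel: "x \<in> carrier A \<Longrightarrow> y \<in> carrier A \<Longrightarrow> (x \<ominus> y) \<oplus> y = x"
  by (simp add: minus_eq a_assoc l_neg)

lemma add_minus_add:
  assumes "a \<in> carrier A" "b \<in> carrier A" "c \<in> carrier A" "d \<in> carrier A"
  shows "(a \<oplus> b) \<ominus> (c \<oplus> d) = (a \<ominus> c) \<oplus> (b \<ominus> d)"
  using assms by algebra

lemma mult_minus_mult:
  assumes "a \<in> carrier A" "b \<in> carrier A" "c \<in> carrier A" "d \<in> carrier A"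
  shows "(a \<otimes> b) \<ominus> (c \<otimes> d) = a \<otimes> (b \<ominus> d) \<oplus> (a \<ominus> c) \<otimes> d"
  using assms by algebra

lemma uminus_minus_uminus:
  assumes "a \<in> carrier A" "b \<in> carrier A"
  shows "\<ominus> a \<ominus> (\<ominus> b) = b \<ominus> a"
  using assms by algebra

lemma nrm_le_minus:
  assumes "x \<in> carrier A" "y \<in> carrier A"
  shows "nrm A x \<le> nrm A (x \<ominus> y) + nrm A y"
  using nrm_add[of "x \<ominus> y" y] minus_add_cancel[of x y] assms by simp

end

text \<open>Star-homomorphisms of C*-algebras are contractive automatically; with the abstract norm
  of \<open>normed_star_algebra\<close> this has to be carried along.\<close>

definition contractive_hom :: "'a star_alg \<Rightarrow> 'b star_alg \<Rightarrow> ('a \<Rightarrow> 'b) set" where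
  "contractive_hom A B = {h \<in> star_hom A B. \<forall>x\<in>carrier A. nrm B (h x) \<le> nrm A x}"

lemma contractive_homI:
  assumes "h \<in> star_hom A B" "\<And>x. x \<in> carrier A \<Longrightarrow> nrm B (h x) \<le> nrm A x"
  shows "h \<in> contractive_hom A B"
  using assms by (simp add: contractive_hom_def)

lemma contractive_homD:
  assumes "h \<in> contractive_hom A B"
  shows contractive_hom_hom: "h \<in> star_hom A B"
    and contractive_hom_nrm: "x \<in> carrier A \<Longrightarrow> nrm B (h x) \<le> nrm A x"
    and contractive_hom_closed: "x \<in> carrier A \<Longrightarrow> h x \<in> carrier B"
  using assms star_hom_closed by (auto simp: contractive_hom_def)

lemma contractive_hom_comp:
  assumes "h \<in> contractive_hom A B" "k \<in> contractive_hom B C"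
  shows "k \<circ> h \<in> contractive_hom A C"
proof (rule contractive_homI)
  show "k \<circ> h \<in> star_hom A C"
    by (rule star_hom_comp[OF contractive_hom_hom[OF assms(1)] contractive_hom_hom[OF assms(2)]])
  show "nrm C ((k \<circ> h) x) \<le> nrm A x" if "x \<in> carrier A" for x
    using contractive_hom_nrm[OF assms(1) that]
      contractive_hom_nrm[OF assms(2) contractive_hom_closed[OF assms(1) that]] by simp
qed

lemma contractive_hom_id: "(\<lambda>x. x) \<in> contractive_hom A A"
  by (intro contractive_homI star_homI) simp_all

text \<open>Recursion on the target level, with the identity as value for targets at or below the
  source. No difference of levels appears, so \<open>connect_trans\<close> is a plain
  induction.\<close>

primrec connect :: "(nat \<Rightarrow> 'a \<Rightarrow> 'a) \<Rightarrow> nat \<Rightarrow> nat \<Rightarrow> 'a \<Rightarrow> 'a" where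
  "connect \<phi> m 0 x = x"
| "connect \<phi> m (Suc n) x = (if m \<le> n then \<phi> n (connect \<phi> m n x) else x)"

lemma connect_self [simp]: "connect \<phi> m m x = x"
  by (cases m) auto

lemma connect_Suc: "m \<le> n \<Longrightarrow> connect \<phi> m (Suc n) x = \<phi> n (connect \<phi> m n x)"
  by simp

lemma connect_trans:
  assumes "l \<le> m" "m \<le> n"
  shows "connect \<phi> m n (connect \<phi> l m x) = connect \<phi> l n x"
  using assms(2,1) by (induction rule: dec_induct) simp_all

text \<open>Earlier terms are compared with later ones through the connecting maps. The classes of
  these sequences modulo null sequences are precisely the elements of \<open>cstar_limit\<close>,
  see \<open>limit_carrier\<close>.\<close>

definition cauchy_seqs :: "(nat \<Rightarrow> 'a star_alg) \<Rightarrow> (nat \<Rightarrow> 'a \<Rightarrow> 'a) \<Rightarrow> (nat \<Rightarrow> 'a) set" where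
  "cauchy_seqs A \<phi> = {x \<in> carrier (bounded_prod A).
     \<forall>\<epsilon>>0. \<exists>N. \<forall>n\<ge>N. nrm (A n) (x n \<ominus>\<^bsub>A n\<^esub> connect \<phi> N n (x N)) < \<epsilon>}"

definition cauchy_alg :: "(nat \<Rightarrow> 'a star_alg) \<Rightarrow> (nat \<Rightarrow> 'a \<Rightarrow> 'a) \<Rightarrow> (nat \<Rightarrow> 'a) star_alg" where
  "cauchy_alg A \<phi> = (bounded_prod A)\<lparr>carrier := cauchy_seqs A \<phi>\<rparr>"

definition limit_class :: "(nat \<Rightarrow> 'a star_alg) \<Rightarrow> (nat \<Rightarrow> 'a) \<Rightarrow> (nat \<Rightarrow> 'a) set" where
  "limit_class A x = null_seqs A +>\<^bsub>bounded_prod A\<^esub> x"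

lemma bounded_prod_simps:
  "mult (bounded_prod A) = (\<lambda>x y n. x n \<otimes>\<^bsub>A n\<^esub> y n)"
  "one (bounded_prod A) = (\<lambda>n. \<one>\<^bsub>A n\<^esub>)"
  "zero (bounded_prod A) = (\<lambda>n. \<zero>\<^bsub>A n\<^esub>)"
  "add (bounded_prod A) = (\<lambda>x y n. x n \<oplus>\<^bsub>A n\<^esub> y n)"
  "smult (bounded_prod A) = (\<lambda>c x n. c \<odot>\<^bsub>A n\<^esub> x n)"
  "star (bounded_prod A) = (\<lambda>x n. star (A n) (x n))"
  "nrm (bounded_prod A) = (\<lambda>x. SUP n. nrm (A n) (x n))"
  by (simp_all add: bounded_prod_def)

lemma cauchy_alg_simps:
  "carrier (cauchy_alg A \<phi>) = cauchy_seqs A \<phi>"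
  "mult (cauchy_alg A \<phi>) = mult (bounded_prod A)"
  "one (cauchy_alg A \<phi>) = one (bounded_prod A)"
  "zero (cauchy_alg A \<phi>) = zero (bounded_prod A)"
  "add (cauchy_alg A \<phi>) = add (bounded_prod A)"
  "smult (cauchy_alg A \<phi>) = smult (bounded_prod A)"
  "star (cauchy_alg A \<phi>) = star (bounded_prod A)"
  by (simp_all add: cauchy_alg_def)

lemma bounded_prodI:
  assumes "\<And>n. x n \<in> carrier (A n)" "\<And>n. nrm (A n) (x n) \<le> C"
  shows "x \<in> carrier (bounded_prod A)"
  using assms by (auto simp: bounded_prod_def intro!: bdd_aboveI)

lemma bounded_prod_closed: "x \<in> carrier (bounded_prod A) \<Longrightarrow> x n \<in> carrier (A n)"
  by (simp add: bounded_prod_def)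

lemma null_seqsD:
  assumes "x \<in> null_seqs A"
  shows "x \<in> carrier (bounded_prod A)" "(\<lambda>n. nrm (A n) (x n)) \<longlonglongrightarrow> 0"
  using assms by (auto simp: null_seqs_def)

locale star_sequence =
  fixes A :: "nat \<Rightarrow> 'a star_alg"
  assumes alg: "\<And>n. normed_star_algebra (A n)"
begin

sublocale alg: normed_star_algebra "A n" for n by (rule alg)

lemma bounded_prodE:
  assumes "x \<in> carrier (bounded_prod A)"
  obtains C where "0 \<le> C" "\<And>n. nrm (A n) (x n) \<le> C"
proof -
  obtain C where C: "\<And>n. nrm (A n) (x n) \<le> C"
    using assms by (auto simp: bounded_prod_def bdd_above_def)
  have "0 \<le> C" using C[of 0] alg.nrm_nonneg[OF bounded_prod_closed[OF assms], of 0] by linarith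
  then show thesis using C that by blast
qed

lemma bounded_prod_add:
  assumes x: "x \<in> carrier (bounded_prod A)" and y: "y \<in> carrier (bounded_prod A)"
  shows "x \<oplus>\<^bsub>bounded_prod A\<^esub> y \<in> carrier (bounded_prod A)"
proof -
  obtain C where C: "\<And>n. nrm (A n) (x n) \<le> C" using bounded_prodE[OF x] by blast
  obtain D where D: "\<And>n. nrm (A n) (y n) \<le> D" using bounded_prodE[OF y] by blast
  have "nrm (A n) (x n \<oplus>\<^bsub>A n\<^esub> y n) \<le> C + D" for n
    using alg.nrm_add[OF bounded_prod_closed[OF x] bounded_prod_closed[OF y], of n] C[of n] D[of n]
    by linarith
  then show ?thesis unfolding bounded_prod_simps
    using alg.a_closed[OF bounded_prod_closed[OF x] bounded_prod_closed[OF y]]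
    by (intro bounded_prodI) auto
qed

lemma bounded_prod_mult:
  assumes x: "x \<in> carrier (bounded_prod A)" and y: "y \<in> carrier (bounded_prod A)"
  shows "x \<otimes>\<^bsub>bounded_prod A\<^esub> y \<in> carrier (bounded_prod A)"
proof -
  obtain C where C: "0 \<le> C" "\<And>n. nrm (A n) (x n) \<le> C" using bounded_prodE[OF x] by blast
  obtain D where D: "\<And>n. nrm (A n) (y n) \<le> D" using bounded_prodE[OF y] by blast
  have "nrm (A n) (x n \<otimes>\<^bsub>A n\<^esub> y n) \<le> C * D" for n
    using alg.nrm_mult[OF bounded_prod_closed[OF x] bounded_prod_closed[OF y], of n]
      mult_mono[OF C(2)[of n] D[of n] C(1) alg.nrm_nonneg[OF bounded_prod_closed[OF y]]]
    by linarith
  then show ?thesis unfolding bounded_prod_simps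
    using alg.m_closed[OF bounded_prod_closed[OF x] bounded_prod_closed[OF y]]
    by (intro bounded_prodI) auto
qed

lemma bounded_prod_smult:
  assumes x: "x \<in> carrier (bounded_prod A)"
  shows "c \<odot>\<^bsub>bounded_prod A\<^esub> x \<in> carrier (bounded_prod A)"
proof -
  obtain C where C: "\<And>n. nrm (A n) (x n) \<le> C" using bounded_prodE[OF x] by blast
  have "nrm (A n) (c \<odot>\<^bsub>A n\<^esub> x n) \<le> cmod c * C" for n
    using alg.nrm_smult[OF bounded_prod_closed[OF x], of n c] mult_left_mono[OF C[of n], of "cmod c"]
    by simp
  then show ?thesis unfolding bounded_prod_simps
    using alg.smult_closed[OF bounded_prod_closed[OF x]] by (intro bounded_prodI) auto
qed

lemma bounded_prod_star:
  assumes x: "x \<in> carrier (bounded_prod A)"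
  shows "star (bounded_prod A) x \<in> carrier (bounded_prod A)"
proof -
  obtain C where C: "\<And>n. nrm (A n) (x n) \<le> C" using bounded_prodE[OF x] by blast
  have "nrm (A n) (star (A n) (x n)) \<le> C" for n
    using alg.nrm_star[OF bounded_prod_closed[OF x], of n] C[of n] by linarith
  then show ?thesis unfolding bounded_prod_simps
    using alg.star_closed[OF bounded_prod_closed[OF x]] by (intro bounded_prodI) auto
qed

lemma bounded_prod_zero: "\<zero>\<^bsub>bounded_prod A\<^esub> \<in> carrier (bounded_prod A)"
  unfolding bounded_prod_simps by (rule bounded_prodI[where C = 0]) (simp_all add: alg.nrm_zero)

lemma bounded_prod_neg:
  assumes x: "x \<in> carrier (bounded_prod A)"
  shows "(\<lambda>n. \<ominus>\<^bsub>A n\<^esub> x n) \<in> carrier (bounded_prod A)"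
proof -
  obtain C where C: "\<And>n. nrm (A n) (x n) \<le> C" using bounded_prodE[OF x] by blast
  show ?thesis
    using C bounded_prod_closed[OF x] by (intro bounded_prodI) (auto simp: alg.nrm_uminus)
qed

lemma bounded_prod_neg_add:
  assumes x: "x \<in> carrier (bounded_prod A)"
  shows "(\<lambda>n. \<ominus>\<^bsub>A n\<^esub> x n) \<oplus>\<^bsub>bounded_prod A\<^esub> x = \<zero>\<^bsub>bounded_prod A\<^esub>"
  unfolding bounded_prod_simps using bounded_prod_closed[OF x] by (simp add: alg.l_neg)

end

text \<open>The bound for the unit is an assumption because the norm of \<open>\<one>\<close> is not normalised in
  \<open>normed_star_algebra\<close>.\<close>

locale unital_star_sequence = star_sequence +
  assumes one_bounded: "nrm (A n) \<one>\<^bsub>A n\<^esub> \<le> 1"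
begin

lemma bounded_prod_one: "\<one>\<^bsub>bounded_prod A\<^esub> \<in> carrier (bounded_prod A)"
  unfolding bounded_prod_simps by (rule bounded_prodI[OF alg.one_closed one_bounded])

lemma bounded_prod_ring: "ring (bounded_prod A)"
proof (rule ringI)
  note cl = bounded_prod_closed[of _ A]
  show "abelian_group (bounded_prod A)"
  proof (rule abelian_groupI)
    fix x assume x: "x \<in> carrier (bounded_prod A)"
    show "\<exists>y\<in>carrier (bounded_prod A). y \<oplus>\<^bsub>bounded_prod A\<^esub> x = \<zero>\<^bsub>bounded_prod A\<^esub>"
      using bounded_prod_neg[OF x] bounded_prod_neg_add[OF x] by blast
  next
    fix x y assume x: "x \<in> carrier (bounded_prod A)" and y: "y \<in> carrier (bounded_prod A)"
    show "x \<oplus>\<^bsub>bounded_prod A\<^esub> y = y \<oplus>\<^bsub>bounded_prod A\<^esub> x"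
      unfolding bounded_prod_simps by (rule ext) (rule alg.a_comm[OF cl[OF x] cl[OF y]])
    show "x \<oplus>\<^bsub>bounded_prod A\<^esub> y \<in> carrier (bounded_prod A)"
      by (rule bounded_prod_add[OF x y])
    fix z assume z: "z \<in> carrier (bounded_prod A)"
    show "x \<oplus>\<^bsub>bounded_prod A\<^esub> y \<oplus>\<^bsub>bounded_prod A\<^esub> z = x \<oplus>\<^bsub>bounded_prod A\<^esub> (y \<oplus>\<^bsub>bounded_prod A\<^esub> z)"
      unfolding bounded_prod_simps by (rule ext) (rule alg.a_assoc[OF cl[OF x] cl[OF y] cl[OF z]])
  qed (fact bounded_prod_zero | simp add: bounded_prod_simps cl)+
  show "Group.monoid (bounded_prod A)"
    by (rule monoidI; (fact bounded_prod_mult bounded_prod_one)?)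
      (simp_all add: bounded_prod_simps cl alg.m_assoc)
qed (simp_all add: bounded_prod_simps bounded_prod_closed[of _ A] alg.l_distr alg.r_distr)

sublocale prod: ring "bounded_prod A" by (rule bounded_prod_ring)

sublocale prod: star_algebra "bounded_prod A"
  by unfold_locales
    (fact bounded_prod_smult bounded_prod_star
      | simp add: bounded_prod_simps bounded_prod_closed[of _ A] alg.smult_add alg.star_add)+

lemma bounded_prod_uminus:
  assumes "x \<in> carrier (bounded_prod A)"
  shows "\<ominus>\<^bsub>bounded_prod A\<^esub> x = (\<lambda>n. \<ominus>\<^bsub>A n\<^esub> x n)"
  by (rule prod.minus_equality[OF bounded_prod_neg_add[OF assms] assms bounded_prod_neg[OF assms]])

lemma bounded_prod_minus:
  assumes "x \<in> carrier (bounded_prod A)" "y \<in> carrier (bounded_prod A)"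
  shows "x \<ominus>\<^bsub>bounded_prod A\<^esub> y = (\<lambda>n. x n \<ominus>\<^bsub>A n\<^esub> y n)"
  unfolding a_minus_def bounded_prod_uminus[OF assms(2)] by (simp add: bounded_prod_simps)

lemma null_seqsI:
  assumes x: "x \<in> carrier (bounded_prod A)" and le: "\<And>n. nrm (A n) (x n) \<le> f n"
    and f: "f \<longlonglongrightarrow> 0"
  shows "x \<in> null_seqs A"
proof -
  have "(\<lambda>n. nrm (A n) (x n)) \<longlonglongrightarrow> 0"
    by (rule real_tendsto_sandwich[OF _ _ tendsto_const f])
      (use le alg.nrm_nonneg[OF bounded_prod_closed[OF x]] in auto)
  then show ?thesis using x by (simp add: null_seqs_def)
qed

lemma null_seqs_ideal: "star_ideal (null_seqs A) (bounded_prod A)"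
proof -
  note cl = bounded_prod_closed[OF null_seqsD(1)]
  have "subgroup (null_seqs A) (add_monoid (bounded_prod A))"
  proof (rule prod.add.subgroupI)
    show "null_seqs A \<subseteq> carrier (bounded_prod A)" by (auto simp: null_seqs_def)
    have "\<zero>\<^bsub>bounded_prod A\<^esub> \<in> null_seqs A"
      by (rule null_seqsI[OF bounded_prod_zero, of "\<lambda>_. 0"])
        (simp_all add: bounded_prod_simps alg.nrm_zero)
    then show "null_seqs A \<noteq> {}" by blast
    fix x assume x: "x \<in> null_seqs A"
    show "\<ominus>\<^bsub>bounded_prod A\<^esub> x \<in> null_seqs A"
      unfolding bounded_prod_uminus[OF null_seqsD(1)[OF x]]
      by (rule null_seqsI[OF bounded_prod_neg[OF null_seqsD(1)[OF x]] _ null_seqsD(2)[OF x]])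
        (simp add: alg.nrm_uminus cl[OF x])
    fix y assume y: "y \<in> null_seqs A"
    show "x \<oplus>\<^bsub>bounded_prod A\<^esub> y \<in> null_seqs A"
      by (rule null_seqsI[OF bounded_prod_add[OF null_seqsD(1)[OF x] null_seqsD(1)[OF y]] _
            tendsto_add_zero[OF null_seqsD(2)[OF x] null_seqsD(2)[OF y]]])
        (simp add: bounded_prod_simps alg.nrm_add cl[OF x] cl[OF y])
  qed
  moreover have "y \<otimes>\<^bsub>bounded_prod A\<^esub> x \<in> null_seqs A \<and> x \<otimes>\<^bsub>bounded_prod A\<^esub> y \<in> null_seqs A"
    if x: "x \<in> null_seqs A" and y: "y \<in> carrier (bounded_prod A)" for x y
  proof -
    obtain C where C: "0 \<le> C" "\<And>n. nrm (A n) (y n) \<le> C" using bounded_prodE[OF y] by blast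
    have 0: "(\<lambda>n. C * nrm (A n) (x n)) \<longlonglongrightarrow> 0"
      by (rule tendsto_mult_right_zero[OF null_seqsD(2)[OF x]])
    have "nrm (A n) (y n \<otimes>\<^bsub>A n\<^esub> x n) \<le> C * nrm (A n) (x n)"
      "nrm (A n) (x n \<otimes>\<^bsub>A n\<^esub> y n) \<le> C * nrm (A n) (x n)" for n
      using alg.nrm_mult[OF bounded_prod_closed[OF y] cl[OF x], of n]
        alg.nrm_mult[OF cl[OF x] bounded_prod_closed[OF y], of n]
        mult_right_mono[OF C(2)[of n] alg.nrm_nonneg[OF cl[OF x]], of n] 
      by (simp_all add: mult.commute)
    then show ?thesis
      using null_seqsI[OF bounded_prod_mult[OF y null_seqsD(1)[OF x]] _ 0]
        null_seqsI[OF bounded_prod_mult[OF null_seqsD(1)[OF x] y] _ 0]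
      unfolding bounded_prod_simps by blast
  qed
  ultimately have "ideal (null_seqs A) (bounded_prod A)"
    by (intro idealI[OF bounded_prod_ring]) blast+
  moreover have "c \<odot>\<^bsub>bounded_prod A\<^esub> x \<in> null_seqs A" if x: "x \<in> null_seqs A" for c x
    by (rule null_seqsI[OF bounded_prod_smult[OF null_seqsD(1)[OF x]] _
            tendsto_mult_right_zero[OF null_seqsD(2)[OF x], of "cmod c"]])
        (simp add: bounded_prod_simps alg.nrm_smult cl[OF x])
  moreover have "star (bounded_prod A) x \<in> null_seqs A" if x: "x \<in> null_seqs A" for x
    by (rule null_seqsI[OF bounded_prod_star[OF null_seqsD(1)[OF x]] _ null_seqsD(2)[OF x]])
        (simp add: bounded_prod_simps alg.nrm_star cl[OF x])
  ultimately show ?thesis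
    by (intro star_ideal.intro star_ideal_axioms.intro prod.star_algebra_axioms) blast+
qed

sublocale null: star_ideal "null_seqs A" "bounded_prod A" by (rule null_seqs_ideal)

lemma limit_class_eq:
  assumes "x \<in> carrier (bounded_prod A)" "y \<in> carrier (bounded_prod A)"
  shows "limit_class A x = limit_class A y \<longleftrightarrow> (\<lambda>n. nrm (A n) (x n \<ominus>\<^bsub>A n\<^esub> y n)) \<longlonglongrightarrow> 0"
proof -
  have "limit_class A x = limit_class A y \<longleftrightarrow> (\<lambda>n. x n \<ominus>\<^bsub>A n\<^esub> y n) \<in> null_seqs A"
    unfolding limit_class_def null.coset_eq[OF assms] bounded_prod_minus[OF assms] ..
  then show ?thesis
    using prod.minus_closed[OF assms] unfolding bounded_prod_minus[OF assms] null_seqs_def by blast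
qed

text \<open>Half of the fact that the quotient norm is the limes superior of the norms: some
  representative has supremum below \<epsilon>, and it differs from \<open>d\<close> by a null
  sequence, which is eventually smaller than the gap that is left.\<close>

lemma quot_nrm_lessD:
  assumes d: "d \<in> carrier (bounded_prod A)"
    and less: "nrm (star_quot (bounded_prod A) (null_seqs A)) (limit_class A d) < \<epsilon>"
  shows "\<exists>N. \<forall>n\<ge>N. nrm (A n) (d n) < \<epsilon>"
proof -
  let ?s = "\<lambda>y. SUP n. nrm (A n) (y n)"
  have mem: "y \<in> carrier (bounded_prod A)" "y \<ominus>\<^bsub>bounded_prod A\<^esub> d \<in> null_seqs A"
    if "y \<in> limit_class A d" for y
    using null.coset_memD[OF that[unfolded limit_class_def] d] by auto
  have up: "nrm (A n) (y n) \<le> ?s y" if "y \<in> carrier (bounded_prod A)" for y n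
    using that by (intro cSUP_upper) (auto simp: bounded_prod_def)
  have "0 \<le> ?s y" if "y \<in> limit_class A d" for y
    using up[OF mem(1)[OF that], of 0] alg.nrm_nonneg[OF bounded_prod_closed[OF mem(1)[OF that]], of 0]
    by linarith
  then have "bdd_below (?s ` limit_class A d)" by (auto intro!: bdd_belowI)
  moreover have "limit_class A d \<noteq> {}"
    using null.coset_self[OF d] unfolding limit_class_def by blast
  ultimately obtain y where y: "y \<in> limit_class A d" "?s y < \<epsilon>"
    using less unfolding star_quot_simps bounded_prod_simps
    by (auto simp: cInf_less_iff)
  define \<delta> where "\<delta> = \<epsilon> - ?s y"
  have yc: "y \<in> carrier (bounded_prod A)" using mem(1)[OF y(1)] .
  have "(\<lambda>n. nrm (A n) (y n \<ominus>\<^bsub>A n\<^esub> d n)) \<longlonglongrightarrow> 0"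
    using null_seqsD(2)[OF mem(2)[OF y(1)]] unfolding bounded_prod_minus[OF yc d] .
  then have "\<forall>\<^sub>F n in sequentially. nrm (A n) (y n \<ominus>\<^bsub>A n\<^esub> d n) < \<delta>"
    using y(2) by (intro order_tendstoD(2)) (auto simp: \<delta>_def)
  then obtain N where N: "\<And>n. n \<ge> N \<Longrightarrow> nrm (A n) (y n \<ominus>\<^bsub>A n\<^esub> d n) < \<delta>"
    by (auto simp: eventually_sequentially)
  have "nrm (A n) (d n) < \<epsilon>" if "n \<ge> N" for n
    using alg.nrm_le_minus[OF bounded_prod_closed[OF d] bounded_prod_closed[OF yc], of n]
      N[OF that] up[OF yc, of n]
      alg.nrm_minus_commute[OF bounded_prod_closed[OF d] bounded_prod_closed[OF yc], of n]
    by (simp add: \<delta>_def)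
  then show ?thesis by blast
qed

text \<open>The other half: replacing the first \<open>N\<close> entries by zero does not change the
  class, and the new representative has supremum at most \<delta>.\<close>

lemma quot_nrm_lessI:
  assumes d: "d \<in> carrier (bounded_prod A)"
    and le: "\<And>n. n \<ge> N \<Longrightarrow> nrm (A n) (d n) \<le> \<delta>" and "0 \<le> \<delta>" "\<delta> < \<epsilon>"
  shows "nrm (star_quot (bounded_prod A) (null_seqs A)) (limit_class A d) < \<epsilon>"
proof -
  let ?s = "\<lambda>y. SUP n. nrm (A n) (y n)"
  define y where "y = (\<lambda>n. if n < N then \<zero>\<^bsub>A n\<^esub> else d n)"
  have yb: "nrm (A n) (y n) \<le> \<delta>" for n
    using le[of n] \<open>0 \<le> \<delta>\<close> by (simp add: y_def alg.nrm_zero)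
  have yc: "y \<in> carrier (bounded_prod A)"
    by (rule bounded_prodI[OF _ yb]) (simp add: y_def bounded_prod_closed[OF d])
  have "(\<lambda>n. nrm (A n) (y n \<ominus>\<^bsub>A n\<^esub> d n)) \<longlonglongrightarrow> 0"
    by (rule tendsto_eventually, rule eventually_sequentiallyI[of N])
      (simp add: y_def alg.minus_self[OF bounded_prod_closed[OF d]] alg.nrm_zero)
  then have "y \<in> limit_class A d"
    using limit_class_eq[OF yc d] null.coset_self[OF yc] unfolding limit_class_def by blast
  moreover have "bdd_below (?s ` limit_class A d)"
  proof (rule bdd_belowI[of _ 0], clarify)
    fix z assume "z \<in> limit_class A d"
    then have z: "z \<in> carrier (bounded_prod A)"
      using null.coset_memD(1)[OF _ d] unfolding limit_class_def by blast
    have "nrm (A 0) (z 0) \<le> ?s z"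
      using z by (intro cSUP_upper) (auto simp: bounded_prod_def)
    then show "0 \<le> ?s z"
      using alg.nrm_nonneg[OF bounded_prod_closed[OF z], of 0] by linarith
  qed
  ultimately have "(INF z\<in>limit_class A d. ?s z) \<le> ?s y" by (intro cINF_lower)
  also have "?s y \<le> \<delta>" by (intro cSUP_least yb) simp
  finally show ?thesis using \<open>\<delta> < \<epsilon>\<close> unfolding star_quot_simps bounded_prod_simps by simp
qed

end

locale star_system = unital_star_sequence A for A :: "nat \<Rightarrow> 'a star_alg" +
  fixes \<phi> :: "nat \<Rightarrow> 'a \<Rightarrow> 'a"
  assumes hom: "\<And>n. \<phi> n \<in> contractive_hom (A n) (A (Suc n))"
begin

lemma connect_hom:
  assumes "m \<le> n"
  shows "connect \<phi> m n \<in> contractive_hom (A m) (A n)"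
  using assms
proof (induction rule: dec_induct)
  case base
  have "connect \<phi> m m = (\<lambda>x. x)" by (rule ext) simp
  then show ?case using contractive_hom_id[of "A m"] by simp
next
  case (step n)
  have "connect \<phi> m (Suc n) = \<phi> n \<circ> connect \<phi> m n"
    using step(1) by (intro ext) simp
  then show ?case using contractive_hom_comp[OF step(3) hom] by (simp only:)
qed

lemmas connect_star_hom = contractive_hom_hom[OF connect_hom]
lemmas connect_closed = contractive_hom_closed[OF connect_hom]
lemmas connect_nrm = contractive_hom_nrm[OF connect_hom]

lemma connect_minus:
  assumes "m \<le> n" "x \<in> carrier (A m)" "y \<in> carrier (A m)"
  shows "connect \<phi> m n (x \<ominus>\<^bsub>A m\<^esub> y) = connect \<phi> m n x \<ominus>\<^bsub>A n\<^esub> connect \<phi> m n y"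
  by (rule star_hom_minus[OF alg.ring_axioms alg.ring_axioms connect_star_hom[OF assms(1)] assms(2,3)])

lemma connect_nrm_minus:
  assumes "m \<le> n" "x \<in> carrier (A m)" "y \<in> carrier (A m)"
  shows "nrm (A n) (connect \<phi> m n x \<ominus>\<^bsub>A n\<^esub> connect \<phi> m n y) \<le> nrm (A m) (x \<ominus>\<^bsub>A m\<^esub> y)"
  using connect_nrm[OF assms(1) alg.minus_closed[OF assms(2,3)]] by (simp add: connect_minus assms)

lemma cauchy_bounded: "x \<in> cauchy_seqs A \<phi> \<Longrightarrow> x \<in> carrier (bounded_prod A)"
  by (simp add: cauchy_seqs_def)

lemmas cauchy_closed = bounded_prod_closed[OF cauchy_bounded]

text \<open>The base level \<open>N\<close> of the definition may be replaced by any later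
  \<open>m\<close>: the connecting maps carry the estimate at level \<open>m\<close> to level
  \<open>n\<close> without loss, and two errors of \<epsilon>/2 add up.\<close>

lemma cauchyD:
  assumes x: "x \<in> cauchy_seqs A \<phi>" and "0 < \<epsilon>"
  shows "\<exists>N. \<forall>m\<ge>N. \<forall>n\<ge>m. nrm (A n) (x n \<ominus>\<^bsub>A n\<^esub> connect \<phi> m n (x m)) < \<epsilon>"
proof -
  note cl = cauchy_closed[OF x]
  obtain N where N: "\<And>n. n \<ge> N \<Longrightarrow> nrm (A n) (x n \<ominus>\<^bsub>A n\<^esub> connect \<phi> N n (x N)) < \<epsilon> / 2"
    using x half_gt_zero[OF \<open>0 < \<epsilon>\<close>] unfolding cauchy_seqs_def by blast
  have "nrm (A n) (x n \<ominus>\<^bsub>A n\<^esub> connect \<phi> m n (x m)) < \<epsilon>" if "N \<le> m" "m \<le> n" for m n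
  proof -
    have c: "connect \<phi> N m (x N) \<in> carrier (A m)" by (rule connect_closed[OF \<open>N \<le> m\<close> cl])
    have "nrm (A n) (connect \<phi> m n (connect \<phi> N m (x N)) \<ominus>\<^bsub>A n\<^esub> connect \<phi> m n (x m)) < \<epsilon> / 2"
      using connect_nrm_minus[OF \<open>m \<le> n\<close> c cl] N[OF \<open>N \<le> m\<close>] alg.nrm_minus_commute[OF c cl] by linarith
    then have "nrm (A n) (connect \<phi> N n (x N) \<ominus>\<^bsub>A n\<^esub> connect \<phi> m n (x m)) < \<epsilon> / 2"
      using that by (simp add: connect_trans)
    moreover have "connect \<phi> N n (x N) \<in> carrier (A n)" "connect \<phi> m n (x m) \<in> carrier (A n)"
      using that connect_closed[OF _ cl] by auto
    ultimately show ?thesis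
      using alg.nrm_triangle[OF cl, of "connect \<phi> N n (x N)" n "connect \<phi> m n (x m)"] N[of n] that by simp
  qed
  then show ?thesis by blast
qed

text \<open>Once the thread is coherent, its term at \<open>n\<close> is the image of its term at
  \<open>N\<close>. The distance to it at level \<open>N\<close> is therefore passed on
  contractively, and the sequence inherits the Cauchy property.\<close>

lemma cauchyI_approx:
  assumes x: "x \<in> carrier (bounded_prod A)"
    and approx: "\<And>\<epsilon>. 0 < \<epsilon> \<Longrightarrow> \<exists>t\<in>threads A \<phi>. \<exists>N. \<forall>n\<ge>N. nrm (A n) (x n \<ominus>\<^bsub>A n\<^esub> t n) < \<epsilon>"
  shows "x \<in> cauchy_seqs A \<phi>"
proof -
  note cl = bounded_prod_closed[OF x]
  have "\<exists>N. \<forall>n\<ge>N. nrm (A n) (x n \<ominus>\<^bsub>A n\<^esub> connect \<phi> N n (x N)) < \<epsilon>" if "0 < \<epsilon>" for \<epsilon>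
  proof -
    obtain t M where t: "t \<in> threads A \<phi>" and M: "\<And>n. n \<ge> M \<Longrightarrow> nrm (A n) (x n \<ominus>\<^bsub>A n\<^esub> t n) < \<epsilon> / 2"
      using approx[of "\<epsilon> / 2"] \<open>0 < \<epsilon>\<close> by auto
    obtain L where L: "\<And>n. n \<ge> L \<Longrightarrow> t (Suc n) = \<phi> n (t n)"
      using t by (auto simp: threads_def)
    have tc: "t n \<in> carrier (A n)" for n
      using t bounded_prod_closed by (auto simp: threads_def)
    define N where "N = max M L"
    have "nrm (A n) (x n \<ominus>\<^bsub>A n\<^esub> connect \<phi> N n (x N)) < \<epsilon>" if "N \<le> n" for n
    proof -
      have "t n = connect \<phi> N n (t N)"
        using that by (induction rule: dec_induct) (simp_all add: N_def L)
      then have "nrm (A n) (t n \<ominus>\<^bsub>A n\<^esub> connect \<phi> N n (x N)) \<le> nrm (A N) (x N \<ominus>\<^bsub>A N\<^esub> t N)"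
        using connect_nrm_minus[OF that tc cl] alg.nrm_minus_commute[OF tc[of N] cl[of N]] by simp
      then show ?thesis
        using alg.nrm_triangle[OF cl tc connect_closed[OF that cl]] M[of n] M[of N] that
        by (simp add: N_def)
    qed
    then show ?thesis by blast
  qed
  then show ?thesis using x by (simp add: cauchy_seqs_def)
qed

text \<open>The coherent sequence started by \<open>a\<close> at level \<open>m\<close>. The zeros
  below \<open>m\<close> are a default that the class in the limit does not see.\<close>

definition thread :: "nat \<Rightarrow> 'a \<Rightarrow> nat \<Rightarrow> 'a" where
  "thread m a = (\<lambda>n. if n < m then \<zero>\<^bsub>A n\<^esub> else connect \<phi> m n a)"

lemma thread_nrm: "a \<in> carrier (A m) \<Longrightarrow> nrm (A n) (thread m a n) \<le> nrm (A m) a"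
  using connect_nrm[of m n a] by (auto simp: thread_def alg.nrm_zero alg.nrm_nonneg)

lemma thread_closed: "a \<in> carrier (A m) \<Longrightarrow> thread m a n \<in> carrier (A n)"
  using connect_closed[of m n a] by (auto simp: thread_def)

lemma thread_threads:
  assumes "a \<in> carrier (A m)"
  shows "thread m a \<in> threads A \<phi>"
proof -
  have "thread m a (Suc n) = \<phi> n (thread m a n)" if "n \<ge> m" for n
    using that by (simp add: thread_def)
  then show ?thesis
    using bounded_prodI[of "thread m a" A, OF thread_closed thread_nrm] assms
    unfolding threads_def by blast
qed

lemma threads_bounded: "t \<in> threads A \<phi> \<Longrightarrow> t \<in> carrier (bounded_prod A)"
  by (simp add: threads_def)

lemma threads_cauchy:
  assumes "t \<in> threads A \<phi>"
  shows "t \<in> cauchy_seqs A \<phi>"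
proof (rule cauchyI_approx[OF threads_bounded[OF assms]])
  fix \<epsilon> :: real assume "0 < \<epsilon>"
  then have "nrm (A n) (t n \<ominus>\<^bsub>A n\<^esub> t n) < \<epsilon>" for n
    using bounded_prod_closed[OF threads_bounded[OF assms]] by (simp add: alg.minus_self alg.nrm_zero)
  then show "\<exists>t'\<in>threads A \<phi>. \<exists>N. \<forall>n\<ge>N. nrm (A n) (t n \<ominus>\<^bsub>A n\<^esub> t' n) < \<epsilon>"
    using assms by blast
qed

lemmas thread_cauchy = threads_cauchy[OF thread_threads]

lemma threads_add:
  assumes "s \<in> threads A \<phi>" "t \<in> threads A \<phi>"
  shows "(\<lambda>n. s n \<oplus>\<^bsub>A n\<^esub> t n) \<in> threads A \<phi>"
proof -
  obtain L where L: "\<And>n. n \<ge> L \<Longrightarrow> s (Suc n) = \<phi> n (s n)" using assms by (auto simp: threads_def)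
  obtain M where M: "\<And>n. n \<ge> M \<Longrightarrow> t (Suc n) = \<phi> n (t n)" using assms by (auto simp: threads_def)
  have "s (Suc n) \<oplus>\<^bsub>A (Suc n)\<^esub> t (Suc n) = \<phi> n (s n \<oplus>\<^bsub>A n\<^esub> t n)" if "n \<ge> max L M" for n
    using that L[of n] M[of n] star_hom_add[OF contractive_hom_hom[OF hom]]
      bounded_prod_closed[OF threads_bounded] assms by simp
  then show ?thesis
    using bounded_prod_add[OF threads_bounded threads_bounded, OF assms]
    unfolding threads_def bounded_prod_simps by blast
qed

lemma cauchy_seqsI:
  assumes "x \<in> carrier (bounded_prod A)"
    and "\<And>\<epsilon>. 0 < \<epsilon> \<Longrightarrow> \<exists>N. \<forall>n\<ge>N. nrm (A n) (x n \<ominus>\<^bsub>A n\<^esub> connect \<phi> N n (x N)) < \<epsilon>"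
  shows "x \<in> cauchy_seqs A \<phi>"
  using assms by (simp add: cauchy_seqs_def)

lemma cauchy_one: "\<one>\<^bsub>bounded_prod A\<^esub> \<in> cauchy_seqs A \<phi>"
proof (rule cauchy_seqsI[OF bounded_prod_one])
  fix \<epsilon> :: real assume "0 < \<epsilon>"
  then have "nrm (A n) (\<one>\<^bsub>A n\<^esub> \<ominus>\<^bsub>A n\<^esub> connect \<phi> 0 n \<one>\<^bsub>A 0\<^esub>) < \<epsilon>" for n
    by (simp add: star_hom_one[OF connect_star_hom] alg.minus_self alg.nrm_zero)
  then show "\<exists>N. \<forall>n\<ge>N. nrm (A n) (\<one>\<^bsub>bounded_prod A\<^esub> n \<ominus>\<^bsub>A n\<^esub> connect \<phi> N n (\<one>\<^bsub>bounded_prod A\<^esub> N)) < \<epsilon>"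
    unfolding bounded_prod_simps by blast
qed

lemma cauchy_add:
  assumes x: "x \<in> cauchy_seqs A \<phi>" and y: "y \<in> cauchy_seqs A \<phi>"
  shows "x \<oplus>\<^bsub>bounded_prod A\<^esub> y \<in> cauchy_seqs A \<phi>"
proof (rule cauchy_seqsI[OF bounded_prod_add[OF cauchy_bounded[OF x] cauchy_bounded[OF y]]])
  note cx = cauchy_closed[OF x] and cy = cauchy_closed[OF y]
  fix \<epsilon> :: real assume "0 < \<epsilon>"
  then have "0 < \<epsilon> / 2" by simp
  from cauchyD[OF x this] obtain K where
    K: "\<And>m n. K \<le> m \<Longrightarrow> m \<le> n \<Longrightarrow> nrm (A n) (x n \<ominus>\<^bsub>A n\<^esub> connect \<phi> m n (x m)) < \<epsilon> / 2" by blast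
  from cauchyD[OF y \<open>0 < \<epsilon> / 2\<close>] obtain L where
    L: "\<And>m n. L \<le> m \<Longrightarrow> m \<le> n \<Longrightarrow> nrm (A n) (y n \<ominus>\<^bsub>A n\<^esub> connect \<phi> m n (y m)) < \<epsilon> / 2" by blast
  define N where "N = max K L"
  have "nrm (A n) ((x n \<oplus>\<^bsub>A n\<^esub> y n) \<ominus>\<^bsub>A n\<^esub> connect \<phi> N n (x N \<oplus>\<^bsub>A N\<^esub> y N)) < \<epsilon>" if "n \<ge> N" for n
  proof -
    note dx = connect_closed[OF that cx] and dy = connect_closed[OF that cy]
    have "nrm (A n) ((x n \<oplus>\<^bsub>A n\<^esub> y n) \<ominus>\<^bsub>A n\<^esub> connect \<phi> N n (x N \<oplus>\<^bsub>A N\<^esub> y N))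
      = nrm (A n) ((x n \<ominus>\<^bsub>A n\<^esub> connect \<phi> N n (x N)) \<oplus>\<^bsub>A n\<^esub> (y n \<ominus>\<^bsub>A n\<^esub> connect \<phi> N n (y N)))"
      by (simp only: star_hom_add[OF connect_star_hom[OF that] cx cy] alg.add_minus_add[OF cx cy dx dy])
    also have "\<dots> \<le> nrm (A n) (x n \<ominus>\<^bsub>A n\<^esub> connect \<phi> N n (x N)) + nrm (A n) (y n \<ominus>\<^bsub>A n\<^esub> connect \<phi> N n (y N))"
      by (intro alg.nrm_add alg.minus_closed cx cy dx dy)
    also have "\<dots> < \<epsilon>" using K[of N n] L[of N n] that by (simp add: N_def)
    finally show ?thesis .
  qed
  then show "\<exists>N. \<forall>n\<ge>N. nrm (A n) ((x \<oplus>\<^bsub>bounded_prod A\<^esub> y) n \<ominus>\<^bsub>A n\<^esub> connect \<phi> N n ((x \<oplus>\<^bsub>bounded_prod A\<^esub> y) N)) < \<epsilon>"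
    unfolding bounded_prod_simps by blast
qed

lemma cauchy_mult:
  assumes x: "x \<in> cauchy_seqs A \<phi>" and y: "y \<in> cauchy_seqs A \<phi>"
  shows "x \<otimes>\<^bsub>bounded_prod A\<^esub> y \<in> cauchy_seqs A \<phi>"
proof (rule cauchy_seqsI[OF bounded_prod_mult[OF cauchy_bounded[OF x] cauchy_bounded[OF y]]])
  note cx = cauchy_closed[OF x] and cy = cauchy_closed[OF y]
  fix \<epsilon> :: real assume "0 < \<epsilon>"
  obtain C where C: "0 \<le> C" "\<And>n. nrm (A n) (x n) \<le> C" using bounded_prodE[OF cauchy_bounded[OF x]] by blast
  obtain D where D: "0 \<le> D" "\<And>n. nrm (A n) (y n) \<le> D" using bounded_prodE[OF cauchy_bounded[OF y]] by blast
  \<comment> \<open>The product error is at most C \<delta> + \<delta> D; the summand 1 keeps the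
    denominator positive and makes the final inequality strict.\<close>
  define \<delta> where "\<delta> = \<epsilon> / (C + D + 1)"
  have "0 < \<delta>" using \<open>0 < \<epsilon>\<close> C(1) D(1) by (simp add: \<delta>_def)
  from cauchyD[OF x this] obtain K where
    K: "\<And>m n. K \<le> m \<Longrightarrow> m \<le> n \<Longrightarrow> nrm (A n) (x n \<ominus>\<^bsub>A n\<^esub> connect \<phi> m n (x m)) < \<delta>" by blast
  from cauchyD[OF y \<open>0 < \<delta>\<close>] obtain L where
    L: "\<And>m n. L \<le> m \<Longrightarrow> m \<le> n \<Longrightarrow> nrm (A n) (y n \<ominus>\<^bsub>A n\<^esub> connect \<phi> m n (y m)) < \<delta>" by blast
  define N where "N = max K L"
  have "nrm (A n) ((x n \<otimes>\<^bsub>A n\<^esub> y n) \<ominus>\<^bsub>A n\<^esub> connect \<phi> N n (x N \<otimes>\<^bsub>A N\<^esub> y N)) < \<epsilon>" if "n \<ge> N" for n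
  proof -
    let ?x = "connect \<phi> N n (x N)" and ?y = "connect \<phi> N n (y N)"
    note dx = connect_closed[OF that cx] and dy = connect_closed[OF that cy]
    have "nrm (A n) ((x n \<otimes>\<^bsub>A n\<^esub> y n) \<ominus>\<^bsub>A n\<^esub> connect \<phi> N n (x N \<otimes>\<^bsub>A N\<^esub> y N))
      = nrm (A n) (x n \<otimes>\<^bsub>A n\<^esub> (y n \<ominus>\<^bsub>A n\<^esub> ?y) \<oplus>\<^bsub>A n\<^esub> (x n \<ominus>\<^bsub>A n\<^esub> ?x) \<otimes>\<^bsub>A n\<^esub> ?y)"
      by (simp only: star_hom_mult[OF connect_star_hom[OF that] cx cy] alg.mult_minus_mult[OF cx cy dx dy])
    also have "\<dots> \<le> nrm (A n) (x n \<otimes>\<^bsub>A n\<^esub> (y n \<ominus>\<^bsub>A n\<^esub> ?y)) + nrm (A n) ((x n \<ominus>\<^bsub>A n\<^esub> ?x) \<otimes>\<^bsub>A n\<^esub> ?y)"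
      by (intro alg.nrm_add alg.minus_closed alg.m_closed cx cy dx dy)
    also have "\<dots> \<le> nrm (A n) (x n) * nrm (A n) (y n \<ominus>\<^bsub>A n\<^esub> ?y) + nrm (A n) (x n \<ominus>\<^bsub>A n\<^esub> ?x) * nrm (A n) ?y"
      by (intro add_mono alg.nrm_mult alg.minus_closed cx cy dx dy)
    also have "\<dots> \<le> C * \<delta> + \<delta> * D"
      using K[of N n] L[of N n] that C D(1) \<open>0 < \<delta>\<close> order_trans[OF connect_nrm[OF that cy] D(2)]
      by (intro add_mono mult_mono alg.nrm_nonneg alg.minus_closed cx cy dx dy) (simp_all add: N_def)
    also have "\<dots> < \<delta> * (C + D + 1)" using \<open>0 < \<delta>\<close> by (simp add: algebra_simps)
    also have "\<dots> = \<epsilon>" using C(1) D(1) by (simp add: \<delta>_def)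
    finally show ?thesis .
  qed
  then show "\<exists>N. \<forall>n\<ge>N. nrm (A n) ((x \<otimes>\<^bsub>bounded_prod A\<^esub> y) n \<ominus>\<^bsub>A n\<^esub> connect \<phi> N n ((x \<otimes>\<^bsub>bounded_prod A\<^esub> y) N)) < \<epsilon>"
    unfolding bounded_prod_simps by blast
qed

lemma cauchy_smult:
  assumes x: "x \<in> cauchy_seqs A \<phi>"
  shows "c \<odot>\<^bsub>bounded_prod A\<^esub> x \<in> cauchy_seqs A \<phi>"
proof (rule cauchy_seqsI[OF bounded_prod_smult[OF cauchy_bounded[OF x]]])
  note cx = cauchy_closed[OF x]
  fix \<epsilon> :: real assume "0 < \<epsilon>"
  define \<delta> where "\<delta> = \<epsilon> / (cmod c + 1)"
  have c1: "0 < cmod c + 1" using norm_ge_zero[of c] by linarith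
  have "0 < \<delta>" using \<open>0 < \<epsilon>\<close> c1 by (simp add: \<delta>_def)
  from cauchyD[OF x this] obtain N where
    N: "\<And>n. N \<le> n \<Longrightarrow> nrm (A n) (x n \<ominus>\<^bsub>A n\<^esub> connect \<phi> N n (x N)) < \<delta>" by blast
  have "nrm (A n) ((c \<odot>\<^bsub>A n\<^esub> x n) \<ominus>\<^bsub>A n\<^esub> connect \<phi> N n (c \<odot>\<^bsub>A N\<^esub> x N)) < \<epsilon>" if "n \<ge> N" for n
  proof -
    note dx = connect_closed[OF that cx]
    have "nrm (A n) ((c \<odot>\<^bsub>A n\<^esub> x n) \<ominus>\<^bsub>A n\<^esub> connect \<phi> N n (c \<odot>\<^bsub>A N\<^esub> x N))
      = nrm (A n) (c \<odot>\<^bsub>A n\<^esub> (x n \<ominus>\<^bsub>A n\<^esub> connect \<phi> N n (x N)))"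
      by (simp only: star_hom_smult[OF connect_star_hom[OF that] cx] alg.smult_minus[OF cx dx])
    also have "\<dots> \<le> cmod c * nrm (A n) (x n \<ominus>\<^bsub>A n\<^esub> connect \<phi> N n (x N))"
      by (intro alg.nrm_smult alg.minus_closed cx dx)
    also have "\<dots> \<le> cmod c * \<delta>" using N[OF that] by (intro mult_left_mono) auto
    also have "\<dots> < (cmod c + 1) * \<delta>" using \<open>0 < \<delta>\<close> by (simp add: algebra_simps)
    also have "\<dots> = \<epsilon>" using c1 by (simp add: \<delta>_def)
    finally show ?thesis .
  qed
  then show "\<exists>N. \<forall>n\<ge>N. nrm (A n) ((c \<odot>\<^bsub>bounded_prod A\<^esub> x) n \<ominus>\<^bsub>A n\<^esub> connect \<phi> N n ((c \<odot>\<^bsub>bounded_prod A\<^esub> x) N)) < \<epsilon>"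
    unfolding bounded_prod_simps by blast
qed

lemma cauchy_star:
  assumes x: "x \<in> cauchy_seqs A \<phi>"
  shows "star (bounded_prod A) x \<in> cauchy_seqs A \<phi>"
proof (rule cauchy_seqsI[OF bounded_prod_star[OF cauchy_bounded[OF x]]])
  note cx = cauchy_closed[OF x]
  fix \<epsilon> :: real assume "0 < \<epsilon>"
  from cauchyD[OF x this] obtain N where
    N: "\<And>n. N \<le> n \<Longrightarrow> nrm (A n) (x n \<ominus>\<^bsub>A n\<^esub> connect \<phi> N n (x N)) < \<epsilon>" by blast
  have "nrm (A n) (star (A n) (x n) \<ominus>\<^bsub>A n\<^esub> connect \<phi> N n (star (A N) (x N))) < \<epsilon>" if "n \<ge> N" for n
    using le_less_trans[OF alg.nrm_star[OF alg.minus_closed[OF cx connect_closed[OF that cx]]] N[OF that]]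
    by (simp only: star_hom_star[OF connect_star_hom[OF that] cx] alg.star_minus[OF cx connect_closed[OF that cx]])
  then show "\<exists>N. \<forall>n\<ge>N. nrm (A n) (star (bounded_prod A) x n \<ominus>\<^bsub>A n\<^esub> connect \<phi> N n (star (bounded_prod A) x N)) < \<epsilon>"
    unfolding bounded_prod_simps by blast
qed

lemma cauchy_uminus:
  assumes x: "x \<in> cauchy_seqs A \<phi>"
  shows "\<ominus>\<^bsub>bounded_prod A\<^esub> x \<in> cauchy_seqs A \<phi>"
  unfolding bounded_prod_uminus[OF cauchy_bounded[OF x]]
proof (rule cauchy_seqsI[OF bounded_prod_neg[OF cauchy_bounded[OF x]]])
  note cx = cauchy_closed[OF x]
  fix \<epsilon> :: real assume "0 < \<epsilon>"
  from cauchyD[OF x this] obtain N where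
    N: "\<And>n. N \<le> n \<Longrightarrow> nrm (A n) (x n \<ominus>\<^bsub>A n\<^esub> connect \<phi> N n (x N)) < \<epsilon>" by blast
  have "nrm (A n) (\<ominus>\<^bsub>A n\<^esub> x n \<ominus>\<^bsub>A n\<^esub> connect \<phi> N n (\<ominus>\<^bsub>A N\<^esub> x N)) < \<epsilon>" if "n \<ge> N" for n
  proof -
    note dx = connect_closed[OF that cx]
    have "connect \<phi> N n (\<zero>\<^bsub>A N\<^esub> \<ominus>\<^bsub>A N\<^esub> x N) = \<zero>\<^bsub>A n\<^esub> \<ominus>\<^bsub>A n\<^esub> connect \<phi> N n (x N)"
      unfolding connect_minus[OF that alg.zero_closed cx]
      by (simp only: star_hom_zero[OF alg.ring_axioms alg.ring_axioms connect_star_hom[OF that]])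
    then have "connect \<phi> N n (\<ominus>\<^bsub>A N\<^esub> x N) = \<ominus>\<^bsub>A n\<^esub> connect \<phi> N n (x N)"
      using cx dx by (simp add: alg.minus_eq)
    then show ?thesis
      using N[OF that] alg.nrm_minus_commute[OF cx dx] by (simp only: alg.uminus_minus_uminus[OF cx dx])
  qed
  then show "\<exists>N. \<forall>n\<ge>N. nrm (A n) (\<ominus>\<^bsub>A n\<^esub> x n \<ominus>\<^bsub>A n\<^esub> connect \<phi> N n (\<ominus>\<^bsub>A N\<^esub> x N)) < \<epsilon>"
    by blast
qed

lemma cauchy_algebra: "star_algebra (cauchy_alg A \<phi>)"
proof -
  have "subring (cauchy_seqs A \<phi>) (bounded_prod A)"
    by (rule prod.subringI[OF _ cauchy_one cauchy_uminus cauchy_mult cauchy_add])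
      (auto dest: cauchy_bounded)
  from prod.subring_is_ring[OF this] interpret ring "cauchy_alg A \<phi>"
    unfolding cauchy_alg_def .
  show ?thesis
    by unfold_locales
      (simp_all only: cauchy_alg_simps cauchy_smult cauchy_star prod.smult_add prod.star_add cauchy_bounded)
qed

lemma limit_simps:
  "mult (cstar_limit A \<phi>) = mult (star_quot (bounded_prod A) (null_seqs A))"
  "one (cstar_limit A \<phi>) = one (star_quot (bounded_prod A) (null_seqs A))"
  "zero (cstar_limit A \<phi>) = zero (star_quot (bounded_prod A) (null_seqs A))"
  "add (cstar_limit A \<phi>) = add (star_quot (bounded_prod A) (null_seqs A))"
  "smult (cstar_limit A \<phi>) = smult (star_quot (bounded_prod A) (null_seqs A))"
  "star (cstar_limit A \<phi>) = star (star_quot (bounded_prod A) (null_seqs A))"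
  by (simp_all add: cstar_limit_def Let_def)

lemma limit_class_zero: "limit_class A \<zero>\<^bsub>bounded_prod A\<^esub> = \<zero>\<^bsub>star_quot (bounded_prod A) (null_seqs A)\<^esub>"
  unfolding limit_class_def null.coset_zero star_quot_simps FactRing_def by simp

lemma quot_ring: "ring (star_quot (bounded_prod A) (null_seqs A))"
proof (rule ring_hom_image_ring[where h = "(+>\<^bsub>bounded_prod A\<^esub>) (null_seqs A)"])
  show "null_seqs A +>\<^bsub>bounded_prod A\<^esub> \<zero>\<^bsub>bounded_prod A\<^esub> = \<zero>\<^bsub>star_quot (bounded_prod A) (null_seqs A)\<^esub>"
    by (rule limit_class_zero[unfolded limit_class_def])
qed (rule prod.ring_axioms null.coset_surj star_hom_ring_hom[OF null.quot_map_hom])+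

lemma limit_class_minus:
  assumes "x \<in> carrier (bounded_prod A)" "y \<in> carrier (bounded_prod A)"
  shows "limit_class A x \<ominus>\<^bsub>star_quot (bounded_prod A) (null_seqs A)\<^esub> limit_class A y
    = limit_class A (\<lambda>n. x n \<ominus>\<^bsub>A n\<^esub> y n)"
  unfolding limit_class_def bounded_prod_minus[OF assms, symmetric]
  by (rule star_hom_minus[OF prod.ring_axioms quot_ring null.quot_map_hom assms, symmetric])

text \<open>The approximation by threads in the definition of the limit amounts to the Cauchy
  property of one, equivalently every, representative. From here on the quotient norm is replaced by
  the norms of the levels.\<close>

lemma limit_carrier: "carrier (cstar_limit A \<phi>) = limit_class A ` cauchy_seqs A \<phi>"
proof -
  let ?Q = "star_quot (bounded_prod A) (null_seqs A)"
  have Q: "carrier ?Q = limit_class A ` carrier (bounded_prod A)"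
    unfolding limit_class_def by (rule null.coset_surj[symmetric])
  have "(\<forall>\<epsilon>>0. \<exists>t\<in>threads A \<phi>. nrm ?Q (limit_class A x \<ominus>\<^bsub>?Q\<^esub> limit_class A t) < \<epsilon>)
      \<longleftrightarrow> x \<in> cauchy_seqs A \<phi>" (is "?l \<longleftrightarrow> _") if x: "x \<in> carrier (bounded_prod A)" for x
  proof
    assume l: ?l
    show "x \<in> cauchy_seqs A \<phi>"
    proof (rule cauchyI_approx[OF x])
      fix \<epsilon> :: real assume "0 < \<epsilon>"
      with l obtain t where t: "t \<in> threads A \<phi>"
        "nrm ?Q (limit_class A x \<ominus>\<^bsub>?Q\<^esub> limit_class A t) < \<epsilon>" by blast
      have tb: "t \<in> carrier (bounded_prod A)" by (rule threads_bounded[OF t(1)])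
      from quot_nrm_lessD[OF _ t(2)[unfolded limit_class_minus[OF x tb]]]
        prod.minus_closed[OF x tb, unfolded bounded_prod_minus[OF x tb]] t(1)
      show "\<exists>t\<in>threads A \<phi>. \<exists>N. \<forall>n\<ge>N. nrm (A n) (x n \<ominus>\<^bsub>A n\<^esub> t n) < \<epsilon>" by blast
    qed
  next
    assume c: "x \<in> cauchy_seqs A \<phi>"
    show ?l
    proof (intro allI impI)
      fix \<epsilon> :: real assume "0 < \<epsilon>"
      then have "0 < \<epsilon> / 2" by simp
      from cauchyD[OF c this] obtain N where
        N: "\<And>n. N \<le> n \<Longrightarrow> nrm (A n) (x n \<ominus>\<^bsub>A n\<^esub> connect \<phi> N n (x N)) < \<epsilon> / 2" by blast
      define t where "t = thread N (x N)"
      have t: "t \<in> threads A \<phi>" unfolding t_def by (rule thread_threads[OF cauchy_closed[OF c]])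
      have tb: "t \<in> carrier (bounded_prod A)" by (rule threads_bounded[OF t])
      have "nrm (A n) (x n \<ominus>\<^bsub>A n\<^esub> t n) \<le> \<epsilon> / 2" if "N \<le> n" for n
        using N[OF that] that by (simp add: t_def thread_def)
      from quot_nrm_lessI[OF prod.minus_closed[OF x tb, unfolded bounded_prod_minus[OF x tb]] this]
      have "nrm ?Q (limit_class A x \<ominus>\<^bsub>?Q\<^esub> limit_class A t) < \<epsilon>"
        unfolding limit_class_minus[OF x tb] using \<open>0 < \<epsilon>\<close> by simp
      then show "\<exists>t\<in>threads A \<phi>. nrm ?Q (limit_class A x \<ominus>\<^bsub>?Q\<^esub> limit_class A t) < \<epsilon>"
        using t by blast
    qed
  qed
  then have "{X \<in> carrier ?Q. \<forall>\<epsilon>>0. \<exists>t\<in>threads A \<phi>. nrm ?Q (X \<ominus>\<^bsub>?Q\<^esub> limit_class A t) < \<epsilon>}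
      = limit_class A ` cauchy_seqs A \<phi>"
    unfolding Q using cauchy_bounded by blast
  then show ?thesis
    unfolding cstar_limit_def Let_def limit_class_def by simp
qed

lemma limit_class_hom: "limit_class A \<in> star_hom (cauchy_alg A \<phi>) (cstar_limit A \<phi>)"
proof -
  note h = null.quot_map_hom[folded limit_class_def]
  have eta: "(+>\<^bsub>bounded_prod A\<^esub>) (null_seqs A) = limit_class A"
    by (rule ext) (simp add: limit_class_def)
  note H = star_homD[OF null.quot_map_hom[unfolded eta]]
  show ?thesis
  proof (rule star_homI)
    show "limit_class A x \<in> carrier (cstar_limit A \<phi>)" if "x \<in> carrier (cauchy_alg A \<phi>)" for x
      using that unfolding limit_carrier cauchy_alg_simps by (rule imageI)
  qed (simp_all only: cauchy_alg_simps limit_simps H cauchy_bounded)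
qed

lemma limit_class_zero': "limit_class A \<zero>\<^bsub>cauchy_alg A \<phi>\<^esub> = \<zero>\<^bsub>cstar_limit A \<phi>\<^esub>"
  unfolding cauchy_alg_simps limit_simps by (rule limit_class_zero)

lemma limit_algebra: "star_algebra (cstar_limit A \<phi>)"
proof (rule star_hom_image_algebra[OF cauchy_algebra, where h = "limit_class A"])
  show "limit_class A ` carrier (cauchy_alg A \<phi>) = carrier (cstar_limit A \<phi>)"
    by (simp only: cauchy_alg_simps limit_carrier)
qed (rule limit_class_hom limit_class_zero')+

lemma limit_class_eq_zero:
  assumes "x \<in> cauchy_seqs A \<phi>"
  shows "limit_class A x = \<zero>\<^bsub>cstar_limit A \<phi>\<^esub> \<longleftrightarrow> (\<lambda>n. nrm (A n) (x n)) \<longlonglongrightarrow> 0"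
  unfolding limit_simps limit_class_zero[symmetric]
    limit_class_eq[OF cauchy_bounded[OF assms] bounded_prod_zero]
  unfolding bounded_prod_simps using cauchy_closed[OF assms] by (simp add: alg.minus_eq)

text \<open>Maps out of the limit are defined on Cauchy sequences, where all operations are
  pointwise, and descend if they agree on sequences with null difference.\<close>

theorem limit_lift:
  assumes F: "F \<in> star_hom (cauchy_alg A \<phi>) B"
    and null: "\<And>x y. x \<in> cauchy_seqs A \<phi> \<Longrightarrow> y \<in> cauchy_seqs A \<phi> \<Longrightarrow>
      (\<lambda>n. nrm (A n) (x n \<ominus>\<^bsub>A n\<^esub> y n)) \<longlonglongrightarrow> 0 \<Longrightarrow> F x = F y"
  obtains h where "h \<in> star_hom (cstar_limit A \<phi>) B"
    and "\<And>x. x \<in> cauchy_seqs A \<phi> \<Longrightarrow> h (limit_class A x) = F x"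
proof -
  define h where "h X = F (SOME x. x \<in> cauchy_seqs A \<phi> \<and> limit_class A x = X)" for X
  have h: "h (limit_class A x) = F x" if x: "x \<in> cauchy_seqs A \<phi>" for x
  proof -
    define y where "y = (SOME y. y \<in> cauchy_seqs A \<phi> \<and> limit_class A y = limit_class A x)"
    have y: "y \<in> cauchy_seqs A \<phi> \<and> limit_class A y = limit_class A x"
      unfolding y_def by (rule someI[of _ x]) (simp add: x)
    then have "F y = F x"
      using null[of y x] x limit_class_eq[of y x] cauchy_bounded by blast
    then show ?thesis unfolding h_def y_def .
  qed
  note L = star_homD(2-)[OF limit_class_hom, unfolded cauchy_alg_simps]
  note F' = star_homD[OF F, unfolded cauchy_alg_simps]
  have rep: "\<exists>x\<in>cauchy_seqs A \<phi>. X = limit_class A x" if "X \<in> carrier (cstar_limit A \<phi>)" for X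
    using that unfolding limit_carrier by blast
  have "h \<in> star_hom (cstar_limit A \<phi>) B"
  proof (rule star_homI)
    fix X c assume "X \<in> carrier (cstar_limit A \<phi>)"
    from rep[OF this] obtain x where x: "x \<in> cauchy_seqs A \<phi>" and X: "X = limit_class A x" by blast
    show "h X \<in> carrier B" unfolding X h[OF x] by (rule F'(2)[OF x])
    show "h (c \<odot>\<^bsub>cstar_limit A \<phi>\<^esub> X) = c \<odot>\<^bsub>B\<^esub> h X"
      unfolding X L(5)[symmetric, OF x] h[OF x] h[OF cauchy_smult[OF x]] by (rule F'(6)[OF x])
    show "h (star (cstar_limit A \<phi>) X) = star B (h X)"
      unfolding X L(6)[symmetric, OF x] h[OF x] h[OF cauchy_star[OF x]] by (rule F'(7)[OF x])
    fix Y assume "Y \<in> carrier (cstar_limit A \<phi>)"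
    from rep[OF this] obtain y where y: "y \<in> cauchy_seqs A \<phi>" and Y: "Y = limit_class A y" by blast
    show "h (X \<otimes>\<^bsub>cstar_limit A \<phi>\<^esub> Y) = h X \<otimes>\<^bsub>B\<^esub> h Y"
      unfolding X Y L(2)[symmetric, OF x y] h[OF x] h[OF y] h[OF cauchy_mult[OF x y]] by (rule F'(3)[OF x y])
    show "h (X \<oplus>\<^bsub>cstar_limit A \<phi>\<^esub> Y) = h X \<oplus>\<^bsub>B\<^esub> h Y"
      unfolding X Y L(3)[symmetric, OF x y] h[OF x] h[OF y] h[OF cauchy_add[OF x y]] by (rule F'(4)[OF x y])
  next
    show "h \<one>\<^bsub>cstar_limit A \<phi>\<^esub> = \<one>\<^bsub>B\<^esub>"
      unfolding L(4)[symmetric] h[OF cauchy_one] by (rule F'(5))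
  qed
  then show thesis using h by (rule that)
qed

end

text \<open>A map of towers that reaches level \<open>j\<close> of \<open>B\<close> from level
  \<open>N j\<close> of \<open>A\<close>. \<open>N_ge\<close> forces \<open>N\<close> to be
  unbounded, with \<open>Suc\<close> because in the Effros-Shen case \<open>N 1\<close> may still be
  0. The squares are required from \<open>j = 1\<close> on: level 0 of the Effros-Shen tower sees
  one of the two summands of level 0 of the Pascal tower, and there the square does not commute.
  \<open>lift\<close> makes the map of limits surjective.\<close>

locale limit_morphism = A: star_system A \<phi> + B: star_system B \<psi>
  for A :: "nat \<Rightarrow> 'a star_alg" and \<phi> and B :: "nat \<Rightarrow> 'b star_alg" and \<psi> +
  fixes N :: "nat \<Rightarrow> nat" and \<rho> :: "nat \<Rightarrow> 'a \<Rightarrow> 'b"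
  assumes N_mono: "mono N" and N_ge: "\<And>j. j \<le> Suc (N j)"
    and hom: "\<And>j. \<rho> j \<in> contractive_hom (A (N j)) (B j)"
    and intertwine: "\<And>j x. 1 \<le> j \<Longrightarrow> x \<in> carrier (A (N j)) \<Longrightarrow>
      \<rho> (Suc j) (connect \<phi> (N j) (N (Suc j)) x) = \<psi> j (\<rho> j x)"
    and lift: "\<And>j b. b \<in> carrier (B j) \<Longrightarrow>
      \<exists>a\<in>carrier (A (N j)). \<rho> j a = b \<and> nrm (A (N j)) a \<le> nrm (B j) b"
begin

lemmas \<rho>_hom = contractive_hom_hom[OF hom]
lemmas \<rho>_closed = contractive_hom_closed[OF hom]
lemmas \<rho>_nrm = contractive_hom_nrm[OF hom]

lemma N_le: "i \<le> j \<Longrightarrow> N i \<le> N j"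
  by (rule monoD[OF N_mono])

lemma le_N: "Suc k \<le> j \<Longrightarrow> k \<le> N j"
  using N_ge[of j] by simp

lemma N_at_top: "filterlim N at_top sequentially"
  unfolding filterlim_at_top eventually_sequentially using le_N by blast

lemma \<rho>_minus:
  assumes "x \<in> carrier (A (N j))" "y \<in> carrier (A (N j))"
  shows "\<rho> j (x \<ominus>\<^bsub>A (N j)\<^esub> y) = \<rho> j x \<ominus>\<^bsub>B j\<^esub> \<rho> j y"
  by (rule star_hom_minus[OF A.alg.ring_axioms B.alg.ring_axioms \<rho>_hom assms])

lemma \<rho>_nrm_minus:
  assumes "x \<in> carrier (A (N j))" "y \<in> carrier (A (N j))"
  shows "nrm (B j) (\<rho> j x \<ominus>\<^bsub>B j\<^esub> \<rho> j y) \<le> nrm (A (N j)) (x \<ominus>\<^bsub>A (N j)\<^esub> y)"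
  using \<rho>_nrm[OF A.alg.minus_closed[OF assms]] by (simp only: \<rho>_minus[OF assms])

lemma \<rho>_connect:
  assumes "1 \<le> i" "i \<le> j" "x \<in> carrier (A (N i))"
  shows "\<rho> j (connect \<phi> (N i) (N j) x) = connect \<psi> i j (\<rho> i x)"
  using assms(2)
proof (induction rule: dec_induct)
  case base
  show ?case by simp
next
  case (step j)
  have "connect \<phi> (N i) (N (Suc j)) x = connect \<phi> (N j) (N (Suc j)) (connect \<phi> (N i) (N j) x)"
    using step by (simp only: connect_trans N_le le_SucI le_refl)
  then show ?case
    using step assms intertwine[of j "connect \<phi> (N i) (N j) x"] A.connect_closed[OF N_le[OF step(1)]]
    by simp
qed

definition push :: "(nat \<Rightarrow> 'a) \<Rightarrow> nat \<Rightarrow> 'b" where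
  "push x = (\<lambda>j. \<rho> j (x (N j)))"

lemma push_bounded:
  assumes "x \<in> carrier (bounded_prod A)"
  shows "push x \<in> carrier (bounded_prod B)"
proof -
  obtain C where C: "\<And>n. nrm (A n) (x n) \<le> C" using A.bounded_prodE[OF assms] by blast
  show ?thesis unfolding push_def
    by (rule bounded_prodI[OF \<rho>_closed[OF bounded_prod_closed[OF assms]]
          order_trans[OF \<rho>_nrm[OF bounded_prod_closed[OF assms]] C]])
qed

lemma push_cauchy:
  assumes x: "x \<in> cauchy_seqs A \<phi>"
  shows "push x \<in> cauchy_seqs B \<psi>"
proof (rule B.cauchy_seqsI[OF push_bounded[OF A.cauchy_bounded[OF x]]])
  note cx = A.cauchy_closed[OF x]
  fix \<epsilon> :: real assume "0 < \<epsilon>"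
  from A.cauchyD[OF x this] obtain K where
    K: "\<And>m n. K \<le> m \<Longrightarrow> m \<le> n \<Longrightarrow> nrm (A n) (x n \<ominus>\<^bsub>A n\<^esub> connect \<phi> m n (x m)) < \<epsilon>" by blast
  define M where "M = Suc K"
  have M: "1 \<le> M" "K \<le> N M" using le_N[of K M] by (auto simp: M_def)
  have "nrm (B n) (push x n \<ominus>\<^bsub>B n\<^esub> connect \<psi> M n (push x M)) < \<epsilon>" if "M \<le> n" for n
    using \<rho>_nrm_minus[OF cx A.connect_closed[OF N_le[OF that] cx]] K[OF M(2) N_le[OF that]]
    unfolding push_def \<rho>_connect[OF M(1) that cx] by linarith
  then show "\<exists>M. \<forall>n\<ge>M. nrm (B n) (push x n \<ominus>\<^bsub>B n\<^esub> connect \<psi> M n (push x M)) < \<epsilon>" by blast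
qed

lemma push_hom: "push \<in> star_hom (cauchy_alg A \<phi>) (cauchy_alg B \<psi>)"
proof (rule star_homI, unfold cauchy_alg_simps)
  show "push x \<in> cauchy_seqs B \<psi>" if "x \<in> cauchy_seqs A \<phi>" for x
    using that by (rule push_cauchy)
qed (simp_all add: push_def bounded_prod_simps star_homD(2-)[OF \<rho>_hom] A.cauchy_closed)

text \<open>One correction step. At a late level \<open>i\<close> the error is lifted without
  increase of norm, continued as a thread and added to \<open>x\<close>. The image of the sum agrees
  with \<open>y\<close> at level \<open>i\<close> exactly, and beyond \<open>i\<close> within
  \<epsilon> because \<open>y\<close> is Cauchy, while \<open>x\<close> has moved by at most
  \<delta>.\<close>

lemma approximate_lift:
  assumes y: "y \<in> cauchy_seqs B \<psi>" and x: "x \<in> threads A \<phi>" and "0 < \<epsilon>"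
    and near: "\<exists>J. \<forall>j\<ge>J. nrm (B j) (push x j \<ominus>\<^bsub>B j\<^esub> y j) \<le> \<delta>"
  shows "\<exists>x'\<in>threads A \<phi>. (\<forall>n. nrm (A n) (x' n \<ominus>\<^bsub>A n\<^esub> x n) \<le> \<delta>) \<and>
    (\<exists>J. \<forall>j\<ge>J. nrm (B j) (push x' j \<ominus>\<^bsub>B j\<^esub> y j) \<le> \<epsilon>)"
proof -
  note cy = B.cauchy_closed[OF y]
  note cx = bounded_prod_closed[OF A.threads_bounded[OF x]]
  obtain J where J: "\<And>j. j \<ge> J \<Longrightarrow> nrm (B j) (push x j \<ominus>\<^bsub>B j\<^esub> y j) \<le> \<delta>" using near by blast
  obtain K where K: "\<And>i j. K \<le> i \<Longrightarrow> i \<le> j \<Longrightarrow> nrm (B j) (y j \<ominus>\<^bsub>B j\<^esub> connect \<psi> i j (y i)) < \<epsilon>"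
    using B.cauchyD[OF y \<open>0 < \<epsilon>\<close>] by blast
  obtain L where L: "\<And>n. n \<ge> L \<Longrightarrow> x (Suc n) = \<phi> n (x n)" using x by (auto simp: threads_def)
  \<comment> \<open>\<open>Suc\<close> gives \<open>1 \<le> i\<close>, where the squares commute,
    and \<open>L \<le> N i\<close>, where \<open>x\<close> is already coherent.\<close>
  define i where "i = Suc (max J (max K L))"
  have i: "1 \<le> i" "J \<le> i" "K \<le> i" "L \<le> N i"
    using le_N[of L i] by (auto simp: i_def)
  have coherent: "x n = connect \<phi> (N i) n (x (N i))" if "N i \<le> n" for n
    using that by (induction rule: dec_induct) (use i(4) L in simp_all)
  define d where "d = y i \<ominus>\<^bsub>B i\<^esub> push x i"
  have cp: "push x i \<in> carrier (B i)" unfolding push_def by (rule \<rho>_closed[OF cx])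
  have dc: "d \<in> carrier (B i)" unfolding d_def by (rule B.alg.minus_closed[OF cy cp])
  obtain a where a: "a \<in> carrier (A (N i))" "\<rho> i a = d" "nrm (A (N i)) a \<le> nrm (B i) d"
    using lift[OF dc] by blast
  have "nrm (B i) d \<le> \<delta>"
    using J[OF i(2)] B.alg.nrm_minus_commute[OF cy cp] unfolding d_def by simp
  define t where "t = A.thread (N i) a"
  have t: "t \<in> threads A \<phi>" unfolding t_def by (rule A.thread_threads[OF a(1)])
  have ct: "t n \<in> carrier (A n)" for n unfolding t_def by (rule A.thread_closed[OF a(1)])
  define x' where "x' = (\<lambda>n. t n \<oplus>\<^bsub>A n\<^esub> x n)"
  have "x' \<in> threads A \<phi>" unfolding x'_def by (rule A.threads_add[OF t x])
  moreover have "nrm (A n) (x' n \<ominus>\<^bsub>A n\<^esub> x n) \<le> \<delta>" for n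
  proof -
    have eq: "x' n \<ominus>\<^bsub>A n\<^esub> x n = t n"
      unfolding x'_def using ct[of n] cx[of n] by (simp add: A.alg.minus_eq A.alg.a_assoc A.alg.r_neg)
    show ?thesis
      using A.thread_nrm[OF a(1), of n] a(3) \<open>nrm (B i) d \<le> \<delta>\<close> unfolding eq t_def by linarith
  qed
  moreover have "nrm (B j) (push x' j \<ominus>\<^bsub>B j\<^esub> y j) \<le> \<epsilon>" if "i \<le> j" for j
  proof -
    have "x' (N j) = connect \<phi> (N i) (N j) (a \<oplus>\<^bsub>A (N i)\<^esub> x (N i))"
      unfolding x'_def t_def A.thread_def using N_le[OF that] coherent[OF N_le[OF that]]
        star_hom_add[OF A.connect_star_hom[OF N_le[OF that]] a(1) cx] by simp
    then have "push x' j = connect \<psi> i j (d \<oplus>\<^bsub>B i\<^esub> push x i)"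
      unfolding push_def
      using \<rho>_connect[OF i(1) that A.alg.a_closed[OF a(1) cx]] star_hom_add[OF \<rho>_hom a(1) cx] a(2)
      by simp
    also have "d \<oplus>\<^bsub>B i\<^esub> push x i = y i"
      unfolding d_def by (rule B.alg.minus_add_cancel[OF cy cp])
    finally show ?thesis
      using K[OF i(3) that] B.alg.nrm_minus_commute[OF cy B.connect_closed[OF that cy]] by simp
  qed
  ultimately show ?thesis by blast
qed

text \<open>Approximants \<open>X k\<close> of a preimage differ by at most \<open>2\<^sup>-\<^sup>k\<close> in every coordinate, so the diagonal
  sequence \<open>X n n\<close> is a limit of them.\<close>

lemma push_surj:
  assumes y: "y \<in> cauchy_seqs B \<psi>"
  shows "\<exists>x\<in>cauchy_seqs A \<phi>. limit_class B (push x) = limit_class B y"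
proof -
  note cy = B.cauchy_closed[OF y]
  define near where "near X \<epsilon> \<longleftrightarrow> (\<exists>J. \<forall>j\<ge>J. nrm (B j) (push X j \<ominus>\<^bsub>B j\<^esub> y j) \<le> \<epsilon>)" for X and \<epsilon> :: real
  obtain C where C: "\<And>n. nrm (B n) (y n) \<le> C" using B.bounded_prodE[OF B.cauchy_bounded[OF y]] by blast
  define z where "z = A.thread 0 \<zero>\<^bsub>A 0\<^esub>"
  have z: "z \<in> threads A \<phi>" unfolding z_def by (rule A.thread_threads) simp
  have cz: "z n \<in> carrier (A n)" "nrm (A n) (z n) \<le> 0" for n
    unfolding z_def using A.thread_closed[OF A.alg.zero_closed] A.thread_nrm[of "\<zero>\<^bsub>A 0\<^esub>" 0 n]
    by (simp_all add: A.alg.nrm_zero)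
  \<comment> \<open>The zero thread has distance at most \<open>C\<close> to \<open>y\<close>; this
    is the crude start of the corrections.\<close>
  have "nrm (B j) (push z j \<ominus>\<^bsub>B j\<^esub> y j) \<le> C" for j
    using B.alg.nrm_minus_le[OF \<rho>_closed[OF cz(1)] cy] \<rho>_nrm[OF cz(1)] cz(2)[of "N j"] C[of j]
    unfolding push_def by (smt (verit))
  then have "near z C" unfolding near_def by blast
  from approximate_lift[OF y z _ this[unfolded near_def], of 1]
  obtain X0 where X0: "X0 \<in> threads A \<phi> \<and> near X0 ((1/2) ^ 0)"
    unfolding near_def by auto
  have "\<exists>X. \<forall>k. (X k \<in> threads A \<phi> \<and> near (X k) ((1/2) ^ k)) \<and>
      (\<forall>n. nrm (A n) (X (Suc k) n \<ominus>\<^bsub>A n\<^esub> X k n) \<le> (1/2) ^ k)"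
  proof (rule dependent_nat_choice)
    show "\<exists>X. X \<in> threads A \<phi> \<and> near X ((1/2) ^ 0)" using X0 by blast
    fix X k assume X: "X \<in> threads A \<phi> \<and> near X ((1/2) ^ k)"
    from approximate_lift[OF y conjunct1[OF X] _ conjunct2[OF X, unfolded near_def], of "(1/2) ^ Suc k"]
    show "\<exists>Y. (Y \<in> threads A \<phi> \<and> near Y ((1/2) ^ Suc k)) \<and>
      (\<forall>n. nrm (A n) (Y n \<ominus>\<^bsub>A n\<^esub> X n) \<le> (1/2) ^ k)"
      unfolding near_def by auto
  qed
  then obtain X where X: "\<And>k. X k \<in> threads A \<phi>" "\<And>k. near (X k) ((1/2) ^ k)"
    "\<And>k n. nrm (A n) (X (Suc k) n \<ominus>\<^bsub>A n\<^esub> X k n) \<le> (1/2) ^ k" by blast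
  have cX: "X k n \<in> carrier (A n)" for k n
    by (rule bounded_prod_closed[OF A.threads_bounded[OF X(1)]])
  \<comment> \<open>The right-hand side is the partial sum of the geometric series in closed form,
    which keeps the induction linear.\<close>
  have dist: "nrm (A n) (X (k + i) n \<ominus>\<^bsub>A n\<^esub> X k n) \<le> 2 * (1/2) ^ k - 2 * (1/2) ^ (k + i)" for k i n
  proof (induction i)
    case 0
    show ?case using cX by (simp add: A.alg.minus_self A.alg.nrm_zero)
  next
    case (Suc i)
    have "nrm (A n) (X (k + Suc i) n \<ominus>\<^bsub>A n\<^esub> X k n) \<le> (1/2) ^ (k + i) + (2 * (1/2) ^ k - 2 * (1/2) ^ (k + i))"
      using A.alg.nrm_triangle[OF cX[of "k + Suc i" n] cX[of "k + i" n] cX[of k n]] X(3)[of n "k + i"] Suc by simp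
    then show ?case by simp
  qed
  define x where "x = (\<lambda>n. X n n)"
  have near_x: "nrm (A n) (x n \<ominus>\<^bsub>A n\<^esub> X k n) \<le> 2 * (1/2) ^ k" if "k \<le> n" for k n
  proof -
    have "nrm (A n) (x n \<ominus>\<^bsub>A n\<^esub> X k n) \<le> 2 * (1/2) ^ k - 2 * (1/2) ^ n"
      using dist[of n k "n - k"] that unfolding x_def by simp
    also have "\<dots> \<le> 2 * (1/2) ^ k" by simp
    finally show ?thesis .
  qed
  obtain D where D: "\<And>n. nrm (A n) (X 0 n) \<le> D"
    using A.bounded_prodE[OF A.threads_bounded[OF X(1)]] by blast
  have "nrm (A n) (x n) \<le> 2 + D" for n
    using A.alg.nrm_le_minus[OF cX[of n n] cX[of 0 n]] near_x[of 0 n] D[of n] unfolding x_def by simp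
  then have xb: "x \<in> carrier (bounded_prod A)"
    by (rule bounded_prodI[rotated]) (simp add: x_def cX)
  \<comment> \<open>The factor 3 is 2 for the distance from \<open>x\<close> to \<open>X k\<close>
    plus 1 for the error of \<open>X k\<close>.\<close>
  have small: "\<exists>k. 3 * (1/2) ^ k < \<epsilon>" if "0 < \<epsilon>" for \<epsilon> :: real
    using real_arch_pow_inv[of "\<epsilon> / 3" "1/2"] that by (auto simp: field_simps)
  have x: "x \<in> cauchy_seqs A \<phi>"
  proof (rule A.cauchyI_approx[OF xb])
    fix \<epsilon> :: real assume "0 < \<epsilon>"
    from small[OF this] obtain k where k: "3 * (1/2) ^ k < \<epsilon>" by blast
    moreover have "2 * (1/2) ^ k \<le> 3 * (1/2 :: real) ^ k" by simp
    ultimately have "nrm (A n) (x n \<ominus>\<^bsub>A n\<^esub> X k n) < \<epsilon>" if "k \<le> n" for n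
      using near_x[OF that] by linarith
    then show "\<exists>t\<in>threads A \<phi>. \<exists>K. \<forall>n\<ge>K. nrm (A n) (x n \<ominus>\<^bsub>A n\<^esub> t n) < \<epsilon>"
      using X(1)[of k] by blast
  qed
  have "(\<lambda>j. nrm (B j) (push x j \<ominus>\<^bsub>B j\<^esub> y j)) \<longlonglongrightarrow> 0"
  proof (rule LIMSEQ_I)
    fix \<epsilon> :: real assume "0 < \<epsilon>"
    from small[OF this] obtain k where k: "3 * (1/2) ^ k < \<epsilon>" by blast
    obtain J where J: "\<And>j. j \<ge> J \<Longrightarrow> nrm (B j) (push (X k) j \<ominus>\<^bsub>B j\<^esub> y j) \<le> (1/2) ^ k"
      using X(2)[of k] unfolding near_def by blast
    have "norm (nrm (B j) (push x j \<ominus>\<^bsub>B j\<^esub> y j) - 0) < \<epsilon>" if "j \<ge> max J (Suc k)" for j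
    proof -
      have cp: "push x j \<in> carrier (B j)" "push (X k) j \<in> carrier (B j)"
        unfolding push_def by (rule \<rho>_closed, simp add: x_def cX)+
      have "nrm (B j) (push x j \<ominus>\<^bsub>B j\<^esub> push (X k) j) \<le> nrm (A (N j)) (x (N j) \<ominus>\<^bsub>A (N j)\<^esub> X k (N j))"
        unfolding push_def by (rule \<rho>_nrm_minus) (simp_all add: x_def cX)
      also have "\<dots> \<le> 2 * (1/2) ^ k"
        using near_x[of k "N j"] le_N[of k j] that by simp
      finally show ?thesis
        using B.alg.nrm_triangle[OF cp cy] J[of j] that k
          B.alg.nrm_nonneg[OF B.alg.minus_closed[OF cp(1) cy]] by simp
    qed
    then show "\<exists>J. \<forall>j\<ge>J. norm (nrm (B j) (push x j \<ominus>\<^bsub>B j\<^esub> y j) - 0) < \<epsilon>" by blast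
  qed
  then have "limit_class B (push x) = limit_class B y"
    using B.limit_class_eq[OF push_bounded[OF xb] B.cauchy_bounded[OF y]] by blast
  then show ?thesis using x by blast
qed

text \<open>Since \<open>N\<close> tends to infinity, sequences with null difference are pushed to
  sequences with null difference, so \<open>push\<close> descends to the limits.\<close>

theorem limit_surjection:
  "\<exists>h\<in>star_hom (cstar_limit A \<phi>) (cstar_limit B \<psi>). h ` carrier (cstar_limit A \<phi>) = carrier (cstar_limit B \<psi>)"
proof -
  have F: "limit_class B \<circ> push \<in> star_hom (cauchy_alg A \<phi>) (cstar_limit B \<psi>)"
    by (rule star_hom_comp[OF push_hom B.limit_class_hom])
  have F_eq: "(limit_class B \<circ> push) x = (limit_class B \<circ> push) y"
    if x: "x \<in> cauchy_seqs A \<phi>" and y: "y \<in> cauchy_seqs A \<phi>"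
      and 0: "(\<lambda>n. nrm (A n) (x n \<ominus>\<^bsub>A n\<^esub> y n)) \<longlonglongrightarrow> 0" for x y
  proof -
    note cx = A.cauchy_closed[OF x] and cy = A.cauchy_closed[OF y]
    have "(\<lambda>j. nrm (B j) (push x j \<ominus>\<^bsub>B j\<^esub> push y j)) \<longlonglongrightarrow> 0"
    proof (rule real_tendsto_sandwich[OF _ _ tendsto_const filterlim_compose[OF 0 N_at_top]])
      show "\<forall>\<^sub>F j in sequentially. 0 \<le> nrm (B j) (push x j \<ominus>\<^bsub>B j\<^esub> push y j)"
        unfolding push_def
        by (intro always_eventually allI B.alg.nrm_nonneg B.alg.minus_closed \<rho>_closed cx cy)
      show "\<forall>\<^sub>F j in sequentially. nrm (B j) (push x j \<ominus>\<^bsub>B j\<^esub> push y j)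
          \<le> nrm (A (N j)) (x (N j) \<ominus>\<^bsub>A (N j)\<^esub> y (N j))"
        unfolding push_def by (intro always_eventually allI \<rho>_nrm_minus cx cy)
    qed
    then show ?thesis
      using B.limit_class_eq[OF push_bounded push_bounded] A.cauchy_bounded x y by simp
  qed
  obtain h where h: "h \<in> star_hom (cstar_limit A \<phi>) (cstar_limit B \<psi>)"
    "\<And>x. x \<in> cauchy_seqs A \<phi> \<Longrightarrow> h (limit_class A x) = (limit_class B \<circ> push) x"
    using A.limit_lift[OF F F_eq] by blast
  have "carrier (cstar_limit B \<psi>) \<subseteq> h ` carrier (cstar_limit A \<phi>)"
  proof
    fix Y assume "Y \<in> carrier (cstar_limit B \<psi>)"
    then obtain y where y: "y \<in> cauchy_seqs B \<psi>" "Y = limit_class B y"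
      unfolding B.limit_carrier by blast
    obtain x where "x \<in> cauchy_seqs A \<phi>" "limit_class B (push x) = Y"
      using push_surj[OF y(1)] y(2) by blast
    then show "Y \<in> h ` carrier (cstar_limit A \<phi>)"
      unfolding A.limit_carrier using h(2) by force
  qed
  moreover have "h ` carrier (cstar_limit A \<phi>) \<subseteq> carrier (cstar_limit B \<psi>)"
    using star_hom_closed[OF h(1)] by blast
  ultimately show ?thesis using h(1) by blast
qed

end

section \<open>Operator norm and multimatrix algebras\<close>

lemma l2_norm_L2_set: "l2_norm v = L2_set (\<lambda>i. cmod (v $ i)) {..<dim_vec v}"
  by (simp add: l2_norm_def L2_set_def)

lemma l2_norm_nonneg [simp]: "0 \<le> l2_norm v"
  by (simp add: l2_norm_def sum_nonneg)

lemma l2_norm_square: "(l2_norm v)\<^sup>2 = (\<Sum>i<dim_vec v. (cmod (v $ i))\<^sup>2)"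
  by (simp add: l2_norm_def sum_nonneg)

lemma l2_norm_zero [simp]: "l2_norm (0\<^sub>v n) = 0"
  by (simp add: l2_norm_def)

lemma l2_norm_entry: "i < dim_vec v \<Longrightarrow> cmod (v $ i) \<le> l2_norm v"
  unfolding l2_norm_L2_set by (rule member_le_L2_set) auto

lemma l2_norm_unit:
  assumes "j < n" shows "l2_norm (unit_vec n j) = 1"
proof -
  have "(\<Sum>i<n. (cmod (unit_vec n j $ i))\<^sup>2) = (\<Sum>i<n. if i = j then 1 else 0)"
    by (rule sum.cong) (use assms in auto)
  then show ?thesis using assms by (simp add: l2_norm_def)
qed

lemma l2_norm_add:
  assumes "v \<in> carrier_vec n" "w \<in> carrier_vec n"
  shows "l2_norm (v + w) \<le> l2_norm v + l2_norm w"
proof -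
  have "l2_norm (v + w) \<le> L2_set (\<lambda>i. cmod (v $ i) + cmod (w $ i)) {..<n}"
    unfolding l2_norm_L2_set using assms
    by (auto intro!: L2_set_mono norm_triangle_ineq)
  also have "\<dots> \<le> L2_set (\<lambda>i. cmod (v $ i)) {..<n} + L2_set (\<lambda>i. cmod (w $ i)) {..<n}"
    by (rule L2_set_triangle_ineq)
  finally show ?thesis using assms by (simp add: l2_norm_L2_set)
qed

lemma l2_norm_smult: "l2_norm (c \<cdot>\<^sub>v v) = cmod c * l2_norm v"
  by (simp add: l2_norm_def norm_mult power_mult_distrib sum_distrib_left[symmetric] real_sqrt_mult)

lemma l2_norm_append:
  "(l2_norm (v @\<^sub>v w))\<^sup>2 = (l2_norm v)\<^sup>2 + (l2_norm w)\<^sup>2"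
proof -
  define f where "f i = (cmod ((v @\<^sub>v w) $ i))\<^sup>2" for i
  define a b where "a = dim_vec v" and "b = dim_vec w"
  have "(\<Sum>i<a + b. f i) = (\<Sum>i = 0..<a. f i) + (\<Sum>i = 0 + a..<b + a. f i)"
    by (simp add: lessThan_atLeast0 sum.atLeastLessThan_concat add.commute)
  also have "(\<Sum>i = 0 + a..<b + a. f i) = (\<Sum>i = 0..<b. f (i + a))"
    by (rule sum.shift_bounds_nat_ivl)
  also have "(\<Sum>i = 0..<a. f i) = (\<Sum>i<a. (cmod (v $ i))\<^sup>2)"
    by (simp add: f_def a_def lessThan_atLeast0)
  also have "(\<Sum>i = 0..<b. f (i + a)) = (\<Sum>i<b. (cmod (w $ i))\<^sup>2)"
    by (simp add: f_def a_def b_def lessThan_atLeast0)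
  finally show ?thesis by (simp add: l2_norm_square f_def a_def b_def)
qed

lemma l2_norm_append_zero [simp]:
  "l2_norm (v @\<^sub>v 0\<^sub>v m) = l2_norm v" "l2_norm (0\<^sub>v m @\<^sub>v v) = l2_norm v"
  by (rule power2_eq_imp_eq; simp add: l2_norm_append)+

lemma zero_mat_mult_vec [simp]: "v \<in> carrier_vec m \<Longrightarrow> 0\<^sub>m n m *\<^sub>v v = (0\<^sub>v n :: complex vec)"
  by (rule eq_vecI) auto

lemma mat_mult_zero_vec [simp]: "A \<in> carrier_mat n m \<Longrightarrow> A *\<^sub>v 0\<^sub>v m = (0\<^sub>v n :: complex vec)"
  by (rule eq_vecI) auto

definition cinner :: "complex vec \<Rightarrow> complex vec \<Rightarrow> complex" where
  "cinner v w = (\<Sum>i<dim_vec w. cnj (v $ i) * w $ i)"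

lemma cinner_self: "cinner v v = complex_of_real ((l2_norm v)\<^sup>2)"
  unfolding cinner_def l2_norm_square of_real_sum
  by (rule sum.cong[OF refl]) (metis complex_norm_square mult.commute)

lemma cinner_le:
  assumes "dim_vec v = dim_vec w"
  shows "cmod (cinner v w) \<le> l2_norm v * l2_norm w"
proof -
  have "cmod (cinner v w) \<le> (\<Sum>i<dim_vec w. \<bar>cmod (v $ i)\<bar> * \<bar>cmod (w $ i)\<bar>)"
    unfolding cinner_def by (rule order_trans[OF norm_sum]) (simp add: norm_mult)
  also have "\<dots> \<le> l2_norm v * l2_norm w"
    unfolding l2_norm_L2_set assms by (rule L2_set_mult_ineq)
  finally show ?thesis .
qed

lemma mat_adjoint_dim [simp]:
  "dim_row (mat_adjoint A) = dim_col A" "dim_col (mat_adjoint A) = dim_row A"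
  by (simp_all add: mat_adjoint_def)

lemma mat_adjoint_carrier [simp]: "A \<in> carrier_mat n m \<Longrightarrow> mat_adjoint A \<in> carrier_mat m n"
  unfolding carrier_mat_def by simp

lemma mat_adjoint_index [simp]:
  "i < dim_col A \<Longrightarrow> j < dim_row A \<Longrightarrow> mat_adjoint A $$ (i, j) = cnj (A $$ (j, i))"
  by (simp add: mat_adjoint_def mat_of_rows_index conjugate_complex_def)

lemma cinner_adjoint:
  assumes A: "A \<in> carrier_mat n n" and v: "v \<in> carrier_vec n" and w: "w \<in> carrier_vec n"
  shows "cinner (mat_adjoint A *\<^sub>v v) w = cinner v (A *\<^sub>v w)"
proof -
  have "cinner (mat_adjoint A *\<^sub>v v) w = (\<Sum>i<n. \<Sum>j<n. cnj (v $ j) * A $$ (j, i) * w $ i)"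
    unfolding cinner_def using assms
    by (auto intro!: sum.cong simp: scalar_prod_def sum_distrib_left sum_distrib_right lessThan_atLeast0 mult_ac)
  also have "\<dots> = (\<Sum>j<n. \<Sum>i<n. cnj (v $ j) * A $$ (j, i) * w $ i)" by (rule sum.swap)
  also have "\<dots> = cinner v (A *\<^sub>v w)"
    unfolding cinner_def using assms
    by (auto intro!: sum.cong simp: scalar_prod_def sum_distrib_left lessThan_atLeast0 mult_ac)
  finally show ?thesis .
qed

text \<open>A crude bound. It shows that the supremum in \<open>op_norm\<close> is finite and,
  later, that entrywise null sequences of matrices of fixed size are null in norm.\<close>

lemma mult_mat_vec_bound:
  assumes A: "A \<in> carrier_mat n m" and v: "v \<in> carrier_vec m"
  shows "l2_norm (A *\<^sub>v v) \<le> (\<Sum>i<n. \<Sum>j<m. cmod (A $$ (i, j))) * l2_norm v"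
proof -
  have "l2_norm (A *\<^sub>v v) \<le> (\<Sum>i<n. cmod ((A *\<^sub>v v) $ i))"
    using A unfolding l2_norm_L2_set by (auto intro!: order_trans[OF L2_set_le_sum])
  also have "\<dots> \<le> (\<Sum>i<n. \<Sum>j<m. cmod (A $$ (i, j)) * l2_norm v)"
  proof (rule sum_mono)
    fix i assume i: "i \<in> {..<n}"
    have "cmod ((A *\<^sub>v v) $ i) \<le> (\<Sum>j<m. cmod (A $$ (i, j)) * cmod (v $ j))"
      using A v i by (auto simp: scalar_prod_def lessThan_atLeast0 norm_mult intro!: order_trans[OF norm_sum])
    also have "\<dots> \<le> (\<Sum>j<m. cmod (A $$ (i, j)) * l2_norm v)"
      using v by (intro sum_mono mult_left_mono l2_norm_entry) auto
    finally show "cmod ((A *\<^sub>v v) $ i) \<le> (\<Sum>j<m. cmod (A $$ (i, j)) * l2_norm v)" .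
  qed
  also have "\<dots> = (\<Sum>i<n. \<Sum>j<m. cmod (A $$ (i, j))) * l2_norm v" by (simp add: sum_distrib_right)
  finally show ?thesis .
qed

lemma op_norm_bdd: "bdd_above ((\<lambda>v. l2_norm (A *\<^sub>v v)) ` {v \<in> carrier_vec (dim_col A). l2_norm v \<le> 1})"
proof -
  define C where "C = (\<Sum>i<dim_row A. \<Sum>j<dim_col A. cmod (A $$ (i, j)))"
  have C: "C \<ge> 0" "\<And>v. v \<in> carrier_vec (dim_col A) \<Longrightarrow> l2_norm (A *\<^sub>v v) \<le> C * l2_norm v"
    unfolding C_def using mult_mat_vec_bound[of A "dim_row A" "dim_col A"] by (simp_all add: sum_nonneg)
  have "l2_norm (A *\<^sub>v v) \<le> C" if "v \<in> carrier_vec (dim_col A)" "l2_norm v \<le> 1" for v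
    using C(2)[OF that(1)] mult_left_mono[OF that(2) C(1)] by simp
  then show ?thesis by (auto intro!: bdd_aboveI)
qed

lemma op_norm_upper: "v \<in> carrier_vec (dim_col A) \<Longrightarrow> l2_norm v \<le> 1 \<Longrightarrow> l2_norm (A *\<^sub>v v) \<le> op_norm A"
  unfolding op_norm_def by (rule cSUP_upper[OF _ op_norm_bdd]) simp

lemma op_norm_nonneg [simp]: "0 \<le> op_norm A"
  by (rule order_trans[OF l2_norm_nonneg op_norm_upper[of "0\<^sub>v (dim_col A)" A]]) simp_all

lemma op_norm_apply:
  assumes v: "v \<in> carrier_vec (dim_col A)"
  shows "l2_norm (A *\<^sub>v v) \<le> op_norm A * l2_norm v"
proof (cases "l2_norm v = 0")
  case True
  \<comment> \<open>Here \<open>v\<close> cannot be normalised; the crude bound gives norm 0 for its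
    image.\<close>
  then show ?thesis
    using mult_mat_vec_bound[of A "dim_row A" "dim_col A" v] v by simp
next
  case False
  define c where "c = complex_of_real (1 / l2_norm v)"
  have "A *\<^sub>v (c \<cdot>\<^sub>v v) = c \<cdot>\<^sub>v (A *\<^sub>v v)"
    by (rule mult_mat_vec[of _ "dim_row A" "dim_col A"]) (use v in auto)
  moreover have "l2_norm (c \<cdot>\<^sub>v v) \<le> 1"
    using False by (simp add: l2_norm_smult c_def norm_divide)
  ultimately have "cmod c * l2_norm (A *\<^sub>v v) \<le> op_norm A"
    using op_norm_upper[of "c \<cdot>\<^sub>v v" A] v by (simp add: l2_norm_smult)
  moreover have "0 < l2_norm v" using False l2_norm_nonneg[of v] by linarith
  ultimately show ?thesis by (simp add: c_def field_simps norm_divide)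
qed

lemma op_norm_leI:
  assumes "0 \<le> c" "\<And>v. v \<in> carrier_vec (dim_col A) \<Longrightarrow> l2_norm (A *\<^sub>v v) \<le> c * l2_norm v"
  shows "op_norm A \<le> c"
  unfolding op_norm_def
proof (rule cSUP_least)
  have "0\<^sub>v (dim_col A) \<in> {v \<in> carrier_vec (dim_col A). l2_norm v \<le> 1}" by simp
  then show "{v \<in> carrier_vec (dim_col A). l2_norm v \<le> 1} \<noteq> {}" by blast
  fix v assume v: "v \<in> {v \<in> carrier_vec (dim_col A). l2_norm v \<le> 1}"
  then show "l2_norm (A *\<^sub>v v) \<le> c"
    using assms(2)[of v] mult_left_mono[of "l2_norm v" 1 c] assms(1) by simp
qed

lemma op_norm_entry:
  assumes "A \<in> carrier_mat n m" "i < n" "j < m"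
  shows "cmod (A $$ (i, j)) \<le> op_norm A"
proof -
  have "A *\<^sub>v unit_vec m j = col A j"
    using assms by (intro eq_vecI) auto
  then have "cmod (A $$ (i, j)) \<le> l2_norm (A *\<^sub>v unit_vec m j)"
    using l2_norm_entry[of i "col A j"] assms by auto
  also have "\<dots> \<le> op_norm A"
    using op_norm_apply[of "unit_vec m j" A] assms by (simp add: l2_norm_unit)
  finally show ?thesis .
qed

lemma op_norm_zero [simp]: "op_norm (0\<^sub>m n m) = 0"
proof -
  have "op_norm (0\<^sub>m n m) \<le> 0" by (rule op_norm_leI) simp_all
  then show ?thesis using op_norm_nonneg[of "0\<^sub>m n m"] by linarith
qed

lemma op_norm_one: "op_norm (1\<^sub>m n) \<le> 1"
  by (rule op_norm_leI) auto

lemma op_norm_add: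
  assumes "A \<in> carrier_mat n m" "B \<in> carrier_mat n m"
  shows "op_norm (A + B) \<le> op_norm A + op_norm B"
proof (rule op_norm_leI)
  fix v :: "complex vec" assume "v \<in> carrier_vec (dim_col (A + B))"
  then have v: "v \<in> carrier_vec m" using assms by simp
  have "l2_norm ((A + B) *\<^sub>v v) \<le> l2_norm (A *\<^sub>v v) + l2_norm (B *\<^sub>v v)"
    unfolding add_mult_distrib_mat_vec[OF assms v] using assms v by (intro l2_norm_add[of _ n]) auto
  then show "l2_norm ((A + B) *\<^sub>v v) \<le> (op_norm A + op_norm B) * l2_norm v"
    using op_norm_apply[of v A] op_norm_apply[of v B] assms v by (simp add: algebra_simps)
qed simp

lemma op_norm_mult:
  assumes "A \<in> carrier_mat n m" "B \<in> carrier_mat m k"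
  shows "op_norm (A * B) \<le> op_norm A * op_norm B"
proof (rule op_norm_leI)
  fix v :: "complex vec" assume "v \<in> carrier_vec (dim_col (A * B))"
  then have v: "v \<in> carrier_vec k" using assms by simp
  have "l2_norm ((A * B) *\<^sub>v v) = l2_norm (A *\<^sub>v (B *\<^sub>v v))"
    unfolding assoc_mult_mat_vec[OF assms v] ..
  also have "\<dots> \<le> op_norm A * l2_norm (B *\<^sub>v v)"
    using assms v by (intro op_norm_apply) auto
  also have "\<dots> \<le> op_norm A * (op_norm B * l2_norm v)"
    using assms v by (intro mult_left_mono op_norm_apply) auto
  finally show "l2_norm ((A * B) *\<^sub>v v) \<le> (op_norm A * op_norm B) * l2_norm v" by simp
qed simp

lemma smult_mat_vec:
  assumes "A \<in> carrier_mat n m" "v \<in> carrier_vec m"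
  shows "(c \<cdot>\<^sub>m A) *\<^sub>v v = c \<cdot>\<^sub>v (A *\<^sub>v (v :: complex vec))"
  using assms by (intro eq_vecI) (auto simp: scalar_prod_def sum_distrib_left mult_ac)

lemma op_norm_smult: "op_norm (c \<cdot>\<^sub>m A) \<le> cmod c * op_norm A"
proof (rule op_norm_leI)
  fix v :: "complex vec" assume "v \<in> carrier_vec (dim_col (c \<cdot>\<^sub>m A))"
  then have v: "v \<in> carrier_vec (dim_col A)" by simp
  show "l2_norm ((c \<cdot>\<^sub>m A) *\<^sub>v v) \<le> cmod c * op_norm A * l2_norm v"
    using op_norm_apply[OF v] mult_left_mono[of "l2_norm (A *\<^sub>v v)" "op_norm A * l2_norm v" "cmod c"]
    by (simp add: smult_mat_vec[OF _ v, of _ "dim_row A"] l2_norm_smult mult.assoc)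
qed simp

text \<open>With u the image of w under the adjoint, the square of the norm of u is, up to modulus,
  the inner product of w with A u; Cauchy-Schwarz and cancelling the norm of u give the
  bound.\<close>

lemma op_norm_adjoint:
  assumes A: "A \<in> carrier_mat n n"
  shows "op_norm (mat_adjoint A) \<le> op_norm A"
proof (rule op_norm_leI)
  fix w :: "complex vec" assume "w \<in> carrier_vec (dim_col (mat_adjoint A))"
  then have w: "w \<in> carrier_vec n" using A by simp
  define u where "u = mat_adjoint A *\<^sub>v w"
  have u: "u \<in> carrier_vec n" unfolding u_def using A w by (intro mult_mat_vec_carrier) auto
  have "(l2_norm u)\<^sup>2 = cmod (cinner u u)" unfolding cinner_self norm_of_real by simp
  also have "\<dots> = cmod (cinner w (A *\<^sub>v u))"
    using cinner_adjoint[OF A w u] unfolding u_def[symmetric] by simp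
  also have "\<dots> \<le> l2_norm w * l2_norm (A *\<^sub>v u)" using A w u by (intro cinner_le) auto
  also have "\<dots> \<le> l2_norm w * (op_norm A * l2_norm u)"
    using A u by (intro mult_left_mono op_norm_apply) auto
  finally have "l2_norm u * l2_norm u \<le> (op_norm A * l2_norm w) * l2_norm u"
    by (simp add: power2_eq_square mult_ac)
  then show "l2_norm (mat_adjoint A *\<^sub>v w) \<le> op_norm A * l2_norm w"
    unfolding u_def[symmetric] using l2_norm_nonneg[of u] l2_norm_nonneg[of w] op_norm_nonneg[of A]
    by (cases "l2_norm u = 0") (simp_all add: mult_le_cancel_right)
qed simp

text \<open>The binary case of \<open>diag_block_mat\<close>, so that direct sums along a list can
  be treated by induction.\<close>

definition block_sum :: "complex mat \<Rightarrow> complex mat \<Rightarrow> complex mat" where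
  "block_sum A B = four_block_mat A (0\<^sub>m (dim_row A) (dim_col B)) (0\<^sub>m (dim_row B) (dim_col A)) B"

lemma block_sum_dim [simp]:
  "dim_row (block_sum A B) = dim_row A + dim_row B" "dim_col (block_sum A B) = dim_col A + dim_col B"
  by (simp_all add: block_sum_def)

lemma block_sum_carrier [simp]:
  "A \<in> carrier_mat n n \<Longrightarrow> B \<in> carrier_mat m m \<Longrightarrow> block_sum A B \<in> carrier_mat (n + m) (n + m)"
  unfolding carrier_mat_def by simp

lemma block_sum_index [simp]:
  "i < dim_row A + dim_row B \<Longrightarrow> j < dim_col A + dim_col B \<Longrightarrow> block_sum A B $$ (i, j) =
    (if i < dim_row A then if j < dim_col A then A $$ (i, j) else 0
     else if j < dim_col A then 0 else B $$ (i - dim_row A, j - dim_col A))"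
  unfolding block_sum_def by (subst index_mat_four_block) auto

lemma diag_block_mat_Cons: "diag_block_mat (A # As) = block_sum A (diag_block_mat As)"
  by (simp add: block_sum_def Let_def)

lemma block_sum_empty [simp]: "block_sum A (0\<^sub>m 0 0) = A"
  by (rule eq_matI) auto

lemma diag_block_mat_append_block_sum:
  "diag_block_mat (As @ Bs) = block_sum (diag_block_mat As) (diag_block_mat Bs)"
  by (simp add: diag_block_mat_append block_sum_def Let_def)

lemma block_sum_mult:
  assumes "A \<in> carrier_mat n n" "C \<in> carrier_mat n n" "B \<in> carrier_mat m m" "D \<in> carrier_mat m m"
  shows "block_sum A B * block_sum C D = block_sum (A * C) (B * D)"
proof -
  have "block_sum A B * block_sum C D = four_block_mat (A * C + 0\<^sub>m n m * 0\<^sub>m m n) (A * 0\<^sub>m n m + 0\<^sub>m n m * D)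
      (0\<^sub>m m n * C + B * 0\<^sub>m m n) (0\<^sub>m m n * 0\<^sub>m n m + B * D)"
    unfolding block_sum_def using assms by (subst mult_four_block_mat) auto
  also have "\<dots> = block_sum (A * C) (B * D)" unfolding block_sum_def using assms by simp
  finally show ?thesis .
qed

lemma block_sum_add:
  assumes "A \<in> carrier_mat n n" "C \<in> carrier_mat n n" "B \<in> carrier_mat m m" "D \<in> carrier_mat m m"
  shows "block_sum A B + block_sum C D = block_sum (A + C) (B + D)"
  using assms by (intro eq_matI) simp_all

lemma block_sum_smult: "c \<cdot>\<^sub>m block_sum A B = block_sum (c \<cdot>\<^sub>m A) (c \<cdot>\<^sub>m B)"
  by (intro eq_matI) simp_all

lemma block_sum_adjoint: "mat_adjoint (block_sum A B) = block_sum (mat_adjoint A) (mat_adjoint B)"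
  by (intro eq_matI) simp_all

lemma block_sum_one: "block_sum (1\<^sub>m n) (1\<^sub>m m) = 1\<^sub>m (n + m)"
  by (rule eq_matI) (auto simp del: block_sum_index simp: block_sum_index)

lemma block_sum_mult_vec:
  assumes A: "A \<in> carrier_mat n n" and B: "B \<in> carrier_mat m m"
    and v: "v \<in> carrier_vec n" and w: "w \<in> carrier_vec m"
  shows "block_sum A B *\<^sub>v (v @\<^sub>v w) = (A *\<^sub>v v) @\<^sub>v (B *\<^sub>v w)"
proof -
  have "block_sum A B *\<^sub>v (v @\<^sub>v w) = (A *\<^sub>v v + 0\<^sub>m n m *\<^sub>v w) @\<^sub>v (0\<^sub>m m n *\<^sub>v v + B *\<^sub>v w)"
    unfolding block_sum_def using assms by (subst four_block_mat_mult_vec) auto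
  then show ?thesis using assms by simp
qed

text \<open>The norm of a direct sum is the maximum of the norms, by Pythagoras. Stating it through
  a bound \<open>c\<close> lets it iterate along a list without computing maxima.\<close>

lemma op_norm_block_sum_le_iff:
  assumes A: "A \<in> carrier_mat n n" and B: "B \<in> carrier_mat m m" and "0 \<le> c"
  shows "op_norm (block_sum A B) \<le> c \<longleftrightarrow> op_norm A \<le> c \<and> op_norm B \<le> c"
proof (intro iffI conjI)
  assume le: "op_norm (block_sum A B) \<le> c"
  have ap: "l2_norm (block_sum A B *\<^sub>v u) \<le> c * l2_norm u" if "u \<in> carrier_vec (n + m)" for u
    using op_norm_apply[of u "block_sum A B"] mult_right_mono[OF le l2_norm_nonneg[of u]] that A B by simp
  show "op_norm A \<le> c"
  proof (rule op_norm_leI[OF \<open>0 \<le> c\<close>])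
    fix v :: "complex vec" assume "v \<in> carrier_vec (dim_col A)"
    then have v: "v \<in> carrier_vec n" using A by simp
    have "l2_norm (block_sum A B *\<^sub>v (v @\<^sub>v 0\<^sub>v m)) = l2_norm (A *\<^sub>v v)"
      unfolding block_sum_mult_vec[OF A B v zero_carrier_vec]
      using B by simp
    then show "l2_norm (A *\<^sub>v v) \<le> c * l2_norm v" using ap[of "v @\<^sub>v 0\<^sub>v m"] v by simp
  qed
  show "op_norm B \<le> c"
  proof (rule op_norm_leI[OF \<open>0 \<le> c\<close>])
    fix v :: "complex vec" assume "v \<in> carrier_vec (dim_col B)"
    then have v: "v \<in> carrier_vec m" using B by simp
    have "l2_norm (block_sum A B *\<^sub>v (0\<^sub>v n @\<^sub>v v)) = l2_norm (B *\<^sub>v v)"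
      unfolding block_sum_mult_vec[OF A B zero_carrier_vec v]
      using A by simp
    then show "l2_norm (B *\<^sub>v v) \<le> c * l2_norm v" using ap[of "0\<^sub>v n @\<^sub>v v"] v by simp
  qed
next
  assume le: "op_norm A \<le> c \<and> op_norm B \<le> c"
  show "op_norm (block_sum A B) \<le> c"
  proof (rule op_norm_leI[OF \<open>0 \<le> c\<close>])
    fix u :: "complex vec" assume "u \<in> carrier_vec (dim_col (block_sum A B))"
    then have u: "u \<in> carrier_vec (n + m)" using A B by simp
    define v w where "v = vec_first u n" and "w = vec_last u m"
    have vw: "v \<in> carrier_vec n" "w \<in> carrier_vec m" "u = v @\<^sub>v w"
      using u by (simp_all add: v_def w_def)
    have "l2_norm (A *\<^sub>v v) \<le> c * l2_norm v" "l2_norm (B *\<^sub>v w) \<le> c * l2_norm w"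
      using op_norm_apply[of v A] op_norm_apply[of w B] A B vw le
        mult_right_mono[of "op_norm A" c "l2_norm v"] mult_right_mono[of "op_norm B" c "l2_norm w"]
      by auto
    then have sq: "(l2_norm (A *\<^sub>v v))\<^sup>2 \<le> (c * l2_norm v)\<^sup>2" "(l2_norm (B *\<^sub>v w))\<^sup>2 \<le> (c * l2_norm w)\<^sup>2"
      by (intro power_mono; simp)+
    have "(l2_norm (block_sum A B *\<^sub>v u))\<^sup>2 \<le> (c * l2_norm u)\<^sup>2"
      unfolding vw(3) block_sum_mult_vec[OF A B vw(1,2)] l2_norm_append power_mult_distrib distrib_left
      by (rule add_mono[OF sq, unfolded power_mult_distrib])
    then show "l2_norm (block_sum A B *\<^sub>v u) \<le> c * l2_norm u"
      by (rule power2_le_imp_le) (simp add: \<open>0 \<le> c\<close>)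
  qed
qed

section \<open>Direct sums of matrix algebras and Bratteli maps\<close>

lemma matrix_alg_simps [simp]:
  "carrier (matrix_alg d) = carrier_mat d d" "mult (matrix_alg d) = (*)" "one (matrix_alg d) = 1\<^sub>m d"
  "zero (matrix_alg d) = 0\<^sub>m d d" "add (matrix_alg d) = (+)" "smult (matrix_alg d) = (\<cdot>\<^sub>m)"
  "star (matrix_alg d) = mat_adjoint" "nrm (matrix_alg d) = op_norm"
  by (simp_all add: matrix_alg_def)

lemma multimatrix_carrier:
  "xs \<in> carrier (multimatrix_alg ds) \<longleftrightarrow>
    length xs = length ds \<and> (\<forall>k<length ds. xs ! k \<in> carrier_mat (ds ! k) (ds ! k))"
  by (auto simp: multimatrix_alg_def list_all2_conv_all_nth)

lemma multimatrix_simps: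
  "mult (multimatrix_alg ds) = map2 (*)" "one (multimatrix_alg ds) = map (\<lambda>d. 1\<^sub>m d) ds"
  "zero (multimatrix_alg ds) = map (\<lambda>d. 0\<^sub>m d d) ds" "add (multimatrix_alg ds) = map2 (+)"
  "smult (multimatrix_alg ds) = (\<lambda>c. map (\<lambda>x. c \<cdot>\<^sub>m x))" "star (multimatrix_alg ds) = map mat_adjoint"
  "nrm (multimatrix_alg ds) = (\<lambda>xs. Max (op_norm ` set xs))"
  by (simp_all add: multimatrix_alg_def)

lemma multimatrix_closed:
  assumes "xs \<in> carrier (multimatrix_alg ds)"
  shows multimatrix_length: "length xs = length ds"
    and multimatrix_nth: "k < length ds \<Longrightarrow> xs ! k \<in> carrier_mat (ds ! k) (ds ! k)"
  using assms by (auto simp: multimatrix_carrier)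

lemma multimatrix_eqI:
  assumes "length xs = length ds" "length ys = length ds" "\<And>k. k < length ds \<Longrightarrow> xs ! k = ys ! k"
  shows "xs = ys"
  using assms by (intro nth_equalityI) auto

lemma multimatrix_nrm_le_iff:
  assumes "xs \<in> carrier (multimatrix_alg ds)" "ds \<noteq> []"
  shows "nrm (multimatrix_alg ds) xs \<le> c \<longleftrightarrow> (\<forall>k<length ds. op_norm (xs ! k) \<le> c)"
proof -
  have "length xs = length ds" "set xs \<noteq> {}"
    using assms multimatrix_length[OF assms(1)] by auto
  then show ?thesis by (auto simp: multimatrix_simps all_set_conv_all_nth)
qed

lemma op_norm_le_multimatrix_nrm:
  assumes "xs \<in> carrier (multimatrix_alg ds)" "k < length ds"
  shows "op_norm (xs ! k) \<le> nrm (multimatrix_alg ds) xs"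
  using multimatrix_nrm_le_iff[OF assms(1), of "nrm (multimatrix_alg ds) xs"] assms(2) by fastforce

lemma multimatrix_star_algebra: "star_algebra (multimatrix_alg ds)"
proof -
  let ?M = "multimatrix_alg ds"
  note len = multimatrix_length[of _ ds] and nth = multimatrix_nth[of _ ds]
  have "ring ?M"
  proof (rule ringI)
    show "abelian_group ?M"
    proof (rule abelian_groupI)
      fix x y z assume x: "x \<in> carrier ?M" and y: "y \<in> carrier ?M" and z: "z \<in> carrier ?M"
      show "x \<oplus>\<^bsub>?M\<^esub> y \<in> carrier ?M"
        using x y by (simp add: multimatrix_carrier multimatrix_simps)
      show "x \<oplus>\<^bsub>?M\<^esub> y \<oplus>\<^bsub>?M\<^esub> z = x \<oplus>\<^bsub>?M\<^esub> (y \<oplus>\<^bsub>?M\<^esub> z)"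
        using x y z by (intro multimatrix_eqI[where ds = ds])
          (simp_all add: len multimatrix_simps assoc_add_mat[OF nth nth nth])
      show "x \<oplus>\<^bsub>?M\<^esub> y = y \<oplus>\<^bsub>?M\<^esub> x"
        using x y by (intro multimatrix_eqI[where ds = ds])
          (simp_all add: len multimatrix_simps comm_add_mat[OF nth[of x] nth[of y]])
    next
      fix x assume x: "x \<in> carrier ?M"
      show "\<zero>\<^bsub>?M\<^esub> \<oplus>\<^bsub>?M\<^esub> x = x"
        using x by (intro multimatrix_eqI[where ds = ds])
          (simp_all add: len multimatrix_simps left_add_zero_mat[OF nth])
      have "map uminus x \<oplus>\<^bsub>?M\<^esub> x = \<zero>\<^bsub>?M\<^esub>"
        using x by (intro multimatrix_eqI[where ds = ds])
          (simp_all add: len multimatrix_simps uminus_l_inv_mat[OF nth])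
      moreover have "map uminus x \<in> carrier ?M"
        using x by (simp add: multimatrix_carrier)
      ultimately show "\<exists>y\<in>carrier ?M. y \<oplus>\<^bsub>?M\<^esub> x = \<zero>\<^bsub>?M\<^esub>" by blast
    qed (simp add: multimatrix_carrier multimatrix_simps)
    show "Group.monoid ?M"
    proof (rule monoidI)
      fix x y z assume x: "x \<in> carrier ?M" and y: "y \<in> carrier ?M" and z: "z \<in> carrier ?M"
      show "x \<otimes>\<^bsub>?M\<^esub> y \<in> carrier ?M"
        using x y by (auto simp: multimatrix_carrier multimatrix_simps intro: mult_carrier_mat)
      show "x \<otimes>\<^bsub>?M\<^esub> y \<otimes>\<^bsub>?M\<^esub> z = x \<otimes>\<^bsub>?M\<^esub> (y \<otimes>\<^bsub>?M\<^esub> z)"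
        using x y z by (intro multimatrix_eqI[where ds = ds])
          (simp_all add: len multimatrix_simps assoc_mult_mat[OF nth nth nth])
    next
      fix x assume x: "x \<in> carrier ?M"
      show "\<one>\<^bsub>?M\<^esub> \<otimes>\<^bsub>?M\<^esub> x = x" "x \<otimes>\<^bsub>?M\<^esub> \<one>\<^bsub>?M\<^esub> = x"
        using x by (auto intro!: multimatrix_eqI[where ds = ds]
          simp: len multimatrix_simps left_mult_one_mat[OF nth] right_mult_one_mat[OF nth])
    qed (simp add: multimatrix_carrier multimatrix_simps)
    fix x y z assume x: "x \<in> carrier ?M" and y: "y \<in> carrier ?M" and z: "z \<in> carrier ?M"
    show "(x \<oplus>\<^bsub>?M\<^esub> y) \<otimes>\<^bsub>?M\<^esub> z = x \<otimes>\<^bsub>?M\<^esub> z \<oplus>\<^bsub>?M\<^esub> y \<otimes>\<^bsub>?M\<^esub> z"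
      using x y z by (intro multimatrix_eqI[where ds = ds])
        (simp_all add: len multimatrix_simps add_mult_distrib_mat[OF nth nth nth])
    show "z \<otimes>\<^bsub>?M\<^esub> (x \<oplus>\<^bsub>?M\<^esub> y) = z \<otimes>\<^bsub>?M\<^esub> x \<oplus>\<^bsub>?M\<^esub> z \<otimes>\<^bsub>?M\<^esub> y"
      using x y z by (intro multimatrix_eqI[where ds = ds])
        (simp_all add: len multimatrix_simps mult_add_distrib_mat[OF nth nth nth])
  qed
  then interpret ring ?M .
  show ?thesis
  proof unfold_locales
    fix x y c assume x: "x \<in> carrier ?M"
    show "c \<odot>\<^bsub>?M\<^esub> x \<in> carrier ?M" "star ?M x \<in> carrier ?M"
      using x by (simp_all add: multimatrix_carrier multimatrix_simps)
    assume y: "y \<in> carrier ?M"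
    show "c \<odot>\<^bsub>?M\<^esub> (x \<oplus>\<^bsub>?M\<^esub> y) = c \<odot>\<^bsub>?M\<^esub> x \<oplus>\<^bsub>?M\<^esub> c \<odot>\<^bsub>?M\<^esub> y"
      using x y by (intro multimatrix_eqI[where ds = ds])
        (simp_all add: len multimatrix_simps add_smult_distrib_left_mat[OF nth nth])
    have "mat_adjoint (x ! k + y ! k) = mat_adjoint (x ! k) + mat_adjoint (y ! k)" if "k < length ds" for k
      using nth[OF x that] nth[OF y that] by (intro eq_matI) auto
    then show "star ?M (x \<oplus>\<^bsub>?M\<^esub> y) = star ?M x \<oplus>\<^bsub>?M\<^esub> star ?M y"
      using x y by (intro multimatrix_eqI[where ds = ds]) (simp_all add: len multimatrix_simps)
  qed
qed

text \<open>Nonemptiness is required because \<open>Max\<close> is unspecified on the empty set. The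
  negative is rewritten as the multiple by -1, so the bound for multiples, applied to an element and
  to its negative, gives \<open>nrm_uminus\<close>.\<close>

lemma multimatrix_normed:
  assumes ds: "ds \<noteq> []"
  shows "normed_star_algebra (multimatrix_alg ds)"
proof -
  let ?M = "multimatrix_alg ds"
  interpret star_algebra ?M by (rule multimatrix_star_algebra)
  note len = multimatrix_length[of _ ds] and nth = multimatrix_nth[of _ ds]
  note le_iff = multimatrix_nrm_le_iff[OF _ ds] and up = op_norm_le_multimatrix_nrm[of _ ds]
  have nonneg: "0 \<le> nrm ?M x" if "x \<in> carrier ?M" for x
    using order_trans[OF op_norm_nonneg up[OF that, of 0]] ds by simp
  have smult: "nrm ?M (c \<odot>\<^bsub>?M\<^esub> x) \<le> cmod c * nrm ?M x" if x: "x \<in> carrier ?M" for c x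
    unfolding le_iff[OF smult_closed[OF x]]
  proof (intro allI impI)
    fix k assume k: "k < length ds"
    show "op_norm ((c \<odot>\<^bsub>?M\<^esub> x) ! k) \<le> cmod c * nrm ?M x"
      using order_trans[OF op_norm_smult mult_left_mono[OF up[OF x k]]] k x
      by (simp add: len multimatrix_simps(5))
  qed
  have neg: "\<ominus>\<^bsub>?M\<^esub> x = (- 1) \<odot>\<^bsub>?M\<^esub> x" if x: "x \<in> carrier ?M" for x
  proof (rule minus_equality[OF _ x smult_closed[OF x]])
    have "((- 1) \<cdot>\<^sub>m (x ! k)) + x ! k = 0\<^sub>m (ds ! k) (ds ! k)" if "k < length ds" for k
      using nth[OF x that] by (intro eq_matI) auto
    then show "(- 1) \<odot>\<^bsub>?M\<^esub> x \<oplus>\<^bsub>?M\<^esub> x = \<zero>\<^bsub>?M\<^esub>"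
      using x by (intro multimatrix_eqI[where ds = ds]) (simp_all add: len multimatrix_simps)
  qed
  have neg_le: "nrm ?M (\<ominus>\<^bsub>?M\<^esub> x) \<le> nrm ?M x" if "x \<in> carrier ?M" for x
    using smult[OF that, of "- 1"] by (simp add: neg[OF that])
  show ?thesis
  proof unfold_locales
    show "nrm ?M \<zero>\<^bsub>?M\<^esub> = 0"
      using le_iff[OF zero_closed, of 0] nonneg[OF zero_closed] by (simp add: multimatrix_simps(3))
    fix x c assume x: "x \<in> carrier ?M"
    show "0 \<le> nrm ?M x" by (rule nonneg[OF x])
    show "nrm ?M (c \<odot>\<^bsub>?M\<^esub> x) \<le> cmod c * nrm ?M x" by (rule smult[OF x])
    show "nrm ?M (\<ominus>\<^bsub>?M\<^esub> x) = nrm ?M x"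
      using neg_le[OF x] neg_le[OF a_inv_closed[OF x]] x by simp
    show "nrm ?M (star ?M x) \<le> nrm ?M x"
      unfolding le_iff[OF star_closed[OF x]]
      using order_trans[OF op_norm_adjoint[OF nth[OF x]] up[OF x]] x
      by (simp add: len multimatrix_simps(6))
    fix y assume y: "y \<in> carrier ?M"
    show "nrm ?M (x \<oplus>\<^bsub>?M\<^esub> y) \<le> nrm ?M x + nrm ?M y"
      unfolding le_iff[OF a_closed[OF x y]]
      using order_trans[OF op_norm_add[OF nth[OF x] nth[OF y]] add_mono[OF up[OF x] up[OF y]]] x y
      by (simp add: len multimatrix_simps(4))
    show "nrm ?M (x \<otimes>\<^bsub>?M\<^esub> y) \<le> nrm ?M x * nrm ?M y"
      unfolding le_iff[OF m_closed[OF x y]]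
      using order_trans[OF op_norm_mult[OF nth[OF x] nth[OF y]]
          mult_mono[OF up[OF x] up[OF y] nonneg[OF x] op_norm_nonneg]] x y
      by (simp add: len multimatrix_simps(1))
  qed
qed

text \<open>Every summand of a \<open>bratteli_map\<close> has this form, with
  \<open>incoming\<close> as the list; repetitions in the list are multiplicities of edges.\<close>

definition select :: "nat list \<Rightarrow> complex mat list \<Rightarrow> complex mat" where
  "select ks xs = diag_block_mat (map ((!) xs) ks)"

definition select_dim :: "nat list \<Rightarrow> nat list \<Rightarrow> nat" where
  "select_dim ks ds = sum_list (map ((!) ds) ks)"

lemma select_Nil [simp]: "select [] xs = 0\<^sub>m 0 0" "select_dim [] ds = 0"
  by (simp_all add: select_def select_dim_def)

lemma select_Cons [simp]:
  "select (k # ks) xs = block_sum (xs ! k) (select ks xs)"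
  "select_dim (k # ks) ds = ds ! k + select_dim ks ds"
  by (simp_all add: select_def select_dim_def diag_block_mat_Cons del: diag_block_mat.simps(2))

lemma select_closed:
  assumes "xs \<in> carrier (multimatrix_alg ds)" "set ks \<subseteq> {..<length ds}"
  shows "select ks xs \<in> carrier_mat (select_dim ks ds) (select_dim ks ds)"
  using assms(2) by (induction ks) (simp_all add: multimatrix_nth[OF assms(1)])

lemma select_hom:
  assumes ks: "set ks \<subseteq> {..<length ds}"
  shows "select ks \<in> star_hom (multimatrix_alg ds) (matrix_alg (select_dim ks ds))"
proof (rule star_homI, unfold matrix_alg_simps)
  let ?M = "multimatrix_alg ds"
  show "select ks \<one>\<^bsub>?M\<^esub> = 1\<^sub>m (select_dim ks ds)"
    using ks
  proof (induction ks)
    case (Cons k ks)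
    then show ?case by (simp add: multimatrix_simps block_sum_one)
  qed (simp, rule eq_matI, auto)
  fix x assume x: "x \<in> carrier ?M"
  show "select ks x \<in> carrier_mat (select_dim ks ds) (select_dim ks ds)"
    by (rule select_closed[OF x ks])
  show "select ks (c \<odot>\<^bsub>?M\<^esub> x) = c \<cdot>\<^sub>m select ks x" for c
    using ks
  proof (induction ks)
    case (Cons k ks)
    then show ?case by (simp add: multimatrix_simps multimatrix_length[OF x] block_sum_smult)
  qed simp
  show "select ks (star ?M x) = mat_adjoint (select ks x)"
    using ks
  proof (induction ks)
    case (Cons k ks)
    then show ?case by (simp add: multimatrix_simps multimatrix_length[OF x] block_sum_adjoint)
  qed (simp, rule eq_matI, auto)
  fix y assume y: "y \<in> carrier ?M"
  show "select ks (x \<oplus>\<^bsub>?M\<^esub> y) = select ks x + select ks y"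
    using ks
  proof (induction ks)
    case (Cons k ks)
    then show ?case
      using block_sum_add[OF multimatrix_nth[OF x, of k] multimatrix_nth[OF y, of k]
          select_closed[OF x, of ks] select_closed[OF y, of ks]]
      by (simp add: multimatrix_simps multimatrix_length[OF x] multimatrix_length[OF y])
  qed simp
  show "select ks (x \<otimes>\<^bsub>?M\<^esub> y) = select ks x * select ks y"
    using ks
  proof (induction ks)
    case (Cons k ks)
    then show ?case
      using block_sum_mult[OF multimatrix_nth[OF x, of k] multimatrix_nth[OF y, of k]
          select_closed[OF x, of ks] select_closed[OF y, of ks]]
      by (simp add: multimatrix_simps multimatrix_length[OF x] multimatrix_length[OF y])
  qed simp
qed

text \<open>Repetitions do not matter: the norm depends on the set of selected summands only. So a
  summand that receives an edge from every vertex sees the whole norm of the preceding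
  level.\<close>

lemma select_op_norm_le_iff:
  assumes x: "xs \<in> carrier (multimatrix_alg ds)" and ks: "set ks \<subseteq> {..<length ds}" and "0 \<le> c"
  shows "op_norm (select ks xs) \<le> c \<longleftrightarrow> (\<forall>k\<in>set ks. op_norm (xs ! k) \<le> c)"
  using ks
proof (induction ks)
  case (Cons k ks)
  then show ?case
    using op_norm_block_sum_le_iff[OF multimatrix_nth[OF x, of k] select_closed[OF x, of ks] \<open>0 \<le> c\<close>]
    by simp
qed (simp add: \<open>0 \<le> c\<close>)

lemma select_contractive:
  assumes ks: "set ks \<subseteq> {..<length ds}" and ds: "ds \<noteq> []"
  shows "select ks \<in> contractive_hom (multimatrix_alg ds) (matrix_alg (select_dim ks ds))"
proof (rule contractive_homI[OF select_hom[OF ks]])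
  fix x assume x: "x \<in> carrier (multimatrix_alg ds)"
  interpret normed_star_algebra "multimatrix_alg ds" by (rule multimatrix_normed[OF ds])
  show "nrm (matrix_alg (select_dim ks ds)) (select ks x) \<le> nrm (multimatrix_alg ds) x"
    unfolding matrix_alg_simps select_op_norm_le_iff[OF x ks nrm_nonneg[OF x]]
    using op_norm_le_multimatrix_nrm[OF x] ks by auto
qed

lemma multimatrix_hom:
  assumes fs: "fs \<noteq> []" "length fs = length es"
    and f: "\<And>l. l < length es \<Longrightarrow> fs ! l \<in> contractive_hom A (matrix_alg (es ! l))"
  shows "(\<lambda>x. map (\<lambda>f. f x) fs) \<in> contractive_hom A (multimatrix_alg es)"
proof (rule contractive_homI)
  note F = star_homD(2-)[OF contractive_hom_hom[OF f], unfolded matrix_alg_simps]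
  show hom: "(\<lambda>x. map (\<lambda>f. f x) fs) \<in> star_hom A (multimatrix_alg es)"
  proof (rule star_homI)
    show "map (\<lambda>f. f x) fs \<in> carrier (multimatrix_alg es)" if "x \<in> carrier A" for x
      using that F(1) fs by (simp add: multimatrix_carrier)
  qed (intro multimatrix_eqI[where ds = es]; simp add: multimatrix_simps F fs)+
  fix x assume x: "x \<in> carrier A"
  have "es \<noteq> []" using fs by auto
  show "nrm (multimatrix_alg es) (map (\<lambda>f. f x) fs) \<le> nrm A x"
    unfolding multimatrix_nrm_le_iff[OF star_hom_closed[OF hom x] \<open>es \<noteq> []\<close>]
    using contractive_hom_nrm[OF f x] fs by simp
qed

definition incoming :: "bratteli \<Rightarrow> nat \<Rightarrow> nat \<Rightarrow> nat list" where
  "incoming B n l = concat (map (\<lambda>k. replicate (edges B n k l) k) [0..<length (dims B n)])"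

lemma incoming_set: "set (incoming B n l) \<subseteq> {..<length (dims B n)}"
  by (auto simp: incoming_def)

lemma bratteli_map_eq:
  "bratteli_map B n xs = map (\<lambda>f. f xs) (map (\<lambda>l. select (incoming B n l)) [0..<length (dims B (Suc n))])"
  by (simp add: bratteli_map_def select_def incoming_def map_concat o_def)

text \<open>Here \<open>bratteli_unital\<close> enters: the selected blocks fill the target summand
  exactly, which makes the map unital.\<close>

lemma incoming_dim:
  assumes "bratteli_unital B" "l < length (dims B (Suc n))"
  shows "select_dim (incoming B n l) (dims B n) = dims B (Suc n) ! l"
proof -
  have "select_dim (concat kss) ds = sum_list (map (\<lambda>ks. select_dim ks ds) kss)" for kss ds
    by (induction kss) (simp_all add: select_dim_def)
  then have "select_dim (incoming B n l) (dims B n)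
    = sum_list (map (\<lambda>k. edges B n k l * dims B n ! k) [0..<length (dims B n)])"
    by (simp add: incoming_def o_def select_dim_def sum_list_replicate)
  also have "\<dots> = (\<Sum>k<length (dims B n). edges B n k l * dims B n ! k)"
    by (simp add: interv_sum_list_conv_sum_set_nat lessThan_atLeast0)
  finally show ?thesis using assms by (simp add: bratteli_unital_def)
qed

lemma bratteli_map_hom:
  assumes "bratteli_unital B" "\<And>n. dims B n \<noteq> []"
  shows "bratteli_map B n \<in> contractive_hom (multimatrix_alg (dims B n)) (multimatrix_alg (dims B (Suc n)))"
  unfolding bratteli_map_eq[abs_def]
proof (rule multimatrix_hom)
  fix l assume l: "l < length (dims B (Suc n))"
  then show "map (\<lambda>l. select (incoming B n l)) [0..<length (dims B (Suc n))] ! l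
      \<in> contractive_hom (multimatrix_alg (dims B n)) (matrix_alg (dims B (Suc n) ! l))"
    using select_contractive[OF incoming_set[of B n l] assms(2)[of n]] incoming_dim[OF assms(1) l] by simp
qed (use assms(2)[of "Suc n"] in simp_all)

lemma bratteli_system:
  assumes "bratteli_unital B" "\<And>n. dims B n \<noteq> []"
  shows "star_system (\<lambda>n. multimatrix_alg (dims B n)) (bratteli_map B)"
proof (intro star_system.intro unital_star_sequence.intro star_sequence.intro
    unital_star_sequence_axioms.intro star_system_axioms.intro)
  show "normed_star_algebra (multimatrix_alg (dims B n))" for n
    by (rule multimatrix_normed[OF assms(2)])
  then interpret normed_star_algebra "multimatrix_alg (dims B n)" for n .
  show "nrm (multimatrix_alg (dims B n)) \<one>\<^bsub>multimatrix_alg (dims B n)\<^esub> \<le> 1" for n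
    unfolding multimatrix_nrm_le_iff[OF one_closed assms(2)]
    by (simp add: multimatrix_simps(2) op_norm_one)
  show "bratteli_map B n \<in> contractive_hom (multimatrix_alg (dims B n)) (multimatrix_alg (dims B (Suc n)))" for n
    by (rule bratteli_map_hom[OF assms])
qed

section \<open>Orthonormal bases\<close>

text \<open>The axioms of \<open>hilbert_space\<close> without completeness: the metric and its
  calculus have to be available before the completeness of a sequence space can be proved.\<close>

locale pre_hilbert = vectorspace class_ring H for H :: "'h hilbert" +
  assumes ip_add: "\<lbrakk>x \<in> carrier H; y \<in> carrier H; z \<in> carrier H\<rbrakk>
      \<Longrightarrow> ip H x (y \<oplus>\<^bsub>H\<^esub> z) = ip H x y + ip H x z"
    and ip_smult: "\<lbrakk>x \<in> carrier H; y \<in> carrier H\<rbrakk> \<Longrightarrow> ip H x (c \<odot>\<^bsub>H\<^esub> y) = c * ip H x y"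
    and ip_cnj: "\<lbrakk>x \<in> carrier H; y \<in> carrier H\<rbrakk> \<Longrightarrow> ip H y x = cnj (ip H x y)"
    and ip_pos: "\<lbrakk>x \<in> carrier H; x \<noteq> \<zero>\<^bsub>H\<^esub>\<rbrakk> \<Longrightarrow> 0 < Re (ip H x x)"
begin

lemma sm_closed [simp]: "x \<in> carrier H \<Longrightarrow> c \<odot>\<^bsub>H\<^esub> x \<in> carrier H"
  using smult_closed[of c x] by simp

lemma sm_add: "x \<in> carrier H \<Longrightarrow> y \<in> carrier H \<Longrightarrow> c \<odot>\<^bsub>H\<^esub> (x \<oplus>\<^bsub>H\<^esub> y) = c \<odot>\<^bsub>H\<^esub> x \<oplus>\<^bsub>H\<^esub> c \<odot>\<^bsub>H\<^esub> y"
  using smult_r_distr[of c x y] by simp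

lemma ip_zero [simp]:
  assumes "x \<in> carrier H"
  shows "ip H x \<zero>\<^bsub>H\<^esub> = 0" "ip H \<zero>\<^bsub>H\<^esub> x = 0"
proof -
  have "ip H x \<zero>\<^bsub>H\<^esub> + ip H x \<zero>\<^bsub>H\<^esub> = ip H x \<zero>\<^bsub>H\<^esub>"
    using ip_add[OF assms M.zero_closed M.zero_closed] by simp
  then show "ip H x \<zero>\<^bsub>H\<^esub> = 0" by simp
  then show "ip H \<zero>\<^bsub>H\<^esub> x = 0" using ip_cnj[OF assms M.zero_closed] by simp
qed

lemma ip_uminus:
  assumes "x \<in> carrier H" "y \<in> carrier H"
  shows "ip H x (\<ominus>\<^bsub>H\<^esub> y) = - ip H x y"
proof -
  have "ip H x y + ip H x (\<ominus>\<^bsub>H\<^esub> y) = 0"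
    using ip_add[of x y "\<ominus>\<^bsub>H\<^esub> y"] assms by (simp add: M.r_neg)
  then show ?thesis by (simp add: add_eq_0_iff)
qed

lemma ip_minus:
  assumes "x \<in> carrier H" "y \<in> carrier H" "z \<in> carrier H"
  shows "ip H x (y \<ominus>\<^bsub>H\<^esub> z) = ip H x y - ip H x z"
  using assms by (simp add: a_minus_def ip_add ip_uminus)

lemma ip_add_left:
  assumes "x \<in> carrier H" "y \<in> carrier H" "z \<in> carrier H"
  shows "ip H (x \<oplus>\<^bsub>H\<^esub> y) z = ip H x z + ip H y z"
  using assms by (simp add: ip_cnj[of z "x \<oplus>\<^bsub>H\<^esub> y"] ip_cnj[of z x] ip_cnj[of z y] ip_add)

lemma ip_minus_left:
  assumes "x \<in> carrier H" "y \<in> carrier H" "z \<in> carrier H"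
  shows "ip H (x \<ominus>\<^bsub>H\<^esub> y) z = ip H x z - ip H y z"
  using assms by (simp add: ip_cnj[of z "x \<ominus>\<^bsub>H\<^esub> y"] ip_cnj[of z x] ip_cnj[of z y] ip_minus)

lemma ip_smult_left:
  assumes "x \<in> carrier H" "y \<in> carrier H"
  shows "ip H (c \<odot>\<^bsub>H\<^esub> x) y = cnj c * ip H x y"
  using assms by (simp add: ip_cnj[of y "c \<odot>\<^bsub>H\<^esub> x"] ip_cnj[of y x] ip_smult)

lemma ip_self_nonneg: "x \<in> carrier H \<Longrightarrow> 0 \<le> Re (ip H x x)"
  by (cases "x = \<zero>\<^bsub>H\<^esub>") (use ip_pos[of x] in auto)

lemma ip_self: "x \<in> carrier H \<Longrightarrow> ip H x x = complex_of_real ((hnorm H x)\<^sup>2)"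
  using ip_cnj[of x x] ip_self_nonneg[of x]
  by (simp add: hnorm_def complex_eq_iff)

lemma hnorm_nonneg [simp]: "x \<in> carrier H \<Longrightarrow> 0 \<le> hnorm H x"
  using ip_self_nonneg by (simp add: hnorm_def)

lemma hnorm_zero [simp]: "hnorm H \<zero>\<^bsub>H\<^esub> = 0"
  by (simp add: hnorm_def)

lemma hnorm_eq_zero: "x \<in> carrier H \<Longrightarrow> hnorm H x = 0 \<longleftrightarrow> x = \<zero>\<^bsub>H\<^esub>"
  using ip_pos[of x] by (cases "x = \<zero>\<^bsub>H\<^esub>") (auto simp: hnorm_def)

lemma hnorm_smult:
  assumes "x \<in> carrier H" shows "hnorm H (c \<odot>\<^bsub>H\<^esub> x) = cmod c * hnorm H x"
proof -
  have "complex_of_real ((hnorm H (c \<odot>\<^bsub>H\<^esub> x))\<^sup>2) = complex_of_real ((cmod c * hnorm H x)\<^sup>2)"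
    using assms unfolding ip_self[OF sm_closed[OF assms], symmetric] power_mult_distrib of_real_mult
      ip_self[OF assms, symmetric] complex_norm_square
    by (simp add: ip_smult ip_smult_left mult_ac)
  then have "(hnorm H (c \<odot>\<^bsub>H\<^esub> x))\<^sup>2 = (cmod c * hnorm H x)\<^sup>2" by (simp only: of_real_eq_iff)
  then show ?thesis by (rule power2_eq_imp_eq) (simp_all add: assms)
qed

lemma hnorm_square_minus:
  assumes "x \<in> carrier H" "y \<in> carrier H"
  shows "(hnorm H (x \<ominus>\<^bsub>H\<^esub> y))\<^sup>2 = (hnorm H x)\<^sup>2 - 2 * Re (ip H x y) + (hnorm H y)\<^sup>2"
proof -
  have "(hnorm H (x \<ominus>\<^bsub>H\<^esub> y))\<^sup>2 = Re (ip H (x \<ominus>\<^bsub>H\<^esub> y) (x \<ominus>\<^bsub>H\<^esub> y))"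
    using assms by (simp add: ip_self)
  also have "\<dots> = Re (ip H x x) - Re (ip H x y) - Re (ip H y x) + Re (ip H y y)"
    using assms by (simp add: ip_minus ip_minus_left)
  also have "Re (ip H y x) = Re (ip H x y)" using assms by (simp add: ip_cnj[of x y])
  finally show ?thesis using assms by (simp add: ip_self)
qed

lemma hnorm_square_add:
  assumes "x \<in> carrier H" "y \<in> carrier H"
  shows "(hnorm H (x \<oplus>\<^bsub>H\<^esub> y))\<^sup>2 = (hnorm H x)\<^sup>2 + 2 * Re (ip H x y) + (hnorm H y)\<^sup>2"
proof -
  have "(hnorm H (x \<oplus>\<^bsub>H\<^esub> y))\<^sup>2 = Re (ip H (x \<oplus>\<^bsub>H\<^esub> y) (x \<oplus>\<^bsub>H\<^esub> y))"
    using assms by (simp add: ip_self)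
  also have "\<dots> = Re (ip H x x) + Re (ip H x y) + Re (ip H y x) + Re (ip H y y)"
    using assms by (simp add: ip_add ip_add_left)
  also have "Re (ip H y x) = Re (ip H x y)" using assms by (simp add: ip_cnj[of x y])
  finally show ?thesis using assms by (simp add: ip_self)
qed

lemma cauchy_schwarz:
  assumes x: "x \<in> carrier H" and y: "y \<in> carrier H"
  shows "cmod (ip H x y) \<le> hnorm H x * hnorm H y"
proof (cases "y = \<zero>\<^bsub>H\<^esub>")
  case False
  then have pos: "0 < hnorm H y" using hnorm_eq_zero[OF y] hnorm_nonneg[OF y] by linarith
  \<comment> \<open>\<open>c\<close> is the coefficient of the orthogonal projection of
    \<open>x\<close> onto \<open>y\<close>; the square of the remaining distance is
    nonnegative.\<close>
  define c where "c = ip H y x / complex_of_real ((hnorm H y)\<^sup>2)"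
  have xy: "ip H x y = cnj (ip H y x)" by (rule ip_cnj[OF y x])
  have c2: "(hnorm H (c \<odot>\<^bsub>H\<^esub> y))\<^sup>2 = (cmod (ip H x y))\<^sup>2 / (hnorm H y)\<^sup>2"
    unfolding hnorm_smult[OF y] xy using pos
    by (simp add: c_def norm_divide norm_power power_mult_distrib power_divide)
      (simp add: power2_eq_square power4_eq_xxxx)
  have "ip H x (c \<odot>\<^bsub>H\<^esub> y) = complex_of_real ((cmod (ip H x y))\<^sup>2 / (hnorm H y)\<^sup>2)"
    unfolding ip_smult[OF x y] xy c_def using complex_norm_square[of "ip H y x"] by simp
  then have "Re (ip H x (c \<odot>\<^bsub>H\<^esub> y)) = (cmod (ip H x y))\<^sup>2 / (hnorm H y)\<^sup>2"
    by (simp only: Re_complex_of_real)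
  then have "(hnorm H (x \<ominus>\<^bsub>H\<^esub> c \<odot>\<^bsub>H\<^esub> y))\<^sup>2 = (hnorm H x)\<^sup>2 - (cmod (ip H x y))\<^sup>2 / (hnorm H y)\<^sup>2"
    using hnorm_square_minus[OF x sm_closed[OF y, of c]] c2 by linarith
  then have "(cmod (ip H x y))\<^sup>2 / (hnorm H y)\<^sup>2 \<le> (hnorm H x)\<^sup>2"
    using zero_le_power2[of "hnorm H (x \<ominus>\<^bsub>H\<^esub> c \<odot>\<^bsub>H\<^esub> y)"] by linarith
  then have "(cmod (ip H x y))\<^sup>2 \<le> (hnorm H x * hnorm H y)\<^sup>2"
    using pos by (simp add: divide_le_eq power_mult_distrib)
  then show ?thesis by (rule power2_le_imp_le) (simp add: x y)
qed (use assms in simp)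

lemma hnorm_triangle:
  assumes x: "x \<in> carrier H" and y: "y \<in> carrier H"
  shows "hnorm H (x \<oplus>\<^bsub>H\<^esub> y) \<le> hnorm H x + hnorm H y"
proof (rule power2_le_imp_le)
  have "Re (ip H x y) \<le> hnorm H x * hnorm H y"
    using cauchy_schwarz[OF x y] complex_Re_le_cmod[of "ip H x y"] by linarith
  then show "(hnorm H (x \<oplus>\<^bsub>H\<^esub> y))\<^sup>2 \<le> (hnorm H x + hnorm H y)\<^sup>2"
    unfolding hnorm_square_add[OF x y] by (simp add: power2_sum)
qed (simp add: x y)

lemma sm_minus_one:
  assumes "x \<in> carrier H" shows "(- 1) \<odot>\<^bsub>H\<^esub> x = \<ominus>\<^bsub>H\<^esub> x"
proof -
  have "(- 1) \<odot>\<^bsub>H\<^esub> x \<oplus>\<^bsub>H\<^esub> x = (- 1 + 1) \<odot>\<^bsub>H\<^esub> x"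
    using smult_l_distr[of "- 1" 1 x] smult_one[OF assms] assms by simp
  also have "\<dots> = \<zero>\<^bsub>H\<^esub>" using hnorm_smult[OF assms, of 0] hnorm_eq_zero[of "0 \<odot>\<^bsub>H\<^esub> x"] assms by simp
  finally show ?thesis using assms by (intro M.minus_equality[symmetric]) simp_all
qed

lemma hnorm_uminus: "x \<in> carrier H \<Longrightarrow> hnorm H (\<ominus>\<^bsub>H\<^esub> x) = hnorm H x"
  using hnorm_smult[of x "- 1"] sm_minus_one[of x] by simp

lemma h_minus_swap: "x \<in> carrier H \<Longrightarrow> y \<in> carrier H \<Longrightarrow> \<ominus>\<^bsub>H\<^esub> (x \<ominus>\<^bsub>H\<^esub> y) = y \<ominus>\<^bsub>H\<^esub> x"
  by (simp add: M.minus_eq M.minus_add M.a_comm)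

lemma hnorm_minus_commute:
  assumes "x \<in> carrier H" "y \<in> carrier H"
  shows "hnorm H (x \<ominus>\<^bsub>H\<^esub> y) = hnorm H (y \<ominus>\<^bsub>H\<^esub> x)"
  using hnorm_uminus[of "x \<ominus>\<^bsub>H\<^esub> y"] h_minus_swap assms by simp

lemma h_minus_split:
  assumes "x \<in> carrier H" "y \<in> carrier H" "z \<in> carrier H"
  shows "x \<ominus>\<^bsub>H\<^esub> z = (x \<ominus>\<^bsub>H\<^esub> y) \<oplus>\<^bsub>H\<^esub> (y \<ominus>\<^bsub>H\<^esub> z)"
proof -
  have "(x \<ominus>\<^bsub>H\<^esub> y) \<oplus>\<^bsub>H\<^esub> (y \<ominus>\<^bsub>H\<^esub> z) = x \<oplus>\<^bsub>H\<^esub> ((\<ominus>\<^bsub>H\<^esub> y \<oplus>\<^bsub>H\<^esub> y) \<oplus>\<^bsub>H\<^esub> \<ominus>\<^bsub>H\<^esub> z)"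
    using assms by (simp only: M.minus_eq M.a_assoc M.a_inv_closed M.a_closed)
  then show ?thesis using assms by (simp add: M.l_neg M.minus_eq)
qed

lemma hnorm_triangle_minus:
  assumes "x \<in> carrier H" "y \<in> carrier H" "z \<in> carrier H"
  shows "hnorm H (x \<ominus>\<^bsub>H\<^esub> z) \<le> hnorm H (x \<ominus>\<^bsub>H\<^esub> y) + hnorm H (y \<ominus>\<^bsub>H\<^esub> z)"
  unfolding h_minus_split[OF assms] using assms by (intro hnorm_triangle M.minus_closed)

lemma h_minus_add_cancel: "x \<in> carrier H \<Longrightarrow> y \<in> carrier H \<Longrightarrow> (x \<ominus>\<^bsub>H\<^esub> y) \<oplus>\<^bsub>H\<^esub> y = x"
  by (simp add: M.minus_eq M.a_assoc M.l_neg)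

lemma h_add_minus_cancel: "x \<in> carrier H \<Longrightarrow> y \<in> carrier H \<Longrightarrow> (x \<oplus>\<^bsub>H\<^esub> y) \<ominus>\<^bsub>H\<^esub> y = x"
  by (simp add: M.minus_eq M.a_assoc M.r_neg)

lemma hnorm_le_minus:
  assumes "x \<in> carrier H" "y \<in> carrier H"
  shows "hnorm H x \<le> hnorm H (x \<ominus>\<^bsub>H\<^esub> y) + hnorm H y"
  using hnorm_triangle[of "x \<ominus>\<^bsub>H\<^esub> y" y] assms by (simp add: h_minus_add_cancel)

lemma h_minus_self: "x \<in> carrier H \<Longrightarrow> x \<ominus>\<^bsub>H\<^esub> x = \<zero>\<^bsub>H\<^esub>"
  by (simp add: M.minus_eq M.r_neg)

lemma h_eq_iff_minus: "x \<in> carrier H \<Longrightarrow> y \<in> carrier H \<Longrightarrow> x = y \<longleftrightarrow> hnorm H (x \<ominus>\<^bsub>H\<^esub> y) = 0"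
  by (simp add: hnorm_eq_zero)

lemma hilbert_metric: "Metric_space (carrier H) (hdist H)"
proof
  fix x y z
  show "0 \<le> hdist H x y" by (simp add: hdist_def)
  show "hdist H x y = hdist H y x" by (simp add: hdist_def hnorm_minus_commute)
  assume x: "x \<in> carrier H" and y: "y \<in> carrier H"
  show "hdist H x y = 0 \<longleftrightarrow> x = y" using x y by (simp add: hdist_def h_eq_iff_minus)
  assume z: "z \<in> carrier H"
  show "hdist H x z \<le> hdist H x y + hdist H y z"
    using x y z hnorm_triangle_minus by (simp add: hdist_def)
qed

sublocale hm: Metric_space "carrier H" "hdist H" by (rule hilbert_metric)

text \<open>Convergence in \<open>htopology H\<close> of sequences inside the carrier, phrased by
  norms so that limits of numbers apply; \<open>tends_limitin\<close> and
  \<open>limitin_tends\<close> give the link.\<close>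

definition tends :: "(nat \<Rightarrow> 'h) \<Rightarrow> 'h \<Rightarrow> bool" where
  "tends s y \<longleftrightarrow> range s \<subseteq> carrier H \<and> y \<in> carrier H \<and> (\<lambda>n. hnorm H (s n \<ominus>\<^bsub>H\<^esub> y)) \<longlonglongrightarrow> 0"

lemma tendsD:
  assumes "tends s y"
  shows "s n \<in> carrier H" "y \<in> carrier H" "(\<lambda>n. hnorm H (s n \<ominus>\<^bsub>H\<^esub> y)) \<longlonglongrightarrow> 0"
  using assms by (auto simp: tends_def)

lemma tends_limitin:
  assumes "tends s y"
  shows "limitin (htopology H) s y sequentially"
proof -
  have "\<exists>N. \<forall>n\<ge>N. s n \<in> carrier H \<and> hdist H (s n) y < \<epsilon>" if "0 < \<epsilon>" for \<epsilon>
    using order_tendstoD(2)[OF tendsD(3)[OF assms] that] tendsD(1,2)[OF assms]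
    by (auto simp: eventually_sequentially hdist_def)
  then show ?thesis unfolding hm.limit_metric_sequentially using tendsD(2)[OF assms] by blast
qed

lemma limitin_tends:
  assumes "limitin (htopology H) s y sequentially" "range s \<subseteq> carrier H"
  shows "tends s y"
proof -
  have y: "y \<in> carrier H" using assms(1) unfolding hm.limit_metric_sequentially by blast
  have "(\<lambda>n. hnorm H (s n \<ominus>\<^bsub>H\<^esub> y)) \<longlonglongrightarrow> 0"
  proof (rule LIMSEQ_I)
    fix \<epsilon> :: real assume "0 < \<epsilon>"
    then obtain N where "\<forall>n\<ge>N. s n \<in> carrier H \<and> hdist H (s n) y < \<epsilon>"
      using assms(1) unfolding hm.limit_metric_sequentially by blast
    then show "\<exists>N. \<forall>n\<ge>N. norm (hnorm H (s n \<ominus>\<^bsub>H\<^esub> y) - 0) < \<epsilon>"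
      using y by (auto simp: hdist_def intro!: exI[of _ N])
  qed
  then show ?thesis using assms(2) y by (simp add: tends_def)
qed

lemma closedin_tends:
  assumes "closedin (htopology H) W" "tends s y" "\<And>n. s n \<in> W"
  shows "y \<in> W"
  using assms(1,3) tends_limitin[OF assms(2)] unfolding hm.metric_closedin_iff_sequentially_closed
  by blast

lemma tends_unique:
  assumes "tends s x" "tends s y" shows "x = y"
  using hm.limitin_metric_unique[OF tends_limitin[OF assms(1)] tends_limitin[OF assms(2)]] by simp

lemma tendsI:
  assumes "range s \<subseteq> carrier H" "y \<in> carrier H" "\<And>n. hnorm H (s n \<ominus>\<^bsub>H\<^esub> y) \<le> f n" "f \<longlonglongrightarrow> 0"
  shows "tends s y"
proof -
  have "s n \<in> carrier H" for n using assms(1) by blast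
  then have "(\<lambda>n. hnorm H (s n \<ominus>\<^bsub>H\<^esub> y)) \<longlonglongrightarrow> 0"
    by (intro real_tendsto_sandwich[OF _ _ tendsto_const assms(4)] always_eventually allI assms(3))
      (simp add: assms(2))
  then show ?thesis using assms by (simp add: tends_def)
qed

lemma tends_const: "x \<in> carrier H \<Longrightarrow> tends (\<lambda>_. x) x"
  by (rule tendsI[of _ _ "\<lambda>_. 0"]) (auto simp: h_minus_self)

lemma h_add_minus_add:
  assumes "a \<in> carrier H" "b \<in> carrier H" "c \<in> carrier H" "d \<in> carrier H"
  shows "(a \<oplus>\<^bsub>H\<^esub> b) \<ominus>\<^bsub>H\<^esub> (c \<oplus>\<^bsub>H\<^esub> d) = (a \<ominus>\<^bsub>H\<^esub> c) \<oplus>\<^bsub>H\<^esub> (b \<ominus>\<^bsub>H\<^esub> d)"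
  using assms by (simp add: M.minus_eq M.minus_add M.a_ac)

lemma tends_add:
  assumes "tends s x" "tends t y"
  shows "tends (\<lambda>n. s n \<oplus>\<^bsub>H\<^esub> t n) (x \<oplus>\<^bsub>H\<^esub> y)"
proof (rule tendsI[OF _ _ _ tendsto_add_zero[OF tendsD(3)[OF assms(1)] tendsD(3)[OF assms(2)]]])
  note c = tendsD(1,2)[OF assms(1)] tendsD(1,2)[OF assms(2)]
  show "hnorm H ((s n \<oplus>\<^bsub>H\<^esub> t n) \<ominus>\<^bsub>H\<^esub> (x \<oplus>\<^bsub>H\<^esub> y)) \<le> hnorm H (s n \<ominus>\<^bsub>H\<^esub> x) + hnorm H (t n \<ominus>\<^bsub>H\<^esub> y)" for n
    unfolding h_add_minus_add[OF c(1,3,2,4)] by (intro hnorm_triangle M.minus_closed c)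
qed (use tendsD[OF assms(1)] tendsD[OF assms(2)] in auto)

lemma sm_minus:
  assumes "x \<in> carrier H" "y \<in> carrier H"
  shows "c \<odot>\<^bsub>H\<^esub> (x \<ominus>\<^bsub>H\<^esub> y) = c \<odot>\<^bsub>H\<^esub> x \<ominus>\<^bsub>H\<^esub> c \<odot>\<^bsub>H\<^esub> y"
proof -
  have "c \<odot>\<^bsub>H\<^esub> (x \<ominus>\<^bsub>H\<^esub> y) \<oplus>\<^bsub>H\<^esub> c \<odot>\<^bsub>H\<^esub> y = c \<odot>\<^bsub>H\<^esub> x"
    using assms by (simp add: sm_add[symmetric] h_minus_add_cancel)
  moreover have "(c \<odot>\<^bsub>H\<^esub> x \<ominus>\<^bsub>H\<^esub> c \<odot>\<^bsub>H\<^esub> y) \<oplus>\<^bsub>H\<^esub> c \<odot>\<^bsub>H\<^esub> y = c \<odot>\<^bsub>H\<^esub> x"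
    using assms by (simp add: h_minus_add_cancel)
  ultimately show ?thesis
    using assms h_add_minus_cancel by (metis M.minus_closed sm_closed)
qed

lemma tends_smult:
  assumes "tends s x" shows "tends (\<lambda>n. c \<odot>\<^bsub>H\<^esub> s n) (c \<odot>\<^bsub>H\<^esub> x)"
proof (rule tendsI[OF _ _ _ tendsto_mult_right_zero[OF tendsD(3)[OF assms], of "cmod c"]])
  note cl = tendsD(1,2)[OF assms]
  show "hnorm H (c \<odot>\<^bsub>H\<^esub> s n \<ominus>\<^bsub>H\<^esub> c \<odot>\<^bsub>H\<^esub> x) \<le> cmod c * hnorm H (s n \<ominus>\<^bsub>H\<^esub> x)" for n
    using cl by (simp add: sm_minus[symmetric] hnorm_smult)
qed (use tendsD[OF assms] in auto)

lemma tends_ip: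
  assumes "tends s x" "z \<in> carrier H" shows "(\<lambda>n. ip H z (s n)) \<longlonglongrightarrow> ip H z x"
proof (rule LIM_zero_cancel, rule Lim_null_comparison)
  note cl = tendsD(1,2)[OF assms(1)]
  show "\<forall>\<^sub>F n in sequentially. norm (ip H z (s n) - ip H z x) \<le> hnorm H z * hnorm H (s n \<ominus>\<^bsub>H\<^esub> x)"
    using cauchy_schwarz[OF assms(2) M.minus_closed[OF cl]] ip_minus[OF assms(2) cl]
    by (intro always_eventually) simp
  show "(\<lambda>n. hnorm H z * hnorm H (s n \<ominus>\<^bsub>H\<^esub> x)) \<longlonglongrightarrow> 0"
    by (rule tendsto_mult_right_zero[OF tendsD(3)[OF assms(1)]])
qed

lemma tends_ip_left:
  assumes "tends s x" "z \<in> carrier H" shows "(\<lambda>n. ip H (s n) z) \<longlonglongrightarrow> ip H x z"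
  using tendsto_cnj[OF tends_ip[OF assms]] tendsD(1,2)[OF assms(1)] assms(2)
  by (simp add: ip_cnj[of z])

lemma tends_hnorm:
  assumes "tends s x" shows "(\<lambda>n. hnorm H (s n)) \<longlonglongrightarrow> hnorm H x"
proof (rule LIM_zero_cancel, rule Lim_null_comparison[OF _ tendsD(3)[OF assms]])
  note cl = tendsD(1,2)[OF assms]
  show "\<forall>\<^sub>F n in sequentially. norm (hnorm H (s n) - hnorm H x) \<le> hnorm H (s n \<ominus>\<^bsub>H\<^esub> x)"
  proof (intro always_eventually allI)
    fix n
    show "norm (hnorm H (s n) - hnorm H x) \<le> hnorm H (s n \<ominus>\<^bsub>H\<^esub> x)"
      using hnorm_le_minus[OF cl(1)[of n] cl(2)] hnorm_le_minus[OF cl(2) cl(1)[of n]]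
        hnorm_minus_commute[OF cl(2) cl(1)[of n]] unfolding real_norm_def by linarith
  qed
qed

lemma ip_finsum:
  assumes "finite F" "\<And>i. i \<in> F \<Longrightarrow> f i \<in> carrier H" "x \<in> carrier H"
  shows "ip H x (finsum H f F) = (\<Sum>i\<in>F. ip H x (f i))"
  using assms(1,2)
proof (induction F rule: finite_induct)
  case (insert i F)
  then have "f \<in> F \<rightarrow> carrier H" "f i \<in> carrier H" by auto
  with insert show ?case
    using assms(3) by (simp add: M.finsum_insert ip_add M.finsum_closed)
qed (simp add: assms(3))

text \<open>Reduces \<open>mcomplete\<close> to a Cauchy condition with a fixed comparison index,
  the form in which Cauchy sequences are handled everywhere else.\<close>

lemma hilbert_spaceI:
  assumes "\<And>s. range s \<subseteq> carrier H \<Longrightarrow> (\<And>\<epsilon>. 0 < \<epsilon> \<Longrightarrow> \<exists>N. \<forall>n\<ge>N. hnorm H (s n \<ominus>\<^bsub>H\<^esub> s N) < \<epsilon>) \<Longrightarrow>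
    \<exists>y. tends s y"
  shows "hilbert_space H"
proof (rule hilbert_space.intro[OF vectorspace_axioms], rule hilbert_space_axioms.intro)
  show "hm.mcomplete"
    unfolding hm.mcomplete_def
  proof (intro allI impI)
    fix s assume s: "hm.MCauchy s"
    then have range: "range s \<subseteq> carrier H" unfolding hm.MCauchy_def by blast
    then have sc: "s n \<in> carrier H" for n by blast
    have "\<exists>N. \<forall>n\<ge>N. hnorm H (s n \<ominus>\<^bsub>H\<^esub> s N) < \<epsilon>" if "0 < \<epsilon>" for \<epsilon>
    proof -
      obtain N where "\<And>n n'. N \<le> n \<Longrightarrow> N \<le> n' \<Longrightarrow> hdist H (s n) (s n') < \<epsilon>"
        using s \<open>0 < \<epsilon>\<close> unfolding hm.MCauchy_def by blast
      then show ?thesis using sc by (intro exI[of _ N]) (simp add: hdist_def)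
    qed
    with assms range obtain y where "tends s y" by blast
    then show "\<exists>y. limitin (htopology H) s y sequentially" using tends_limitin by blast
  qed
qed (fact ip_add ip_smult ip_cnj ip_pos)+

end

sublocale hilbert_space \<subseteq> pre_hilbert
  by unfold_locales (fact ip_add ip_smult ip_cnj ip_pos)+

context hilbert_space
begin

lemma h_complete:
  assumes "range s \<subseteq> carrier H"
    and "\<And>\<epsilon>. 0 < \<epsilon> \<Longrightarrow> \<exists>N. \<forall>n\<ge>N. hnorm H (s n \<ominus>\<^bsub>H\<^esub> s N) < \<epsilon>"
  shows "\<exists>y. tends s y"
proof -
  have sc: "s n \<in> carrier H" for n using assms(1) by blast
  have "\<exists>N. \<forall>n n'. N \<le> n \<longrightarrow> N \<le> n' \<longrightarrow> hdist H (s n) (s n') < \<epsilon>" if "0 < \<epsilon>" for \<epsilon>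
  proof -
    have "0 < \<epsilon> / 2" using that by simp
    then obtain N where N: "\<And>n. n \<ge> N \<Longrightarrow> hnorm H (s n \<ominus>\<^bsub>H\<^esub> s N) < \<epsilon> / 2"
      using assms(2) by blast
    have "hdist H (s n) (s n') < \<epsilon>" if "N \<le> n" "N \<le> n'" for n n'
      using hnorm_triangle_minus[OF sc[of n] sc[of N] sc[of n']] N[OF that(1)] N[OF that(2)]
        hnorm_minus_commute[OF sc[of N] sc[of n']] sc by (simp add: hdist_def)
    then show ?thesis by blast
  qed
  then have "hm.MCauchy s" unfolding hm.MCauchy_def using assms(1) by blast
  then obtain y where "limitin (htopology H) s y sequentially"
    using complete unfolding hm.mcomplete_def by blast
  then show ?thesis using limitin_tends assms(1) by blast
qed

end

text \<open>Totality says that only zero is orthogonal to the family; this makes vectors comparable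
  by their coordinates, and density of the span follows in \<open>proj_tends\<close>. The index set
  \<open>J\<close> allows finite dimension as well.\<close>

locale onb_space = hilbert_space H for H :: "'h hilbert" +
  fixes e :: "nat \<Rightarrow> 'h" and J :: "nat set"
  assumes e_closed: "j \<in> J \<Longrightarrow> e j \<in> carrier H"
    and e_ortho: "i \<in> J \<Longrightarrow> j \<in> J \<Longrightarrow> ip H (e i) (e j) = of_bool (i = j)"
    and total: "x \<in> carrier H \<Longrightarrow> (\<And>j. j \<in> J \<Longrightarrow> ip H (e j) x = 0) \<Longrightarrow> x = \<zero>\<^bsub>H\<^esub>"
begin

lemma coord_eqI:
  assumes "x \<in> carrier H" "y \<in> carrier H" "\<And>j. j \<in> J \<Longrightarrow> ip H (e j) x = ip H (e j) y"
  shows "x = y"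
proof -
  have "x \<ominus>\<^bsub>H\<^esub> y = \<zero>\<^bsub>H\<^esub>"
    using assms by (intro total) (simp_all add: ip_minus e_closed)
  then show ?thesis using assms(1,2) by (metis h_minus_add_cancel M.l_zero)
qed

text \<open>\<open>synth\<close> and \<open>coords n\<close> are adjoint to each other, so
  \<open>synth (coords n x)\<close> is the orthogonal projection of \<open>x\<close> onto the span
  of the first \<open>n\<close> basis vectors.\<close>

definition synth :: "complex Matrix.vec \<Rightarrow> 'h" where
  "synth v = finsum H (\<lambda>i. v $ i \<odot>\<^bsub>H\<^esub> e i) {..<dim_vec v}"

definition coords :: "nat \<Rightarrow> 'h \<Rightarrow> complex Matrix.vec" where
  "coords n x = Matrix.vec n (\<lambda>i. ip H (e i) x)"

lemma coords_carrier [simp]: "coords n x \<in> carrier_vec n" "dim_vec (coords n x) = n"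
  by (simp_all add: coords_def)

lemma coords_index [simp]: "i < n \<Longrightarrow> coords n x $ i = ip H (e i) x"
  by (simp add: coords_def)

context
  fixes n assumes n: "{..<n} \<subseteq> J"
begin

lemma synth_closed: "v \<in> carrier_vec n \<Longrightarrow> synth v \<in> carrier H"
  unfolding synth_def using n by (intro M.finsum_closed) (auto intro!: sm_closed e_closed)

lemma ip_synth:
  assumes "v \<in> carrier_vec n" "x \<in> carrier H"
  shows "ip H x (synth v) = (\<Sum>i<n. v $ i * ip H x (e i))"
proof -
  have "e i \<in> carrier H" if "i < n" for i using that n e_closed by auto
  then show ?thesis
    unfolding synth_def using assms by (subst ip_finsum) (auto intro!: sum.cong simp: ip_smult)
qed

lemma coord_synth:
  assumes "v \<in> carrier_vec n" "j \<in> J"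
  shows "ip H (e j) (synth v) = (if j < n then v $ j else 0)"
proof -
  have "ip H (e j) (synth v) = (\<Sum>i<n. if i = j then v $ i else 0)"
    unfolding ip_synth[OF assms(1) e_closed[OF assms(2)]]
    using n assms(2) by (intro sum.cong) (auto simp: e_ortho subset_iff)
  then show ?thesis by simp
qed

lemma coords_synth: "v \<in> carrier_vec n \<Longrightarrow> coords n (synth v) = v"
  using n by (intro eq_vecI) (auto simp: coord_synth subset_iff)

lemma ip_synth_left:
  assumes "v \<in> carrier_vec n" "x \<in> carrier H"
  shows "ip H (synth v) x = cinner v (coords n x)"
proof -
  have e: "e i \<in> carrier H" if "i < n" for i using that n e_closed by auto
  have "ip H (synth v) x = cnj (\<Sum>i<n. v $ i * ip H x (e i))"
    using assms by (simp add: ip_cnj[of x "synth v"] synth_closed ip_synth)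
  also have "\<dots> = (\<Sum>i<n. cnj (v $ i) * ip H (e i) x)"
    using assms e by (simp add: ip_cnj[of x "e _"])
  finally show ?thesis by (simp add: cinner_def)
qed

lemma hnorm_synth:
  assumes "v \<in> carrier_vec n" shows "hnorm H (synth v) = l2_norm v"
proof -
  have "complex_of_real ((hnorm H (synth v))\<^sup>2) = complex_of_real ((l2_norm v)\<^sup>2)"
    using assms by (simp only: ip_self[symmetric] synth_closed ip_synth_left coords_synth cinner_self)
  then have "(hnorm H (synth v))\<^sup>2 = (l2_norm v)\<^sup>2" by (simp only: of_real_eq_iff)
  then show ?thesis by (rule power2_eq_imp_eq) (simp_all add: assms synth_closed)
qed

text \<open>The square of the norm of the projection of \<open>x\<close> equals its inner product
  with \<open>x\<close>, so Cauchy-Schwarz applies and one factor cancels.\<close>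

lemma bessel:
  assumes x: "x \<in> carrier H" shows "l2_norm (coords n x) \<le> hnorm H x"
proof -
  let ?c = "coords n x"
  have "(l2_norm ?c)\<^sup>2 = cmod (ip H (synth ?c) x)"
    using x by (simp add: ip_synth_left cinner_self norm_power)
  also have "\<dots> \<le> hnorm H (synth ?c) * hnorm H x" by (intro cauchy_schwarz synth_closed x) simp
  also have "\<dots> = l2_norm ?c * hnorm H x" by (simp add: hnorm_synth)
  finally have "l2_norm ?c * l2_norm ?c \<le> l2_norm ?c * hnorm H x" by (simp add: power2_eq_square)
  then show ?thesis
    using hnorm_nonneg[OF x] l2_norm_nonneg[of ?c] by (cases "l2_norm ?c = 0") simp_all
qed

lemma synth_add:
  assumes "v \<in> carrier_vec n" "w \<in> carrier_vec n" shows "synth (v + w) = synth v \<oplus>\<^bsub>H\<^esub> synth w"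
  using assms by (intro coord_eqI) (auto simp: synth_closed ip_add e_closed coord_synth)

lemma synth_smult:
  assumes "v \<in> carrier_vec n" shows "synth (c \<cdot>\<^sub>v v) = c \<odot>\<^bsub>H\<^esub> synth v"
  using assms by (intro coord_eqI) (auto simp: synth_closed ip_smult e_closed coord_synth)

lemma e_closed': "i < n \<Longrightarrow> e i \<in> carrier H"
  using n e_closed by auto

lemma coords_add:
  "x \<in> carrier H \<Longrightarrow> y \<in> carrier H \<Longrightarrow> coords n (x \<oplus>\<^bsub>H\<^esub> y) = coords n x + coords n y"
  by (intro eq_vecI) (auto simp: ip_add e_closed')

lemma coords_smult: "x \<in> carrier H \<Longrightarrow> coords n (c \<odot>\<^bsub>H\<^esub> x) = c \<cdot>\<^sub>v coords n x"
  by (intro eq_vecI) (auto simp: ip_smult e_closed')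

lemma ip_synth_right:
  assumes "v \<in> carrier_vec n" "x \<in> carrier H"
  shows "ip H x (synth v) = cinner (coords n x) v"
  using assms by (simp add: ip_cnj[of "synth v" x] synth_closed ip_synth_left cinner_def mult.commute)

end

text \<open>The squared norms \<open>a n\<close> of the projections increase and are bounded by
  Bessel, hence form a Cauchy sequence. By Pythagoras their differences are squared distances, so
  the projections converge, and the limit has the coordinates of \<open>x\<close>.\<close>

lemma proj_tends:
  assumes x: "x \<in> carrier H" and d: "mono d" and J: "J = (\<Union>n. {..<d n})"
  shows "tends (\<lambda>n. synth (coords (d n) x)) x"
proof -
  have dJ: "{..<d n} \<subseteq> J" for n using J by auto
  define s where "s = (\<lambda>n. synth (coords (d n) x))"
  have sc: "s n \<in> carrier H" for n
    unfolding s_def by (rule synth_closed[OF dJ[of n] coords_carrier(1)])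
  have cs: "coords (d m) (s n) = coords (d m) x" if "m \<le> n" for m n
  proof (rule eq_vecI)
    fix i assume "i < dim_vec (coords (d m) x)"
    then have i: "i < d m" "i < d n" "i \<in> J" using monoD[OF d that] dJ[of m] by auto
    then show "coords (d m) (s n) $ i = coords (d m) x $ i"
      unfolding s_def by (simp add: coord_synth[OF dJ coords_carrier(1)])
  qed simp
  define a where "a n = (hnorm H (s n))\<^sup>2" for n
  have diff: "(hnorm H (s n \<ominus>\<^bsub>H\<^esub> s m))\<^sup>2 = a n - a m" if "m \<le> n" for m n
  proof -
    have "ip H (s n) (s m) = cinner (coords (d m) (s n)) (coords (d m) x)"
      using ip_synth_right[OF dJ[of m] coords_carrier(1) sc[of n]] by (simp add: s_def)
    also have "\<dots> = complex_of_real (a m)"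
      unfolding cs[OF that] cinner_self a_def by (simp add: s_def hnorm_synth[OF dJ coords_carrier(1)])
    finally show ?thesis
      unfolding hnorm_square_minus[OF sc sc] by (simp add: a_def)
  qed
  have "incseq a"
  proof (rule monoI)
    fix m n :: nat assume "m \<le> n"
    show "a m \<le> a n"
      using diff[OF \<open>m \<le> n\<close>] zero_le_power2[of "hnorm H (s n \<ominus>\<^bsub>H\<^esub> s m)"] by linarith
  qed
  moreover have "a n \<le> (hnorm H x)\<^sup>2" for n
    unfolding a_def s_def hnorm_synth[OF dJ coords_carrier(1)] by (intro power_mono bessel[OF dJ x]) simp
  ultimately obtain L where "a \<longlonglongrightarrow> L"
    using incseq_convergent[of a "(hnorm H x)\<^sup>2"] by blast
  then have "Cauchy a" by (rule LIMSEQ_imp_Cauchy)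
  have "\<exists>N. \<forall>n\<ge>N. hnorm H (s n \<ominus>\<^bsub>H\<^esub> s N) < \<epsilon>" if "0 < \<epsilon>" for \<epsilon>
  proof -
    have "0 < \<epsilon>\<^sup>2" using that by simp
    then obtain N where N: "\<And>m n. m \<ge> N \<Longrightarrow> n \<ge> N \<Longrightarrow> norm (a m - a n) < \<epsilon>\<^sup>2"
      using CauchyD[OF \<open>Cauchy a\<close> \<open>0 < \<epsilon>\<^sup>2\<close>] by blast
    have "hnorm H (s n \<ominus>\<^bsub>H\<^esub> s N) < \<epsilon>" if "n \<ge> N" for n
    proof (rule power2_less_imp_less)
      show "(hnorm H (s n \<ominus>\<^bsub>H\<^esub> s N))\<^sup>2 < \<epsilon>\<^sup>2"
        unfolding diff[OF that] using N[OF that order_refl] by simp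
    qed (use \<open>0 < \<epsilon>\<close> in simp)
    then show ?thesis by blast
  qed
  note s_cauchy = this
  have "range s \<subseteq> carrier H" using sc by blast
  from h_complete[OF this s_cauchy] obtain y where y: "tends s y" by blast
  have "ip H (e j) y = ip H (e j) x" if "j \<in> J" for j
  proof -
    obtain m where "j < d m" using J \<open>j \<in> J\<close> by auto
    then have "ip H (e j) (s n) = ip H (e j) x" if "m \<le> n" for n
      using monoD[OF d that] \<open>j \<in> J\<close> unfolding s_def by (simp add: coord_synth[OF dJ coords_carrier(1)])
    then have "(\<lambda>n. ip H (e j) (s n)) \<longlonglongrightarrow> ip H (e j) x"
      by (intro tendsto_eventually eventually_sequentiallyI)
    then show ?thesis using LIMSEQ_unique[OF tends_ip[OF y e_closed[OF that]]] by blast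
  qed
  then have "y = x" using coord_eqI[OF tendsD(2)[OF y] x] by blast
  then show ?thesis using y by (simp add: s_def)
qed

text \<open>The matrix acts on the span of the first \<open>n\<close> basis vectors, and the
  orthogonal complement is sent to zero.\<close>

definition mat_op :: "nat \<Rightarrow> complex mat \<Rightarrow> 'h \<Rightarrow> 'h" where
  "mat_op n Y x = synth (Y *\<^sub>v coords n x)"

context
  fixes n assumes n: "{..<n} \<subseteq> J"
begin

lemma mat_op_closed: "Y \<in> carrier_mat n n \<Longrightarrow> mat_op n Y x \<in> carrier H"
  unfolding mat_op_def by (intro synth_closed[OF n] mult_mat_vec_carrier) auto

lemma mat_op_nrm:
  assumes Y: "Y \<in> carrier_mat n n" and x: "x \<in> carrier H"
  shows "hnorm H (mat_op n Y x) \<le> op_norm Y * hnorm H x"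
proof -
  have "hnorm H (mat_op n Y x) = l2_norm (Y *\<^sub>v coords n x)"
    unfolding mat_op_def using Y by (intro hnorm_synth[OF n] mult_mat_vec_carrier) auto
  also have "\<dots> \<le> op_norm Y * l2_norm (coords n x)" using Y by (intro op_norm_apply) auto
  also have "\<dots> \<le> op_norm Y * hnorm H x" by (intro mult_left_mono bessel[OF n x]) simp
  finally show ?thesis .
qed

lemma mat_op_add:
  assumes "Y \<in> carrier_mat n n" "x \<in> carrier H" "y \<in> carrier H"
  shows "mat_op n Y (x \<oplus>\<^bsub>H\<^esub> y) = mat_op n Y x \<oplus>\<^bsub>H\<^esub> mat_op n Y y"
  unfolding mat_op_def coords_add[OF n assms(2,3)]
    mult_add_distrib_mat_vec[OF assms(1) coords_carrier(1) coords_carrier(1)]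
  using assms(1) by (intro synth_add[OF n] mult_mat_vec_carrier) auto

lemma mat_op_minus:
  assumes "Y \<in> carrier_mat n n" "x \<in> carrier H" "y \<in> carrier H"
  shows "mat_op n Y (x \<ominus>\<^bsub>H\<^esub> y) = mat_op n Y x \<ominus>\<^bsub>H\<^esub> mat_op n Y y"
proof -
  have "mat_op n Y x = mat_op n Y (x \<ominus>\<^bsub>H\<^esub> y) \<oplus>\<^bsub>H\<^esub> mat_op n Y y"
    using mat_op_add[OF assms(1) M.minus_closed[OF assms(2,3)] assms(3)] assms
    by (simp add: h_minus_add_cancel)
  then show ?thesis
    using mat_op_closed[OF assms(1)] by (simp add: M.minus_eq M.a_assoc M.r_neg)
qed

lemma mat_op_smult:
  assumes "Y \<in> carrier_mat n n" "x \<in> carrier H"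
  shows "mat_op n Y (c \<odot>\<^bsub>H\<^esub> x) = c \<odot>\<^bsub>H\<^esub> mat_op n Y x"
  unfolding mat_op_def coords_smult[OF n assms(2)] mult_mat_vec[OF assms(1) coords_carrier(1)]
  using assms(1) by (intro synth_smult[OF n] mult_mat_vec_carrier) auto

lemma mat_op_add_mat:
  assumes "Y \<in> carrier_mat n n" "Z \<in> carrier_mat n n"
  shows "mat_op n (Y + Z) x = mat_op n Y x \<oplus>\<^bsub>H\<^esub> mat_op n Z x"
  unfolding mat_op_def add_mult_distrib_mat_vec[OF assms coords_carrier(1)]
  using assms by (intro synth_add[OF n] mult_mat_vec_carrier) auto

lemma mat_op_smult_mat:
  assumes "Y \<in> carrier_mat n n"
  shows "mat_op n (c \<cdot>\<^sub>m Y) x = c \<odot>\<^bsub>H\<^esub> mat_op n Y x"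
  unfolding mat_op_def smult_mat_vec[OF assms coords_carrier(1)]
  using assms by (intro synth_smult[OF n] mult_mat_vec_carrier) auto

lemma mat_op_synth:
  assumes "v \<in> carrier_vec n"
  shows "mat_op n Y (synth v) = synth (Y *\<^sub>v v)"
  unfolding mat_op_def coords_synth[OF n assms] ..

lemma mat_op_mult:
  assumes "Y \<in> carrier_mat n n" "Z \<in> carrier_mat n n"
  shows "mat_op n (Y * Z) x = mat_op n Y (mat_op n Z x)"
  unfolding mat_op_def[of n Z] mat_op_def[of n "Y * Z"] assoc_mult_mat_vec[OF assms coords_carrier(1)]
  using assms by (subst mat_op_synth) (auto intro: mult_mat_vec_carrier)

lemma mat_op_one: "mat_op n (1\<^sub>m n) x = synth (coords n x)"
  by (simp add: mat_op_def)

lemma mat_op_adjoint: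
  assumes Y: "Y \<in> carrier_mat n n" and x: "x \<in> carrier H" and y: "y \<in> carrier H"
  shows "ip H (mat_op n (mat_adjoint Y) x) y = ip H x (mat_op n Y y)"
proof -
  have "mat_adjoint Y *\<^sub>v coords n x \<in> carrier_vec n" "Y *\<^sub>v coords n y \<in> carrier_vec n"
    using Y by (auto intro!: mult_mat_vec_carrier)
  then show ?thesis
    unfolding mat_op_def using x y by (simp add: ip_synth_left[OF n] ip_synth_right[OF n] cinner_adjoint[OF Y])
qed

end

end

section \<open>Representations of inductive limits\<close>

lemma operator_alg_simps:
  "carrier (operator_alg H) = bounded_operators H"
  "mult (operator_alg H) = compose (carrier H)"
  "one (operator_alg H) = (\<lambda>x\<in>carrier H. x)"
  "zero (operator_alg H) = (\<lambda>x\<in>carrier H. \<zero>\<^bsub>H\<^esub>)"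
  "add (operator_alg H) = (\<lambda>S T. \<lambda>x\<in>carrier H. S x \<oplus>\<^bsub>H\<^esub> T x)"
  "smult (operator_alg H) = (\<lambda>c T. \<lambda>x\<in>carrier H. c \<odot>\<^bsub>H\<^esub> T x)"
  "star (operator_alg H) = adjoint_op H"
  by (simp_all add: operator_alg_def)

context hilbert_space
begin

lemma bounded_operatorsI:
  assumes "T \<in> extensional (carrier H)"
    and "\<And>x. x \<in> carrier H \<Longrightarrow> T x \<in> carrier H"
    and "\<And>x y. x \<in> carrier H \<Longrightarrow> y \<in> carrier H \<Longrightarrow> T (x \<oplus>\<^bsub>H\<^esub> y) = T x \<oplus>\<^bsub>H\<^esub> T y"
    and "\<And>c x. x \<in> carrier H \<Longrightarrow> T (c \<odot>\<^bsub>H\<^esub> x) = c \<odot>\<^bsub>H\<^esub> T x"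
    and "\<And>x. x \<in> carrier H \<Longrightarrow> hnorm H (T x) \<le> C * hnorm H x"
  shows "T \<in> bounded_operators H"
proof -
  have "T \<in> LinearCombinations.module_hom class_ring H H"
    unfolding LinearCombinations.module_hom_def using assms(2-4) by simp
  moreover have "\<exists>C. \<forall>x\<in>carrier H. hnorm H (T x) \<le> C * hnorm H x"
    using assms(5) by (intro exI[of _ C] ballI)
  ultimately show ?thesis unfolding bounded_operators_def using assms(1) by simp
qed

lemma bounded_operatorsD:
  assumes "T \<in> bounded_operators H"
  shows "T \<in> extensional (carrier H)"
    and "x \<in> carrier H \<Longrightarrow> T x \<in> carrier H"
    and "x \<in> carrier H \<Longrightarrow> y \<in> carrier H \<Longrightarrow> T (x \<oplus>\<^bsub>H\<^esub> y) = T x \<oplus>\<^bsub>H\<^esub> T y"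
    and "x \<in> carrier H \<Longrightarrow> T (c \<odot>\<^bsub>H\<^esub> x) = c \<odot>\<^bsub>H\<^esub> T x"
    and "\<exists>C\<ge>0. \<forall>x\<in>carrier H. hnorm H (T x) \<le> C * hnorm H x"
proof -
  show "T \<in> extensional (carrier H)" "x \<in> carrier H \<Longrightarrow> T x \<in> carrier H"
    "x \<in> carrier H \<Longrightarrow> y \<in> carrier H \<Longrightarrow> T (x \<oplus>\<^bsub>H\<^esub> y) = T x \<oplus>\<^bsub>H\<^esub> T y"
    "x \<in> carrier H \<Longrightarrow> T (c \<odot>\<^bsub>H\<^esub> x) = c \<odot>\<^bsub>H\<^esub> T x"
    using assms unfolding bounded_operators_def LinearCombinations.module_hom_def by auto
  obtain C where C: "\<And>x. x \<in> carrier H \<Longrightarrow> hnorm H (T x) \<le> C * hnorm H x"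
    using assms unfolding bounded_operators_def by blast
  have "hnorm H (T x) \<le> max C 0 * hnorm H x" if "x \<in> carrier H" for x
    using C[OF that] mult_right_mono[of C "max C 0" "hnorm H x"] that by simp
  then show "\<exists>C\<ge>0. \<forall>x\<in>carrier H. hnorm H (T x) \<le> C * hnorm H x"
    by (intro exI[of _ "max C 0"]) auto
qed

text \<open>The description in \<open>adjoint_op\<close> is resolved by exhibiting an adjoint: the
  difference of two candidates at \<open>x\<close> has inner product zero with itself.\<close>

lemma adjoint_op_eqI:
  assumes S: "S \<in> bounded_operators H"
    and eq: "\<And>x y. x \<in> carrier H \<Longrightarrow> y \<in> carrier H \<Longrightarrow> ip H (S x) y = ip H x (T y)"
  shows "adjoint_op H T = S"
  unfolding adjoint_op_def
proof (rule the_equality)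
  show "S \<in> bounded_operators H \<and> (\<forall>x\<in>carrier H. \<forall>y\<in>carrier H. ip H (S x) y = ip H x (T y))"
    using S eq by blast
  fix R assume R: "R \<in> bounded_operators H \<and> (\<forall>x\<in>carrier H. \<forall>y\<in>carrier H. ip H (R x) y = ip H x (T y))"
  show "R = S"
  proof (rule extensionalityI[OF bounded_operatorsD(1) bounded_operatorsD(1)[OF S]])
    fix x assume x: "x \<in> carrier H"
    have c: "R x \<in> carrier H" "S x \<in> carrier H"
      using R S bounded_operatorsD(2) x by blast+
    have "ip H (R x \<ominus>\<^bsub>H\<^esub> S x) (R x \<ominus>\<^bsub>H\<^esub> S x) = 0"
      using R eq x c by (subst ip_minus_left) simp_all
    then have "hnorm H (R x \<ominus>\<^bsub>H\<^esub> S x) = 0" using c by (simp add: hnorm_def)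
    then show "R x = S x" using h_eq_iff_minus[OF c] by blast
  qed (use R in blast)
qed

lemma h_minus_zero: "x \<in> carrier H \<Longrightarrow> x \<ominus>\<^bsub>H\<^esub> \<zero>\<^bsub>H\<^esub> = x"
  using h_add_minus_cancel[of x "\<zero>\<^bsub>H\<^esub>"] by simp

lemma finsum_mem:
  assumes "finite F" "\<And>i. i \<in> F \<Longrightarrow> f i \<in> W" "W \<subseteq> carrier H" "\<zero>\<^bsub>H\<^esub> \<in> W"
    and "\<And>x y. x \<in> W \<Longrightarrow> y \<in> W \<Longrightarrow> x \<oplus>\<^bsub>H\<^esub> y \<in> W"
  shows "finsum H f F \<in> W"
  using assms(1,2)
proof (induction F rule: finite_induct)
  case (insert i F)
  then have "f \<in> F \<rightarrow> carrier H" "f i \<in> carrier H" using assms(3) by auto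
  with insert show ?case using assms(5) by (simp add: M.finsum_insert)
qed (simp add: assms(4))

end

text \<open>\<open>r n\<close> represents level \<open>n\<close> on the span of the first
  \<open>d n\<close> basis vectors. \<open>r_extend\<close> says that the image of an element at the
  next level maps this subspace to itself and acts there as before, so the representations fit
  together on the union. \<open>r_lift\<close> supplies preimages of matrix units of norm at most 1,
  from which irreducibility follows.\<close>

locale limit_rep = star_system A \<phi> + onb_space H e J
  for A :: "nat \<Rightarrow> 'a star_alg" and \<phi> and H :: "'h hilbert" and e and J +
  fixes d :: "nat \<Rightarrow> nat" and r :: "nat \<Rightarrow> 'a \<Rightarrow> complex mat"
  assumes d_mono: "mono d" and d_union: "J = (\<Union>n. {..<d n})"
    and r_hom: "\<And>n. r n \<in> contractive_hom (A n) (matrix_alg (d n))"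
    and r_lift: "\<And>n Y. Y \<in> carrier_mat (d n) (d n) \<Longrightarrow>
      \<exists>a\<in>carrier (A n). r n a = Y \<and> nrm (A n) a \<le> op_norm Y"
    and r_extend: "\<And>n a i j. a \<in> carrier (A n) \<Longrightarrow> i < d (Suc n) \<Longrightarrow> j < d n \<Longrightarrow>
      r (Suc n) (\<phi> n a) $$ (i, j) = (if i < d n then r n a $$ (i, j) else 0)"
begin

lemma dJ: "{..<d n} \<subseteq> J"
  using d_union by auto

lemma d_le: "m \<le> n \<Longrightarrow> d m \<le> d n"
  by (rule monoD[OF d_mono])

lemmas r_star_hom = star_homD(2-)[OF contractive_hom_hom[OF r_hom], unfolded matrix_alg_simps]
lemmas r_nrm = contractive_hom_nrm[OF r_hom, unfolded matrix_alg_simps]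
lemmas r_closed = r_star_hom(1)

abbreviation proj :: "nat \<Rightarrow> 'h \<Rightarrow> 'h" where
  "proj n \<xi> \<equiv> synth (coords (d n) \<xi>)"

lemma proj_closed: "proj n \<xi> \<in> carrier H"
  by (rule synth_closed[OF dJ coords_carrier(1)])

definition trunc :: "(nat \<Rightarrow> 'a) \<Rightarrow> nat \<Rightarrow> 'h \<Rightarrow> 'h" where
  "trunc x n \<xi> = mat_op (d n) (r n (x n)) \<xi>"

lemma r_connect_extend:
  assumes "m \<le> n" "a \<in> carrier (A m)" "i < d n" "j < d m"
  shows "r n (connect \<phi> m n a) $$ (i, j) = (if i < d m then r m a $$ (i, j) else 0)"
  using assms(1,3)
proof (induction n arbitrary: i rule: dec_induct)
  case (step n)
  have "r (Suc n) (connect \<phi> m (Suc n) a) $$ (i, j)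
      = (if i < d n then r n (connect \<phi> m n a) $$ (i, j) else 0)"
    using step r_extend[OF connect_closed[OF step(1) assms(2)], of i j] d_le[OF step(1)] assms(4)
    by simp
  then show ?case using step d_le[OF step(1)] by simp
qed (use d_le in simp)

text \<open>Iterated \<open>r_extend\<close>: on the range of \<open>proj m\<close> the later images
  of \<open>a\<close> act as \<open>a\<close> did at level \<open>m\<close>.\<close>

lemma mat_op_connect:
  assumes "m \<le> n" "a \<in> carrier (A m)" "\<xi> \<in> carrier H"
  shows "mat_op (d n) (r n (connect \<phi> m n a)) (proj m \<xi>) = mat_op (d m) (r m a) \<xi>"
proof -
  let ?R = "r n (connect \<phi> m n a)" and ?w = "coords (d m) \<xi>"
  have R: "?R \<in> carrier_mat (d n) (d n)" and R0: "r m a \<in> carrier_mat (d m) (d m)"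
    using r_closed connect_closed assms by blast+
  have dm: "d m \<le> d n" by (rule d_le[OF assms(1)])
  have Rv: "?R *\<^sub>v coords (d n) (proj m \<xi>) \<in> carrier_vec (d n)" "r m a *\<^sub>v ?w \<in> carrier_vec (d m)"
    using R R0 by (auto intro!: mult_mat_vec_carrier)
  show ?thesis
    unfolding mat_op_def
  proof (rule coord_eqI)
    fix j assume j: "j \<in> J"
    have "(?R *\<^sub>v coords (d n) (proj m \<xi>)) $ j = (if j < d m then (r m a *\<^sub>v ?w) $ j else 0)" if jn: "j < d n"
    proof -
      have "(?R *\<^sub>v coords (d n) (proj m \<xi>)) $ j
          = (\<Sum>i<d n. ?R $$ (j, i) * (if i < d m then ?w $ i else 0))"
        using R jn dJ[of n] by (auto simp: scalar_prod_def lessThan_atLeast0 subset_iff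
            coord_synth[OF dJ coords_carrier(1)] intro!: sum.cong)
      also have "\<dots> = (\<Sum>i<d m. ?R $$ (j, i) * ?w $ i)"
        using dm by (intro sum.mono_neutral_cong_right) auto
      also have "\<dots> = (\<Sum>i<d m. if j < d m then r m a $$ (j, i) * ?w $ i else 0)"
        by (intro sum.cong) (auto simp: r_connect_extend[OF assms(1,2) jn])
      also have "\<dots> = (if j < d m then (r m a *\<^sub>v ?w) $ j else 0)"
        using R0 by (auto simp: scalar_prod_def lessThan_atLeast0 intro!: sum.cong)
      finally show ?thesis .
    qed
    then show "ip H (e j) (synth (?R *\<^sub>v coords (d n) (proj m \<xi>))) = ip H (e j) (synth (r m a *\<^sub>v ?w))"
      using j dm by (auto simp: coord_synth[OF dJ Rv(1)] coord_synth[OF dJ Rv(2)])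
  qed (rule synth_closed[OF dJ Rv(1)] synth_closed[OF dJ Rv(2)])+
qed

lemma trunc_closed: "x \<in> carrier (bounded_prod A) \<Longrightarrow> trunc x n \<xi> \<in> carrier H"
  unfolding trunc_def by (rule mat_op_closed[OF dJ r_closed[OF bounded_prod_closed]])

lemma mat_op_r_nrm:
  assumes "a \<in> carrier (A n)" "\<xi> \<in> carrier H"
  shows "hnorm H (mat_op (d n) (r n a) \<xi>) \<le> nrm (A n) a * hnorm H \<xi>"
  using mat_op_nrm[OF dJ r_closed[OF assms(1)] assms(2)] mult_right_mono[OF r_nrm[OF assms(1)] hnorm_nonneg[OF assms(2)]]
  by linarith

text \<open>\<open>trunc x n\<close> differs from \<open>trunc x m\<close> by a part of size \<open>\<parallel>x\<^sub>n - \<phi>(x\<^sub>m)\<parallel>\<close> and, because the image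
  of \<open>x\<^sub>m\<close> acts on \<open>proj m \<xi>\<close> in the same way at every later level, by a part supported on \<open>\<xi> - proj m \<xi>\<close>.\<close>

lemma trunc_diff:
  assumes "m \<le> n" and x: "x \<in> carrier (bounded_prod A)" and \<xi>: "\<xi> \<in> carrier H"
  shows "hnorm H (trunc x n \<xi> \<ominus>\<^bsub>H\<^esub> trunc x m \<xi>)
    \<le> nrm (A n) (x n \<ominus>\<^bsub>A n\<^esub> connect \<phi> m n (x m)) * hnorm H \<xi> + nrm (A m) (x m) * hnorm H (\<xi> \<ominus>\<^bsub>H\<^esub> proj m \<xi>)"
proof -
  note cx = bounded_prod_closed[OF x]
  let ?y = "connect \<phi> m n (x m)"
  have y: "?y \<in> carrier (A n)" by (rule connect_closed[OF assms(1) cx])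
  have xy: "x n \<ominus>\<^bsub>A n\<^esub> ?y \<in> carrier (A n)" by (rule alg.minus_closed[OF cx y])
  have pc: "proj m \<xi> \<in> carrier H" by (rule proj_closed)
  have qc: "\<xi> \<ominus>\<^bsub>H\<^esub> proj m \<xi> \<in> carrier H" by (rule M.minus_closed[OF \<xi> pc])
  define a where "a = mat_op (d n) (r n (x n \<ominus>\<^bsub>A n\<^esub> ?y)) \<xi>"
  define b where "b = mat_op (d n) (r n ?y) (\<xi> \<ominus>\<^bsub>H\<^esub> proj m \<xi>)"
  have c: "a \<in> carrier H" "b \<in> carrier H" "trunc x m \<xi> \<in> carrier H"
    unfolding a_def b_def by (rule mat_op_closed[OF dJ r_closed] xy y trunc_closed[OF x])+
  have "trunc x n \<xi> = mat_op (d n) (r n ((x n \<ominus>\<^bsub>A n\<^esub> ?y) \<oplus>\<^bsub>A n\<^esub> ?y)) \<xi>"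
    unfolding trunc_def alg.minus_add_cancel[OF cx y] ..
  also have "\<dots> = a \<oplus>\<^bsub>H\<^esub> mat_op (d n) (r n ?y) \<xi>"
    unfolding a_def r_star_hom(3)[OF xy y] by (rule mat_op_add_mat[OF dJ r_closed[OF xy] r_closed[OF y]])
  also have "mat_op (d n) (r n ?y) \<xi> = b \<oplus>\<^bsub>H\<^esub> trunc x m \<xi>"
    using mat_op_add[OF dJ r_closed[OF y] qc pc] mat_op_connect[OF assms(1) cx \<xi>]
    unfolding h_minus_add_cancel[OF \<xi> pc] b_def trunc_def by simp
  finally have "trunc x n \<xi> \<ominus>\<^bsub>H\<^esub> trunc x m \<xi> = a \<oplus>\<^bsub>H\<^esub> b"
    using c h_add_minus_cancel[of "a \<oplus>\<^bsub>H\<^esub> b" "trunc x m \<xi>"] by (simp add: M.a_assoc)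
  moreover have "hnorm H a \<le> nrm (A n) (x n \<ominus>\<^bsub>A n\<^esub> ?y) * hnorm H \<xi>"
    unfolding a_def by (rule mat_op_r_nrm[OF xy \<xi>])
  moreover have "hnorm H b \<le> nrm (A m) (x m) * hnorm H (\<xi> \<ominus>\<^bsub>H\<^esub> proj m \<xi>)"
    unfolding b_def using mat_op_r_nrm[OF y qc] mult_right_mono[OF connect_nrm[OF assms(1) cx] hnorm_nonneg[OF qc]]
    by linarith
  ultimately show ?thesis using hnorm_triangle[OF c(1,2)] by simp
qed

lemma proj_tends: "\<xi> \<in> carrier H \<Longrightarrow> tends (\<lambda>n. proj n \<xi>) \<xi>"
  by (rule proj_tends[OF _ d_mono d_union])

lemma proj_near:
  assumes "\<xi> \<in> carrier H" "0 < \<epsilon>"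
  shows "\<exists>N. \<forall>n\<ge>N. hnorm H (\<xi> \<ominus>\<^bsub>H\<^esub> proj n \<xi>) < \<epsilon>"
  using order_tendstoD(2)[OF tendsD(3)[OF proj_tends[OF assms(1)]] assms(2)]
    hnorm_minus_commute[OF assms(1) proj_closed] by (simp add: eventually_sequentially)

text \<open>In \<open>trunc_diff\<close> the Cauchy property makes the first term small, and
  convergence of the projections the second. The second depends on \<xi>, so the truncations
  converge pointwise and in general not in norm.\<close>

lemma trunc_converges:
  assumes x: "x \<in> cauchy_seqs A \<phi>" and \<xi>: "\<xi> \<in> carrier H"
  shows "\<exists>\<eta>. tends (\<lambda>n. trunc x n \<xi>) \<eta>"
proof (rule h_complete)
  note xb = cauchy_bounded[OF x]
  show "range (\<lambda>n. trunc x n \<xi>) \<subseteq> carrier H" using trunc_closed[OF xb] by blast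
  fix \<epsilon> :: real assume "0 < \<epsilon>"
  obtain C where C: "0 \<le> C" "\<And>n. nrm (A n) (x n) \<le> C" using bounded_prodE[OF xb] by blast
  define \<delta> where "\<delta> = \<epsilon> / (hnorm H \<xi> + C + 1)"
  have pos: "0 < hnorm H \<xi> + C + 1" using C(1) hnorm_nonneg[OF \<xi>] by linarith
  then have "0 < \<delta>" using \<open>0 < \<epsilon>\<close> by (simp add: \<delta>_def)
  obtain K where K: "\<And>m n. K \<le> m \<Longrightarrow> m \<le> n \<Longrightarrow> nrm (A n) (x n \<ominus>\<^bsub>A n\<^esub> connect \<phi> m n (x m)) < \<delta>"
    using cauchyD[OF x \<open>0 < \<delta>\<close>] by blast
  obtain L where L: "\<And>n. L \<le> n \<Longrightarrow> hnorm H (\<xi> \<ominus>\<^bsub>H\<^esub> proj n \<xi>) < \<delta>"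
    using proj_near[OF \<xi> \<open>0 < \<delta>\<close>] by blast
  define N where "N = max K L"
  have "hnorm H (trunc x n \<xi> \<ominus>\<^bsub>H\<^esub> trunc x N \<xi>) < \<epsilon>" if "N \<le> n" for n
  proof -
    have "nrm (A n) (x n \<ominus>\<^bsub>A n\<^esub> connect \<phi> N n (x N)) * hnorm H \<xi> \<le> \<delta> * hnorm H \<xi>"
      using K[of N n] that \<xi> by (intro mult_right_mono) (simp_all add: N_def)
    moreover have "nrm (A N) (x N) * hnorm H (\<xi> \<ominus>\<^bsub>H\<^esub> proj N \<xi>) \<le> C * \<delta>"
      using L[of N] C \<xi> proj_closed by (intro mult_mono) (simp_all add: N_def)
    ultimately have "hnorm H (trunc x n \<xi> \<ominus>\<^bsub>H\<^esub> trunc x N \<xi>) \<le> \<delta> * hnorm H \<xi> + C * \<delta>"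
      using trunc_diff[OF that xb \<xi>] by linarith
    also have "\<dots> < \<delta> * (hnorm H \<xi> + C + 1)" using \<open>0 < \<delta>\<close> by (simp add: algebra_simps)
    also have "\<dots> = \<epsilon>" using pos by (simp add: \<delta>_def)
    finally show ?thesis .
  qed
  then show "\<exists>N. \<forall>n\<ge>N. hnorm H (trunc x n \<xi> \<ominus>\<^bsub>H\<^esub> trunc x N \<xi>) < \<epsilon>" by blast
qed

definition rep :: "(nat \<Rightarrow> 'a) \<Rightarrow> 'h \<Rightarrow> 'h" where
  "rep x = (\<lambda>\<xi>\<in>carrier H. THE \<eta>. tends (\<lambda>n. trunc x n \<xi>) \<eta>)"

lemma rep_tends:
  assumes "x \<in> cauchy_seqs A \<phi>" "\<xi> \<in> carrier H"
  shows "tends (\<lambda>n. trunc x n \<xi>) (rep x \<xi>)"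
proof -
  obtain \<eta> where "tends (\<lambda>n. trunc x n \<xi>) \<eta>" using trunc_converges[OF assms] by blast
  then show ?thesis
    unfolding rep_def using assms(2) tends_unique by (simp add: theI)
qed

lemma rep_eqI:
  assumes "x \<in> cauchy_seqs A \<phi>" "\<xi> \<in> carrier H" "tends (\<lambda>n. trunc x n \<xi>) \<eta>"
  shows "rep x \<xi> = \<eta>"
  by (rule tends_unique[OF rep_tends[OF assms(1,2)] assms(3)])

lemma rep_closed: "x \<in> cauchy_seqs A \<phi> \<Longrightarrow> \<xi> \<in> carrier H \<Longrightarrow> rep x \<xi> \<in> carrier H"
  by (rule tendsD(2)[OF rep_tends])

lemma trunc_nrm:
  assumes "x \<in> carrier (bounded_prod A)" "\<xi> \<in> carrier H" "\<And>n. nrm (A n) (x n) \<le> C"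
  shows "hnorm H (trunc x n \<xi>) \<le> C * hnorm H \<xi>"
  unfolding trunc_def using mat_op_r_nrm[OF bounded_prod_closed[OF assms(1)] assms(2)]
    mult_right_mono[OF assms(3) hnorm_nonneg[OF assms(2)]] by (rule order_trans)

lemma rep_nrm:
  assumes "x \<in> cauchy_seqs A \<phi>" "\<xi> \<in> carrier H" "\<And>n. nrm (A n) (x n) \<le> C"
  shows "hnorm H (rep x \<xi>) \<le> C * hnorm H \<xi>"
  using LIMSEQ_le_const2[OF tends_hnorm[OF rep_tends[OF assms(1,2)]]]
    trunc_nrm[OF cauchy_bounded[OF assms(1)] assms(2,3)] by blast

lemma rep_bounded:
  assumes x: "x \<in> cauchy_seqs A \<phi>"
  shows "rep x \<in> bounded_operators H"
proof -
  note rx = r_closed[OF cauchy_closed[OF x]]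
  obtain C where C: "\<And>n. nrm (A n) (x n) \<le> C" using bounded_prodE[OF cauchy_bounded[OF x]] by blast
  show ?thesis
  proof (rule bounded_operatorsI)
    show "rep x \<in> extensional (carrier H)" unfolding rep_def by (rule restrict_extensional)
    fix \<xi> assume \<xi>: "\<xi> \<in> carrier H"
    show "rep x \<xi> \<in> carrier H" by (rule rep_closed[OF x \<xi>])
    show "hnorm H (rep x \<xi>) \<le> C * hnorm H \<xi>" by (rule rep_nrm[OF x \<xi> C])
    show "rep x (c \<odot>\<^bsub>H\<^esub> \<xi>) = c \<odot>\<^bsub>H\<^esub> rep x \<xi>" for c
      using tends_smult[OF rep_tends[OF x \<xi>], of c]
      by (intro rep_eqI[OF x sm_closed[OF \<xi>]]) (simp add: trunc_def mat_op_smult[OF dJ rx \<xi>])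
    fix \<eta> assume \<eta>: "\<eta> \<in> carrier H"
    show "rep x (\<xi> \<oplus>\<^bsub>H\<^esub> \<eta>) = rep x \<xi> \<oplus>\<^bsub>H\<^esub> rep x \<eta>"
      using tends_add[OF rep_tends[OF x \<xi>] rep_tends[OF x \<eta>]]
      by (intro rep_eqI[OF x M.a_closed[OF \<xi> \<eta>]]) (simp add: trunc_def mat_op_add[OF dJ rx \<xi> \<eta>])
  qed
qed

lemma rep_extI:
  assumes "x \<in> cauchy_seqs A \<phi>" "T \<in> extensional (carrier H)"
    and "\<And>\<xi>. \<xi> \<in> carrier H \<Longrightarrow> tends (\<lambda>n. trunc x n \<xi>) (T \<xi>)"
  shows "rep x = T"
proof (rule extensionalityI[OF _ assms(2)])
  show "rep x \<in> extensional (carrier H)" unfolding rep_def by (rule restrict_extensional)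
qed (rule rep_eqI[OF assms(1) _ assms(3)])

lemma rep_hom: "rep \<in> star_hom (cauchy_alg A \<phi>) (operator_alg H)"
proof (rule star_homI, unfold cauchy_alg_simps operator_alg_simps)
  show "rep \<one>\<^bsub>bounded_prod A\<^esub> = (\<lambda>x\<in>carrier H. x)"
  proof (rule rep_extI[OF cauchy_one restrict_extensional])
    fix \<xi> assume "\<xi> \<in> carrier H"
    then show "tends (\<lambda>n. trunc \<one>\<^bsub>bounded_prod A\<^esub> n \<xi>) ((\<lambda>x\<in>carrier H. x) \<xi>)"
      using proj_tends by (simp add: trunc_def bounded_prod_simps r_star_hom(4) mat_op_one[OF dJ])
  qed
  fix x assume x: "x \<in> cauchy_seqs A \<phi>"
  note cx = cauchy_closed[OF x]
  note rx = r_closed[OF cx]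
  show "rep x \<in> bounded_operators H" by (rule rep_bounded[OF x])
  show "rep (c \<odot>\<^bsub>bounded_prod A\<^esub> x) = (\<lambda>\<xi>\<in>carrier H. c \<odot>\<^bsub>H\<^esub> rep x \<xi>)" for c
  proof (rule rep_extI[OF cauchy_smult[OF x] restrict_extensional])
    fix \<xi> assume \<xi>: "\<xi> \<in> carrier H"
    show "tends (\<lambda>n. trunc (c \<odot>\<^bsub>bounded_prod A\<^esub> x) n \<xi>) ((\<lambda>\<xi>\<in>carrier H. c \<odot>\<^bsub>H\<^esub> rep x \<xi>) \<xi>)"
      using tends_smult[OF rep_tends[OF x \<xi>], of c] \<xi>
      by (simp add: trunc_def bounded_prod_simps r_star_hom(5)[OF cx] mat_op_smult_mat[OF dJ rx])
  qed
  show "rep (star (bounded_prod A) x) = adjoint_op H (rep x)"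
  proof (rule adjoint_op_eqI[symmetric, OF rep_bounded[OF cauchy_star[OF x]]])
    fix \<xi> \<eta> assume \<xi>: "\<xi> \<in> carrier H" and \<eta>: "\<eta> \<in> carrier H"
    have "(\<lambda>n. ip H (trunc (star (bounded_prod A) x) n \<xi>) \<eta>) \<longlonglongrightarrow> ip H (rep (star (bounded_prod A) x) \<xi>) \<eta>"
      by (rule tends_ip_left[OF rep_tends[OF cauchy_star[OF x] \<xi>] \<eta>])
    moreover have "ip H (trunc (star (bounded_prod A) x) n \<xi>) \<eta> = ip H \<xi> (trunc x n \<eta>)" for n
      unfolding trunc_def bounded_prod_simps r_star_hom(6)[OF cx] by (rule mat_op_adjoint[OF dJ rx \<xi> \<eta>])
    ultimately show "ip H (rep (star (bounded_prod A) x) \<xi>) \<eta> = ip H \<xi> (rep x \<eta>)"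
      using LIMSEQ_unique tends_ip[OF rep_tends[OF x \<eta>] \<xi>] by simp
  qed
  fix y assume y: "y \<in> cauchy_seqs A \<phi>"
  note cy = cauchy_closed[OF y]
  note ry = r_closed[OF cy]
  show "rep (x \<oplus>\<^bsub>bounded_prod A\<^esub> y) = (\<lambda>\<xi>\<in>carrier H. rep x \<xi> \<oplus>\<^bsub>H\<^esub> rep y \<xi>)"
  proof (rule rep_extI[OF cauchy_add[OF x y] restrict_extensional])
    fix \<xi> assume \<xi>: "\<xi> \<in> carrier H"
    show "tends (\<lambda>n. trunc (x \<oplus>\<^bsub>bounded_prod A\<^esub> y) n \<xi>) ((\<lambda>\<xi>\<in>carrier H. rep x \<xi> \<oplus>\<^bsub>H\<^esub> rep y \<xi>) \<xi>)"
      using tends_add[OF rep_tends[OF x \<xi>] rep_tends[OF y \<xi>]] \<xi>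
      by (simp add: trunc_def bounded_prod_simps r_star_hom(3)[OF cx cy] mat_op_add_mat[OF dJ rx ry])
  qed
  show "rep (x \<otimes>\<^bsub>bounded_prod A\<^esub> y) = compose (carrier H) (rep x) (rep y)"
  proof (rule rep_extI[OF cauchy_mult[OF x y]])
    show "compose (carrier H) (rep x) (rep y) \<in> extensional (carrier H)" by (rule compose_extensional)
    fix \<xi> assume \<xi>: "\<xi> \<in> carrier H"
    let ?\<eta> = "rep y \<xi>"
    have \<eta>: "?\<eta> \<in> carrier H" by (rule rep_closed[OF y \<xi>])
    obtain C where C: "\<And>n. nrm (A n) (x n) \<le> C" using bounded_prodE[OF cauchy_bounded[OF x]] by blast
    note tx = trunc_closed[OF cauchy_bounded[OF x]] and ty = trunc_closed[OF cauchy_bounded[OF y]]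
    \<comment> \<open>Products of pointwise convergent sequences of operators converge because the
      bound \<open>C\<close> on \<open>x\<close> controls the truncations uniformly.\<close>
    have "tends (\<lambda>n. trunc x n (trunc y n \<xi>)) (rep x ?\<eta>)"
    proof (rule tendsI)
      show "range (\<lambda>n. trunc x n (trunc y n \<xi>)) \<subseteq> carrier H" using tx by blast
      show "rep x ?\<eta> \<in> carrier H" by (rule rep_closed[OF x \<eta>])
      show "(\<lambda>n. C * hnorm H (trunc y n \<xi> \<ominus>\<^bsub>H\<^esub> ?\<eta>) + hnorm H (trunc x n ?\<eta> \<ominus>\<^bsub>H\<^esub> rep x ?\<eta>)) \<longlonglongrightarrow> 0"
        by (intro tendsto_add_zero tendsto_mult_right_zero tendsD(3) rep_tends x y \<xi> \<eta>)
      fix n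
      have "trunc x n (trunc y n \<xi>) \<ominus>\<^bsub>H\<^esub> trunc x n ?\<eta> = trunc x n (trunc y n \<xi> \<ominus>\<^bsub>H\<^esub> ?\<eta>)"
        unfolding trunc_def[of x] by (rule mat_op_minus[symmetric, OF dJ rx ty \<eta>])
      then show "hnorm H (trunc x n (trunc y n \<xi>) \<ominus>\<^bsub>H\<^esub> rep x ?\<eta>)
          \<le> C * hnorm H (trunc y n \<xi> \<ominus>\<^bsub>H\<^esub> ?\<eta>) + hnorm H (trunc x n ?\<eta> \<ominus>\<^bsub>H\<^esub> rep x ?\<eta>)"
        using hnorm_triangle_minus[OF tx tx rep_closed[OF x \<eta>], of n "trunc y n \<xi>" n ?\<eta>]
          trunc_nrm[OF cauchy_bounded[OF x] M.minus_closed[OF ty \<eta>] C, of n n \<xi>] by simp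
    qed
    then show "tends (\<lambda>n. trunc (x \<otimes>\<^bsub>bounded_prod A\<^esub> y) n \<xi>) (compose (carrier H) (rep x) (rep y) \<xi>)"
      using \<xi> by (simp add: trunc_def bounded_prod_simps r_star_hom(2)[OF cx cy] mat_op_mult[OF dJ rx ry]
          compose_eq)
  qed
qed

text \<open>For a vector in the range of \<open>proj m\<close> the projection term of
  \<open>trunc_diff\<close> vanishes. Letting \<open>n\<close> tend to infinity bounds
  \<open>r m (x m)\<close> on it by the Cauchy error alone, so if \<open>rep x\<close> is zero the
  norms tend to zero.\<close>

lemma rep_eq_zero_iff:
  assumes x: "x \<in> cauchy_seqs A \<phi>"
  shows "rep x = \<zero>\<^bsub>operator_alg H\<^esub> \<longleftrightarrow> (\<lambda>n. op_norm (r n (x n))) \<longlonglongrightarrow> 0"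
proof
  note cx = cauchy_closed[OF x] and xb = cauchy_bounded[OF x]
  assume 0: "rep x = \<zero>\<^bsub>operator_alg H\<^esub>"
  show "(\<lambda>n. op_norm (r n (x n))) \<longlonglongrightarrow> 0"
  proof (rule LIMSEQ_I)
    fix \<epsilon> :: real assume "0 < \<epsilon>"
    then have "0 < \<epsilon> / 2" by simp
    obtain N where N: "\<And>m n. N \<le> m \<Longrightarrow> m \<le> n \<Longrightarrow> nrm (A n) (x n \<ominus>\<^bsub>A n\<^esub> connect \<phi> m n (x m)) < \<epsilon> / 2"
      using cauchyD[OF x \<open>0 < \<epsilon> / 2\<close>] by blast
    have "op_norm (r m (x m)) \<le> \<epsilon> / 2" if "N \<le> m" for m
    proof (rule op_norm_leI)
      fix v :: "complex Matrix.vec" assume "v \<in> carrier_vec (dim_col (r m (x m)))"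
      then have v: "v \<in> carrier_vec (d m)" using r_closed[OF cx, of m] by simp
      let ?\<xi> = "synth v"
      have \<xi>: "?\<xi> \<in> carrier H" by (rule synth_closed[OF dJ v])
      have proj: "?\<xi> \<ominus>\<^bsub>H\<^esub> proj m ?\<xi> = \<zero>\<^bsub>H\<^esub>"
        unfolding coords_synth[OF dJ v] by (rule h_minus_self[OF \<xi>])
      have "hnorm H (trunc x m ?\<xi>) \<le> \<epsilon> / 2 * hnorm H ?\<xi> + hnorm H (trunc x n ?\<xi>)" if "m \<le> n" for n
      proof -
        have "hnorm H (trunc x n ?\<xi> \<ominus>\<^bsub>H\<^esub> trunc x m ?\<xi>) \<le> \<epsilon> / 2 * hnorm H ?\<xi>"
          using trunc_diff[OF that xb \<xi>] mult_right_mono[OF less_imp_le[OF N[OF \<open>N \<le> m\<close> that]] hnorm_nonneg[OF \<xi>]]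
          unfolding proj by simp
        then show ?thesis
          using hnorm_le_minus[OF trunc_closed[OF xb, of m ?\<xi>] trunc_closed[OF xb, of n ?\<xi>]]
            hnorm_minus_commute[OF trunc_closed[OF xb, of m ?\<xi>] trunc_closed[OF xb, of n ?\<xi>]] by linarith
      qed
      moreover have "(\<lambda>n. \<epsilon> / 2 * hnorm H ?\<xi> + hnorm H (trunc x n ?\<xi>)) \<longlonglongrightarrow> \<epsilon> / 2 * hnorm H ?\<xi> + 0"
        using tends_hnorm[OF rep_tends[OF x \<xi>]] \<xi> unfolding 0 operator_alg_simps
        by (intro tendsto_intros) simp
      ultimately have "hnorm H (trunc x m ?\<xi>) \<le> \<epsilon> / 2 * hnorm H ?\<xi> + 0"
        by (intro LIMSEQ_le_const) blast+
      moreover have "r m (x m) *\<^sub>v v \<in> carrier_vec (d m)"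
        using r_closed[OF cx, of m] v by (intro mult_mat_vec_carrier)
      ultimately show "l2_norm (r m (x m) *\<^sub>v v) \<le> \<epsilon> / 2 * l2_norm v"
        unfolding trunc_def mat_op_synth[OF dJ v] by (simp add: hnorm_synth[OF dJ] hnorm_synth[OF dJ v])
    qed (use \<open>0 < \<epsilon>\<close> in simp)
    then have "norm (op_norm (r m (x m)) - 0) < \<epsilon>" if "N \<le> m" for m
      using that \<open>0 < \<epsilon>\<close> by (smt (verit) field_sum_of_halves op_norm_nonneg real_norm_def)
    then show "\<exists>N. \<forall>m\<ge>N. norm (op_norm (r m (x m)) - 0) < \<epsilon>" by blast
  qed
next
  note cx = cauchy_closed[OF x] and xb = cauchy_bounded[OF x]
  assume lim: "(\<lambda>n. op_norm (r n (x n))) \<longlonglongrightarrow> 0"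
  show "rep x = \<zero>\<^bsub>operator_alg H\<^esub>"
    unfolding operator_alg_simps
  proof (rule rep_extI[OF x restrict_extensional])
    fix \<xi> assume \<xi>: "\<xi> \<in> carrier H"
    have "tends (\<lambda>n. trunc x n \<xi>) \<zero>\<^bsub>H\<^esub>"
    proof (rule tendsI[OF _ M.zero_closed _ tendsto_mult_left_zero[OF lim, of "hnorm H \<xi>"]])
      show "hnorm H (trunc x n \<xi> \<ominus>\<^bsub>H\<^esub> \<zero>\<^bsub>H\<^esub>) \<le> op_norm (r n (x n)) * hnorm H \<xi>" for n
        using mat_op_nrm[OF dJ r_closed[OF cx[of n]] \<xi>]
        unfolding trunc_def h_minus_zero[OF mat_op_closed[OF dJ r_closed[OF cx]]] .
    qed (use trunc_closed[OF xb] in blast)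
    then show "tends (\<lambda>n. trunc x n \<xi>) ((\<lambda>x\<in>carrier H. \<zero>\<^bsub>H\<^esub>) \<xi>)" using \<xi> by simp
  qed
qed

text \<open>For a thread the Cauchy error is zero, and only the part of \<xi> outside the range of
  \<open>proj n\<close> contributes. This controls the action of a lift beyond the block in which it
  is prescribed.\<close>

lemma thread_rep_near:
  assumes a: "a \<in> carrier (A n)" and \<xi>: "\<xi> \<in> carrier H"
  shows "hnorm H (rep (thread n a) \<xi> \<ominus>\<^bsub>H\<^esub> mat_op (d n) (r n a) \<xi>) \<le> nrm (A n) a * hnorm H (\<xi> \<ominus>\<^bsub>H\<^esub> proj n \<xi>)"
proof -
  let ?x = "thread n a"
  have x: "?x \<in> cauchy_seqs A \<phi>" by (rule thread_cauchy[OF a])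
  note xb = cauchy_bounded[OF x]
  have t: "trunc ?x n \<xi> = mat_op (d n) (r n a) \<xi>" by (simp add: trunc_def thread_def)
  have bound: "hnorm H (trunc ?x m \<xi> \<ominus>\<^bsub>H\<^esub> trunc ?x n \<xi>) \<le> nrm (A n) a * hnorm H (\<xi> \<ominus>\<^bsub>H\<^esub> proj n \<xi>)" if "n \<le> m" for m
    using trunc_diff[OF that xb \<xi>] that
    by (simp add: thread_def alg.minus_self[OF connect_closed[OF that a]] alg.nrm_zero)
  have "tends (\<lambda>m. trunc ?x m \<xi> \<ominus>\<^bsub>H\<^esub> trunc ?x n \<xi>) (rep ?x \<xi> \<ominus>\<^bsub>H\<^esub> trunc ?x n \<xi>)"
    using tends_add[OF rep_tends[OF x \<xi>] tends_const[OF M.a_inv_closed[OF trunc_closed[OF xb, of n \<xi>]]]]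
    by (simp add: M.minus_eq)
  from LIMSEQ_le_const2[OF tends_hnorm[OF this]] bound
  show ?thesis unfolding t by blast
qed

text \<open>Sequences with null difference have truncations with null difference at every vector, so
  \<open>rep\<close> descends to the limit.\<close>

theorem limit_rep:
  "\<exists>\<pi>\<in>star_hom (cstar_limit A \<phi>) (operator_alg H). \<forall>x\<in>cauchy_seqs A \<phi>. \<pi> (limit_class A x) = rep x"
proof -
  have "rep x = rep y" if x: "x \<in> cauchy_seqs A \<phi>" and y: "y \<in> cauchy_seqs A \<phi>"
    and 0: "(\<lambda>n. nrm (A n) (x n \<ominus>\<^bsub>A n\<^esub> y n)) \<longlonglongrightarrow> 0" for x y
  proof (rule rep_extI[OF x bounded_operatorsD(1)[OF rep_bounded[OF y]]])
    note cx = cauchy_closed[OF x] and cy = cauchy_closed[OF y]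
    fix \<xi> assume \<xi>: "\<xi> \<in> carrier H"
    have dc: "x n \<ominus>\<^bsub>A n\<^esub> y n \<in> carrier (A n)" for n by (rule alg.minus_closed[OF cx cy])
    define z where "z n = mat_op (d n) (r n (x n \<ominus>\<^bsub>A n\<^esub> y n)) \<xi>" for n
    have zc: "z n \<in> carrier H" for n unfolding z_def by (rule mat_op_closed[OF dJ r_closed[OF dc]])
    have "tends z \<zero>\<^bsub>H\<^esub>"
    proof (rule tendsI[OF _ M.zero_closed _ tendsto_mult_left_zero[OF 0, of "hnorm H \<xi>"]])
      show "hnorm H (z n \<ominus>\<^bsub>H\<^esub> \<zero>\<^bsub>H\<^esub>) \<le> nrm (A n) (x n \<ominus>\<^bsub>A n\<^esub> y n) * hnorm H \<xi>" for n
        using mat_op_r_nrm[OF dc[of n] \<xi>] unfolding z_def h_minus_zero[OF mat_op_closed[OF dJ r_closed[OF dc]]] .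
    qed (use zc in blast)
    moreover have "trunc x n \<xi> = z n \<oplus>\<^bsub>H\<^esub> trunc y n \<xi>" for n
      unfolding trunc_def z_def mat_op_add_mat[symmetric, OF dJ r_closed[OF dc] r_closed[OF cy]]
        r_star_hom(3)[symmetric, OF dc cy] alg.minus_add_cancel[OF cx cy] ..
    ultimately show "tends (\<lambda>n. trunc x n \<xi>) (rep y \<xi>)"
      using tends_add[OF _ rep_tends[OF y \<xi>], of z "\<zero>\<^bsub>H\<^esub>"] rep_closed[OF y \<xi>] by simp
  qed
  note rep_eq = this
  show ?thesis
  proof (rule limit_lift[OF rep_hom rep_eq])
    fix \<pi> assume \<pi>: "\<pi> \<in> star_hom (cstar_limit A \<phi>) (operator_alg H)"
      and rep: "\<And>x. x \<in> cauchy_seqs A \<phi> \<Longrightarrow> \<pi> (limit_class A x) = rep x"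
    show ?thesis by (rule bexI[OF _ \<pi>]) (rule ballI[OF rep])
  qed
qed

text \<open>Let \<open>w\<close> be a nonzero vector of a closed invariant subspace, with nonzero
  coordinate at \<open>j\<close>. Lifts of the matrix units that send \<open>e j\<close> to
  \<open>e i\<close> map \<open>w\<close> close to a nonzero multiple of \<open>e i\<close>, so the
  subspace contains every \<open>e i\<close> and, being closed, the limits of all
  projections.\<close>

lemma rep_irreducible:
  assumes J: "J \<noteq> {}" and \<pi>: "\<pi> \<in> star_hom (cstar_limit A \<phi>) (operator_alg H)"
    and \<pi>_rep: "\<And>x. x \<in> cauchy_seqs A \<phi> \<Longrightarrow> \<pi> (limit_class A x) = rep x"
  shows "irreducible_rep (cstar_limit A \<phi>) H \<pi>"
  unfolding irreducible_rep_def
proof (intro conjI allI impI)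
  show "hilbert_space H" by (rule hilbert_space_axioms)
  obtain j where "j \<in> J" using J by blast
  then have "e j \<in> carrier H" "e j \<noteq> \<zero>\<^bsub>H\<^esub>"
    using e_ortho[of j j] e_closed by force+
  then show "carrier H \<noteq> {\<zero>\<^bsub>H\<^esub>}" by blast
  show "\<pi> \<in> star_hom (cstar_limit A \<phi>) (operator_alg H)" by (rule \<pi>)
  fix W assume W: "VectorSpace.subspace class_ring W H \<and> closedin (htopology H) W \<and>
      (\<forall>a\<in>carrier (cstar_limit A \<phi>). \<forall>w\<in>W. \<pi> a w \<in> W)"
  note sub = VectorSpace.subspace.submod[OF conjunct1[OF W]]
  have W_sub: "W \<subseteq> carrier H" and W_zero: "\<zero>\<^bsub>H\<^esub> \<in> W"
    and W_add: "\<And>x y. x \<in> W \<Longrightarrow> y \<in> W \<Longrightarrow> x \<oplus>\<^bsub>H\<^esub> y \<in> W"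
    and W_smult: "\<And>c x. x \<in> W \<Longrightarrow> c \<odot>\<^bsub>H\<^esub> x \<in> W"
    using LinearCombinations.submodule.subset[OF sub] LinearCombinations.submodule.zero_closed[OF sub]
      LinearCombinations.submodule.m_closed[OF sub] LinearCombinations.submodule.smult_closed[OF sub] by simp_all
  have W_rep: "rep x w \<in> W" if "x \<in> cauchy_seqs A \<phi>" "w \<in> W" for x w
    using W that \<pi>_rep unfolding limit_carrier by (metis imageI)
  show "W = {\<zero>\<^bsub>H\<^esub>} \<or> W = carrier H"
  proof (cases "W = {\<zero>\<^bsub>H\<^esub>}")
    case False
    then obtain w where w: "w \<in> W" "w \<noteq> \<zero>\<^bsub>H\<^esub>" using W_zero by blast
    have wc: "w \<in> carrier H" using w(1) W_sub by blast
    obtain j where j: "j \<in> J" "ip H (e j) w \<noteq> 0" using total[OF wc] w(2) by blast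
    have eW: "e i \<in> W" if i: "i \<in> J" for i
    proof -
      define c where "c = ip H (e j) w"
      obtain k l where kl: "i < d k" "j < d l" using i j(1) d_union by auto
      define N where "N = max k l"
      have ij: "i < d n" "j < d n" if "N \<le> n" for n
        using kl d_le[of k n] d_le[of l n] that by (auto simp: N_def)
      define E where "E n = mat (d n) (d n) (\<lambda>(p, q). of_bool (p = i \<and> q = j) :: complex)" for n
      have E: "E n \<in> carrier_mat (d n) (d n)" for n by (simp add: E_def)
      have E_vec: "E n *\<^sub>v v = v $ j \<cdot>\<^sub>v unit_vec (d n) i" if "v \<in> carrier_vec (d n)" "N \<le> n" for n v
      proof (rule eq_vecI)
        fix p assume p: "p < dim_vec (v $ j \<cdot>\<^sub>v unit_vec (d n) i)"
        have "(E n *\<^sub>v v) $ p = (\<Sum>q<d n. if q = j then of_bool (p = i) * v $ q else 0)"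
          using p that by (auto simp: E_def scalar_prod_def lessThan_atLeast0 intro!: sum.cong)
        also have "\<dots> = of_bool (p = i) * v $ j" using ij[OF that(2)] by simp
        finally show "(E n *\<^sub>v v) $ p = (v $ j \<cdot>\<^sub>v unit_vec (d n) i) $ p"
          using p ij[OF that(2)] by auto
      qed (simp add: E_def)
      have E_norm: "op_norm (E n) \<le> 1" if "N \<le> n" for n
      proof (rule op_norm_leI)
        fix v :: "complex Matrix.vec" assume "v \<in> carrier_vec (dim_col (E n))"
        then have v: "v \<in> carrier_vec (d n)" by (simp add: E_def)
        show "l2_norm (E n *\<^sub>v v) \<le> 1 * l2_norm v"
          unfolding E_vec[OF v that] l2_norm_smult using l2_norm_entry[of j v] v ij[OF that]
          by (simp add: l2_norm_unit)
      qed simp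
      have mat_E: "mat_op (d n) (E n) w = c \<odot>\<^bsub>H\<^esub> e i" if "N \<le> n" for n
      proof -
        have u: "unit_vec (d n) i \<in> carrier_vec (d n)" by simp
        have "synth (unit_vec (d n) i) = e i"
        proof (rule coord_eqI[OF synth_closed[OF dJ u] e_closed[OF i]])
          fix p assume "p \<in> J"
          then show "ip H (e p) (synth (unit_vec (d n) i)) = ip H (e p) (e i)"
            using ij[OF that] i by (auto simp: coord_synth[OF dJ u] e_ortho)
        qed
        then show ?thesis
          unfolding mat_op_def E_vec[OF coords_carrier(1) that] synth_smult[OF dJ u]
          using ij[OF that] by (simp add: c_def)
      qed
      have "\<forall>n. \<exists>a\<in>carrier (A n). r n a = E n \<and> nrm (A n) a \<le> op_norm (E n)"
        using r_lift E by blast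
      then obtain a where a: "\<And>n. a n \<in> carrier (A n)" "\<And>n. r n (a n) = E n"
        "\<And>n. nrm (A n) (a n) \<le> op_norm (E n)" by metis
      \<comment> \<open>The lift of \<open>E n\<close> acts on the complement of the first
        \<open>d n\<close> vectors in an unknown way; as its norm is at most 1, the error is bounded
        by the distance of \<open>w\<close> from its projection, which tends to 0. Starting at
        \<open>N\<close> ensures that \<open>i\<close> and \<open>j\<close> lie inside the
        block.\<close>
      define s where "s n = rep (thread (n + N) (a (n + N))) w" for n
      have sW: "s n \<in> W" for n
        unfolding s_def by (rule W_rep[OF thread_cauchy[OF a(1)] w(1)])
      have "tends s (c \<odot>\<^bsub>H\<^esub> e i)"
      proof (rule tendsI)
        show "range s \<subseteq> carrier H" using sW W_sub by blast
        show "c \<odot>\<^bsub>H\<^esub> e i \<in> carrier H" by (rule sm_closed[OF e_closed[OF i]])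
        show "(\<lambda>n. hnorm H (proj (n + N) w \<ominus>\<^bsub>H\<^esub> w)) \<longlonglongrightarrow> 0"
          by (rule LIMSEQ_ignore_initial_segment[OF tendsD(3)[OF proj_tends[OF wc]]])
        fix n
        have "nrm (A (n + N)) (a (n + N)) \<le> 1"
          using a(3)[of "n + N"] E_norm[of "n + N"] by simp
        then have "nrm (A (n + N)) (a (n + N)) * hnorm H (w \<ominus>\<^bsub>H\<^esub> proj (n + N) w) \<le> 1 * hnorm H (w \<ominus>\<^bsub>H\<^esub> proj (n + N) w)"
          by (intro mult_right_mono hnorm_nonneg M.minus_closed wc proj_closed)
        then show "hnorm H (s n \<ominus>\<^bsub>H\<^esub> c \<odot>\<^bsub>H\<^esub> e i) \<le> hnorm H (proj (n + N) w \<ominus>\<^bsub>H\<^esub> w)"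
          using thread_rep_near[OF a(1) wc, of "n + N"] mat_E[of "n + N"]
            hnorm_minus_commute[OF proj_closed wc, of "n + N"] unfolding s_def a(2) by simp
      qed
      then have "c \<odot>\<^bsub>H\<^esub> e i \<in> W" using closedin_tends W sW by blast
      then have "(1 / c) \<odot>\<^bsub>H\<^esub> (c \<odot>\<^bsub>H\<^esub> e i) \<in> W" by (rule W_smult)
      then show ?thesis
        using j(2) smult_assoc1[of "1 / c" c "e i"] smult_one[OF e_closed[OF i]] e_closed[OF i]
        by (simp add: c_def)
    qed
    have "x \<in> W" if x: "x \<in> carrier H" for x
    proof (rule closedin_tends[OF _ proj_tends[OF x]])
      show "closedin (htopology H) W" using W by blast
      show "proj n x \<in> W" for n
        unfolding synth_def using dJ[of n] eW
        by (intro finsum_mem[OF _ _ W_sub W_zero W_add]) (auto intro!: W_smult)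
    qed
    then show ?thesis using W_sub by blast
  qed simp
qed

end

section \<open>Sequence spaces and separable Hilbert spaces\<close>

text \<open>All sequences are indexed by the natural numbers and vanish outside \<open>J\<close>, so
  finite and infinite dimension share one construction.\<close>

definition ell2 :: "nat set \<Rightarrow> (nat \<Rightarrow> complex) set" where
  "ell2 J = {c. (\<forall>i. i \<notin> J \<longrightarrow> c i = 0) \<and> summable (\<lambda>i. (cmod (c i))\<^sup>2)}"

lemma ell2_add:
  assumes "c \<in> ell2 J" "d \<in> ell2 J" shows "(\<lambda>i. c i + d i) \<in> ell2 J"
proof -
  have le: "(cmod (a + b))\<^sup>2 \<le> 2 * (cmod a)\<^sup>2 + 2 * (cmod b)\<^sup>2" for a b :: complex
  proof -
    have "(cmod (a + b))\<^sup>2 \<le> (cmod a + cmod b)\<^sup>2" by (intro power_mono norm_triangle_ineq) simp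
    also have "\<dots> \<le> 2 * (cmod a)\<^sup>2 + 2 * (cmod b)\<^sup>2"
      using zero_le_power2[of "cmod a - cmod b"] by (simp add: power2_sum power2_diff)
    finally show ?thesis .
  qed
  have summ: "summable (\<lambda>i. 2 * (cmod (c i))\<^sup>2 + 2 * (cmod (d i))\<^sup>2)"
    using assms by (intro summable_add summable_mult) (auto simp: ell2_def)
  have "summable (\<lambda>i. (cmod (c i + d i))\<^sup>2)"
    by (rule summable_comparison_test'[OF summ, of 0]) (simp add: le)
  then show ?thesis using assms by (simp add: ell2_def)
qed

lemma ell2_smult:
  assumes "c \<in> ell2 J" shows "(\<lambda>i. a * c i) \<in> ell2 J"
proof -
  have "summable (\<lambda>i. (cmod a)\<^sup>2 * (cmod (c i))\<^sup>2)"
    using assms by (intro summable_mult) (auto simp: ell2_def)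
  then show ?thesis using assms by (simp add: ell2_def norm_mult power_mult_distrib)
qed

lemma ell2_diff:
  assumes "c \<in> ell2 J" "d \<in> ell2 J" shows "(\<lambda>i. c i - d i) \<in> ell2 J"
  using ell2_add[OF assms(1) ell2_smult[OF assms(2), of "- 1"]] by simp

lemma ell2_zero: "(\<lambda>_. 0) \<in> ell2 J"
  by (simp add: ell2_def)

lemma ell2_single: "j \<in> J \<Longrightarrow> (\<lambda>i. of_bool (i = j)) \<in> ell2 J"
  using summable_finite[of "{j}" "\<lambda>i. (cmod (of_bool (i = j)))\<^sup>2"] by (auto simp: ell2_def)

lemma ell2_product:
  assumes "c \<in> ell2 J" "d \<in> ell2 J" shows "summable (\<lambda>i. cnj (c i) * d i)"
proof (rule summable_comparison_test'[of _ 0])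
  show "summable (\<lambda>i. (cmod (c i))\<^sup>2 + (cmod (d i))\<^sup>2)"
    using assms by (intro summable_add) (auto simp: ell2_def)
  fix i
  have "2 * (cmod (c i) * cmod (d i)) \<le> (cmod (c i))\<^sup>2 + (cmod (d i))\<^sup>2"
    using zero_le_power2[of "cmod (c i) - cmod (d i)"] by (simp add: power2_diff)
  moreover have "0 \<le> cmod (c i) * cmod (d i)" by simp
  ultimately show "norm (cnj (c i) * d i) \<le> (cmod (c i))\<^sup>2 + (cmod (d i))\<^sup>2"
    unfolding norm_mult complex_mod_cnj by linarith
qed

text \<open>The primitive ideals of an algebra are defined by representations whose underlying set lies in
  the type of the algebra; \<open>\<iota>\<close> transports \<open>\<ell>\<^sup>2(J)\<close> there.\<close>

definition ell2_space :: "nat set \<Rightarrow> ((nat \<Rightarrow> complex) \<Rightarrow> 'b) \<Rightarrow> 'b hilbert" where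
  "ell2_space J \<iota> = \<lparr>carrier = \<iota> ` ell2 J, mult = (\<lambda>x y. x), one = \<iota> (\<lambda>_. 0), zero = \<iota> (\<lambda>_. 0),
     add = (\<lambda>x y. \<iota> (\<lambda>i. inv_into UNIV \<iota> x i + inv_into UNIV \<iota> y i)), smult = (\<lambda>c x. \<iota> (\<lambda>i. c * inv_into UNIV \<iota> x i)),
     ip = (\<lambda>x y. \<Sum>i. cnj (inv_into UNIV \<iota> x i) * inv_into UNIV \<iota> y i)\<rparr>"

lemma field_class_ring: "Ring.field (class_ring :: complex ring)"
  by (rule vectorspace.axioms(2)[OF vec_vs])

context
  fixes J :: "nat set" and \<iota> :: "(nat \<Rightarrow> complex) \<Rightarrow> 'b"
  assumes inj: "inj \<iota>"
begin

private abbreviation "K \<equiv> ell2_space J \<iota>"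

private lemma inv_inj [simp]: "inv_into UNIV \<iota> (\<iota> c) = c"
  by (rule inv_f_f[OF inj])

private lemma K_simps:
  "carrier K = \<iota> ` ell2 J" "zero K = \<iota> (\<lambda>_. 0)"
  "add K = (\<lambda>x y. \<iota> (\<lambda>i. inv_into UNIV \<iota> x i + inv_into UNIV \<iota> y i))" "smult K = (\<lambda>c x. \<iota> (\<lambda>i. c * inv_into UNIV \<iota> x i))"
  "ip K = (\<lambda>x y. \<Sum>i. cnj (inv_into UNIV \<iota> x i) * inv_into UNIV \<iota> y i)"
  by (simp_all add: ell2_space_def)

private lemma ell2_pre_hilbert: "pre_hilbert K"
proof (rule pre_hilbert.intro)
  have "abelian_group K"
  proof (rule abelian_groupI)
    fix x assume "x \<in> carrier K"
    then obtain c where c: "c \<in> ell2 J" "x = \<iota> c" by (auto simp: K_simps)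
    then show "\<exists>y\<in>carrier K. y \<oplus>\<^bsub>K\<^esub> x = \<zero>\<^bsub>K\<^esub>"
      using ell2_smult[OF c(1), of "- 1"] by (intro bexI[of _ "\<iota> (\<lambda>i. - 1 * c i)"]) (auto simp: K_simps)
  qed (auto simp: K_simps ell2_add ell2_zero add_ac)
  moreover have "cring (class_ring :: complex ring)"
    by (rule domain.axioms(1)[OF field.axioms(1)[OF field_class_ring]])
  ultimately have "Module.module class_ring K"
    by (intro Module.moduleI) (auto simp: K_simps ell2_smult algebra_simps)
  then show "vectorspace class_ring K" by (intro vectorspace.intro field_class_ring)
  show "pre_hilbert_axioms K"
  proof
    fix x assume "x \<in> carrier K"
    then obtain c where c: "c \<in> ell2 J" "x = \<iota> c" by (auto simp: K_simps)
    show "0 < Re (ip K x x)" if "x \<noteq> \<zero>\<^bsub>K\<^esub>"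
    proof -
      have sq: "cnj (c i) * c i = complex_of_real ((cmod (c i))\<^sup>2)" for i
        by (metis complex_norm_square mult.commute)
      have s: "summable (\<lambda>i. (cmod (c i))\<^sup>2)" using c by (simp add: ell2_def)
      have "c \<noteq> (\<lambda>_. 0)" using that c(2) by (auto simp: K_simps)
      then obtain i where "c i \<noteq> 0" by auto
      then have "0 < (\<Sum>i. (cmod (c i))\<^sup>2)" by (intro suminf_pos2[OF s, of i]) auto
      then show ?thesis by (simp only: c K_simps inv_inj sq suminf_of_real[OF s, symmetric] Re_complex_of_real)
    qed
    fix y assume "y \<in> carrier K"
    then obtain d where d: "d \<in> ell2 J" "y = \<iota> d" by (auto simp: K_simps)
    note cd = ell2_product[OF c(1) d(1)]
    show "ip K x (a \<odot>\<^bsub>K\<^esub> y) = a * ip K x y" for a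
      unfolding c d K_simps inv_inj suminf_mult[OF cd, symmetric] by (simp add: mult_ac)
    show "ip K y x = cnj (ip K x y)"
    proof -
      have "(\<lambda>i. cnj (cnj (c i) * d i)) sums cnj (\<Sum>i. cnj (c i) * d i)"
        unfolding sums_cnj by (rule summable_sums[OF cd])
      then show ?thesis
        unfolding c d K_simps inv_inj by (simp add: sums_iff mult.commute)
    qed
    fix z assume "z \<in> carrier K"
    then obtain e where e: "e \<in> ell2 J" "z = \<iota> e" by (auto simp: K_simps)
    show "ip K x (y \<oplus>\<^bsub>K\<^esub> z) = ip K x y + ip K x z"
      unfolding c d e K_simps inv_inj suminf_add[OF cd ell2_product[OF c(1) e(1)]]
      by (simp add: distrib_left)
  qed
qed

text \<open>Completeness is the classical argument: coordinates converge, finite partial sums of the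
  squared distance pass to the limit, and the bound obtained is uniform in the number of
  terms.\<close>

lemma ell2_onb: "onb_space K (\<lambda>j. \<iota> (\<lambda>i. of_bool (i = j))) J"
proof -
  interpret pre_hilbert K by (rule ell2_pre_hilbert)
  have el: "inv_into UNIV \<iota> x \<in> ell2 J" "x = \<iota> (inv_into UNIV \<iota> x)" if "x \<in> carrier K" for x
    using that by (auto simp: K_simps)
  have inv_minus: "inv_into UNIV \<iota> (x \<ominus>\<^bsub>K\<^esub> y) = (\<lambda>i. inv_into UNIV \<iota> x i - inv_into UNIV \<iota> y i)"
    if "x \<in> carrier K" "y \<in> carrier K" for x y
  proof -
    have "x = (x \<ominus>\<^bsub>K\<^esub> y) \<oplus>\<^bsub>K\<^esub> y" by (rule h_minus_add_cancel[OF that, symmetric])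
    then have "inv_into UNIV \<iota> x = (\<lambda>i. inv_into UNIV \<iota> (x \<ominus>\<^bsub>K\<^esub> y) i + inv_into UNIV \<iota> y i)" by (metis K_simps(3) inv_inj)
    then show ?thesis by (simp add: fun_eq_iff)
  qed
  have norm_sq: "(hnorm K x)\<^sup>2 = (\<Sum>i. (cmod (inv_into UNIV \<iota> x i))\<^sup>2)" if "x \<in> carrier K" for x
  proof -
    have s: "summable (\<lambda>i. (cmod (inv_into UNIV \<iota> x i))\<^sup>2)" using el(1)[OF that] by (simp add: ell2_def)
    have "complex_of_real ((hnorm K x)\<^sup>2) = (\<Sum>i. cnj (inv_into UNIV \<iota> x i) * inv_into UNIV \<iota> x i)"
      using ip_self[OF that] by (simp add: K_simps)
    also have "\<dots> = (\<Sum>i. complex_of_real ((cmod (inv_into UNIV \<iota> x i))\<^sup>2))"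
      by (rule suminf_cong) (metis complex_norm_square mult.commute)
    finally show ?thesis unfolding suminf_of_real[OF s, symmetric] by (simp only: of_real_eq_iff)
  qed
  have partial: "(\<Sum>i<k. (cmod (inv_into UNIV \<iota> x i))\<^sup>2) \<le> (hnorm K x)\<^sup>2" if "x \<in> carrier K" for x k
    unfolding norm_sq[OF that] using el(1)[OF that] by (intro sum_le_suminf) (auto simp: ell2_def)
  have hilbert: "hilbert_space K"
  proof (rule hilbert_spaceI)
    fix s :: "nat \<Rightarrow> 'b" assume "range s \<subseteq> carrier K"
      and cauchy: "\<And>\<epsilon>. 0 < \<epsilon> \<Longrightarrow> \<exists>N. \<forall>n\<ge>N. hnorm K (s n \<ominus>\<^bsub>K\<^esub> s N) < \<epsilon>"
    then have sc: "s n \<in> carrier K" for n by blast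
    have dist: "\<exists>N. \<forall>m\<ge>N. \<forall>n\<ge>N. hnorm K (s n \<ominus>\<^bsub>K\<^esub> s m) < \<epsilon>" if "0 < \<epsilon>" for \<epsilon>
    proof -
      have "0 < \<epsilon> / 2" using that by simp
      from cauchy[OF this] obtain N where N: "\<And>n. n \<ge> N \<Longrightarrow> hnorm K (s n \<ominus>\<^bsub>K\<^esub> s N) < \<epsilon> / 2" by blast
      have "hnorm K (s n \<ominus>\<^bsub>K\<^esub> s m) < \<epsilon>" if "N \<le> n" "N \<le> m" for n m
        using hnorm_triangle_minus[OF sc[of n] sc[of N] sc[of m]] N[OF that(1)] N[OF that(2)]
          hnorm_minus_commute[OF sc[of N] sc[of m]] by linarith
      then show ?thesis by blast
    qed
    have "\<exists>l. (\<lambda>n. inv_into UNIV \<iota> (s n) i) \<longlonglongrightarrow> l" for i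
    proof -
      have "Cauchy (\<lambda>n. inv_into UNIV \<iota> (s n) i)"
      proof (rule CauchyI)
        fix \<epsilon> :: real assume "0 < \<epsilon>"
        from dist[OF this] obtain N where
          N: "\<And>m n. N \<le> m \<Longrightarrow> N \<le> n \<Longrightarrow> hnorm K (s n \<ominus>\<^bsub>K\<^esub> s m) < \<epsilon>" by blast
        have "norm (inv_into UNIV \<iota> (s m) i - inv_into UNIV \<iota> (s n) i) < \<epsilon>" if "N \<le> m" "N \<le> n" for m n
        proof -
          have c: "s m \<ominus>\<^bsub>K\<^esub> s n \<in> carrier K" by (rule M.minus_closed[OF sc sc])
          have "(cmod (inv_into UNIV \<iota> (s m \<ominus>\<^bsub>K\<^esub> s n) i))\<^sup>2 \<le> (\<Sum>i<Suc i. (cmod (inv_into UNIV \<iota> (s m \<ominus>\<^bsub>K\<^esub> s n) i))\<^sup>2)"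
            by (rule member_le_sum) auto
          also have "\<dots> \<le> (hnorm K (s m \<ominus>\<^bsub>K\<^esub> s n))\<^sup>2" by (rule partial[OF c])
          finally have "cmod (inv_into UNIV \<iota> (s m \<ominus>\<^bsub>K\<^esub> s n) i) \<le> hnorm K (s m \<ominus>\<^bsub>K\<^esub> s n)"
            by (rule power2_le_imp_le) (rule hnorm_nonneg[OF c])
          then show ?thesis using N[OF that(2,1)] inv_minus[OF sc sc] by simp
        qed
        then show "\<exists>M. \<forall>m\<ge>M. \<forall>n\<ge>M. norm (inv_into UNIV \<iota> (s m) i - inv_into UNIV \<iota> (s n) i) < \<epsilon>" by blast
      qed
      then show ?thesis using Cauchy_convergent convergent_def by blast
    qed
    then obtain l where l: "\<And>i. (\<lambda>n. inv_into UNIV \<iota> (s n) i) \<longlonglongrightarrow> l i" by metis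
    \<comment> \<open>Finite partial sums are used because the difference of \<open>s n\<close> and
      \<open>l\<close> is not yet known to be square summable.\<close>
    have key: "\<exists>N. \<forall>n\<ge>N. \<forall>k. (\<Sum>i<k. (cmod (inv_into UNIV \<iota> (s n) i - l i))\<^sup>2) \<le> \<epsilon>\<^sup>2" if "0 < \<epsilon>" for \<epsilon>
    proof -
      from dist[OF that] obtain N where
        N: "\<And>m n. N \<le> m \<Longrightarrow> N \<le> n \<Longrightarrow> hnorm K (s n \<ominus>\<^bsub>K\<^esub> s m) < \<epsilon>" by blast
      have "(\<Sum>i<k. (cmod (inv_into UNIV \<iota> (s n) i - l i))\<^sup>2) \<le> \<epsilon>\<^sup>2" if "N \<le> n" for n k
      proof (rule LIMSEQ_le_const2)
        show "(\<lambda>m. \<Sum>i<k. (cmod (inv_into UNIV \<iota> (s n) i - inv_into UNIV \<iota> (s m) i))\<^sup>2) \<longlonglongrightarrow> (\<Sum>i<k. (cmod (inv_into UNIV \<iota> (s n) i - l i))\<^sup>2)"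
          by (intro tendsto_intros l)
        have "(\<Sum>i<k. (cmod (inv_into UNIV \<iota> (s n) i - inv_into UNIV \<iota> (s m) i))\<^sup>2) \<le> \<epsilon>\<^sup>2" if "N \<le> m" for m
        proof -
          have c: "s n \<ominus>\<^bsub>K\<^esub> s m \<in> carrier K" by (rule M.minus_closed[OF sc sc])
          have "(hnorm K (s n \<ominus>\<^bsub>K\<^esub> s m))\<^sup>2 \<le> \<epsilon>\<^sup>2"
            using N[OF that \<open>N \<le> n\<close>] hnorm_nonneg[OF c] by (intro power_mono) auto
          then show ?thesis using partial[OF c, of k] unfolding inv_minus[OF sc sc] by linarith
        qed
        then show "\<exists>M. \<forall>m\<ge>M. (\<Sum>i<k. (cmod (inv_into UNIV \<iota> (s n) i - inv_into UNIV \<iota> (s m) i))\<^sup>2) \<le> \<epsilon>\<^sup>2" by blast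
      qed
      then show ?thesis by blast
    qed
    have l0: "l i = 0" if "i \<notin> J" for i
    proof -
      have "inv_into UNIV \<iota> (s n) i = 0" for n using el(1)[OF sc[of n]] that by (simp add: ell2_def)
      then show ?thesis using LIMSEQ_unique[OF l[of i], of 0] by simp
    qed
    have diff_ell2: "(\<lambda>i. inv_into UNIV \<iota> (s n) i - l i) \<in> ell2 J"
      if "\<And>k. (\<Sum>i<k. (cmod (inv_into UNIV \<iota> (s n) i - l i))\<^sup>2) \<le> B" for n B
    proof -
      have "summable (\<lambda>i. (cmod (inv_into UNIV \<iota> (s n) i - l i))\<^sup>2)"
        by (rule bounded_imp_summable[of _ B]) (use that lessThan_Suc_atMost in \<open>auto simp del: sum.lessThan_Suc\<close>, metis that lessThan_Suc_atMost)
      then show ?thesis using l0 el(1)[OF sc[of n]] by (simp add: ell2_def)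
    qed
    obtain N1 where N1: "\<And>k. (\<Sum>i<k. (cmod (inv_into UNIV \<iota> (s N1) i - l i))\<^sup>2) \<le> 1\<^sup>2"
      using key[of 1] by auto
    \<comment> \<open>\<open>l\<close> is written as the difference of two square summable
      sequences.\<close>
    have "(\<lambda>i. inv_into UNIV \<iota> (s N1) i - (inv_into UNIV \<iota> (s N1) i - l i)) \<in> ell2 J"
      by (rule ell2_diff[OF el(1)[OF sc] diff_ell2[OF N1]])
    then have lc: "\<iota> l \<in> carrier K" by (simp add: K_simps)
    have "(\<lambda>n. hnorm K (s n \<ominus>\<^bsub>K\<^esub> \<iota> l)) \<longlonglongrightarrow> 0"
    proof (rule LIMSEQ_I)
      fix \<epsilon> :: real assume "0 < \<epsilon>"
      then have "0 < \<epsilon> / 2" by simp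
      from key[OF this] obtain N where
        N: "\<And>n k. n \<ge> N \<Longrightarrow> (\<Sum>i<k. (cmod (inv_into UNIV \<iota> (s n) i - l i))\<^sup>2) \<le> (\<epsilon> / 2)\<^sup>2" by blast
      have "norm (hnorm K (s n \<ominus>\<^bsub>K\<^esub> \<iota> l) - 0) < \<epsilon>" if "N \<le> n" for n
      proof -
        have c: "s n \<ominus>\<^bsub>K\<^esub> \<iota> l \<in> carrier K" by (rule M.minus_closed[OF sc lc])
        have "summable (\<lambda>i. (cmod (inv_into UNIV \<iota> (s n) i - l i))\<^sup>2)"
          using diff_ell2[OF N[OF that]] by (simp add: ell2_def)
        then have "(\<Sum>i. (cmod (inv_into UNIV \<iota> (s n) i - l i))\<^sup>2) \<le> (\<epsilon> / 2)\<^sup>2"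
          by (rule suminf_le_const) (rule N[OF that])
        then have "(hnorm K (s n \<ominus>\<^bsub>K\<^esub> \<iota> l))\<^sup>2 \<le> (\<epsilon> / 2)\<^sup>2"
          unfolding norm_sq[OF c] inv_minus[OF sc lc] inv_inj .
        then have "hnorm K (s n \<ominus>\<^bsub>K\<^esub> \<iota> l) \<le> \<epsilon> / 2"
          by (rule power2_le_imp_le) (use \<open>0 < \<epsilon>\<close> in simp)
        then show ?thesis using \<open>0 < \<epsilon>\<close> hnorm_nonneg[OF c] by simp
      qed
      then show "\<exists>N. \<forall>n\<ge>N. norm (hnorm K (s n \<ominus>\<^bsub>K\<^esub> \<iota> l) - 0) < \<epsilon>" by blast
    qed
    then have "tends s (\<iota> l)" unfolding tends_def using sc lc by blast
    then show "\<exists>y. tends s y" by blast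
  qed
  have coord: "ip K (\<iota> (\<lambda>i. of_bool (i = j))) x = inv_into UNIV \<iota> x j" for j x
  proof -
    have "(\<Sum>i. cnj (of_bool (i = j)) * inv_into UNIV \<iota> x i) = (\<Sum>i\<in>{j}. cnj (of_bool (i = j)) * inv_into UNIV \<iota> x i)"
      by (rule suminf_finite) auto
    then show ?thesis by (simp add: K_simps)
  qed
  show ?thesis
  proof (rule onb_space.intro[OF hilbert], rule onb_space_axioms.intro)
    fix x assume x: "x \<in> carrier K" and 0: "\<And>j. j \<in> J \<Longrightarrow> ip K (\<iota> (\<lambda>i. of_bool (i = j))) x = 0"
    have "inv_into UNIV \<iota> x = (\<lambda>_. 0)"
      using 0 el(1)[OF x] unfolding coord by (auto simp: ell2_def)
    then show "x = \<zero>\<^bsub>K\<^esub>" using el(2)[OF x] by (simp add: K_simps)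
  qed (auto simp: coord ell2_single K_simps(1))
qed

end

section \<open>Orthonormal bases of separable Hilbert spaces\<close>

definition orthonormal :: "'h hilbert \<Rightarrow> 'h set \<Rightarrow> bool" where
  "orthonormal H E \<longleftrightarrow> E \<subseteq> carrier H \<and> (\<forall>x\<in>E. \<forall>y\<in>E. ip H x y = of_bool (x = y))"

context hilbert_space
begin

text \<open>Zorn's lemma. A nonzero vector orthogonal to a maximal family could be normalised and
  adjoined.\<close>

lemma maximal_orthonormal:
  obtains E where "orthonormal H E"
    "\<And>x. x \<in> carrier H \<Longrightarrow> (\<And>y. y \<in> E \<Longrightarrow> ip H y x = 0) \<Longrightarrow> x = \<zero>\<^bsub>H\<^esub>"
proof -
  have "\<exists>M\<in>{E. orthonormal H E}. \<forall>X\<in>{E. orthonormal H E}. M \<subseteq> X \<longrightarrow> X = M"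
  proof (rule subset_Zorn_nonempty)
    show "{E. orthonormal H E} \<noteq> {}" by (auto simp: orthonormal_def intro: exI[of _ "{}"])
    fix C assume C: "C \<noteq> {}" "subset.chain {E. orthonormal H E} C"
    have "ip H x y = of_bool (x = y)" if xy: "x \<in> \<Union>C" "y \<in> \<Union>C" for x y
    proof -
      obtain X Y where XY: "X \<in> C" "x \<in> X" "Y \<in> C" "y \<in> Y" using xy by blast
      then have "X \<subseteq> Y \<or> Y \<subseteq> X" using C(2) unfolding subset_chain_def by blast
      then obtain Z where "Z \<in> C" "x \<in> Z" "y \<in> Z" using XY by blast
      then show ?thesis using C(2) unfolding subset_chain_def orthonormal_def by blast
    qed
    moreover have "\<Union>C \<subseteq> carrier H" using C(2) unfolding subset_chain_def orthonormal_def by blast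
    ultimately show "\<Union>C \<in> {E. orthonormal H E}" unfolding orthonormal_def by blast
  qed
  then obtain E where E: "orthonormal H E" and max: "\<And>X. orthonormal H X \<Longrightarrow> E \<subseteq> X \<Longrightarrow> X = E" by blast
  have "x = \<zero>\<^bsub>H\<^esub>" if x: "x \<in> carrier H" and orth: "\<And>y. y \<in> E \<Longrightarrow> ip H y x = 0" for x
  proof (rule ccontr)
    assume "x \<noteq> \<zero>\<^bsub>H\<^esub>"
    then have pos: "hnorm H x \<noteq> 0" using hnorm_eq_zero[OF x] by blast
    define u where "u = complex_of_real (1 / hnorm H x) \<odot>\<^bsub>H\<^esub> x"
    have uc: "u \<in> carrier H" unfolding u_def by (rule sm_closed[OF x])
    have "hnorm H u = 1" unfolding u_def hnorm_smult[OF x]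
      using pos hnorm_nonneg[OF x] by (simp add: norm_divide)
    then have uu: "ip H u u = 1" using ip_self[OF uc] by simp
    have yu: "ip H y u = 0" "ip H u y = 0" if "y \<in> E" for y
    proof -
      have y: "y \<in> carrier H" using that E unfolding orthonormal_def by blast
      show "ip H y u = 0" unfolding u_def ip_smult[OF y x] orth[OF that] by simp
      then show "ip H u y = 0" using ip_cnj[OF y uc] by simp
    qed
    have "u \<notin> E" using yu(1) uu by force
    have "orthonormal H (insert u E)"
      unfolding orthonormal_def
    proof (intro conjI ballI)
      show "insert u E \<subseteq> carrier H" using uc E unfolding orthonormal_def by blast
      fix a b assume "a \<in> insert u E" "b \<in> insert u E"
      then show "ip H a b = of_bool (a = b)"
        using uu yu \<open>u \<notin> E\<close> E unfolding orthonormal_def by auto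
    qed
    then show False using max[of "insert u E"] \<open>u \<notin> E\<close> by blast
  qed
  then show thesis using that E by blast
qed

text \<open>Distinct orthonormal vectors have squared distance 2, so points of a dense set chosen
  within 1/2 of them are distinct. This embeds the family into a countable dense set.\<close>

lemma orthonormal_countable:
  assumes sep: "separable_space (htopology H)" and E: "orthonormal H E"
  shows "countable E"
proof -
  obtain C where C: "countable C" "C \<subseteq> carrier H" "htopology H closure_of C = carrier H"
    using sep unfolding separable_space_def by auto
  have Ec: "x \<in> carrier H" if "x \<in> E" for x using that E unfolding orthonormal_def by blast
  have "\<exists>c\<in>C. hnorm H (x \<ominus>\<^bsub>H\<^esub> c) < 1 / 2" if "x \<in> E" for x
  proof -
    have "x \<in> htopology H closure_of C" using C(3) Ec[OF that] by blast
    then have "\<forall>\<delta>>0. \<exists>c\<in>C. c \<in> hm.mball x \<delta>"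
      unfolding hm.metric_closure_of by blast
    from this[rule_format, of "1 / 2"] obtain c where c: "c \<in> C" "c \<in> hm.mball x (1 / 2)" by auto
    then have "hnorm H (x \<ominus>\<^bsub>H\<^esub> c) < 1 / 2" by (auto simp: hdist_def split: if_splits)
    then show ?thesis using c(1) by blast
  qed
  then obtain f where f: "\<And>x. x \<in> E \<Longrightarrow> f x \<in> C" "\<And>x. x \<in> E \<Longrightarrow> hnorm H (x \<ominus>\<^bsub>H\<^esub> f x) < 1 / 2"
    by metis
  have "inj_on f E"
  proof (rule inj_onI, rule ccontr)
    fix x y assume xy: "x \<in> E" "y \<in> E" "f x = f y" "x \<noteq> y"
    note c = Ec[OF xy(1)] Ec[OF xy(2)]
    have fc: "f x \<in> carrier H" using f(1)[OF xy(1)] C(2) by blast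
    have "hnorm H (x \<ominus>\<^bsub>H\<^esub> y) < 1"
      using hnorm_triangle_minus[OF c(1) fc c(2)] f(2)[OF xy(1)] f(2)[OF xy(2)]
        hnorm_minus_commute[OF fc c(2)] xy(3) by simp
    then have "(hnorm H (x \<ominus>\<^bsub>H\<^esub> y))\<^sup>2 < 1\<^sup>2"
      by (rule power_strict_mono) (use c in simp_all)
    moreover have "ip H x x = 1" "ip H y y = 1" "ip H x y = 0"
      using E xy unfolding orthonormal_def by auto
    then have ip: "Re (ip H x x) = 1" "Re (ip H y y) = 1" "Re (ip H x y) = 0" by simp_all
    have "(hnorm H x)\<^sup>2 = 1" "(hnorm H y)\<^sup>2 = 1"
      unfolding hnorm_def ip by simp_all
    then have "(hnorm H (x \<ominus>\<^bsub>H\<^esub> y))\<^sup>2 = 2"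
      unfolding hnorm_square_minus[OF c] ip by simp
    ultimately show False by simp
  qed
  moreover have "f ` E \<subseteq> C" using f(1) by (rule image_subsetI)
  then have "countable (f ` E)" using C(1) by (rule countable_subset)
  ultimately show ?thesis using countable_image_inj_on by blast
qed

text \<open>A finite maximal orthonormal family would span the space, so the family is countably
  infinite and can be enumerated by the natural numbers.\<close>

lemma separable_onb:
  assumes sep: "separable_space (htopology H)" and infdim: "\<not> vectorspace.fin_dim class_ring H"
  shows "\<exists>e. onb_space H e UNIV"
proof -
  obtain E where E: "orthonormal H E"
    and max: "\<And>x. x \<in> carrier H \<Longrightarrow> (\<And>y. y \<in> E \<Longrightarrow> ip H y x = 0) \<Longrightarrow> x = \<zero>\<^bsub>H\<^esub>"
    using maximal_orthonormal by blast
  have Ec: "x \<in> carrier H" if "x \<in> E" for x using that E unfolding orthonormal_def by blast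
  have "infinite E"
  proof
    assume fin: "finite E"
    have "x \<in> span E" if x: "x \<in> carrier H" for x
    proof -
      \<comment> \<open>\<open>y\<close> is the projection of \<open>x\<close> on the span of
        \<open>E\<close>; maximality applied to the difference gives \<open>x = y\<close>.\<close>
      define y where "y = lincomb (\<lambda>v. ip H v x) E"
      have y_sum: "y = finsum H (\<lambda>v. ip H v x \<odot>\<^bsub>H\<^esub> v) E" unfolding y_def lincomb_def ..
      have yc: "y \<in> carrier H" unfolding y_sum by (intro M.finsum_closed Pi_I sm_closed Ec)
      have "x \<ominus>\<^bsub>H\<^esub> y = \<zero>\<^bsub>H\<^esub>"
      proof (rule max)
        fix v assume v: "v \<in> E"
        have "ip H v y = (\<Sum>w\<in>E. ip H v (ip H w x \<odot>\<^bsub>H\<^esub> w))"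
          unfolding y_sum by (intro ip_finsum[OF fin] sm_closed Ec v)
        also have "\<dots> = (\<Sum>w\<in>E. if w = v then ip H w x else 0)"
          using E v by (intro sum.cong) (auto simp: ip_smult Ec orthonormal_def)
        also have "\<dots> = ip H v x" using fin v by simp
        finally show "ip H v (x \<ominus>\<^bsub>H\<^esub> y) = 0" using ip_minus[OF Ec[OF v] x yc] by simp
      qed (rule M.minus_closed[OF x yc])
      then have "x = y" using h_eq_iff_minus[OF x yc] by simp
      then show ?thesis unfolding y_def span_def using fin by auto
    qed
    moreover have "span E \<subseteq> carrier H" by (rule span_is_subset2) (use Ec in blast)
    ultimately have "span E = carrier H" by blast
    then have "fin_dim" unfolding fin_dim_def using fin Ec by blast
    then show False using infdim by blast
  qed
  with orthonormal_countable[OF sep E] obtain e :: "nat \<Rightarrow> 'h" where e: "bij_betw e UNIV E"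
    by (metis bij_betw_from_nat_into)
  have eE: "e j \<in> E" for j using e by (auto simp: bij_betw_def)
  have "onb_space H e UNIV"
  proof (rule onb_space.intro[OF hilbert_space_axioms], rule onb_space_axioms.intro)
    fix i j show "e j \<in> carrier H" by (rule Ec[OF eE])
    show "ip H (e i) (e j) = of_bool (i = j)"
      using E eE[of i] eE[of j] bij_betw_imp_inj_on[OF e] unfolding orthonormal_def
      by (simp add: inj_on_eq_iff)
  next
    fix x assume "x \<in> carrier H" "\<And>j. j \<in> UNIV \<Longrightarrow> ip H (e j) x = 0"
    moreover have "\<exists>j. y = e j" if "y \<in> E" for y using that e by (auto simp: bij_betw_def)
    ultimately show "x = \<zero>\<^bsub>H\<^esub>" using max[of x] by blast
  qed
  then show ?thesis by blast
qed

end

section \<open>Quotients of the Pascal triangle algebra\<close>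

definition perm_mat :: "(nat \<Rightarrow> nat) \<Rightarrow> complex mat \<Rightarrow> complex mat" where
  "perm_mat \<sigma> A = mat (dim_row A) (dim_col A) (\<lambda>(i, j). A $$ (\<sigma> i, \<sigma> j))"

lemma perm_mat_dim [simp]: "dim_row (perm_mat \<sigma> A) = dim_row A" "dim_col (perm_mat \<sigma> A) = dim_col A"
  by (simp_all add: perm_mat_def)

lemma perm_mat_carrier [simp]: "perm_mat \<sigma> A \<in> carrier_mat n m \<longleftrightarrow> A \<in> carrier_mat n m"
  unfolding carrier_mat_def by simp

lemma perm_mat_index [simp]:
  "i < dim_row A \<Longrightarrow> j < dim_col A \<Longrightarrow> perm_mat \<sigma> A $$ (i, j) = A $$ (\<sigma> i, \<sigma> j)"
  by (simp add: perm_mat_def)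

lemma permutes_less: "\<sigma> permutes {..<d} \<Longrightarrow> \<sigma> i < d \<longleftrightarrow> i < (d :: nat)"
  using permutes_in_image[of \<sigma> "{..<d}" i] by simp

lemma perm_mat_id [simp]: "perm_mat id A = A" "perm_mat (\<lambda>i. i) A = A"
  by (rule eq_matI; simp)+

lemma perm_mat_comp:
  assumes "\<sigma> permutes {..<d}" "A \<in> carrier_mat d d"
  shows "perm_mat \<sigma> (perm_mat \<tau> A) = perm_mat (\<tau> \<circ> \<sigma>) A"
  using assms by (intro eq_matI) (auto simp: permutes_less)

lemma perm_mat_inv:
  assumes "\<sigma> permutes {..<d}" "A \<in> carrier_mat d d"
  shows "perm_mat \<sigma> (perm_mat (inv_into UNIV \<sigma>) A) = A" "perm_mat (inv_into UNIV \<sigma>) (perm_mat \<sigma> A) = A"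
  using assms permutes_inv[OF assms(1)]
  by (simp_all add: perm_mat_comp permutes_inv_o)

text \<open>Permuting coordinates is isometric: the image of \<open>v\<close> under
  \<open>perm_mat \<sigma> A\<close> is, up to order, the image under \<open>A\<close> of the vector
  \<open>w\<close> obtained by permuting \<open>v\<close>. The inverse permutation gives the
  converse inequality.\<close>

lemma op_norm_perm_mat_le:
  assumes \<sigma>: "\<sigma> permutes {..<d}" and A: "A \<in> carrier_mat d d"
  shows "op_norm (perm_mat \<sigma> A) \<le> op_norm A"
proof (rule op_norm_leI)
  fix v :: "complex Matrix.vec" assume "v \<in> carrier_vec (dim_col (perm_mat \<sigma> A))"
  then have v: "v \<in> carrier_vec d" using A by simp
  define w where "w = Matrix.vec d (\<lambda>j. v $ inv_into UNIV \<sigma> j)"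
  have w: "w \<in> carrier_vec d" by (simp add: w_def)
  have bij: "bij_betw \<sigma> {..<d} {..<d}" by (rule permutes_imp_bij[OF \<sigma>])
  have w_ix: "w $ \<sigma> i = v $ i" if "i < d" for i
    using that permutes_less[OF \<sigma>, of i] permutes_inverses(2)[OF \<sigma>] by (simp add: w_def)
  have "(perm_mat \<sigma> A *\<^sub>v v) $ i = (A *\<^sub>v w) $ \<sigma> i" if i: "i < d" for i
  proof -
    have "(perm_mat \<sigma> A *\<^sub>v v) $ i = (\<Sum>j<d. A $$ (\<sigma> i, \<sigma> j) * w $ \<sigma> j)"
      using A v i w_ix by (simp add: scalar_prod_def lessThan_atLeast0)
    also have "\<dots> = (\<Sum>j<d. A $$ (\<sigma> i, j) * w $ j)"
      by (rule sum.reindex_bij_betw[OF bij])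
    also have "\<dots> = (A *\<^sub>v w) $ \<sigma> i"
      using A w i permutes_less[OF \<sigma>, of i] by (simp add: scalar_prod_def lessThan_atLeast0)
    finally show ?thesis .
  qed
  then have "(l2_norm (perm_mat \<sigma> A *\<^sub>v v))\<^sup>2 = (\<Sum>i<d. (cmod ((A *\<^sub>v w) $ \<sigma> i))\<^sup>2)"
    unfolding l2_norm_square using A by simp
  also have "\<dots> = (\<Sum>i<d. (cmod ((A *\<^sub>v w) $ i))\<^sup>2)"
    by (rule sum.reindex_bij_betw[OF bij])
  also have "\<dots> = (l2_norm (A *\<^sub>v w))\<^sup>2" unfolding l2_norm_square using A by simp
  finally have "l2_norm (perm_mat \<sigma> A *\<^sub>v v) = l2_norm (A *\<^sub>v w)"
    by (rule power2_eq_imp_eq) simp_all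
  moreover have "(l2_norm w)\<^sup>2 = (l2_norm v)\<^sup>2"
  proof -
    have "(\<Sum>i<d. (cmod (v $ i))\<^sup>2) = (\<Sum>i<d. (cmod (w $ \<sigma> i))\<^sup>2)" by (simp add: w_ix)
    also have "\<dots> = (\<Sum>i<d. (cmod (w $ i))\<^sup>2)" by (rule sum.reindex_bij_betw[OF bij])
    finally show ?thesis unfolding l2_norm_square using v w by simp
  qed
  then have "l2_norm w = l2_norm v" by (rule power2_eq_imp_eq) simp_all
  ultimately show "l2_norm (perm_mat \<sigma> A *\<^sub>v v) \<le> op_norm A * l2_norm v"
    using op_norm_apply[of w A] A w by simp
qed simp

lemma op_norm_perm_mat:
  assumes "\<sigma> permutes {..<d}" "A \<in> carrier_mat d d"
  shows "op_norm (perm_mat \<sigma> A) = op_norm A"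
  using op_norm_perm_mat_le[OF assms] op_norm_perm_mat_le[OF permutes_inv[OF assms(1)], of "perm_mat \<sigma> A"]
    perm_mat_inv(2)[OF assms] assms(2) by simp

lemma perm_mat_hom:
  assumes \<sigma>: "\<sigma> permutes {..<d}"
  shows "perm_mat \<sigma> \<in> contractive_hom (matrix_alg d) (matrix_alg d)"
proof (rule contractive_homI[OF star_homI])
  note less = permutes_less[OF \<sigma>]
  show "perm_mat \<sigma> \<one>\<^bsub>matrix_alg d\<^esub> = \<one>\<^bsub>matrix_alg d\<^esub>"
    using less permutes_inj[OF \<sigma>] by (intro eq_matI) (auto simp: inj_eq)
  fix x assume x: "x \<in> carrier (matrix_alg d)"
  show "perm_mat \<sigma> x \<in> carrier (matrix_alg d)" using x by simp
  show "perm_mat \<sigma> (c \<odot>\<^bsub>matrix_alg d\<^esub> x) = c \<odot>\<^bsub>matrix_alg d\<^esub> perm_mat \<sigma> x" for c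
    using x less by (intro eq_matI) auto
  show "perm_mat \<sigma> (star (matrix_alg d) x) = star (matrix_alg d) (perm_mat \<sigma> x)"
    using x less by (intro eq_matI) auto
  show "nrm (matrix_alg d) (perm_mat \<sigma> x) \<le> nrm (matrix_alg d) x"
    using op_norm_perm_mat[OF \<sigma>] x by simp
  fix y assume y: "y \<in> carrier (matrix_alg d)"
  show "perm_mat \<sigma> (x \<oplus>\<^bsub>matrix_alg d\<^esub> y) = perm_mat \<sigma> x \<oplus>\<^bsub>matrix_alg d\<^esub> perm_mat \<sigma> y"
    using x y less by (intro eq_matI) auto
  show "perm_mat \<sigma> (x \<otimes>\<^bsub>matrix_alg d\<^esub> y) = perm_mat \<sigma> x \<otimes>\<^bsub>matrix_alg d\<^esub> perm_mat \<sigma> y"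
    unfolding matrix_alg_simps
  proof (rule eq_matI)
    fix i j assume ij: "i < dim_row (perm_mat \<sigma> x * perm_mat \<sigma> y)" "j < dim_col (perm_mat \<sigma> x * perm_mat \<sigma> y)"
    have "(\<Sum>k<d. x $$ (\<sigma> i, k) * y $$ (k, \<sigma> j)) = (\<Sum>k<d. x $$ (\<sigma> i, \<sigma> k) * y $$ (\<sigma> k, \<sigma> j))"
      by (rule sum.reindex_bij_betw[OF permutes_imp_bij[OF \<sigma>], symmetric])
    then show "perm_mat \<sigma> (x * y) $$ (i, j) = (perm_mat \<sigma> x * perm_mat \<sigma> y) $$ (i, j)"
      using x y ij less by (simp add: scalar_prod_def lessThan_atLeast0)
  qed (use x y in auto)
qed

text \<open>A single permutation has to work for all \<open>x\<close> in \<open>X\<close>: the two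
  families are representations that differ by reordering the basis. Fixing the sizes makes the
  relation symmetric and transitive.\<close>

definition perm_equiv :: "nat \<Rightarrow> 'a set \<Rightarrow> ('a \<Rightarrow> complex mat) \<Rightarrow> ('a \<Rightarrow> complex mat) \<Rightarrow> bool" where
  "perm_equiv d X f g \<longleftrightarrow> (\<forall>x\<in>X. f x \<in> carrier_mat d d \<and> g x \<in> carrier_mat d d) \<and>
    (\<exists>\<sigma>. \<sigma> permutes {..<d} \<and> (\<forall>x\<in>X. f x = perm_mat \<sigma> (g x)))"

lemma perm_equivI:
  assumes "\<sigma> permutes {..<d}" "\<And>x. x \<in> X \<Longrightarrow> g x \<in> carrier_mat d d" "\<And>x. x \<in> X \<Longrightarrow> f x = perm_mat \<sigma> (g x)"
  shows "perm_equiv d X f g"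
  using assms unfolding perm_equiv_def by auto

lemma perm_equiv_refl: "(\<And>x. x \<in> X \<Longrightarrow> f x \<in> carrier_mat d d) \<Longrightarrow> perm_equiv d X f f"
  by (rule perm_equivI[of id]) (auto simp: permutes_id)

lemma perm_equiv_sym:
  assumes "perm_equiv d X f g" shows "perm_equiv d X g f"
proof -
  obtain \<sigma> where \<sigma>: "\<sigma> permutes {..<d}" "\<And>x. x \<in> X \<Longrightarrow> f x = perm_mat \<sigma> (g x)"
    using assms unfolding perm_equiv_def by blast
  have g: "g x \<in> carrier_mat d d" "f x \<in> carrier_mat d d" if "x \<in> X" for x
    using assms that unfolding perm_equiv_def by blast+
  show ?thesis
    by (rule perm_equivI[OF permutes_inv[OF \<sigma>(1)] g(2)]) (simp_all add: \<sigma> perm_mat_inv(2)[OF \<sigma>(1) g(1)])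
qed

lemma perm_equiv_trans:
  assumes "perm_equiv d X f g" "perm_equiv d X g h" shows "perm_equiv d X f h"
proof -
  obtain \<sigma> where \<sigma>: "\<sigma> permutes {..<d}" "\<And>x. x \<in> X \<Longrightarrow> f x = perm_mat \<sigma> (g x)"
    using assms(1) unfolding perm_equiv_def by blast
  obtain \<tau> where \<tau>: "\<tau> permutes {..<d}" "\<And>x. x \<in> X \<Longrightarrow> g x = perm_mat \<tau> (h x)"
    using assms(2) unfolding perm_equiv_def by blast
  have h: "h x \<in> carrier_mat d d" if "x \<in> X" for x
    using assms(2) that unfolding perm_equiv_def by blast
  show ?thesis
    by (rule perm_equivI[OF permutes_compose[OF \<sigma>(1) \<tau>(1)] h])
      (simp_all add: \<sigma>(2) \<tau>(2) perm_mat_comp[OF \<sigma>(1) h])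
qed

lemma permutes_lessI:
  assumes "\<And>i. i < d \<Longrightarrow> \<sigma> i < d" "\<And>i. i < d \<Longrightarrow> \<tau> i < d" "\<And>i. d \<le> i \<Longrightarrow> \<sigma> i = i"
    and "\<And>i. i < d \<Longrightarrow> \<tau> (\<sigma> i) = i" "\<And>i. i < d \<Longrightarrow> \<sigma> (\<tau> i) = (i :: nat)"
  shows "\<sigma> permutes {..<d}"
proof (rule bij_imp_permutes)
  show "bij_betw \<sigma> {..<d} {..<d}"
    by (rule bij_betw_byWitness[where f' = \<tau>]) (use assms in auto)
qed (use assms(3) in simp)

lemma perm_equiv_block_sum:
  assumes "perm_equiv d X f g" "perm_equiv m X f' g'"
  shows "perm_equiv (d + m) X (\<lambda>x. block_sum (f x) (f' x)) (\<lambda>x. block_sum (g x) (g' x))"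
proof -
  obtain \<sigma> where \<sigma>: "\<sigma> permutes {..<d}" "\<And>x. x \<in> X \<Longrightarrow> f x = perm_mat \<sigma> (g x)"
    using assms(1) unfolding perm_equiv_def by blast
  obtain \<tau> where \<tau>: "\<tau> permutes {..<m}" "\<And>x. x \<in> X \<Longrightarrow> f' x = perm_mat \<tau> (g' x)"
    using assms(2) unfolding perm_equiv_def by blast
  have g: "g x \<in> carrier_mat d d" "g' x \<in> carrier_mat m m" if "x \<in> X" for x
    using assms that unfolding perm_equiv_def by blast+
  \<comment> \<open>\<rho> acts by \<sigma> on the first block and by \<tau>, shifted by
    \<open>d\<close>, on the second; \<rho>' is its inverse on the two blocks, built in the same
    way.\<close>
  define \<rho> where "\<rho> i = (if i < d then \<sigma> i else if i < d + m then \<tau> (i - d) + d else i)" for i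
  define \<rho>' where "\<rho>' i = (if i < d then inv_into UNIV \<sigma> i else if i < d + m then inv_into UNIV \<tau> (i - d) + d else i)" for i
  note l = permutes_less[OF \<sigma>(1)] permutes_less[OF \<tau>(1)] permutes_less[OF permutes_inv[OF \<sigma>(1)]]
    permutes_less[OF permutes_inv[OF \<tau>(1)]]
  have \<rho>: "\<rho> permutes {..<d + m}"
    by (rule permutes_lessI[where \<tau> = \<rho>'])
      (auto simp: \<rho>_def \<rho>'_def l permutes_inverses[OF \<sigma>(1)] permutes_inverses[OF \<tau>(1)] less_diff_conv2
        trans_less_add1 simp flip: less_diff_conv)
  show ?thesis
  proof (rule perm_equivI[OF \<rho>])
    fix x assume x: "x \<in> X"
    show "block_sum (g x) (g' x) \<in> carrier_mat (d + m) (d + m)" using g[OF x] by simp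
    have lt: "\<tau> (i - d) < m" if "i < d + m" "\<not> i < d" for i using that l(2)[of "i - d"] by auto
    show "block_sum (f x) (f' x) = perm_mat \<rho> (block_sum (g x) (g' x))"
      using g[OF x] \<sigma>(2)[OF x] \<tau>(2)[OF x] l(1) lt
      by (intro eq_matI) (simp_all add: \<rho>_def add.commute trans_less_add1)
  qed
qed

text \<open>Rotating the basis exchanges the blocks. This serves where the diagram appends a block
  on the side opposite to that of \<open>pile\<close>.\<close>

lemma perm_equiv_swap:
  assumes "\<And>x. x \<in> X \<Longrightarrow> f x \<in> carrier_mat d d" "\<And>x. x \<in> X \<Longrightarrow> g x \<in> carrier_mat m m"
  shows "perm_equiv (d + m) X (\<lambda>x. block_sum (g x) (f x)) (\<lambda>x. block_sum (f x) (g x))"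
proof -
  define \<sigma> where "\<sigma> i = (if i < m then d + i else if i < d + m then i - m else i)" for i
  define \<tau> where "\<tau> i = (if i < d then m + i else if i < d + m then i - d else i)" for i
  have \<sigma>: "\<sigma> permutes {..<d + m}"
    by (rule permutes_lessI[where \<tau> = \<tau>]) (auto simp: \<sigma>_def \<tau>_def)
  show ?thesis
  proof (rule perm_equivI[OF \<sigma>])
    fix x assume x: "x \<in> X"
    show "block_sum (f x) (g x) \<in> carrier_mat (d + m) (d + m)" using assms[OF x] by simp
    have lt: "i - m < d" if "i < d + m" "\<not> i < m" for i using that by auto
    show "block_sum (g x) (f x) = perm_mat \<sigma> (block_sum (f x) (g x))"
      using assms[OF x] lt by (intro eq_matI) (simp_all add: \<sigma>_def add.commute)
  qed
qed

section \<open>Restriction of a level to selected summands\<close>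

lemma nth_contractive:
  assumes "k < length ds"
  shows "(\<lambda>xs. xs ! k) \<in> contractive_hom (multimatrix_alg ds) (matrix_alg (ds ! k))"
proof -
  have "select [k] = (\<lambda>xs. xs ! k)" by (rule ext) simp
  moreover have "ds \<noteq> []" using assms by auto
  ultimately show ?thesis using select_contractive[of "[k]" ds] assms by simp
qed

definition restrict2 :: "nat \<Rightarrow> nat \<Rightarrow> (nat \<Rightarrow> nat) \<Rightarrow> (nat \<Rightarrow> nat) \<Rightarrow> complex mat list \<Rightarrow> complex mat list" where
  "restrict2 u v s t xs = [perm_mat s (xs ! u), perm_mat t (xs ! v)]"

lemma restrict2_hom:
  assumes "u < length ds" "v < length ds" "s permutes {..<ds ! u}" "t permutes {..<ds ! v}"
  shows "restrict2 u v s t \<in> contractive_hom (multimatrix_alg ds) (multimatrix_alg [ds ! u, ds ! v])"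
proof -
  have "(\<lambda>x. map (\<lambda>f. f x) [perm_mat s \<circ> (\<lambda>xs. xs ! u), perm_mat t \<circ> (\<lambda>xs. xs ! v)])
      \<in> contractive_hom (multimatrix_alg ds) (multimatrix_alg [ds ! u, ds ! v])"
  proof (rule multimatrix_hom)
    fix l assume "l < length [ds ! u, ds ! v]"
    then consider "l = 0" | "l = 1" by fastforce
    then show "[perm_mat s \<circ> (\<lambda>xs. xs ! u), perm_mat t \<circ> (\<lambda>xs. xs ! v)] ! l
        \<in> contractive_hom (multimatrix_alg ds) (matrix_alg ([ds ! u, ds ! v] ! l))"
      by cases (use contractive_hom_comp[OF nth_contractive[OF assms(1)] perm_mat_hom[OF assms(3)]]
          contractive_hom_comp[OF nth_contractive[OF assms(2)] perm_mat_hom[OF assms(4)]] in simp_all)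
  qed simp_all
  then show ?thesis by (simp add: restrict2_def[abs_def] o_def)
qed

text \<open>The lift is zero on all other summands and undoes the permutations, which are isometric,
  on the two chosen ones.\<close>

lemma restrict2_lift:
  assumes uv: "u < length ds" "v < length ds" "u \<noteq> v"
    and s: "s permutes {..<ds ! u}" and t: "t permutes {..<ds ! v}"
    and b: "b \<in> carrier (multimatrix_alg [ds ! u, ds ! v])"
  shows "\<exists>a\<in>carrier (multimatrix_alg ds). restrict2 u v s t a = b \<and>
    nrm (multimatrix_alg ds) a \<le> nrm (multimatrix_alg [ds ! u, ds ! v]) b"
proof -
  let ?es = "[ds ! u, ds ! v]"
  define a where "a = map (\<lambda>k. if k = u then perm_mat (inv_into UNIV s) (b ! 0)
      else if k = v then perm_mat (inv_into UNIV t) (b ! 1) else 0\<^sub>m (ds ! k) (ds ! k)) [0..<length ds]"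
  have b01: "b ! 0 \<in> carrier_mat (ds ! u) (ds ! u)" "b ! 1 \<in> carrier_mat (ds ! v) (ds ! v)" "length b = 2"
    using multimatrix_nth[OF b, of 0] multimatrix_nth[OF b, of 1] multimatrix_length[OF b] by simp_all
  then have b_eq: "b = [b ! 0, b ! 1]" by (intro nth_equalityI) (auto simp: less_Suc_eq numeral_2_eq_2)
  have ac: "a \<in> carrier (multimatrix_alg ds)"
    using b01 by (simp add: multimatrix_carrier a_def)
  have "restrict2 u v s t a = [b ! 0, b ! 1]"
    using uv perm_mat_inv(1)[OF s b01(1)] perm_mat_inv(1)[OF t b01(2)]
    by (simp add: restrict2_def a_def)
  then have "restrict2 u v s t a = b" unfolding b_eq[symmetric] .
  moreover have "ds \<noteq> []" using uv by auto
  have "nrm (multimatrix_alg ds) a \<le> nrm (multimatrix_alg ?es) b"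
    unfolding multimatrix_nrm_le_iff[OF ac \<open>ds \<noteq> []\<close>]
  proof (intro allI impI)
    fix k assume "k < length ds"
    have n: "op_norm (b ! 0) \<le> nrm (multimatrix_alg ?es) b" "op_norm (b ! 1) \<le> nrm (multimatrix_alg ?es) b"
      using op_norm_le_multimatrix_nrm[OF b, of 0] op_norm_le_multimatrix_nrm[OF b, of 1] by simp_all
    have "0 \<le> nrm (multimatrix_alg ?es) b" using order_trans[OF op_norm_nonneg n(1)] .
    then show "op_norm (a ! k) \<le> nrm (multimatrix_alg ?es) b"
      using \<open>k < length ds\<close> n op_norm_perm_mat[OF permutes_inv[OF s] b01(1)]
        op_norm_perm_mat[OF permutes_inv[OF t] b01(2)] by (simp add: a_def)
  qed
  ultimately show ?thesis using ac by blast
qed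

section \<open>Connecting maps of the Pascal diagram\<close>

lemma concat_replicate_filter:
  "concat (map (\<lambda>k. replicate (if P k then 1 else 0) k) xs) = filter P xs"
  by (induction xs) auto

lemma pascal_dims [simp]:
  "length (dims pascal_diagram n) = Suc (2 ^ n)"
  "k \<le> 2 ^ n \<Longrightarrow> dims pascal_diagram n ! k = pascal_q n k"
  by (simp_all add: pascal_diagram_def del: upt_Suc)

lemma pascal_incoming:
  "incoming pascal_diagram n l = filter (\<lambda>k. \<bar>2 * int k - int l\<bar> \<le> 1) [0..<Suc (2 ^ n)]"
  unfolding incoming_def pascal_dims concat_replicate_filter[symmetric] by (simp add: pascal_diagram_def)

lemma pascal_incoming_even:
  assumes "k \<le> 2 ^ n" shows "incoming pascal_diagram n (2 * k) = [k]"
proof -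
  have "[0..<Suc (2 ^ n)] = [0..<k] @ [k] @ [Suc k..<Suc (2 ^ n)]"
    using assms upt_add_eq_append[of 0 k "Suc (2 ^ n) - k"] upt_conv_Cons[of k "Suc (2 ^ n)"] by simp
  then show ?thesis unfolding pascal_incoming by (auto simp: filter_empty_conv simp del: upt_Suc)
qed

lemma pascal_incoming_odd:
  assumes "k < 2 ^ n" shows "incoming pascal_diagram n (Suc (2 * k)) = [k, Suc k]"
proof -
  have "[0..<Suc (2 ^ n)] = [0..<k] @ [k, Suc k] @ [Suc (Suc k)..<Suc (2 ^ n)]"
    using assms upt_add_eq_append[of 0 k "Suc (2 ^ n) - k"] upt_conv_Cons[of k "Suc (2 ^ n)"]
      upt_conv_Cons[of "Suc k" "Suc (2 ^ n)"] by simp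
  then show ?thesis unfolding pascal_incoming by (auto simp: filter_empty_conv simp del: upt_Suc)
qed

abbreviation "pascal_level n \<equiv> multimatrix_alg (dims pascal_diagram n)"
abbreviation "pascal_map \<equiv> bratteli_map pascal_diagram"

lemma pascal_map_even: "k \<le> 2 ^ n \<Longrightarrow> pascal_map n xs ! (2 * k) = xs ! k"
  unfolding bratteli_map_eq by (simp add: pascal_incoming_even del: upt_Suc)

lemma pascal_map_odd: "k < 2 ^ n \<Longrightarrow> pascal_map n xs ! Suc (2 * k) = block_sum (xs ! k) (xs ! Suc k)"
  unfolding bratteli_map_eq by (simp add: pascal_incoming_odd del: upt_Suc)

lemma pascal_system: "star_system pascal_level pascal_map"
  by (rule bratteli_system[OF pascal_unital]) (simp add: pascal_diagram_def)

lemma pascal_nth: "xs \<in> carrier (pascal_level n) \<Longrightarrow> k \<le> 2 ^ n \<Longrightarrow> xs ! k \<in> carrier_mat (pascal_q n k) (pascal_q n k)"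
  using multimatrix_nth[of xs "dims pascal_diagram n" k] by simp

text \<open>The list selected here is \<open>incoming\<close> at the first vertex of the Effros-Shen
  diagram, with \<open>c\<close> the partial quotient.\<close>

definition pile :: "nat \<Rightarrow> complex mat \<Rightarrow> complex mat \<Rightarrow> complex mat" where
  "pile c x y = select (replicate c 0 @ [1]) [x, y]"

lemma pile_simps [simp]: "pile 0 x y = y" "pile (Suc c) x y = block_sum x (pile c x y)"
  by (simp_all add: pile_def)

lemma pile_carrier: "x \<in> carrier_mat d d \<Longrightarrow> y \<in> carrier_mat m m \<Longrightarrow> pile c x y \<in> carrier_mat (c * d + m) (c * d + m)"
proof (induction c)
  case (Suc c)
  then show ?case using block_sum_carrier[of x d "pile c x y" "c * d + m"] by (simp add: add.assoc)
qed simp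

lemma perm_equiv_pile:
  assumes "perm_equiv d X f g" "perm_equiv m X f' g'"
  shows "perm_equiv (c * d + m) X (\<lambda>x. pile c (f x) (f' x)) (\<lambda>x. pile c (g x) (g' x))"
proof (induction c)
  case (Suc c)
  then show ?case using perm_equiv_block_sum[OF assms(1) Suc] by (simp add: add.assoc)
qed (simp add: assms(2))

text \<open>An even vertex has a single incoming edge, so vertex \<open>u\<close> is copied
  unchanged to vertex \<open>2 ^ c * u\<close>, \<open>c\<close> floors later.\<close>

lemma pascal_run_even:
  assumes "u \<le> 2 ^ n"
  shows "2 ^ c * u \<le> 2 ^ (n + c)" "connect pascal_map n (n + c) xs ! (2 ^ c * u) = xs ! u"
    "pascal_q (n + c) (2 ^ c * u) = pascal_q n u"
proof -
  show le: "2 ^ c * u \<le> 2 ^ (n + c)" for c using assms by (simp add: power_add)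
  show "connect pascal_map n (n + c) xs ! (2 ^ c * u) = xs ! u"
    by (induction c) (use pascal_map_even[OF le] in \<open>simp_all add: mult.assoc\<close>)
  show "pascal_q (n + c) (2 ^ c * u) = pascal_q n u"
    by (induction c) (simp_all add: mult.assoc)
qed

text \<open>On each further floor the right neighbour of the copied vertex is odd and receives the
  copied block in front of what it had.\<close>

lemma pascal_run_right:
  assumes u: "u < 2 ^ n"
  shows "Suc (2 ^ c * u) \<le> 2 ^ (n + c)"
    "connect pascal_map n (n + c) xs ! Suc (2 ^ c * u) = pile c (xs ! u) (xs ! Suc u)"
    "pascal_q (n + c) (Suc (2 ^ c * u)) = c * pascal_q n u + pascal_q n (Suc u)"
proof -
  have lt: "2 ^ c * u < 2 ^ (n + c)" for c using u by (simp add: power_add)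
  then show "Suc (2 ^ c * u) \<le> 2 ^ (n + c)" by (simp add: Suc_leI)
  note ev = pascal_run_even[OF less_imp_le[OF u]]
  show "connect pascal_map n (n + c) xs ! Suc (2 ^ c * u) = pile c (xs ! u) (xs ! Suc u)"
    by (induction c) (use pascal_map_odd[OF lt] in \<open>simp_all add: mult.assoc ev(2)\<close>)
  show "pascal_q (n + c) (Suc (2 ^ c * u)) = c * pascal_q n u + pascal_q n (Suc u)"
  proof (induction c)
    case (Suc c)
    have "pascal_q (n + Suc c) (Suc (2 ^ Suc c * u)) = pascal_q (n + c) (2 ^ c * u) + pascal_q (n + c) (Suc (2 ^ c * u))"
      by (simp add: mult.assoc)
    then show ?case using Suc ev(3)[of c] by simp
  qed simp
qed

text \<open>The mirror image of the run to the right. Here the copied block arrives behind what the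
  neighbour had, so \<open>pile\<close> is reached only after reordering the basis.\<close>

lemma pascal_run_left:
  assumes u: "0 < u" "u \<le> 2 ^ n"
  shows "pascal_q (n + c) (2 ^ c * u - 1) = c * pascal_q n u + pascal_q n (u - 1)"
    "perm_equiv (c * pascal_q n u + pascal_q n (u - 1)) (carrier (pascal_level n))
      (\<lambda>xs. connect pascal_map n (n + c) xs ! (2 ^ c * u - 1)) (\<lambda>xs. pile c (xs ! u) (xs ! (u - 1)))"
proof -
  note ev = pascal_run_even[OF u(2)]
  let ?w = "\<lambda>c. 2 ^ c * u - 1"
  have w: "2 ^ c * u = Suc (?w c)" "?w c < 2 ^ (n + c)" "?w (Suc c) = Suc (2 * ?w c)" for c
  proof -
    have "0 < 2 ^ c * u" using u by simp
    moreover have "2 ^ Suc c * u = 2 * (2 ^ c * u)" by simp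
    ultimately show "2 ^ c * u = Suc (?w c)" "?w c < 2 ^ (n + c)" "?w (Suc c) = Suc (2 * ?w c)"
      using ev(1)[of c] by linarith+
  qed
  show q: "pascal_q (n + c) (?w c) = c * pascal_q n u + pascal_q n (u - 1)" for c
  proof (induction c)
    case (Suc c)
    have "pascal_q (n + Suc c) (?w (Suc c)) = pascal_q (n + c) (?w c) + pascal_q (n + c) (Suc (?w c))"
      unfolding w(3) by simp
    then show ?case using Suc ev(3)[of c] w(1)[of c] by simp
  qed simp
  show "perm_equiv (c * pascal_q n u + pascal_q n (u - 1)) (carrier (pascal_level n))
      (\<lambda>xs. connect pascal_map n (n + c) xs ! ?w c) (\<lambda>xs. pile c (xs ! u) (xs ! (u - 1)))"
  proof (induction c)
    case 0
    show ?case by (simp, rule perm_equiv_refl) (use u pascal_nth in auto)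
  next
    case (Suc c)
    let ?X = "carrier (pascal_level n)"
    let ?z = "\<lambda>xs. connect pascal_map n (n + c) xs"
    have zc: "?z xs \<in> carrier (pascal_level (n + c))" if "xs \<in> ?X" for xs
      using star_system.connect_closed[OF pascal_system le_add1 that] .
    have c1: "xs ! u \<in> carrier_mat (pascal_q n u) (pascal_q n u)" if "xs \<in> ?X" for xs
      using pascal_nth[OF that u(2)] .
    have c2: "?z xs ! ?w c \<in> carrier_mat (c * pascal_q n u + pascal_q n (u - 1)) (c * pascal_q n u + pascal_q n (u - 1))"
      if "xs \<in> ?X" for xs
      using pascal_nth[OF zc[OF that] less_imp_le[OF w(2)]] unfolding q .
    have z: "connect pascal_map n (n + Suc c) xs ! ?w (Suc c) = block_sum (?z xs ! ?w c) (xs ! u)" for xs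
      unfolding w(3) using pascal_map_odd[OF w(2)[of c], of "?z xs"] ev(2) w(1)[of c] by simp
    have "perm_equiv (pascal_q n u + (c * pascal_q n u + pascal_q n (u - 1))) ?X
        (\<lambda>xs. block_sum (?z xs ! ?w c) (xs ! u)) (\<lambda>xs. block_sum (xs ! u) (?z xs ! ?w c))"
      by (rule perm_equiv_swap[OF c1 c2])
    from perm_equiv_trans[OF this perm_equiv_block_sum[OF perm_equiv_refl[OF c1] Suc]]
    show ?case unfolding z by (simp add: add.assoc)
  qed
qed

text \<open>A stage of the Effros-Shen algebra sits in the Pascal diagram on two neighbouring vertices, the
  larger denominator sometimes on the left and sometimes on the right one; hence the permutations.\<close>

definition es_stage :: "(nat \<Rightarrow> nat) \<Rightarrow> nat \<Rightarrow> nat \<times> (complex mat list \<Rightarrow> complex mat list) \<Rightarrow> bool" where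
  "es_stage a j S \<longleftrightarrow> (\<exists>u v s t. snd S = restrict2 u v s t \<and> u \<le> 2 ^ fst S \<and> v \<le> 2 ^ fst S \<and>
     (v = Suc u \<or> u = Suc v) \<and> pascal_q (fst S) u = cf_denom a (Suc j) \<and> pascal_q (fst S) v = cf_denom a j \<and>
     s permutes {..<cf_denom a (Suc j)} \<and> t permutes {..<cf_denom a j})"

text \<open>Both vertices of floor 0 have size 1, so after \<open>a 1 - 1\<close> steps the right
  neighbour of vertex 0 has size \<open>a 1\<close>.\<close>

lemma es_stage_0:
  assumes "1 \<le> a 1"
  shows "\<exists>S. es_stage a 0 S"
proof -
  have "pascal_q (a 1 - 1) (Suc 0) = a 1"
    using pascal_run_right(3)[of 0 0 "a 1 - 1"] assms by simp
  moreover have "pascal_q (a 1 - 1) 0 = 1" by (rule pascal_q_boundary)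
  moreover have "Suc 0 \<le> 2 ^ (a 1 - 1)" by simp
  ultimately have "es_stage a 0 (a 1 - 1, restrict2 (Suc 0) 0 id id)"
    unfolding es_stage_def by (intro exI[of _ "Suc 0"] exI[of _ 0] exI[of _ id]) (simp add: permutes_id)
  then show ?thesis by blast
qed

text \<open>The first vertex \<open>u\<close> of the stage is copied for \<open>c\<close> steps. Its
  neighbour absorbs a copy of it at each step and thereby reaches size
  \<open>cf_denom a (Suc (Suc j))\<close>. Then the roles change: the neighbour, now at
  \<open>w\<close>, becomes the first vertex and the copy of \<open>u\<close> the second.\<close>

lemma es_stage_Suc:
  assumes S: "es_stage a j S"
  shows "\<exists>S'. es_stage a (Suc j) S' \<and> fst S' = fst S + a (Suc (Suc j)) \<and>
    (\<forall>xs\<in>carrier (pascal_level (fst S)). snd S' (connect pascal_map (fst S) (fst S') xs)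
      = [pile (a (Suc (Suc j))) (snd S xs ! 0) (snd S xs ! 1), snd S xs ! 0])"
proof -
  obtain u v s t where \<rho>: "snd S = restrict2 u v s t" and u: "u \<le> 2 ^ fst S" and v: "v \<le> 2 ^ fst S"
    and adj: "v = Suc u \<or> u = Suc v" and qu: "pascal_q (fst S) u = cf_denom a (Suc j)"
    and qv: "pascal_q (fst S) v = cf_denom a j"
    and s: "s permutes {..<cf_denom a (Suc j)}" and t: "t permutes {..<cf_denom a j}"
    using S unfolding es_stage_def by blast
  define n c where "n = fst S" and "c = a (Suc (Suc j))"
  let ?X = "carrier (pascal_level n)" and ?v' = "2 ^ c * u" and ?D = "cf_denom a (Suc (Suc j))"
  have D: "c * cf_denom a (Suc j) + cf_denom a j = ?D" by (simp add: c_def)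
  note u' = u[folded n_def] and v' = v[folded n_def] and qu' = qu[folded n_def] and qv' = qv[folded n_def]
  have xu: "xs ! u \<in> carrier_mat (cf_denom a (Suc j)) (cf_denom a (Suc j))"
    and xv: "xs ! v \<in> carrier_mat (cf_denom a j) (cf_denom a j)" if "xs \<in> ?X" for xs
    using pascal_nth[OF that u'] pascal_nth[OF that v'] unfolding qu' qv' by auto
  have pile: "pile c (xs ! u) (xs ! v) \<in> carrier_mat ?D ?D" if "xs \<in> ?X" for xs
    using pile_carrier[OF xu[OF that] xv[OF that], of c] unfolding D .
  have "\<exists>w. (?v' = Suc w \<or> w = Suc ?v') \<and> w \<le> 2 ^ (n + c) \<and> pascal_q (n + c) w = ?D \<and>
    perm_equiv ?D ?X (\<lambda>xs. connect pascal_map n (n + c) xs ! w) (\<lambda>xs. pile c (xs ! u) (xs ! v))"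
    using adj
  proof
    assume eq: "v = Suc u"
    then have lt: "u < 2 ^ n" using v' by simp
    note run = pascal_run_right[OF lt, of c, folded eq, unfolded qu' qv' D]
    show ?thesis
      by (intro exI[of _ "Suc ?v'"] conjI run(1,3)) (simp_all only: run(2) perm_equiv_refl[OF pile] simp_thms)
  next
    assume eq: "u = Suc v"
    then have pos: "0 < u" and eq': "u - 1 = v" by simp_all
    note run = pascal_run_left[OF pos u', of c, unfolded eq' qu' qv' D]
    have "0 < ?v'" using pos by simp
    then have "?v' = Suc (?v' - 1)" by simp
    moreover have "?v' - 1 \<le> 2 ^ (n + c)" using pascal_run_even(1)[OF u', of c] by simp
    ultimately show ?thesis using run by blast
  qed
  then obtain w where w: "?v' = Suc w \<or> w = Suc ?v'" "w \<le> 2 ^ (n + c)" "pascal_q (n + c) w = ?D"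
    and eq: "perm_equiv ?D ?X (\<lambda>xs. connect pascal_map n (n + c) xs ! w) (\<lambda>xs. pile c (xs ! u) (xs ! v))"
    by blast
  \<comment> \<open>The old permutations inside the blocks and the reordering caused by the run are
    merged into one permutation \<sigma> of the new first block; the second block keeps
    \<open>s\<close>.\<close>
  have "perm_equiv ?D ?X (\<lambda>xs. pile c (perm_mat s (xs ! u)) (perm_mat t (xs ! v))) (\<lambda>xs. pile c (xs ! u) (xs ! v))"
    unfolding D[symmetric]
    by (intro perm_equiv_pile perm_equivI[OF s xu] perm_equivI[OF t xv]) simp_all
  from perm_equiv_trans[OF this perm_equiv_sym[OF eq]] obtain \<sigma> where \<sigma>: "\<sigma> permutes {..<?D}"
    and pile_eq: "\<And>xs. xs \<in> ?X \<Longrightarrow>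
      pile c (perm_mat s (xs ! u)) (perm_mat t (xs ! v)) = perm_mat \<sigma> (connect pascal_map n (n + c) xs ! w)"
    unfolding perm_equiv_def by blast
  define S' where "S' = (n + c, restrict2 w ?v' \<sigma> s)"
  have "es_stage a (Suc j) S'"
    unfolding es_stage_def S'_def fst_conv snd_conv
    by (intro exI[of _ w] exI[of _ ?v'] exI[of _ \<sigma>] exI[of _ s])
      (use w \<sigma> s pascal_run_even(1,3)[OF u', of c] qu' in simp)
  moreover have "snd S' (connect pascal_map n (n + c) xs) = [pile c (snd S xs ! 0) (snd S xs ! 1), snd S xs ! 0]"
    if "xs \<in> ?X" for xs
    unfolding S'_def \<rho> by (simp add: restrict2_def pile_eq[OF that] pascal_run_even(2)[OF u'])
  ultimately show ?thesis
    unfolding n_def c_def by (intro exI[of _ S']) (simp add: S'_def n_def c_def)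
qed

lemma nth_lift:
  assumes k: "k < length ds" and Y: "Y \<in> carrier_mat (ds ! k) (ds ! k)"
  shows "\<exists>a\<in>carrier (multimatrix_alg ds). a ! k = Y \<and> nrm (multimatrix_alg ds) a \<le> op_norm Y"
proof -
  define a where "a = map (\<lambda>i. if i = k then Y else 0\<^sub>m (ds ! i) (ds ! i)) [0..<length ds]"
  have ac: "a \<in> carrier (multimatrix_alg ds)" using Y by (simp add: multimatrix_carrier a_def)
  have "ds \<noteq> []" using k by auto
  then have "nrm (multimatrix_alg ds) a \<le> op_norm Y"
    unfolding multimatrix_nrm_le_iff[OF ac \<open>ds \<noteq> []\<close>] by (simp add: a_def)
  then show ?thesis using ac k by (intro bexI[of _ a]) (simp_all add: a_def)
qed

text \<open>The Effros-Shen diagram of an arbitrary sequence of partial quotients; of the continued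
  fraction only their positivity enters below.\<close>

definition es_diagram :: "(nat \<Rightarrow> nat) \<Rightarrow> bratteli" where
  "es_diagram a = \<lparr>
     dims = (\<lambda>n. case n of 0 \<Rightarrow> [1] | Suc m \<Rightarrow> [cf_denom a (Suc m), cf_denom a m]),
     edges = (\<lambda>n k l. if l = 0 then (if k = 0 then a (Suc n) else 1)
                      else (if k = 0 then 1 else 0))\<rparr>"

lemma es_diagram_eq: "effros_shen_diagram \<theta> = es_diagram (cf_digit \<theta>)"
  unfolding effros_shen_diagram_def es_diagram_def Let_def ..

lemma es_dims [simp]: "dims (es_diagram a) 0 = [1]"
  "dims (es_diagram a) (Suc n) = [cf_denom a (Suc n), cf_denom a n]"
  by (simp_all add: es_diagram_def)

lemma es_unital: "bratteli_unital (es_diagram a)"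
  unfolding bratteli_unital_def es_diagram_def
  by (auto simp: less_Suc_eq numeral_2_eq_2 split: nat.splits)

lemma es_incoming:
  "incoming (es_diagram a) 0 0 = replicate (a 1) 0"
  "incoming (es_diagram a) (Suc n) 0 = replicate (a (Suc (Suc n))) 0 @ [1]"
  "incoming (es_diagram a) (Suc n) (Suc 0) = [0]"
  by (simp_all add: incoming_def es_diagram_def numeral_2_eq_2)

lemma es_system: "star_system (\<lambda>n. multimatrix_alg (dims (es_diagram a) n)) (bratteli_map (es_diagram a))"
  by (rule bratteli_system[OF es_unital]) (simp add: es_diagram_def split: nat.splits)

lemma length_2_eq: "length b = 2 \<Longrightarrow> b = [b ! 0, b ! 1]"
  by (intro nth_equalityI) (auto simp: less_Suc_eq numeral_2_eq_2)

lemma es_map_Suc: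
  assumes "length b = 2"
  shows "bratteli_map (es_diagram a) (Suc n) b = [pile (a (Suc (Suc n))) (b ! 0) (b ! 1), b ! 0]"
proof -
  have "select ks b = select ks [b ! 0, b ! 1]" for ks
    using length_2_eq[OF assms] by simp
  then show ?thesis unfolding bratteli_map_eq
    by (simp add: es_incoming numeral_2_eq_2 pile_def)
qed

text \<open>Stage \<open>i\<close> of the dependent choice realises level \<open>i + 1\<close> of
  the target, and positive partial quotients push the stages down the diagram without bound.\<close>

theorem pascal_onto_effros_shen:
  assumes a: "\<And>n. 1 \<le> a n"
  shows "\<exists>h\<in>star_hom pascal_algebra (af_algebra (es_diagram a)).
    h ` carrier pascal_algebra = carrier (af_algebra (es_diagram a))"
proof -
  have "\<exists>S. \<forall>j. es_stage a j (S j) \<and> (fst (S (Suc j)) = fst (S j) + a (Suc (Suc j)) \<and>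
    (\<forall>xs\<in>carrier (pascal_level (fst (S j))). snd (S (Suc j)) (connect pascal_map (fst (S j)) (fst (S (Suc j))) xs)
      = [pile (a (Suc (Suc j))) (snd (S j) xs ! 0) (snd (S j) xs ! 1), snd (S j) xs ! 0]))"
    by (rule dependent_nat_choice[OF es_stage_0[OF a] es_stage_Suc])
  then obtain S where stage: "\<And>j. es_stage a j (S j)"
    and fst_S: "\<And>j. fst (S (Suc j)) = fst (S j) + a (Suc (Suc j))"
    and snd_S: "\<And>j xs. xs \<in> carrier (pascal_level (fst (S j))) \<Longrightarrow>
      snd (S (Suc j)) (connect pascal_map (fst (S j)) (fst (S (Suc j))) xs)
      = [pile (a (Suc (Suc j))) (snd (S j) xs ! 0) (snd (S j) xs ! 1), snd (S j) xs ! 0]" by blast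
  \<comment> \<open>The index is shifted because level 0 of the target has a single summand; it is
    served by the first vertex of floor 0.\<close>
  define N where "N j = (case j of 0 \<Rightarrow> 0 | Suc i \<Rightarrow> fst (S i))" for j
  define \<rho> where "\<rho> j = (case j of 0 \<Rightarrow> (\<lambda>xs. map (\<lambda>f. f xs) [\<lambda>xs. xs ! 0]) | Suc i \<Rightarrow> snd (S i))" for j
  have N_step: "N j \<le> N (Suc j)" for j
    using fst_S by (cases j) (simp_all add: N_def)
  have "limit_morphism pascal_level pascal_map (\<lambda>n. multimatrix_alg (dims (es_diagram a) n))
      (bratteli_map (es_diagram a)) N \<rho>"
  proof (rule limit_morphism.intro[OF pascal_system es_system], rule limit_morphism_axioms.intro)
    show "mono N" using N_step by (rule mono_iff_le_Suc[THEN iffD2, rule_format])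
    have "j \<le> fst (S j)" for j
    proof (induction j)
      case (Suc j)
      then show ?case using fst_S[of j] a[of "Suc (Suc j)"] by linarith
    qed simp
    then show "j \<le> Suc (N j)" for j by (cases j) (simp_all add: N_def)
    show "\<exists>x\<in>carrier (pascal_level (N j)). \<rho> j x = b \<and> nrm (pascal_level (N j)) x
        \<le> nrm (multimatrix_alg (dims (es_diagram a) j)) b"
      if b: "b \<in> carrier (multimatrix_alg (dims (es_diagram a) j))" for j b
      proof (cases j)
        case 0
        have b0: "b ! 0 \<in> carrier_mat 1 1" "b = [b ! 0]"
          using multimatrix_nth[OF b, of 0] multimatrix_length[OF b] 0 by (auto simp: length_Suc_conv)
        obtain x where x: "x \<in> carrier (pascal_level 0)" "x ! 0 = b ! 0" "nrm (pascal_level 0) x \<le> op_norm (b ! 0)"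
          using nth_lift[of 0 "dims pascal_diagram 0" "b ! 0"] b0(1) by auto
        moreover have "op_norm (b ! 0) \<le> nrm (multimatrix_alg (dims (es_diagram a) 0)) b"
          using op_norm_le_multimatrix_nrm[OF b, of 0] 0 by simp
        ultimately show ?thesis using 0 b0(2) by (intro bexI[of _ x]) (auto simp: \<rho>_def N_def)
      next
        case (Suc i)
        from stage[of i] obtain u v s t where "snd (S i) = restrict2 u v s t" "u \<le> 2 ^ fst (S i)" "v \<le> 2 ^ fst (S i)"
          "v = Suc u \<or> u = Suc v" "pascal_q (fst (S i)) u = cf_denom a (Suc i)" "pascal_q (fst (S i)) v = cf_denom a i"
          "s permutes {..<cf_denom a (Suc i)}" "t permutes {..<cf_denom a i}"
          unfolding es_stage_def by blast
        then show ?thesis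
          using restrict2_lift[of u "dims pascal_diagram (fst (S i))" v s t b] b Suc
          by (auto simp: \<rho>_def N_def)
      qed
    show "\<rho> j \<in> contractive_hom (pascal_level (N j)) (multimatrix_alg (dims (es_diagram a) j))" for j
    proof (cases j)
      case 0
      have "(\<lambda>xs. map (\<lambda>f. f xs) [\<lambda>xs. xs ! 0]) \<in> contractive_hom (pascal_level 0) (multimatrix_alg [1])"
        by (rule multimatrix_hom) (use nth_contractive[of 0 "dims pascal_diagram 0"] in simp_all)
      then show ?thesis by (simp add: 0 \<rho>_def N_def)
    next
      case (Suc i)
      from stage[of i] obtain u v s t where "snd (S i) = restrict2 u v s t" "u \<le> 2 ^ fst (S i)" "v \<le> 2 ^ fst (S i)"
        "pascal_q (fst (S i)) u = cf_denom a (Suc i)" "pascal_q (fst (S i)) v = cf_denom a i"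
        "s permutes {..<cf_denom a (Suc i)}" "t permutes {..<cf_denom a i}"
        unfolding es_stage_def by blast
      then show ?thesis
        using restrict2_hom[of u "dims pascal_diagram (fst (S i))" v s t] Suc
        by (simp add: \<rho>_def N_def)
    qed
    fix j x assume "1 \<le> j" and x: "x \<in> carrier (pascal_level (N j))"
    then obtain i where j: "j = Suc i" by (cases j) auto
    have "length (snd (S i) x) = 2"
      using stage[of i] unfolding es_stage_def by (auto simp: restrict2_def)
    then show "\<rho> (Suc j) (connect pascal_map (N j) (N (Suc j)) x) = bratteli_map (es_diagram a) j (\<rho> j x)"
      using snd_S[of x i] x by (simp add: j \<rho>_def N_def es_map_Suc)
  qed
  then show ?thesis
    unfolding pascal_algebra_def af_algebra_def by (rule limit_morphism.limit_surjection)
qed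

text \<open>The subtractive Euclidean algorithm: the larger of two unequal neighbours is inserted
  between the smaller one and a vertex whose size is the difference. Subtraction keeps the pair
  coprime and ends at the pair of ones on floor 0.\<close>

lemma pascal_neighbours:
  assumes "0 < x" "0 < y" "coprime x y"
  shows "\<exists>n k. k < 2 ^ n \<and> pascal_q n k = x \<and> pascal_q n (Suc k) = y"
  using assms
proof (induction "x + y" arbitrary: x y rule: less_induct)
  case less
  consider "x < y" | "y < x" | "x = y" by linarith
  then show ?case
  proof cases
    case 1
    then have "coprime x (y - x)"
      using less(4) gcd_diff1_nat[of x y] by (simp add: coprime_iff_gcd_eq_1 gcd.commute)
    with less(1)[of x "y - x"] less(2) 1 obtain n k where
      "k < 2 ^ n" "pascal_q n k = x" "pascal_q n (Suc k) = y - x" by auto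
    \<comment> \<open>Vertices \<open>2 * k\<close> and \<open>2 * k + 1\<close> of the next floor
      have sizes \<open>x\<close> and \<open>x + (y - x)\<close>; in the mirrored case the pair
      starts at the inserted vertex.\<close>
    then show ?thesis using 1 by (intro exI[of _ "Suc n"] exI[of _ "2 * k"]) simp
  next
    case 2
    then have "coprime (x - y) y"
      using less(4) gcd_diff1_nat[of y x] by (simp add: coprime_iff_gcd_eq_1)
    with less(1)[of "x - y" y] less(3) 2 obtain n k where
      "k < 2 ^ n" "pascal_q n k = x - y" "pascal_q n (Suc k) = y" by auto
    then show ?thesis using 2 by (intro exI[of _ "Suc n"] exI[of _ "Suc (2 * k)"]) simp
  next
    case 3
    then have "x = 1" using less(4) by simp
    then show ?thesis using 3 by (intro exI[of _ 0]) simp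
  qed
qed

lemma pair_dims [simp]: "dims (pair_diagram q q') n = [q, q' + n * q]"
  by (simp add: pair_diagram_def)

lemma pair_incoming:
  "incoming (pair_diagram q q') n 0 = [0]" "incoming (pair_diagram q q') n (Suc 0) = [0, 1]"
  by (simp_all add: incoming_def pair_diagram_def numeral_2_eq_2)

lemma pair_map_nth:
  "bratteli_map (pair_diagram q q') n b ! 0 = b ! 0"
  "bratteli_map (pair_diagram q q') n b ! Suc 0 = block_sum (b ! 0) (b ! 1)"
  unfolding bratteli_map_eq by (simp_all add: pair_incoming)

lemma pair_system:
  "star_system (\<lambda>n. multimatrix_alg (dims (pair_diagram q q') n)) (bratteli_map (pair_diagram q q'))"
  by (rule bratteli_system[OF pair_unital]) simp

text \<open>The vertex of size \<open>q\<close> stays the left one for ever, and its right neighbour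
  grows by \<open>q\<close> on each floor. On this side the blocks come in the order of the pair
  diagram, so the permutations are identities.\<close>

theorem pascal_onto_pair:
  assumes "0 < q" "0 < q'" "coprime q q'"
  shows "\<exists>h\<in>star_hom pascal_algebra (pair_algebra q q'). h ` carrier pascal_algebra = carrier (pair_algebra q q')"
proof -
  obtain n k where k: "k < 2 ^ n" and q: "pascal_q n k = q" and q': "pascal_q n (Suc k) = q'"
    using pascal_neighbours[OF assms] by blast
  define u where "u j = 2 ^ j * k" for j
  have uj: "u j < 2 ^ (n + j)" for j using k by (simp add: u_def power_add)
  have qu: "pascal_q (n + j) (u j) = q" "pascal_q (n + j) (Suc (u j)) = q' + j * q" for j
    using pascal_run_even(3)[OF less_imp_le[OF k], of j] pascal_run_right(3)[OF k, of j]
    by (simp_all add: u_def q q')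
  let ?\<rho> = "\<lambda>j. restrict2 (u j) (Suc (u j)) id id"
  have "limit_morphism pascal_level pascal_map (\<lambda>j. multimatrix_alg (dims (pair_diagram q q') j))
      (bratteli_map (pair_diagram q q')) (\<lambda>j. n + j) ?\<rho>"
  proof (rule limit_morphism.intro[OF pascal_system pair_system], rule limit_morphism_axioms.intro)
    show "mono (\<lambda>j. n + j)" by (rule monoI) simp
    show "j \<le> Suc (n + j)" for j by simp
    fix j
    have len: "u j < length (dims pascal_diagram (n + j))" "Suc (u j) < length (dims pascal_diagram (n + j))"
      and nth: "dims pascal_diagram (n + j) ! u j = q" "dims pascal_diagram (n + j) ! Suc (u j) = q' + j * q"
      using uj[of j] qu by (simp_all add: less_imp_le Suc_leI)
    show "?\<rho> j \<in> contractive_hom (pascal_level (n + j)) (multimatrix_alg (dims (pair_diagram q q') j))"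
      using restrict2_hom[OF len permutes_id permutes_id] by (simp add: nth)
    show "\<exists>x\<in>carrier (pascal_level (n + j)). ?\<rho> j x = b \<and> nrm (pascal_level (n + j)) x
        \<le> nrm (multimatrix_alg (dims (pair_diagram q q') j)) b"
      if "b \<in> carrier (multimatrix_alg (dims (pair_diagram q q') j))" for b
      using restrict2_lift[OF len _ permutes_id permutes_id, of b] that by (simp add: nth)
    fix x
    have "connect pascal_map (n + j) (n + Suc j) x = pascal_map (n + j) x" by simp
    moreover have "u (Suc j) = 2 * u j" by (simp add: u_def)
    moreover have "bratteli_map (pair_diagram q q') j b = [b ! 0, block_sum (b ! 0) (b ! 1)]" for b
      using length_2_eq[of "bratteli_map (pair_diagram q q') j b"] pair_map_nth[of q q' j b]
      by (simp add: bratteli_map_def)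
    ultimately show "?\<rho> (Suc j) (connect pascal_map (n + j) (n + Suc j) x) = bratteli_map (pair_diagram q q') j (?\<rho> j x)"
      using uj[of j] by (simp add: restrict2_def pascal_map_even pascal_map_odd del: connect.simps(2))
  qed
  then show ?thesis
    unfolding pascal_algebra_def pair_algebra_def af_algebra_def by (rule limit_morphism.limit_surjection)
qed

section \<open>Irreducible representations of the quotients\<close>

text \<open>A summand of level \<open>n\<close> may be invisible to \<open>r n\<close>; seeing it at level \<open>n + 1\<close> is enough.\<close>

lemma (in limit_rep) rep_faithful:
  assumes faithful: "\<And>n a. a \<in> carrier (A n) \<Longrightarrow> nrm (A n) a \<le> op_norm (r (Suc n) (\<phi> n a))"
    and x: "x \<in> cauchy_seqs A \<phi>"
  shows "rep x = \<zero>\<^bsub>operator_alg H\<^esub> \<longleftrightarrow> limit_class A x = \<zero>\<^bsub>cstar_limit A \<phi>\<^esub>"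
  unfolding rep_eq_zero_iff[OF x] limit_class_eq_zero[OF x]
proof
  note cx = cauchy_closed[OF x]
  {
    assume "(\<lambda>n. nrm (A n) (x n)) \<longlonglongrightarrow> 0"
    then show "(\<lambda>n. op_norm (r n (x n))) \<longlonglongrightarrow> 0"
      by (rule Lim_null_comparison[rotated]) (use r_nrm[OF cx] in \<open>auto intro: always_eventually\<close>)
  }
  assume lim: "(\<lambda>n. op_norm (r n (x n))) \<longlonglongrightarrow> 0"
  show "(\<lambda>n. nrm (A n) (x n)) \<longlonglongrightarrow> 0"
  proof (rule LIMSEQ_I)
    fix \<epsilon> :: real assume "0 < \<epsilon>"
    then have "0 < \<epsilon> / 2" by simp
    obtain N where N: "\<And>m n. N \<le> m \<Longrightarrow> m \<le> n \<Longrightarrow> nrm (A n) (x n \<ominus>\<^bsub>A n\<^esub> connect \<phi> m n (x m)) < \<epsilon> / 2"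
      using cauchyD[OF x \<open>0 < \<epsilon> / 2\<close>] by blast
    obtain M where M: "\<And>n. M \<le> n \<Longrightarrow> op_norm (r n (x n)) < \<epsilon> / 2"
      using order_tendstoD(2)[OF lim \<open>0 < \<epsilon> / 2\<close>] unfolding eventually_sequentially by blast
    have "nrm (A n) (x n) < \<epsilon>" if n: "N \<le> n" "M \<le> n" for n
    proof -
      let ?y = "connect \<phi> n (Suc n) (x n)"
      have y: "?y \<in> carrier (A (Suc n))" by (rule connect_closed[OF le_SucI[OF order_refl] cx])
      have d: "?y \<ominus>\<^bsub>A (Suc n)\<^esub> x (Suc n) \<in> carrier (A (Suc n))" by (rule alg.minus_closed[OF y cx])
      have "r (Suc n) ?y = r (Suc n) (?y \<ominus>\<^bsub>A (Suc n)\<^esub> x (Suc n)) + r (Suc n) (x (Suc n))"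
        unfolding r_star_hom(3)[OF d cx, symmetric] alg.minus_add_cancel[OF y cx] ..
      then have "op_norm (r (Suc n) ?y) \<le> op_norm (r (Suc n) (?y \<ominus>\<^bsub>A (Suc n)\<^esub> x (Suc n))) + op_norm (r (Suc n) (x (Suc n)))"
        using op_norm_add[OF r_closed[OF d] r_closed[OF cx[of "Suc n"]]] by simp
      moreover have "op_norm (r (Suc n) (?y \<ominus>\<^bsub>A (Suc n)\<^esub> x (Suc n))) < \<epsilon> / 2"
        using r_nrm[OF d] N[OF n(1), of "Suc n"] alg.nrm_minus_commute[OF y cx[of "Suc n"]] by simp
      moreover have "op_norm (r (Suc n) (x (Suc n))) < \<epsilon> / 2" using M[of "Suc n"] n by simp
      moreover have "nrm (A n) (x n) \<le> op_norm (r (Suc n) ?y)" using faithful[OF cx[of n]] by simp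
      ultimately show ?thesis by linarith
    qed
    then have "\<forall>n\<ge>max N M. norm (nrm (A n) (x n) - 0) < \<epsilon>"
      using alg.nrm_nonneg[OF cx] by simp
    then show "\<exists>N. \<forall>n\<ge>N. norm (nrm (A n) (x n) - 0) < \<epsilon>" by blast
  qed
qed

lemma (in limit_rep) faithful_irreducible:
  assumes J: "J \<noteq> {}"
    and faithful: "\<And>n a. a \<in> carrier (A n) \<Longrightarrow> nrm (A n) a \<le> op_norm (r (Suc n) (\<phi> n a))"
  shows "\<exists>\<pi>. irreducible_rep (cstar_limit A \<phi>) H \<pi> \<and>
    (\<forall>b\<in>carrier (cstar_limit A \<phi>). \<pi> b = \<zero>\<^bsub>operator_alg H\<^esub> \<longleftrightarrow> b = \<zero>\<^bsub>cstar_limit A \<phi>\<^esub>)"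
proof -
  obtain \<pi> where \<pi>: "\<pi> \<in> star_hom (cstar_limit A \<phi>) (operator_alg H)"
    and rep: "\<And>x. x \<in> cauchy_seqs A \<phi> \<Longrightarrow> \<pi> (limit_class A x) = rep x"
    using limit_rep by blast
  have "irreducible_rep (cstar_limit A \<phi>) H \<pi>" by (rule rep_irreducible[OF J \<pi> rep])
  moreover have "\<pi> b = \<zero>\<^bsub>operator_alg H\<^esub> \<longleftrightarrow> b = \<zero>\<^bsub>cstar_limit A \<phi>\<^esub>" if b: "b \<in> carrier (cstar_limit A \<phi>)" for b
  proof -
    obtain x where x: "x \<in> cauchy_seqs A \<phi>" and b: "b = limit_class A x"
      using b unfolding limit_carrier by (rule imageE)
    show ?thesis unfolding b rep[OF x] by (rule rep_faithful[OF faithful x])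
  qed
  ultimately show ?thesis by blast
qed

text \<open>The ideal is the kernel of \<pi> after \<open>h\<close>. The quotient is computed from
  its equality with the kernel of \<open>t\<close> after \<open>h\<close>, so \<pi> may act on a
  space inside the type of \<open>A\<close> while \<open>C\<close> is any algebra, for instance one
  of operators on a different space.\<close>

lemma primitive_quotient:
  fixes A :: "'a star_alg" and H :: "'a hilbert"
  assumes A: "star_algebra A" and B: "ring B"
    and h: "h \<in> star_hom A B" and surj: "h ` carrier A = carrier B"
    and \<pi>: "irreducible_rep B H \<pi>"
    and t: "t \<in> star_hom B C" and t_surj: "t ` carrier B = carrier C" and t_zero: "t \<zero>\<^bsub>B\<^esub> = \<zero>\<^bsub>C\<^esub>"
    and kernel: "\<And>b. b \<in> carrier B \<Longrightarrow> \<pi> b = \<zero>\<^bsub>operator_alg H\<^esub> \<longleftrightarrow> t b = \<zero>\<^bsub>C\<^esub>"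
  shows "\<exists>I. primitive_ideal A I \<and> star_quot A I \<simeq>\<^sub>* C"
proof (intro exI conjI)
  have "ring A" using A unfolding star_algebra_def by blast
  have hc: "h a \<in> carrier B" if "a \<in> carrier A" for a using star_hom_closed[OF h that] .
  have "irreducible_rep A H (\<pi> \<circ> h)"
    unfolding irreducible_rep_def
  proof (intro conjI allI impI)
    show "hilbert_space H" "carrier H \<noteq> {\<zero>\<^bsub>H\<^esub>}" using \<pi> unfolding irreducible_rep_def by blast+
    show "\<pi> \<circ> h \<in> star_hom A (operator_alg H)"
      using \<pi> unfolding irreducible_rep_def by (intro star_hom_comp[OF h]) blast
    fix W assume W: "VectorSpace.subspace class_ring W H \<and> closedin (htopology H) W \<and>
      (\<forall>a\<in>carrier A. \<forall>w\<in>W. (\<pi> \<circ> h) a w \<in> W)"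
    have "\<forall>b\<in>carrier B. \<forall>w\<in>W. \<pi> b w \<in> W"
      using W unfolding surj[symmetric] by simp
    then show "W = {\<zero>\<^bsub>H\<^esub>} \<or> W = carrier H"
      using \<pi> W unfolding irreducible_rep_def by blast
  qed
  then show "primitive_ideal A (a_kernel A (operator_alg H) (\<pi> \<circ> h))"
    unfolding primitive_ideal_def by blast
  have "a_kernel A (operator_alg H) (\<pi> \<circ> h) = a_kernel A C (t \<circ> h)"
    unfolding a_kernel_def' using kernel[OF hc] by auto
  moreover have "star_quot A (a_kernel A C (t \<circ> h)) \<simeq>\<^sub>* C"
  proof (rule star_quot_kernel_isomorphic[OF A star_hom_comp[OF h t]])
    show "(t \<circ> h) ` carrier A = carrier C" unfolding image_comp[symmetric] surj t_surj ..
    show "(t \<circ> h) \<zero>\<^bsub>A\<^esub> = \<zero>\<^bsub>C\<^esub>" by (simp add: star_hom_zero[OF \<open>ring A\<close> B h] t_zero)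
  qed
  ultimately show "star_quot A (a_kernel A (operator_alg H) (\<pi> \<circ> h)) \<simeq>\<^sub>* C" by simp
qed

lemma star_hom_id: "(\<lambda>x. x) \<in> star_hom A A"
  by (rule star_homI) simp_all

lemma pascal_star_algebra: "star_algebra pascal_algebra"
  unfolding pascal_algebra_def af_algebra_def by (rule star_system.limit_algebra[OF pascal_system])

lemma star_algebra_ring: "star_algebra A \<Longrightarrow> ring A"
  unfolding star_algebra_def by blast

text \<open>The model Hilbert spaces live in the element type of \<open>pascal_algebra\<close>, as \<open>primitive_ideal\<close> demands;
  only the injectivity of \<open>c \<mapsto> {seq_embed c}\<close> matters.\<close>

definition seq_embed :: "(nat \<Rightarrow> complex) \<Rightarrow> nat \<Rightarrow> complex mat list" where
  "seq_embed c n = [mat 1 1 (\<lambda>_. c n)]"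

lemma inj_seq_embed: "inj (\<lambda>c. {seq_embed c})"
proof (rule injI)
  fix c d assume "{seq_embed c} = {seq_embed d}"
  then have "seq_embed c n ! 0 $$ (0, 0) = seq_embed d n ! 0 $$ (0, 0)" for n by simp
  then show "c = d" by (intro ext) (simp add: seq_embed_def)
qed

abbreviation model_space :: "nat set \<Rightarrow> (nat \<Rightarrow> complex mat list) set hilbert" where
  "model_space J \<equiv> ell2_space J (\<lambda>c. {seq_embed c})"

lemmas model_onb = ell2_onb[OF inj_seq_embed]

text \<open>Supplies the monotonicity of \<open>d\<close> that \<open>limit_rep\<close>
  demands.\<close>

lemma cf_denom_le:
  assumes a: "\<And>n. 1 \<le> a n"
  shows "cf_denom a n \<le> cf_denom a (Suc n)"
proof (cases n)
  case (Suc m)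
  have "1 * cf_denom a (Suc m) \<le> a (Suc (Suc m)) * cf_denom a (Suc m)" by (intro mult_right_mono a) simp
  then show ?thesis by (simp add: Suc trans_le_add1)
qed (use a in simp)

text \<open>The leading 0 puts the old first block in the upper left corner of the new one, as
  \<open>r_extend\<close> demands. That every vertex occurs makes the first summand see the whole
  norm one level later.\<close>

lemma es_nth_0:
  assumes a: "\<And>n. 1 \<le> a n"
  obtains ks where "incoming (es_diagram a) n 0 = 0 # ks"
    and "set (incoming (es_diagram a) n 0) = {..<length (dims (es_diagram a) n)}"
proof -
  obtain c where c: "a (Suc n) = Suc c" using a[of "Suc n"] by (cases "a (Suc n)") auto
  show ?thesis
  proof (rule that)
    show "incoming (es_diagram a) n 0 = 0 # (case n of 0 \<Rightarrow> replicate c 0 | Suc _ \<Rightarrow> replicate c 0 @ [1])"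
      using c by (cases n) (simp_all add: es_incoming)
    show "set (incoming (es_diagram a) n 0) = {..<length (dims (es_diagram a) n)}"
      using c by (cases n) (auto simp: es_incoming)
  qed
qed

lemma bratteli_map_nth:
  "l < length (dims B (Suc n)) \<Longrightarrow> bratteli_map B n b ! l = select (incoming B n l) b"
  by (simp add: bratteli_map_eq)

text \<open>The representation acts by the first summand of each level. The second summand is not
  seen at its own level, but it is a block of the first summand of the next one.\<close>

theorem effros_shen_rep:
  assumes a: "\<And>n. 1 \<le> a n"
  shows "\<exists>(H :: (nat \<Rightarrow> complex mat list) set hilbert) \<pi>. irreducible_rep (af_algebra (es_diagram a)) H \<pi> \<and>
    (\<forall>b\<in>carrier (af_algebra (es_diagram a)). \<pi> b = \<zero>\<^bsub>operator_alg H\<^esub> \<longleftrightarrow> b = \<zero>\<^bsub>af_algebra (es_diagram a)\<^esub>)"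
proof -
  let ?A = "\<lambda>n. multimatrix_alg (dims (es_diagram a) n)" and ?\<phi> = "bratteli_map (es_diagram a)"
  define d where "d = cf_denom a"
  define J where "J = (\<Union>n. {..<d n})"
  have d: "dims (es_diagram a) n ! 0 = d n" for n by (cases n) (simp_all add: d_def)
  have len: "0 < length (dims (es_diagram a) n)" for n by (cases n) simp_all
  have map0: "?\<phi> n b ! 0 = select (incoming (es_diagram a) n 0) b" for n b
    by (rule bratteli_map_nth[OF len])
  have lr: "limit_rep ?A ?\<phi> (model_space J) (\<lambda>j. {seq_embed (\<lambda>i. of_bool (i = j))}) J d (\<lambda>_ b. b ! 0)"
  proof (rule limit_rep.intro[OF es_system model_onb], rule limit_rep_axioms.intro)
    show "mono d" unfolding d_def by (rule incseq_SucI) (rule cf_denom_le[of a, OF a])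
    show "J = (\<Union>n. {..<d n})" by (rule J_def)
    fix n
    show "(\<lambda>b. b ! 0) \<in> contractive_hom (?A n) (matrix_alg (d n))"
      using nth_contractive[OF len] unfolding d .
    show "\<exists>b\<in>carrier (?A n). b ! 0 = Y \<and> nrm (?A n) b \<le> op_norm Y" if "Y \<in> carrier_mat (d n) (d n)" for Y
      using nth_lift[OF len, of Y] that unfolding d .
    fix b i j assume b: "b \<in> carrier (?A n)" and ij: "i < d (Suc n)" "j < d n"
    obtain ks where ks: "incoming (es_diagram a) n 0 = 0 # ks" by (rule es_nth_0[of a n, OF a])
    have b0: "b ! 0 \<in> carrier_mat (d n) (d n)" using multimatrix_nth[OF b len] unfolding d .
    have c: "?\<phi> n b ! 0 \<in> carrier_mat (d (Suc n)) (d (Suc n))"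
      using multimatrix_nth[OF contractive_hom_closed[OF star_system.hom[OF es_system] b] len] unfolding d .
    then have "dim_row (?\<phi> n b ! 0) = d (Suc n)" "dim_col (?\<phi> n b ! 0) = d (Suc n)" by auto
    then show "?\<phi> n b ! 0 $$ (i, j) = (if i < d n then b ! 0 $$ (i, j) else 0)"
      using ij b0 unfolding map0 ks select_Cons by (subst block_sum_index) auto
  qed
  show ?thesis
    unfolding af_algebra_def
  proof (rule exI, rule limit_rep.faithful_irreducible[OF lr])
    have "0 \<in> J" by (auto simp: J_def d_def intro!: exI[of _ 0])
    then show "J \<noteq> {}" by blast
    fix n b assume b: "b \<in> carrier (?A n)"
    have set: "set (incoming (es_diagram a) n 0) = {..<length (dims (es_diagram a) n)}"
      by (rule es_nth_0[of a n, OF a])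
    show "nrm (?A n) b \<le> op_norm (?\<phi> n b ! 0)"
      using select_op_norm_le_iff[OF b incoming_set op_norm_nonneg] multimatrix_nrm_le_iff[OF b] len[of n]
      unfolding map0 using set by (metis lessThan_iff length_greater_0_conv order_refl)
  qed
qed

section \<open>The stationary summand of \<open>pair_algebra\<close>\<close>

lemma op_norm_le_entries:
  assumes A: "A \<in> carrier_mat n m"
  shows "op_norm A \<le> (\<Sum>i<n. \<Sum>j<m. cmod (A $$ (i, j)))"
  by (rule op_norm_leI) (use A mult_mat_vec_bound[OF A] in \<open>auto intro!: sum_nonneg\<close>)

text \<open>The size \<open>d\<close> is fixed, so the norm is bounded by the finite sum of the
  entries and bounds each of them.\<close>

lemma op_norm_tendsto_zero_iff:
  assumes Y: "\<And>n. Y n \<in> carrier_mat d d"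
  shows "(\<lambda>n. op_norm (Y n)) \<longlonglongrightarrow> 0 \<longleftrightarrow> (\<forall>i<d. \<forall>j<d. (\<lambda>n. Y n $$ (i, j)) \<longlonglongrightarrow> 0)"
proof (intro iffI allI impI)
  fix i j assume lim: "(\<lambda>n. op_norm (Y n)) \<longlonglongrightarrow> 0" and ij: "i < d" "j < d"
  show "(\<lambda>n. Y n $$ (i, j)) \<longlonglongrightarrow> 0"
    by (rule Lim_null_comparison[OF _ lim], rule always_eventually, rule allI, rule op_norm_entry[OF Y ij])
next
  assume entries: "\<forall>i<d. \<forall>j<d. (\<lambda>n. Y n $$ (i, j)) \<longlonglongrightarrow> 0"
  have lim: "(\<lambda>n. \<Sum>i<d. \<Sum>j<d. cmod (Y n $$ (i, j))) \<longlonglongrightarrow> 0"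
    by (intro tendsto_null_sum tendsto_norm_zero) (use entries in auto)
  show "(\<lambda>n. op_norm (Y n)) \<longlonglongrightarrow> 0"
    by (rule Lim_null_comparison[OF _ lim], rule always_eventually, rule allI)
       (use op_norm_le_entries[OF Y] in \<open>simp\<close>)
qed

text \<open>The difference is a derived ring operation; it is handled through its characterisation
  by adding \<open>y\<close> back instead of a componentwise formula.\<close>

lemma multimatrix_nth_minus:
  assumes x: "x \<in> carrier (multimatrix_alg ds)" and y: "y \<in> carrier (multimatrix_alg ds)" and k: "k < length ds"
  shows "x \<ominus>\<^bsub>multimatrix_alg ds\<^esub> y \<in> carrier (multimatrix_alg ds)"
    and "x ! k = (x \<ominus>\<^bsub>multimatrix_alg ds\<^esub> y) ! k + y ! k"
    and "op_norm ((x \<ominus>\<^bsub>multimatrix_alg ds\<^esub> y) ! k) \<le> nrm (multimatrix_alg ds) (x \<ominus>\<^bsub>multimatrix_alg ds\<^esub> y)"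
proof -
  have "ds \<noteq> []" using k by auto
  then interpret normed_star_algebra "multimatrix_alg ds" by (rule multimatrix_normed)
  show d: "x \<ominus>\<^bsub>multimatrix_alg ds\<^esub> y \<in> carrier (multimatrix_alg ds)" by (rule minus_closed[OF x y])
  show "x ! k = (x \<ominus>\<^bsub>multimatrix_alg ds\<^esub> y) ! k + y ! k"
    using star_hom_add[OF contractive_hom_hom[OF nth_contractive[OF k]] d y] minus_add_cancel[OF x y] by simp
  show "op_norm ((x \<ominus>\<^bsub>multimatrix_alg ds\<^esub> y) ! k) \<le> nrm (multimatrix_alg ds) (x \<ominus>\<^bsub>multimatrix_alg ds\<^esub> y)"
    by (rule op_norm_le_multimatrix_nrm[OF d k])
qed

text \<open>Scaling by 0 determines the value at zero without ring axioms for the target.\<close>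

lemma star_hom_matrix_zero:
  assumes "star_algebra A" "t \<in> star_hom A (matrix_alg d)"
  shows "t \<zero>\<^bsub>A\<^esub> = 0\<^sub>m d d"
proof -
  interpret star_algebra A by (rule assms(1))
  have c: "t \<zero>\<^bsub>A\<^esub> \<in> carrier_mat d d" using star_hom_closed[OF assms(2) zero_closed] by simp
  have "t \<zero>\<^bsub>A\<^esub> = t (0 \<odot>\<^bsub>A\<^esub> \<zero>\<^bsub>A\<^esub>)" by simp
  also have "\<dots> = 0 \<cdot>\<^sub>m t \<zero>\<^bsub>A\<^esub>" using star_hom_smult[OF assms(2) zero_closed, of 0] unfolding matrix_alg_simps .
  also have "\<dots> = 0\<^sub>m d d" using c by (intro eq_matI) auto
  finally show ?thesis .
qed

abbreviation pair_level :: "nat \<Rightarrow> nat \<Rightarrow> nat \<Rightarrow> complex mat list star_alg" where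
  "pair_level q q' n \<equiv> multimatrix_alg (dims (pair_diagram q q') n)"

abbreviation pair_map :: "nat \<Rightarrow> nat \<Rightarrow> nat \<Rightarrow> complex mat list \<Rightarrow> complex mat list" where
  "pair_map q q' \<equiv> bratteli_map (pair_diagram q q')"

lemma pair_connect_nth_0: "connect (pair_map q q') m n b ! 0 = b ! 0"
  by (induction n) (simp_all add: pair_map_nth)

lemma pair_nth:
  assumes "b \<in> carrier (pair_level q q' n)"
  shows "b ! 0 \<in> carrier_mat q q" "b ! 1 \<in> carrier_mat (q' + n * q) (q' + n * q)"
  using multimatrix_nth[OF assms, of 0] multimatrix_nth[OF assms, of 1] by simp_all

text \<open>The connecting maps leave the first summand alone, so along a Cauchy sequence its
  entries are ordinary Cauchy sequences and \<open>lim\<close> exists; see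
  \<open>corner_tends\<close>.\<close>

definition corner :: "nat \<Rightarrow> (nat \<Rightarrow> complex mat list) \<Rightarrow> complex mat" where
  "corner q x = mat q q (\<lambda>(i, j). lim (\<lambda>n. x n ! 0 $$ (i, j)))"

lemma corner_carrier: "corner q x \<in> carrier_mat q q"
  by (simp add: corner_def)

lemma corner_tends:
  assumes x: "x \<in> cauchy_seqs (pair_level q q') (pair_map q q')" and ij: "i < q" "j < q"
  shows "(\<lambda>n. x n ! 0 $$ (i, j)) \<longlonglongrightarrow> corner q x $$ (i, j)"
proof -
  note cx = star_system.cauchy_closed[OF pair_system x]
  have "Cauchy (\<lambda>n. x n ! 0 $$ (i, j))"
    unfolding Cauchy_altdef2
  proof (intro allI impI)
    fix \<epsilon> :: real assume "0 < \<epsilon>"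
    obtain N where N: "\<And>n. N \<le> n \<Longrightarrow>
        nrm (pair_level q q' n) (x n \<ominus>\<^bsub>pair_level q q' n\<^esub> connect (pair_map q q') N n (x N)) < \<epsilon>"
      using star_system.cauchyD[OF pair_system x \<open>0 < \<epsilon>\<close>] by blast
    have "dist (x n ! 0 $$ (i, j)) (x N ! 0 $$ (i, j)) < \<epsilon>" if n: "N \<le> n" for n
    proof -
      let ?y = "connect (pair_map q q') N n (x N)"
      have y: "?y \<in> carrier (pair_level q q' n)" by (rule star_system.connect_closed[OF pair_system n cx])
      note D = multimatrix_nth_minus[OF cx[of n] y, of 0, simplified]
      note Dc = pair_nth(1)[OF D(1)[folded pair_dims[of q q' n]]]
      have "x n ! 0 $$ (i, j) - x N ! 0 $$ (i, j) = (x n \<ominus>\<^bsub>pair_level q q' n\<^esub> ?y) ! 0 $$ (i, j)"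
        using D(2) Dc pair_nth(1)[OF y] ij by (simp add: pair_connect_nth_0)
      moreover have "cmod ((x n \<ominus>\<^bsub>pair_level q q' n\<^esub> ?y) ! 0 $$ (i, j)) < \<epsilon>"
        using op_norm_entry[OF Dc ij] D(3) N[OF n] by simp
      ultimately show ?thesis by (simp add: dist_norm)
    qed
    then show "\<exists>N. \<forall>n\<ge>N. dist (x n ! 0 $$ (i, j)) (x N ! 0 $$ (i, j)) < \<epsilon>" by blast
  qed
  then show ?thesis using ij by (simp add: corner_def Cauchy_convergent_iff convergent_LIMSEQ_iff)
qed

lemma corner_eqI:
  assumes x: "x \<in> cauchy_seqs (pair_level q q') (pair_map q q')" and Y: "Y \<in> carrier_mat q q"
    and lim: "\<And>i j. i < q \<Longrightarrow> j < q \<Longrightarrow> (\<lambda>n. x n ! 0 $$ (i, j)) \<longlonglongrightarrow> Y $$ (i, j)"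
  shows "corner q x = Y"
proof (rule eq_matI)
  fix i j assume "i < dim_row Y" "j < dim_col Y"
  then have ij: "i < q" "j < q" using Y by auto
  show "corner q x $$ (i, j) = Y $$ (i, j)" by (rule LIMSEQ_unique[OF corner_tends[OF x ij] lim[OF ij]])
qed (use Y in \<open>simp_all add: corner_def\<close>)

lemma corner_hom: "corner q \<in> star_hom (cauchy_alg (pair_level q q') (pair_map q q')) (matrix_alg q)"
proof (rule star_homI, unfold cauchy_alg_simps matrix_alg_simps bounded_prod_simps)
  note sys = pair_system[of q q']
  note closed = star_system.cauchy_closed[OF sys]
  note c = pair_nth(1)[OF closed]
  note cc = corner_carrier
  note dims = carrier_matD[OF c] carrier_matD[OF cc]
  show "corner q x \<in> carrier_mat q q" for x by (rule corner_carrier)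
  have nth: "0 < length (dims (pair_diagram q q') n)" for n by simp
  note h = contractive_hom_hom[OF nth_contractive[OF nth]]
  fix x assume x: "x \<in> cauchy_seqs (pair_level q q') (pair_map q q')"
  note tx = corner_tends[OF x]
  show "corner q (\<lambda>n. a \<odot>\<^bsub>pair_level q q' n\<^esub> x n) = a \<cdot>\<^sub>m corner q x" for a
  proof (rule corner_eqI[OF star_system.cauchy_smult[OF sys x, unfolded bounded_prod_simps]])
    show "(\<lambda>n. (a \<odot>\<^bsub>pair_level q q' n\<^esub> x n) ! 0 $$ (i, j)) \<longlonglongrightarrow> (a \<cdot>\<^sub>m corner q x) $$ (i, j)" if "i < q" "j < q" for i j
      using that tendsto_mult_left[OF tx[OF that], of a] dims(1,2)[OF x] dims(3,4) star_hom_smult[OF h closed[OF x], of _ a]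
      by (simp del: pair_dims)
  qed (simp add: cc)
  show "corner q (\<lambda>n. star (pair_level q q' n) (x n)) = mat_adjoint (corner q x)"
  proof (rule corner_eqI[OF star_system.cauchy_star[OF sys x, unfolded bounded_prod_simps]])
    show "(\<lambda>n. star (pair_level q q' n) (x n) ! 0 $$ (i, j)) \<longlonglongrightarrow> mat_adjoint (corner q x) $$ (i, j)" if "i < q" "j < q" for i j
      using that tendsto_cnj[OF tx[OF that(2,1)]] dims(1,2)[OF x] dims(3,4) star_hom_star[OF h closed[OF x]]
      by (simp del: pair_dims)
  qed (simp add: cc)
  fix y assume y: "y \<in> cauchy_seqs (pair_level q q') (pair_map q q')"
  note ty = corner_tends[OF y]
  show "corner q (\<lambda>n. x n \<oplus>\<^bsub>pair_level q q' n\<^esub> y n) = corner q x + corner q y"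
  proof (rule corner_eqI[OF star_system.cauchy_add[OF sys x y, unfolded bounded_prod_simps]])
    show "(\<lambda>n. (x n \<oplus>\<^bsub>pair_level q q' n\<^esub> y n) ! 0 $$ (i, j)) \<longlonglongrightarrow> (corner q x + corner q y) $$ (i, j)" if "i < q" "j < q" for i j
      using that tendsto_add[OF tx[OF that] ty[OF that]] dims(1,2)[OF x] dims(1,2)[OF y] dims(3,4)
        star_hom_add[OF h closed[OF x] closed[OF y]] by (simp del: pair_dims)
  qed (simp add: cc)
  show "corner q (\<lambda>n. x n \<otimes>\<^bsub>pair_level q q' n\<^esub> y n) = corner q x * corner q y"
  proof (rule corner_eqI[OF star_system.cauchy_mult[OF sys x y, unfolded bounded_prod_simps]])
    show "corner q x * corner q y \<in> carrier_mat q q" by (rule mult_carrier_mat[OF cc cc])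
    fix i j assume ij: "i < q" "j < q"
    have "(\<lambda>n. \<Sum>k<q. x n ! 0 $$ (i, k) * y n ! 0 $$ (k, j)) \<longlonglongrightarrow> (\<Sum>k<q. corner q x $$ (i, k) * corner q y $$ (k, j))"
      using ij by (intro tendsto_sum tendsto_mult tx ty) auto
    moreover have entry: "(Y * Z) $$ (i, j) = (\<Sum>k<q. Y $$ (i, k) * Z $$ (k, j))"
      if "Y \<in> carrier_mat q q" "Z \<in> carrier_mat q q" for Y Z :: "complex mat"
      using that ij by (auto simp: times_mat_def scalar_prod_def lessThan_atLeast0 intro!: sum.cong)
    ultimately show "(\<lambda>n. (x n \<otimes>\<^bsub>pair_level q q' n\<^esub> y n) ! 0 $$ (i, j)) \<longlonglongrightarrow> (corner q x * corner q y) $$ (i, j)"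
      using star_hom_mult[OF h closed[OF x] closed[OF y]] by (simp add: entry c[OF x] c[OF y] cc del: pair_dims)
  qed
next
  note sys = pair_system[of q q']
  show "corner q (\<lambda>n. \<one>\<^bsub>pair_level q q' n\<^esub>) = 1\<^sub>m q"
    by (rule corner_eqI[OF star_system.cauchy_one[OF sys, unfolded bounded_prod_simps]]) (simp_all add: multimatrix_simps)
qed

lemma corner_null:
  assumes x: "x \<in> cauchy_seqs (pair_level q q') (pair_map q q')" and y: "y \<in> cauchy_seqs (pair_level q q') (pair_map q q')"
    and null: "(\<lambda>n. nrm (pair_level q q' n) (x n \<ominus>\<^bsub>pair_level q q' n\<^esub> y n)) \<longlonglongrightarrow> 0"
  shows "corner q x = corner q y"
proof (rule corner_eqI[OF x corner_carrier])
  note closed = star_system.cauchy_closed[OF pair_system]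
  fix i j assume ij: "i < q" "j < q"
  note D = multimatrix_nth_minus[OF closed[OF x] closed[OF y], of 0 _, simplified]
  have Dc: "(x n \<ominus>\<^bsub>pair_level q q' n\<^esub> y n) ! 0 \<in> carrier_mat q q" for n
    by (rule pair_nth(1)[of _ q q' n]) (simp add: D(1))
  have "(\<lambda>n. (x n \<ominus>\<^bsub>pair_level q q' n\<^esub> y n) ! 0 $$ (i, j)) \<longlonglongrightarrow> 0"
    by (rule Lim_null_comparison[OF _ null], rule always_eventually, rule allI,
        rule order_trans[OF op_norm_entry[OF Dc ij]]) (simp add: D(3))
  from tendsto_add[OF this corner_tends[OF y ij]]
  have lim: "(\<lambda>n. (x n \<ominus>\<^bsub>pair_level q q' n\<^esub> y n) ! 0 $$ (i, j) + y n ! 0 $$ (i, j)) \<longlonglongrightarrow> corner q y $$ (i, j)"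
    unfolding add_0_left .
  have eq: "x n ! 0 $$ (i, j) = (x n \<ominus>\<^bsub>pair_level q q' n\<^esub> y n) ! 0 $$ (i, j) + y n ! 0 $$ (i, j)" for n
    using D(2)[of n] Dc[of n] pair_nth(1)[OF closed[OF y], of n] ij by simp
  show "(\<lambda>n. x n ! 0 $$ (i, j)) \<longlonglongrightarrow> corner q y $$ (i, j)" unfolding eq by (rule lim)
qed

lemma matrix_alg_1_complex: "matrix_alg 1 \<simeq>\<^sub>* complex_alg"
  unfolding star_isomorphic_def
proof (intro bexI)
  show "(\<lambda>Y. Y $$ (0, 0)) \<in> star_hom (matrix_alg 1) complex_alg"
    by (rule star_homI) (simp_all add: complex_alg_def scalar_prod_def)
  show "bij_betw (\<lambda>Y. Y $$ (0, 0)) (carrier (matrix_alg 1)) (carrier complex_alg)"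
  proof (rule bij_betwI[of _ _ _ "\<lambda>c. mat 1 1 (\<lambda>_. c)"])
    show "mat 1 1 (\<lambda>_. Y $$ (0, 0)) = Y" if "Y \<in> carrier (matrix_alg 1)" for Y
      using that by (intro eq_matI) auto
  qed (auto simp: complex_alg_def)
qed

text \<open>Reversing the basis turns \<open>(x, y) \<mapsto> diag(x, y)\<close> into \<open>y \<mapsto> diag(y, x)\<close>, which extends \<open>y\<close> in the sense of
  \<open>limit_rep\<close>.\<close>

definition flip :: "nat \<Rightarrow> nat \<Rightarrow> nat" where
  "flip d i = (if i < d then d - 1 - i else i)"

lemma flip_permutes: "flip d permutes {..<d}"
  by (rule permutes_lessI[of d "flip d" "flip d"]) (auto simp: flip_def)

lemma perm_mat_flip_flip:
  assumes "A \<in> carrier_mat d d" shows "perm_mat (flip d) (perm_mat (flip d) A) = A"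
proof -
  have "flip d \<circ> flip d = id" by (auto simp: flip_def)
  then show ?thesis using perm_mat_comp[OF flip_permutes assms, of "flip d"] by simp
qed

lemma perm_mat_flip_block_sum:
  assumes "A \<in> carrier_mat n n" "B \<in> carrier_mat m m"
  shows "perm_mat (flip (n + m)) (block_sum A B) = block_sum (perm_mat (flip m) B) (perm_mat (flip n) A)"
proof (rule eq_matI)
  fix i j assume "i < dim_row (block_sum (perm_mat (flip m) B) (perm_mat (flip n) A))"
    "j < dim_col (block_sum (perm_mat (flip m) B) (perm_mat (flip n) A))"
  then have ij: "i < m + n" "j < m + n" using assms by auto
  then have f: "flip (n + m) i < n + m" "flip (n + m) j < n + m" by (auto simp: flip_def)
  have idx: "n - Suc (i - m) = n + m - Suc i" "n - Suc (j - m) = n + m - Suc j" if "m \<le> i" "m \<le> j" for i j :: nat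
    using that by auto
  show "perm_mat (flip (n + m)) (block_sum A B) $$ (i, j)
      = block_sum (perm_mat (flip m) B) (perm_mat (flip n) A) $$ (i, j)"
    using ij f assms by (auto simp: flip_def)
qed (use assms in auto)

definition tail_rep :: "nat \<Rightarrow> nat \<Rightarrow> nat \<Rightarrow> complex mat list \<Rightarrow> complex mat" where
  "tail_rep q q' n b = perm_mat (flip (q' + n * q)) (b ! 1)"

lemma tail_rep_map:
  assumes "b \<in> carrier (pair_level q q' n)"
  shows "tail_rep q q' (Suc n) (pair_map q q' n b) = block_sum (tail_rep q q' n b) (perm_mat (flip q) (b ! 0))"
  using perm_mat_flip_block_sum[OF pair_nth[OF assms]] pair_map_nth[of q q' n b]
  by (simp add: tail_rep_def ac_simps)

lemma tail_limit_rep: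
  assumes "onb_space H e (\<Union>n. {..<q' + n * q})"
  shows "limit_rep (pair_level q q') (pair_map q q') H e (\<Union>n. {..<q' + n * q}) (\<lambda>n. q' + n * q) (tail_rep q q')"
proof (rule limit_rep.intro[OF pair_system assms], rule limit_rep_axioms.intro)
  show "mono (\<lambda>n. q' + n * q)" by (rule monoI) simp
  fix n
  let ?d = "q' + n * q"
  have len: "1 < length (dims (pair_diagram q q') n)" and nth: "dims (pair_diagram q q') n ! 1 = ?d" by simp_all
  have "perm_mat (flip ?d) \<circ> (\<lambda>b. b ! 1) \<in> contractive_hom (pair_level q q' n) (matrix_alg ?d)"
    using contractive_hom_comp[OF nth_contractive[OF len], unfolded nth, OF perm_mat_hom[OF flip_permutes]] .
  moreover have "perm_mat (flip ?d) \<circ> (\<lambda>b. b ! 1) = tail_rep q q' n" by (auto simp: tail_rep_def)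
  ultimately show "tail_rep q q' n \<in> contractive_hom (pair_level q q' n) (matrix_alg ?d)" by simp
  show "\<exists>b\<in>carrier (pair_level q q' n). tail_rep q q' n b = Y \<and> nrm (pair_level q q' n) b \<le> op_norm Y"
    if Y: "Y \<in> carrier_mat ?d ?d" for Y
  proof -
    have "\<exists>b\<in>carrier (pair_level q q' n). b ! 1 = perm_mat (flip ?d) Y \<and> nrm (pair_level q q' n) b \<le> op_norm (perm_mat (flip ?d) Y)"
      using nth_lift[OF len, unfolded nth, of "perm_mat (flip ?d) Y"] Y by simp
    then show ?thesis
      unfolding op_norm_perm_mat[OF flip_permutes Y] tail_rep_def using perm_mat_flip_flip[OF Y] by metis
  qed
  fix b i j assume b: "b \<in> carrier (pair_level q q' n)" and ij: "i < q' + Suc n * q" "j < ?d"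
  show "tail_rep q q' (Suc n) (pair_map q q' n b) $$ (i, j) = (if i < ?d then tail_rep q q' n b $$ (i, j) else 0)"
    unfolding tail_rep_map[OF b] using ij pair_nth[OF b] by (simp add: tail_rep_def)
qed (rule refl)

text \<open>Both summands of level \<open>n\<close> are, up to reordering, blocks of the second
  summand of level \<open>n + 1\<close>.\<close>

lemma tail_faithful:
  assumes b: "b \<in> carrier (pair_level q q' n)"
  shows "nrm (pair_level q q' n) b \<le> op_norm (tail_rep q q' (Suc n) (pair_map q q' n b))"
proof -
  note c = pair_nth[OF b]
  have t: "tail_rep q q' n b \<in> carrier_mat (q' + n * q) (q' + n * q)"
    and t0: "perm_mat (flip q) (b ! 0) \<in> carrier_mat q q" using c by (simp_all add: tail_rep_def)
  have "op_norm (b ! 1) = op_norm (tail_rep q q' n b)" "op_norm (b ! 0) = op_norm (perm_mat (flip q) (b ! 0))"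
    unfolding tail_rep_def by (simp_all only: op_norm_perm_mat[OF flip_permutes c(1)] op_norm_perm_mat[OF flip_permutes c(2)])
  then have "op_norm (b ! k) \<le> op_norm (tail_rep q q' (Suc n) (pair_map q q' n b))" if "k < 2" for k
    using iffD1[OF op_norm_block_sum_le_iff[OF t t0 op_norm_nonneg] order_refl] less_2_cases[OF that]
    unfolding tail_rep_map[OF b] by auto
  then show ?thesis by (subst multimatrix_nrm_le_iff[OF b]) (simp_all add: numeral_2_eq_2)
qed

section \<open>Compact operators and finite sections\<close>

text \<open>Balls of a finite-dimensional space are totally bounded: the net consists of all vectors
  with entries from a finite net of a disc.\<close>

lemma vec_net:
  assumes "0 < \<epsilon>"
  shows "\<exists>K. finite K \<and> K \<subseteq> carrier_vec n \<and> (\<forall>v\<in>carrier_vec n. l2_norm v \<le> C \<longrightarrow> (\<exists>w\<in>K. l2_norm (v - w) < \<epsilon>))"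
proof -
  \<comment> \<open>The norm is estimated by the sum of the \<open>n\<close> coordinate errors;
    adding 1 covers \<open>n = 0\<close> and makes the inequality strict.\<close>
  define \<delta> where "\<delta> = \<epsilon> / (real n + 1)"
  have "0 < \<delta>" using assms by (simp add: \<delta>_def)
  then obtain F where F: "finite F" "cball 0 C \<subseteq> (\<Union>z\<in>F. ball (z :: complex) \<delta>)"
    using compact_cball[of "0 :: complex" C] unfolding compact_eq_totally_bounded by blast
  let ?K = "Matrix.vec n ` PiE {..<n} (\<lambda>_. F)"
  have "\<exists>w\<in>?K. l2_norm (v - w) < \<epsilon>" if v: "v \<in> carrier_vec n" "l2_norm v \<le> C" for v
  proof -
    have "\<exists>z\<in>F. dist z (v $ i) < \<delta>" if "i < n" for i
    proof -
      have "v $ i \<in> cball 0 C" using l2_norm_entry[of i v] v that by simp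
      then have "v $ i \<in> (\<Union>z\<in>F. ball z \<delta>)" using F(2) by blast
      then show ?thesis by simp
    qed
    then obtain g where g: "\<And>i. i < n \<Longrightarrow> g i \<in> F" "\<And>i. i < n \<Longrightarrow> dist (g i) (v $ i) < \<delta>" by metis
    let ?w = "Matrix.vec n (restrict g {..<n})"
    have "?w \<in> ?K" by (rule imageI, rule PiE_I) (simp_all add: g(1))
    moreover have "l2_norm (v - ?w) \<le> (\<Sum>i<n. cmod ((v - ?w) $ i))"
      using v unfolding l2_norm_L2_set by (auto intro!: order_trans[OF L2_set_le_sum])
    moreover have "(\<Sum>i<n. cmod ((v - ?w) $ i)) \<le> (\<Sum>i<n. \<delta>)"
      using v g(2) by (intro sum_mono) (simp add: dist_norm norm_minus_commute less_imp_le)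
    moreover have "(\<Sum>i<n. \<delta>) < \<epsilon>" using assms by (simp add: \<delta>_def field_simps)
    ultimately show ?thesis by (meson order_le_less_trans)
  qed
  note net = this
  show ?thesis
  proof (intro exI conjI ballI impI)
    show "finite ?K" by (intro finite_imageI finite_PiE F(1)) simp
    show "?K \<subseteq> carrier_vec n" by (rule image_subsetI) simp
  qed (rule net)
qed

context hilbert_space
begin

lemma bounded_op_minus:
  assumes T: "T \<in> bounded_operators H" and x: "x \<in> carrier H" and y: "y \<in> carrier H"
  shows "T (x \<ominus>\<^bsub>H\<^esub> y) = T x \<ominus>\<^bsub>H\<^esub> T y"
proof -
  have d: "x \<ominus>\<^bsub>H\<^esub> y \<in> carrier H" by (rule M.minus_closed[OF x y])
  note c = bounded_operatorsD(2)[OF T]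
  have "T x = T (x \<ominus>\<^bsub>H\<^esub> y) \<oplus>\<^bsub>H\<^esub> T y"
    using bounded_operatorsD(3)[OF T d y] unfolding h_minus_add_cancel[OF x y] .
  then show ?thesis using h_add_minus_cancel[OF c[OF d] c[OF y]] by simp
qed

text \<open>Extends a bound on the unit ball by homogeneity. If the norm of \<open>x\<close> is 0,
  all multiples lie in the ball, and a positive \<open>g x\<close> would grow beyond
  \<epsilon>.\<close>

lemma ball_scale:
  assumes x: "x \<in> carrier H" and g: "\<And>c. g (c \<odot>\<^bsub>H\<^esub> x) = cmod c * g x"
    and le: "\<And>c. hnorm H (c \<odot>\<^bsub>H\<^esub> x) \<le> 1 \<Longrightarrow> g (c \<odot>\<^bsub>H\<^esub> x) \<le> \<epsilon>"
  shows "g x \<le> \<epsilon> * hnorm H x"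
proof (cases "hnorm H x = 0")
  case True
  have "c * g x \<le> \<epsilon>" if "0 \<le> c" for c
    using le[of "complex_of_real c"] g[of "complex_of_real c"] hnorm_smult[OF x, of "complex_of_real c"] True that by simp
  note bound = this
  show ?thesis
  proof (rule ccontr)
    assume "\<not> ?thesis"
    then have "0 < g x" using True by simp
    then have "(\<bar>\<epsilon>\<bar> + 1) / g x * g x \<le> \<epsilon>" by (intro bound) simp
    then show False using \<open>0 < g x\<close> by simp
  qed
next
  case False
  then have pos: "0 < hnorm H x" using hnorm_nonneg[OF x] by linarith
  define c where "c = complex_of_real (inverse (hnorm H x))"
  have c: "cmod c = inverse (hnorm H x)" using pos unfolding c_def norm_of_real by simp
  have "inverse (hnorm H x) * g x \<le> \<epsilon>"
    using le[of c] unfolding g hnorm_smult[OF x] c using pos by simp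
  then show ?thesis using pos by (simp add: field_simps)
qed

text \<open>In a complete space relatively compact and totally bounded sets coincide; finite nets
  are what the estimates below produce and consume.\<close>

lemma compact_operator_iff:
  "T \<in> compact_operators H \<longleftrightarrow> T \<in> bounded_operators H \<and> hm.mtotally_bounded (T ` {x \<in> carrier H. hnorm H x \<le> 1})"
proof (cases "T \<in> bounded_operators H")
  case True
  then have sub: "T ` {x \<in> carrier H. hnorm H x \<le> 1} \<subseteq> carrier H" using bounded_operatorsD(2) by blast
  show ?thesis
    unfolding compact_operators_def mem_Collect_eq hm.mtotally_bounded_eq_compact_closure_of[OF complete]
    by (simp only: True sub simp_thms)
qed (simp only: compact_operators_def mem_Collect_eq simp_thms)

end

context onb_space
begin

abbreviation P :: "nat \<Rightarrow> 'h \<Rightarrow> 'h" where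
  "P n \<xi> \<equiv> synth (coords n \<xi>)"

lemma additive_finsum:
  fixes f :: "'h \<Rightarrow> complex"
  assumes add: "\<And>x y. x \<in> carrier H \<Longrightarrow> y \<in> carrier H \<Longrightarrow> f (x \<oplus>\<^bsub>H\<^esub> y) = f x + f y"
    and smult: "\<And>c x. x \<in> carrier H \<Longrightarrow> f (c \<odot>\<^bsub>H\<^esub> x) = c * f x"
    and n: "{..<n} \<subseteq> J" and v: "v \<in> carrier_vec n"
  shows "f (synth v) = (\<Sum>i<n. v $ i * f (e i))"
proof -
  have zero: "f \<zero>\<^bsub>H\<^esub> = 0" using add[OF M.zero_closed M.zero_closed] by simp
  have "f (finsum H (\<lambda>i. v $ i \<odot>\<^bsub>H\<^esub> e i) F) = (\<Sum>i\<in>F. v $ i * f (e i))" if "finite F" "F \<subseteq> J" for F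
    using that
  proof (induction F rule: finite_induct)
    case (insert i F)
    have c: "v $ i \<odot>\<^bsub>H\<^esub> e i \<in> carrier H" "e i \<in> carrier H" "(\<lambda>i. v $ i \<odot>\<^bsub>H\<^esub> e i) \<in> F \<rightarrow> carrier H"
      using insert.prems e_closed by auto
    have "finsum H (\<lambda>i. v $ i \<odot>\<^bsub>H\<^esub> e i) (insert i F) = v $ i \<odot>\<^bsub>H\<^esub> e i \<oplus>\<^bsub>H\<^esub> finsum H (\<lambda>i. v $ i \<odot>\<^bsub>H\<^esub> e i) F"
      using insert.hyps c by (simp add: M.finsum_insert)
    then show ?case
      using insert c add[OF c(1) M.finsum_closed[OF c(3)]] smult[OF c(2)] by simp
  qed (simp add: zero)
  from this[of "{..<n}"] n v show ?thesis by (simp add: synth_def)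
qed

text \<open>Boundedness of \<open>f\<close> bounds \<open>\<Sum>\<bar>f(e\<^sub>j)\<bar>\<^sup>2\<close>, so its tails are small; this replaces the Riesz representation of \<open>f\<close>.\<close>

lemma functional_tail:
  fixes f :: "'h \<Rightarrow> complex"
  assumes add: "\<And>x y. x \<in> carrier H \<Longrightarrow> y \<in> carrier H \<Longrightarrow> f (x \<oplus>\<^bsub>H\<^esub> y) = f x + f y"
    and smult: "\<And>c x. x \<in> carrier H \<Longrightarrow> f (c \<odot>\<^bsub>H\<^esub> x) = c * f x"
    and bound: "\<And>x. x \<in> carrier H \<Longrightarrow> cmod (f x) \<le> C * hnorm H x" and "0 \<le> C"
    and J: "J = UNIV" and "0 < \<epsilon>"
  shows "\<forall>\<^sub>F n in sequentially. \<forall>\<xi>\<in>carrier H. P n \<xi> = \<zero>\<^bsub>H\<^esub> \<longrightarrow> cmod (f \<xi>) \<le> \<epsilon> * hnorm H \<xi>"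
proof -
  have n: "{..<n} \<subseteq> J" for n using J by simp
  have fsum: "f (synth v) = (\<Sum>i<n. v $ i * f (e i))" if "v \<in> carrier_vec n" for v n
    by (rule additive_finsum[OF _ _ n that]) (simp_all add: add smult)
  have "(\<Sum>j<n. (cmod (f (e j)))\<^sup>2) \<le> C\<^sup>2" for n
  proof -
    define s where "s = (\<Sum>j<n. (cmod (f (e j)))\<^sup>2)"
    \<comment> \<open>Testing \<open>f\<close> on this vector gives the sum \<open>s\<close> of
      squares itself, while the vector has norm \<open>sqrt s\<close>; hence
      \<open>s \<le> C * sqrt s\<close>.\<close>
    define v where "v = Matrix.vec n (\<lambda>j. cnj (f (e j)))"
    have v: "v \<in> carrier_vec n" by (simp add: v_def)
    have "0 \<le> s" by (simp add: s_def sum_nonneg)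
    have "l2_norm v = sqrt s" by (simp add: l2_norm_def v_def s_def)
    moreover have "f (synth v) = complex_of_real s"
    proof -
      have "f (synth v) = (\<Sum>j<n. cnj (f (e j)) * f (e j))" using fsum[OF v] by (simp add: v_def)
      also have "\<dots> = (\<Sum>j<n. complex_of_real ((cmod (f (e j)))\<^sup>2))"
        by (intro sum.cong refl) (simp only: complex_norm_square mult.commute)
      finally show ?thesis by (simp only: s_def of_real_sum)
    qed
    ultimately have "s \<le> C * sqrt s"
      using bound[OF synth_closed[OF n v]] hnorm_synth[OF n v] \<open>0 \<le> s\<close> by simp
    then have le: "sqrt s * sqrt s \<le> C * sqrt s" using \<open>0 \<le> s\<close> by simp
    have "sqrt s \<le> C"
    proof (cases "s = 0")
      case False
      then have "0 < sqrt s" using \<open>0 \<le> s\<close> by simp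
      then show ?thesis by (rule mult_right_le_imp_le[OF le])
    qed (use \<open>0 \<le> C\<close> in simp)
    then have "(sqrt s)\<^sup>2 \<le> C\<^sup>2" using \<open>0 \<le> s\<close> by (intro power_mono) simp_all
    then show ?thesis using \<open>0 \<le> s\<close> by (simp add: s_def)
  qed
  then have "summable (\<lambda>j. (cmod (f (e j)))\<^sup>2)" by (intro summableI_nonneg_bounded) auto
  then obtain N where N: "\<And>m n. N \<le> m \<Longrightarrow> norm (\<Sum>j=m..<n. (cmod (f (e j)))\<^sup>2) < \<epsilon>\<^sup>2"
    unfolding summable_Cauchy using zero_less_power[OF \<open>0 < \<epsilon>\<close>, of 2] by blast
  have "cmod (f \<xi>) \<le> \<epsilon> * hnorm H \<xi>" if "N \<le> n" and \<xi>: "\<xi> \<in> carrier H" and P0: "P n \<xi> = \<zero>\<^bsub>H\<^esub>" for n \<xi>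
  proof -
    have ip0: "ip H (e i) \<xi> = 0" if "i < n" for i
      using coord_synth[OF n[of n] coords_carrier(1), of i \<xi>] that J P0 e_closed[of i] by simp
    have P: "cmod (f (P m \<xi>)) \<le> \<epsilon> * hnorm H \<xi>" for m
    proof -
      have "f (P m \<xi>) = (\<Sum>i<m. ip H (e i) \<xi> * f (e i))"
        unfolding fsum[OF coords_carrier(1)] by (intro sum.cong) auto
      also have "\<dots> = (\<Sum>i=n..<m. ip H (e i) \<xi> * f (e i))"
        using ip0 by (intro sum.mono_neutral_right) (auto simp: not_le)
      finally have "cmod (f (P m \<xi>)) \<le> (\<Sum>i=n..<m. \<bar>cmod (ip H (e i) \<xi>)\<bar> * \<bar>cmod (f (e i))\<bar>)"
        by (auto simp: norm_mult intro!: order_trans[OF norm_sum])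
      also have "\<dots> \<le> L2_set (\<lambda>i. cmod (ip H (e i) \<xi>)) {n..<m} * L2_set (\<lambda>i. cmod (f (e i))) {n..<m}"
        by (rule L2_set_mult_ineq)
      also have "\<dots> \<le> hnorm H \<xi> * \<epsilon>"
      proof (intro mult_mono)
        have "L2_set (\<lambda>i. cmod (ip H (e i) \<xi>)) {n..<m} \<le> l2_norm (coords m \<xi>)"
          unfolding l2_norm_def L2_set_def by (simp, intro sum_mono2) auto
        then show "L2_set (\<lambda>i. cmod (ip H (e i) \<xi>)) {n..<m} \<le> hnorm H \<xi>"
          using bessel[OF n \<xi>, of m] by linarith
        show "L2_set (\<lambda>i. cmod (f (e i))) {n..<m} \<le> \<epsilon>"
          unfolding L2_set_def using N[OF \<open>N \<le> n\<close>, of m] \<open>0 < \<epsilon>\<close>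
          by (intro real_le_lsqrt) (simp_all add: sum_nonneg less_imp_le)
      qed (use \<xi> in \<open>simp_all add: L2_set_nonneg\<close>)
      finally show ?thesis by (simp add: mult.commute)
    qed
    have pc: "P m \<xi> \<in> carrier H" for m by (rule synth_closed[OF n coords_carrier(1)])
    \<comment> \<open>The estimate for \<open>P m \<xi>\<close> does not depend on \<open>m\<close>,
      so it passes to \<xi> by boundedness of \<open>f\<close>.\<close>
    have "cmod (f \<xi>) \<le> C * hnorm H (P m \<xi> \<ominus>\<^bsub>H\<^esub> \<xi>) + \<epsilon> * hnorm H \<xi>" for m
    proof -
      have d: "\<xi> \<ominus>\<^bsub>H\<^esub> P m \<xi> \<in> carrier H" by (rule M.minus_closed[OF \<xi> pc])
      have "f \<xi> = f (\<xi> \<ominus>\<^bsub>H\<^esub> P m \<xi>) + f (P m \<xi>)"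
        using add[OF d pc[of m]] unfolding h_minus_add_cancel[OF \<xi> pc] .
      then show ?thesis
        using norm_triangle_ineq[of "f (\<xi> \<ominus>\<^bsub>H\<^esub> P m \<xi>)" "f (P m \<xi>)"] bound[OF d] P[of m]
          hnorm_minus_commute[OF \<xi> pc[of m]] by simp
    qed
    moreover have "(\<lambda>m. C * hnorm H (P m \<xi> \<ominus>\<^bsub>H\<^esub> \<xi>) + \<epsilon> * hnorm H \<xi>) \<longlonglongrightarrow> C * 0 + \<epsilon> * hnorm H \<xi>"
      using proj_tends[OF \<xi>, of "\<lambda>m. m"] J by (intro tendsto_intros tendsD(3)) (auto intro: monoI)
    ultimately show ?thesis using LIMSEQ_le_const by fastforce
  qed
  then show ?thesis unfolding eventually_sequentially by blast
qed

end

lemma (in hilbert_space) sm_zero: "c \<odot>\<^bsub>H\<^esub> \<zero>\<^bsub>H\<^esub> = \<zero>\<^bsub>H\<^esub>"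
  using hnorm_smult[OF M.zero_closed, of c] hnorm_eq_zero[OF sm_closed[OF M.zero_closed]] by simp

context onb_space
begin

context
  assumes J: "J = UNIV"
begin

lemma nJ: "{..<n} \<subseteq> J"
  using J by simp

lemma P_closed: "P n \<xi> \<in> carrier H"
  by (rule synth_closed[OF nJ coords_carrier(1)])

lemma P_nrm: "\<xi> \<in> carrier H \<Longrightarrow> hnorm H (P n \<xi>) \<le> hnorm H \<xi>"
  using hnorm_synth[OF nJ coords_carrier(1)] bessel[OF nJ] by simp

lemma P_minus: "x \<in> carrier H \<Longrightarrow> y \<in> carrier H \<Longrightarrow> P n (x \<ominus>\<^bsub>H\<^esub> y) = P n x \<ominus>\<^bsub>H\<^esub> P n y"
  using mat_op_minus[OF nJ one_carrier_mat] unfolding mat_op_one[OF nJ] .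

lemma P_smult: "x \<in> carrier H \<Longrightarrow> P n (c \<odot>\<^bsub>H\<^esub> x) = c \<odot>\<^bsub>H\<^esub> P n x"
  using mat_op_smult[OF nJ one_carrier_mat] unfolding mat_op_one[OF nJ] .

lemma P_tends: "x \<in> carrier H \<Longrightarrow> tends (\<lambda>n. P n x) x"
  by (rule proj_tends) (auto simp: J intro: monoI)

lemma P_complement: "x \<in> carrier H \<Longrightarrow> P n (x \<ominus>\<^bsub>H\<^esub> P n x) = \<zero>\<^bsub>H\<^esub>"
  unfolding P_minus[OF _ P_closed] coords_synth[OF nJ coords_carrier(1)] by (rule h_minus_self[OF P_closed])

text \<open>A norm limit of operators of finite rank is compact: the matrix sends the unit ball into
  a ball of a finite-dimensional space, and a net there yields one for the image under
  \<open>T\<close>.\<close>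

lemma compact_operatorsI:
  assumes T: "T \<in> bounded_operators H"
    and approx: "\<And>\<epsilon>. 0 < \<epsilon> \<Longrightarrow> \<exists>n. \<exists>Y\<in>carrier_mat n n. \<forall>\<xi>\<in>carrier H. hnorm H (T \<xi> \<ominus>\<^bsub>H\<^esub> mat_op n Y \<xi>) \<le> \<epsilon> * hnorm H \<xi>"
  shows "T \<in> compact_operators H"
  unfolding compact_operator_iff hm.mtotally_bounded_def
proof (intro conjI T allI impI)
  fix \<epsilon> :: real assume "0 < \<epsilon>"
  then have "0 < \<epsilon> / 4" by simp
  define B where "B = {x \<in> carrier H. hnorm H x \<le> 1}"
  obtain n Y where Y: "Y \<in> carrier_mat n n"
    and near: "\<And>\<xi>. \<xi> \<in> carrier H \<Longrightarrow> hnorm H (T \<xi> \<ominus>\<^bsub>H\<^esub> mat_op n Y \<xi>) \<le> \<epsilon> / 4 * hnorm H \<xi>"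
    using approx[OF \<open>0 < \<epsilon> / 4\<close>] by blast
  obtain K where K: "finite K" "K \<subseteq> carrier_vec n"
    and net: "\<And>v. v \<in> carrier_vec n \<Longrightarrow> l2_norm v \<le> op_norm Y \<Longrightarrow> \<exists>w\<in>K. l2_norm (v - w) < \<epsilon> / 4"
    using vec_net[OF \<open>0 < \<epsilon> / 4\<close>, of n "op_norm Y"] by blast
  have Tc: "T \<xi> \<in> carrier H" if "\<xi> \<in> B" for \<xi> using that bounded_operatorsD(2)[OF T] unfolding B_def by blast
  have hit: "\<exists>w\<in>K. hnorm H (T \<xi> \<ominus>\<^bsub>H\<^esub> synth w) < \<epsilon> / 2" if "\<xi> \<in> B" for \<xi>
  proof -
    have \<xi>: "\<xi> \<in> carrier H" "hnorm H \<xi> \<le> 1" using that unfolding B_def by blast+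
    define v where "v = Y *\<^sub>v coords n \<xi>"
    have v: "v \<in> carrier_vec n" unfolding v_def by (rule mult_mat_vec_carrier[OF Y coords_carrier(1)])
    have "l2_norm (coords n \<xi>) \<le> 1" using bessel[OF nJ \<xi>(1), of n] \<xi>(2) by linarith
    then have "l2_norm v \<le> op_norm Y"
      unfolding v_def using Y by (intro op_norm_upper) simp_all
    then obtain w where w: "w \<in> K" "l2_norm (v - w) < \<epsilon> / 4" using net[OF v] by blast
    have wc: "w \<in> carrier_vec n" using w(1) K(2) by blast
    have vw: "v - w \<in> carrier_vec n" using v wc by simp
    have "v - w + w = v" using v wc by (intro eq_vecI) auto
    then have "synth v = synth (v - w) \<oplus>\<^bsub>H\<^esub> synth w" using synth_add[OF nJ vw wc] by simp
    then have "hnorm H (synth v \<ominus>\<^bsub>H\<^esub> synth w) = l2_norm (v - w)"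
      using h_add_minus_cancel[OF synth_closed[OF nJ vw] synth_closed[OF nJ wc]] hnorm_synth[OF nJ vw] by simp
    moreover have "hnorm H (T \<xi> \<ominus>\<^bsub>H\<^esub> synth v) \<le> \<epsilon> / 4"
      using order_trans[OF near[OF \<xi>(1)] mult_left_mono[OF \<xi>(2), of "\<epsilon> / 4"]] \<open>0 < \<epsilon>\<close> unfolding mat_op_def v_def by simp
    ultimately have "hnorm H (T \<xi> \<ominus>\<^bsub>H\<^esub> synth w) < \<epsilon> / 2"
      using hnorm_triangle_minus[OF Tc[OF that] synth_closed[OF nJ v] synth_closed[OF nJ wc]] w(2) by linarith
    then show ?thesis using w(1) by blast
  qed
  \<comment> \<open>Total boundedness asks for a net inside the image itself, so each net point that
    is hit is replaced by an image point near it; this doubles \<epsilon>/2 to \<epsilon>.\<close>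
  define W where "W = {w \<in> K. \<exists>\<xi>\<in>B. hnorm H (T \<xi> \<ominus>\<^bsub>H\<^esub> synth w) < \<epsilon> / 2}"
  have "\<forall>w\<in>W. \<exists>\<xi>. \<xi> \<in> B \<and> hnorm H (T \<xi> \<ominus>\<^bsub>H\<^esub> synth w) < \<epsilon> / 2" unfolding W_def by blast
  from bchoice[OF this] obtain g where g: "\<And>w. w \<in> W \<Longrightarrow> g w \<in> B" "\<And>w. w \<in> W \<Longrightarrow> hnorm H (T (g w) \<ominus>\<^bsub>H\<^esub> synth w) < \<epsilon> / 2"
    by blast
  show "\<exists>K. finite K \<and> K \<subseteq> T ` {x \<in> carrier H. hnorm H x \<le> 1} \<and>
      T ` {x \<in> carrier H. hnorm H x \<le> 1} \<subseteq> (\<Union>x\<in>K. hm.mball x \<epsilon>)"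
    unfolding B_def[symmetric]
  proof (intro exI conjI)
    show "finite ((\<lambda>w. T (g w)) ` W)" using K(1) unfolding W_def by simp
    show "(\<lambda>w. T (g w)) ` W \<subseteq> T ` B" using g(1) by blast
    show "T ` B \<subseteq> (\<Union>x\<in>(\<lambda>w. T (g w)) ` W. hm.mball x \<epsilon>)"
    proof (rule image_subsetI)
      fix \<xi> assume \<xi>: "\<xi> \<in> B"
      obtain w where w: "w \<in> K" "hnorm H (T \<xi> \<ominus>\<^bsub>H\<^esub> synth w) < \<epsilon> / 2" using hit[OF \<xi>] by blast
      have W: "w \<in> W" unfolding W_def using w \<xi> by blast
      have sw: "synth w \<in> carrier H" using synth_closed[OF nJ] w(1) K(2) by blast
      note c = Tc[OF \<xi>] Tc[OF g(1)[OF W]]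
      have "hnorm H (T (g w) \<ominus>\<^bsub>H\<^esub> T \<xi>) < \<epsilon>"
        using hnorm_triangle_minus[OF c(2) sw c(1)] g(2)[OF W] w(2) hnorm_minus_commute[OF c(1) sw] by linarith
      then have "T \<xi> \<in> hm.mball (T (g w)) \<epsilon>" using c by (simp add: hdist_def)
      then show "T \<xi> \<in> (\<Union>x\<in>(\<lambda>w. T (g w)) ` W. hm.mball x \<epsilon>)" using W by blast
    qed
  qed
qed

text \<open>With P the projection, T - P T P is T (1 - P) plus (1 - P) T P, and both parts are
  eventually small. \<open>ev1\<close> bounds T on the kernel of P, \<open>ev2\<close> bounds (1 -
  P) T; each reduces to finitely many vectors by a net of the image of the unit ball.\<close>

lemma compact_operator_approx:
  assumes T: "T \<in> compact_operators H" and "0 < \<epsilon>"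
  shows "\<forall>\<^sub>F n in sequentially. \<forall>\<xi>\<in>carrier H. hnorm H (T \<xi> \<ominus>\<^bsub>H\<^esub> P n (T (P n \<xi>))) \<le> \<epsilon> * hnorm H \<xi>"
proof -
  define B where "B = {x \<in> carrier H. hnorm H x \<le> 1}"
  have Tb: "T \<in> bounded_operators H" and tot: "hm.mtotally_bounded (T ` B)"
    using T unfolding compact_operator_iff B_def by blast+
  note Tc = bounded_operatorsD(2)[OF Tb] and T_minus = bounded_op_minus[OF Tb]
  obtain C where C: "0 \<le> C" "\<And>x. x \<in> carrier H \<Longrightarrow> hnorm H (T x) \<le> C * hnorm H x"
    using bounded_operatorsD(5)[OF Tb] by blast
  have net: "\<exists>Y. finite Y \<and> Y \<subseteq> carrier H \<and> (\<forall>x\<in>B. \<exists>y\<in>Y. hnorm H (T x \<ominus>\<^bsub>H\<^esub> y) < \<delta>)" if "0 < \<delta>" for \<delta>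
  proof -
    from tot[unfolded hm.mtotally_bounded_def, rule_format, OF that]
    obtain Y where Y: "finite Y" "Y \<subseteq> T ` B" "T ` B \<subseteq> (\<Union>y\<in>Y. hm.mball y \<delta>)"
      by (elim exE conjE)
    have Yc: "Y \<subseteq> carrier H" using Y(2) Tc unfolding B_def by blast
    have "\<exists>y\<in>Y. hnorm H (T x \<ominus>\<^bsub>H\<^esub> y) < \<delta>" if x: "x \<in> B" for x
    proof -
      obtain y where y: "y \<in> Y" "T x \<in> hm.mball y \<delta>"
        using subsetD[OF Y(3) imageI[OF x]] by (rule UN_E)
      have c: "y \<in> carrier H" "T x \<in> carrier H" using y(2) unfolding hm.in_mball by blast+
      then have "hnorm H (y \<ominus>\<^bsub>H\<^esub> T x) < \<delta>" using y(2) by (simp add: hdist_def)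
      then show ?thesis using y(1) hnorm_minus_commute[OF c] by auto
    qed
    with Y(1) Yc show ?thesis by blast
  qed
  \<comment> \<open>The norm of 1 - P is estimated by 2, so the two parts contribute 2 \<alpha> and
    \<alpha>.\<close>
  define \<alpha> where "\<alpha> = \<epsilon> / 3"
  have "0 < \<alpha>" using \<open>0 < \<epsilon>\<close> by (simp add: \<alpha>_def)
  have ev1: "\<forall>\<^sub>F n in sequentially. \<forall>\<eta>\<in>carrier H. P n \<eta> = \<zero>\<^bsub>H\<^esub> \<longrightarrow> hnorm H (T \<eta>) \<le> \<alpha> * hnorm H \<eta>"
  proof -
    \<comment> \<open>The square of the norm of T x splits at the net point \<open>y\<close>: T x -
      y contributes at most \<delta> C, and the functional of \<open>y\<close> contributes at most
      \<delta> on the kernel of P. The sum is \<alpha> squared.\<close>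
    define \<delta> where "\<delta> = \<alpha>\<^sup>2 / (C + 1)"
    have "0 < \<delta>" using \<open>0 < \<alpha>\<close> C(1) by (simp add: \<delta>_def)
    obtain Y where Y: "finite Y" "Y \<subseteq> carrier H" "\<And>x. x \<in> B \<Longrightarrow> \<exists>y\<in>Y. hnorm H (T x \<ominus>\<^bsub>H\<^esub> y) < \<delta>"
      using net[OF \<open>0 < \<delta>\<close>] by blast
    have "\<forall>\<^sub>F n in sequentially. \<forall>\<xi>\<in>carrier H. P n \<xi> = \<zero>\<^bsub>H\<^esub> \<longrightarrow> cmod (ip H y (T \<xi>)) \<le> \<delta> * hnorm H \<xi>" if "y \<in> Y" for y
    proof (rule functional_tail[where C = "hnorm H y * C"])
      have y: "y \<in> carrier H" using that Y(2) by blast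
      show "0 \<le> hnorm H y * C" using y C(1) by simp
      show "ip H y (T (x \<oplus>\<^bsub>H\<^esub> z)) = ip H y (T x) + ip H y (T z)" if "x \<in> carrier H" "z \<in> carrier H" for x z
        using that bounded_operatorsD(3)[OF Tb that] ip_add[OF y Tc Tc] by simp
      show "ip H y (T (c \<odot>\<^bsub>H\<^esub> x)) = c * ip H y (T x)" if "x \<in> carrier H" for c x
        using bounded_operatorsD(4)[OF Tb that] ip_smult[OF y Tc[OF that]] by simp
      show "cmod (ip H y (T x)) \<le> hnorm H y * C * hnorm H x" if "x \<in> carrier H" for x
        using cauchy_schwarz[OF y Tc[OF that]] mult_left_mono[OF C(2)[OF that] hnorm_nonneg[OF y]] by (simp add: mult.assoc)
    qed (rule J \<open>0 < \<delta>\<close>)+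
    then have "\<forall>\<^sub>F n in sequentially. \<forall>y\<in>Y. \<forall>\<xi>\<in>carrier H. P n \<xi> = \<zero>\<^bsub>H\<^esub> \<longrightarrow> cmod (ip H y (T \<xi>)) \<le> \<delta> * hnorm H \<xi>"
      using Y(1) by (intro eventually_ball_finite) blast+
    then show ?thesis
    proof (rule eventually_mono, intro ballI impI)
      fix n \<eta> assume tail: "\<forall>y\<in>Y. \<forall>\<xi>\<in>carrier H. P n \<xi> = \<zero>\<^bsub>H\<^esub> \<longrightarrow> cmod (ip H y (T \<xi>)) \<le> \<delta> * hnorm H \<xi>"
        and \<eta>: "\<eta> \<in> carrier H" and P0: "P n \<eta> = \<zero>\<^bsub>H\<^esub>"
      show "hnorm H (T \<eta>) \<le> \<alpha> * hnorm H \<eta>"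
      proof (rule ball_scale[OF \<eta>])
        show "hnorm H (T (c \<odot>\<^bsub>H\<^esub> \<eta>)) = cmod c * hnorm H (T \<eta>)" for c
          unfolding bounded_operatorsD(4)[OF Tb \<eta>] by (rule hnorm_smult[OF Tc[OF \<eta>]])
        fix c assume le: "hnorm H (c \<odot>\<^bsub>H\<^esub> \<eta>) \<le> 1"
        define x where "x = c \<odot>\<^bsub>H\<^esub> \<eta>"
        have x: "x \<in> carrier H" "hnorm H x \<le> 1" "P n x = \<zero>\<^bsub>H\<^esub>"
          unfolding x_def P_smult[OF \<eta>] P0 using \<eta> le sm_zero by simp_all
        then obtain y where y: "y \<in> Y" "hnorm H (T x \<ominus>\<^bsub>H\<^esub> y) < \<delta>" using Y(3)[of x] unfolding B_def by blast
        have yc: "y \<in> carrier H" using y(1) Y(2) by blast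
        have Tx: "T x \<in> carrier H" by (rule Tc[OF x(1)])
        have Tle: "hnorm H (T x) \<le> C" using C(2)[OF x(1)] mult_left_mono[OF x(2) C(1)] by simp
        have "(hnorm H (T x))\<^sup>2 = cmod (ip H (T x) (T x))" unfolding ip_self[OF Tx] norm_of_real by simp
        also have "ip H (T x) (T x) = ip H (T x \<ominus>\<^bsub>H\<^esub> y) (T x) + ip H y (T x)"
          by (simp add: ip_minus_left[OF Tx yc Tx])
        also have "cmod \<dots> \<le> hnorm H (T x \<ominus>\<^bsub>H\<^esub> y) * hnorm H (T x) + \<delta> * hnorm H x"
          using norm_triangle_ineq[of "ip H (T x \<ominus>\<^bsub>H\<^esub> y) (T x)" "ip H y (T x)"]
            cauchy_schwarz[OF M.minus_closed[OF Tx yc] Tx] tail y(1) x by fastforce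
        also have "\<dots> \<le> \<delta> * C + \<delta> * 1"
          using y(2) Tle x(1,2) Tx yc \<open>0 < \<delta>\<close> C(1) by (intro add_mono mult_mono) simp_all
        also have "\<dots> = \<delta> * (C + 1)" by (simp only: distrib_left)
        also have "\<dots> = \<alpha>\<^sup>2"
        proof -
          have "C + 1 \<noteq> 0" using C(1) by linarith
          then show ?thesis unfolding \<delta>_def by simp
        qed
        finally show "hnorm H (T (c \<odot>\<^bsub>H\<^esub> \<eta>)) \<le> \<alpha>"
          unfolding x_def[symmetric] by (rule power2_le_imp_le) (use \<open>0 < \<alpha>\<close> in simp)
      qed
    qed
  qed
  have ev2: "\<forall>\<^sub>F n in sequentially. \<forall>\<xi>\<in>carrier H. hnorm H (T \<xi> \<ominus>\<^bsub>H\<^esub> P n (T \<xi>)) \<le> \<alpha> * hnorm H \<xi>"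
  proof -
    define \<delta> where "\<delta> = \<alpha> / 3"
    have "0 < \<delta>" using \<open>0 < \<alpha>\<close> by (simp add: \<delta>_def)
    obtain Y where Y: "finite Y" "Y \<subseteq> carrier H" "\<And>x. x \<in> B \<Longrightarrow> \<exists>y\<in>Y. hnorm H (T x \<ominus>\<^bsub>H\<^esub> y) < \<delta>"
      using net[OF \<open>0 < \<delta>\<close>] by blast
    have "\<forall>\<^sub>F n in sequentially. hnorm H (P n y \<ominus>\<^bsub>H\<^esub> y) < \<delta>" if "y \<in> Y" for y
      using order_tendstoD(2)[OF tendsD(3)[OF P_tends] \<open>0 < \<delta>\<close>] that Y(2) by blast
    then have "\<forall>\<^sub>F n in sequentially. \<forall>y\<in>Y. hnorm H (P n y \<ominus>\<^bsub>H\<^esub> y) < \<delta>"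
      using Y(1) by (intro eventually_ball_finite) blast+
    then show ?thesis
    proof (rule eventually_mono, intro ballI)
      fix n \<xi> assume near: "\<forall>y\<in>Y. hnorm H (P n y \<ominus>\<^bsub>H\<^esub> y) < \<delta>" and \<xi>: "\<xi> \<in> carrier H"
      show "hnorm H (T \<xi> \<ominus>\<^bsub>H\<^esub> P n (T \<xi>)) \<le> \<alpha> * hnorm H \<xi>"
      proof (rule ball_scale[OF \<xi>])
        show "hnorm H (T (c \<odot>\<^bsub>H\<^esub> \<xi>) \<ominus>\<^bsub>H\<^esub> P n (T (c \<odot>\<^bsub>H\<^esub> \<xi>))) = cmod c * hnorm H (T \<xi> \<ominus>\<^bsub>H\<^esub> P n (T \<xi>))" for c
          unfolding bounded_operatorsD(4)[OF Tb \<xi>] P_smult[OF Tc[OF \<xi>]] sm_minus[OF Tc[OF \<xi>] P_closed, symmetric]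
          by (rule hnorm_smult[OF M.minus_closed[OF Tc[OF \<xi>] P_closed]])
        fix c assume le: "hnorm H (c \<odot>\<^bsub>H\<^esub> \<xi>) \<le> 1"
        define x where "x = c \<odot>\<^bsub>H\<^esub> \<xi>"
        have x: "x \<in> carrier H" "x \<in> B" unfolding x_def B_def using \<xi> le by simp_all
        then obtain y where y: "y \<in> Y" "hnorm H (T x \<ominus>\<^bsub>H\<^esub> y) < \<delta>" using Y(3) by blast
        have yc: "y \<in> carrier H" using y(1) Y(2) by blast
        have Tx: "T x \<in> carrier H" by (rule Tc[OF x(1)])
        have "hnorm H (P n y \<ominus>\<^bsub>H\<^esub> P n (T x)) < \<delta>"
          using P_nrm[OF M.minus_closed[OF yc Tx], of n] y(2) hnorm_minus_commute[OF yc Tx] unfolding P_minus[OF yc Tx] by linarith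
        moreover have "hnorm H (y \<ominus>\<^bsub>H\<^esub> P n y) < \<delta>" using near y(1) hnorm_minus_commute[OF yc P_closed] by simp
        ultimately have "hnorm H (T x \<ominus>\<^bsub>H\<^esub> P n (T x)) \<le> \<delta> + (\<delta> + \<delta>)"
          using hnorm_triangle_minus[OF Tx yc P_closed, of n "T x"] hnorm_triangle_minus[OF yc P_closed[of n y] P_closed[of n "T x"]] y(2)
          by linarith
        then show "hnorm H (T (c \<odot>\<^bsub>H\<^esub> \<xi>) \<ominus>\<^bsub>H\<^esub> P n (T (c \<odot>\<^bsub>H\<^esub> \<xi>))) \<le> \<alpha>"
          unfolding x_def[symmetric] by (simp add: \<delta>_def)
      qed
    qed
  qed
  from ev1 ev2 show ?thesis
  proof (rule eventually_elim2, intro ballI)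
    fix n \<xi> assume 1: "\<forall>\<eta>\<in>carrier H. P n \<eta> = \<zero>\<^bsub>H\<^esub> \<longrightarrow> hnorm H (T \<eta>) \<le> \<alpha> * hnorm H \<eta>"
      and 2: "\<forall>\<xi>\<in>carrier H. hnorm H (T \<xi> \<ominus>\<^bsub>H\<^esub> P n (T \<xi>)) \<le> \<alpha> * hnorm H \<xi>" and \<xi>: "\<xi> \<in> carrier H"
    have Pc: "P n \<xi> \<in> carrier H" by (rule P_closed)
    have d: "\<xi> \<ominus>\<^bsub>H\<^esub> P n \<xi> \<in> carrier H" by (rule M.minus_closed[OF \<xi> Pc])
    have "hnorm H (\<xi> \<ominus>\<^bsub>H\<^esub> P n \<xi>) \<le> hnorm H \<xi> + hnorm H (P n \<xi>)"
      using hnorm_triangle[OF \<xi> M.a_inv_closed[OF Pc]] hnorm_uminus[OF Pc] by (simp add: M.minus_eq)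
    then have "hnorm H (\<xi> \<ominus>\<^bsub>H\<^esub> P n \<xi>) \<le> 2 * hnorm H \<xi>" using P_nrm[OF \<xi>, of n] by linarith
    then have "\<alpha> * hnorm H (\<xi> \<ominus>\<^bsub>H\<^esub> P n \<xi>) \<le> \<alpha> * (2 * hnorm H \<xi>)"
      by (rule mult_left_mono) (use \<open>0 < \<alpha>\<close> in simp)
    moreover have "hnorm H (T \<xi> \<ominus>\<^bsub>H\<^esub> T (P n \<xi>)) \<le> \<alpha> * hnorm H (\<xi> \<ominus>\<^bsub>H\<^esub> P n \<xi>)"
      using 1[rule_format, OF d P_complement[OF \<xi>]] unfolding T_minus[OF \<xi> Pc] .
    moreover have "hnorm H (T (P n \<xi>) \<ominus>\<^bsub>H\<^esub> P n (T (P n \<xi>))) \<le> \<alpha> * hnorm H \<xi>"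
      using 2[rule_format, OF Pc] mult_left_mono[OF P_nrm[OF \<xi>, of n], of \<alpha>] \<open>0 < \<alpha>\<close> by linarith
    ultimately have "hnorm H (T \<xi> \<ominus>\<^bsub>H\<^esub> P n (T (P n \<xi>))) \<le> \<alpha> * (2 * hnorm H \<xi>) + \<alpha> * hnorm H \<xi>"
      using hnorm_triangle_minus[OF Tc[OF \<xi>] Tc[OF Pc] P_closed, of n "T (P n \<xi>)"] by linarith
    then show "hnorm H (T \<xi> \<ominus>\<^bsub>H\<^esub> P n (T (P n \<xi>))) \<le> \<epsilon> * hnorm H \<xi>" by (simp add: \<alpha>_def)
  qed
qed

end

end

section \<open>Finite sections as matrices\<close>

context onb_space
begin

context
  assumes J: "J = UNIV"
begin

text \<open>The converse of \<open>mat_op_nrm\<close>, obtained by testing on the vectors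
  \<open>synth v\<close>.\<close>

lemma op_norm_le_mat_op:
  assumes Y: "Y \<in> carrier_mat n n" and "0 \<le> c"
    and le: "\<And>\<xi>. \<xi> \<in> carrier H \<Longrightarrow> hnorm H (mat_op n Y \<xi>) \<le> c * hnorm H \<xi>"
  shows "op_norm Y \<le> c"
proof (rule op_norm_leI[OF \<open>0 \<le> c\<close>])
  fix v :: "complex Matrix.vec" assume "v \<in> carrier_vec (dim_col Y)"
  then have v: "v \<in> carrier_vec n" using Y by simp
  have "Y *\<^sub>v v \<in> carrier_vec n" using Y v by (rule mult_mat_vec_carrier)
  then show "l2_norm (Y *\<^sub>v v) \<le> c * l2_norm v"
    using le[OF synth_closed[OF nJ[OF J] v]] unfolding mat_op_synth[OF nJ[OF J] v]
    by (simp add: hnorm_synth[OF nJ[OF J]] hnorm_synth[OF nJ[OF J] v])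
qed

lemma mat_op_pad:
  assumes Y: "Y \<in> carrier_mat n n"
  shows "mat_op (n + m) (block_sum Y (0\<^sub>m m m)) \<xi> = mat_op n Y \<xi>"
proof -
  let ?w = "Matrix.vec m (\<lambda>i. ip H (e (n + i)) \<xi>)"
  have "coords (n + m) \<xi> = coords n \<xi> @\<^sub>v ?w" by (rule eq_vecI) (auto simp: coords_def)
  moreover have w: "?w \<in> carrier_vec m" by simp
  ultimately have eq: "block_sum Y (0\<^sub>m m m) *\<^sub>v coords (n + m) \<xi> = (Y *\<^sub>v coords n \<xi>) @\<^sub>v 0\<^sub>v m"
    using block_sum_mult_vec[OF Y _ coords_carrier(1) w, of "0\<^sub>m m m" \<xi>] by simp
  have v: "Y *\<^sub>v coords n \<xi> \<in> carrier_vec n" by (rule mult_mat_vec_carrier[OF Y coords_carrier(1)])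
  then have v0: "(Y *\<^sub>v coords n \<xi>) @\<^sub>v 0\<^sub>v m \<in> carrier_vec (n + m)" by simp
  show ?thesis
    unfolding mat_op_def eq
  proof (rule coord_eqI[OF synth_closed[OF nJ[OF J] v0] synth_closed[OF nJ[OF J] v]])
    show "ip H (e j) (synth ((Y *\<^sub>v coords n \<xi>) @\<^sub>v 0\<^sub>v m)) = ip H (e j) (synth (Y *\<^sub>v coords n \<xi>))" if "j \<in> J" for j
      unfolding coord_synth[OF nJ[OF J] v0 that] coord_synth[OF nJ[OF J] v that] using Y by auto
  qed
qed

definition compress :: "nat \<Rightarrow> ('h \<Rightarrow> 'h) \<Rightarrow> complex mat" where
  "compress n T = mat n n (\<lambda>(i, j). ip H (e i) (T (e j)))"

lemma mat_op_compress:
  assumes T: "T \<in> bounded_operators H" and \<xi>: "\<xi> \<in> carrier H"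
  shows "mat_op n (compress n T) \<xi> = P n (T (P n \<xi>))"
proof -
  let ?v = "compress n T *\<^sub>v coords n \<xi>"
  note Tc = bounded_operatorsD(2)[OF T]
  have v: "?v \<in> carrier_vec n" by (rule mult_mat_vec_carrier[of _ _ n]) (simp_all add: compress_def)
  show ?thesis
    unfolding mat_op_def
  proof (rule coord_eqI[OF synth_closed[OF nJ[OF J] v] P_closed[OF J]])
    fix i assume i: "i \<in> J"
    note ei = e_closed[OF i]
    have "ip H (e i) (T (P n \<xi>)) = (\<Sum>j<n. coords n \<xi> $ j * ip H (e i) (T (e j)))"
    proof (rule additive_finsum[of "\<lambda>x. ip H (e i) (T x)", OF _ _ nJ[OF J] coords_carrier(1)])
      show "ip H (e i) (T (x \<oplus>\<^bsub>H\<^esub> y)) = ip H (e i) (T x) + ip H (e i) (T y)" if "x \<in> carrier H" "y \<in> carrier H" for x y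
        unfolding bounded_operatorsD(3)[OF T that] by (rule ip_add[OF ei Tc[OF that(1)] Tc[OF that(2)]])
      show "ip H (e i) (T (c \<odot>\<^bsub>H\<^esub> x)) = c * ip H (e i) (T x)" if "x \<in> carrier H" for c x
        unfolding bounded_operatorsD(4)[OF T that] by (rule ip_smult[OF ei Tc[OF that]])
    qed
    moreover have "?v $ i = (\<Sum>j<n. coords n \<xi> $ j * ip H (e i) (T (e j)))" if "i < n"
      using that by (auto simp: compress_def scalar_prod_def lessThan_atLeast0 mult.commute intro!: sum.cong)
    ultimately show "ip H (e i) (synth ?v) = ip H (e i) (P n (T (P n \<xi>)))"
      unfolding coord_synth[OF nJ[OF J] v i] coord_synth[OF nJ[OF J] coords_carrier(1) i] by simp
  qed
qed

end

end

section \<open>The unitized compact operators as the image of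
  \<open>pair_algebra 1 1\<close>\<close>

declare One_nat_def [simp del]

text \<open>The sizes \<open>1 + n * 1\<close> are written as \<open>Suc\<close>. The parameters of
  the pair diagram are literally \<open>1\<close>, as in \<open>pair_algebra 1 1\<close>; therefore
  simp must not rewrite them to \<open>Suc 0\<close>.\<close>

locale unit_tail = limit_rep "pair_level 1 1" "pair_map 1 1" H e UNIV Suc "tail_rep 1 1"
  for H :: "'h hilbert" and e
begin

abbreviation L :: "nat \<Rightarrow> complex mat list star_alg" where "L \<equiv> pair_level 1 1"
abbreviation f :: "nat \<Rightarrow> complex mat list \<Rightarrow> complex mat list" where "f \<equiv> pair_map 1 1"
abbreviation r :: "nat \<Rightarrow> complex mat list \<Rightarrow> complex mat" where "r \<equiv> tail_rep 1 1"

text \<open>In \<open>pair_algebra 1 1\<close> an element of level \<open>n\<close> acts as \<open>off n b\<close> on the first \<open>n + 1\<close> coordinates plus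
  the scalar \<open>scal b\<close>, and the connecting maps pad \<open>off n b\<close> with zeros.\<close>

definition scal :: "complex mat list \<Rightarrow> complex" where
  "scal b = b ! 0 $$ (0, 0)"

definition off :: "nat \<Rightarrow> complex mat list \<Rightarrow> complex mat" where
  "off n b = r n b + (- scal b) \<cdot>\<^sub>m 1\<^sub>m (Suc n)"

lemma len: "0 < length (dims (pair_diagram 1 1) n)"
  by simp

lemma off_closed: "b \<in> carrier (L n) \<Longrightarrow> off n b \<in> carrier_mat (Suc n) (Suc n)"
  unfolding off_def using r_closed by simp

lemma r_eq: "b \<in> carrier (L n) \<Longrightarrow> r n b = off n b + scal b \<cdot>\<^sub>m 1\<^sub>m (Suc n)"
  unfolding off_def using r_closed[of b n] by (intro eq_matI) auto

lemma mat_op_r: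
  assumes "b \<in> carrier (L n)"
  shows "mat_op (Suc n) (r n b) \<xi> = mat_op (Suc n) (off n b) \<xi> \<oplus>\<^bsub>H\<^esub> scal b \<odot>\<^bsub>H\<^esub> proj n \<xi>"
  unfolding r_eq[OF assms] mat_op_one[OF dJ, symmetric] mat_op_smult_mat[OF dJ one_carrier_mat, symmetric]
  by (rule mat_op_add_mat[OF dJ off_closed[OF assms]]) simp

text \<open>The diagonal entry that the connecting map appends is \<open>scal b\<close>, so
  subtracting the scalar leaves a zero there.\<close>

lemma off_map:
  assumes b: "b \<in> carrier (L n)"
  shows "off (Suc n) (f n b) = block_sum (off n b) (0\<^sub>m 1 1)"
proof (rule eq_matI)
  have r: "r n b \<in> carrier_mat (Suc n) (Suc n)" by (rule r_closed[OF b])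
  have b0: "b ! 0 \<in> carrier_mat 1 1" by (rule pair_nth(1)[OF b])
  fix i j assume "i < dim_row (block_sum (off n b) (0\<^sub>m 1 1))" "j < dim_col (block_sum (off n b) (0\<^sub>m 1 1))"
  then have ij: "i < Suc n + 1" "j < Suc n + 1" using off_closed[OF b] by auto
  have "scal (f n b) = scal b" by (simp add: scal_def pair_map_nth)
  then show "off (Suc n) (f n b) $$ (i, j) = block_sum (off n b) (0\<^sub>m 1 1) $$ (i, j)"
    unfolding off_def tail_rep_map[OF b] using ij r b0
    by (cases "i < Suc n"; cases "j < Suc n") (auto simp: scal_def flip_def less_Suc_eq)
qed (use off_closed[OF b] tail_rep_map[OF b] in \<open>simp_all add: off_def\<close>)

text \<open>Padding by zeros does not change the operator, so along the connecting maps the part off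
  the scalars is one fixed operator of finite rank.\<close>

lemma mat_op_off_connect:
  assumes "m \<le> n" "b \<in> carrier (L m)"
  shows "mat_op (Suc n) (off n (connect f m n b)) \<xi> = mat_op (Suc m) (off m b) \<xi>"
  using assms(1)
proof (induction n rule: dec_induct)
  case (step n)
  have c: "connect f m n b \<in> carrier (L n)" by (rule connect_closed[OF step(1) assms(2)])
  have "mat_op (Suc (Suc n)) (off (Suc n) (connect f m (Suc n) b)) \<xi> = mat_op (Suc n) (off n (connect f m n b)) \<xi>"
    unfolding connect_Suc[OF step(1)] off_map[OF c]
    using mat_op_pad[OF refl off_closed[OF c], of 1 \<xi>] by (simp add: One_nat_def)
  then show ?case using step(3) by simp
qed simp

lemma scal_off_minus:
  assumes x: "x \<in> carrier (L n)" and y: "y \<in> carrier (L n)"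
  shows "scal x = scal (x \<ominus>\<^bsub>L n\<^esub> y) + scal y" and "off n x = off n (x \<ominus>\<^bsub>L n\<^esub> y) + off n y"
proof -
  note D = multimatrix_nth_minus[OF x y len]
  have d: "x \<ominus>\<^bsub>L n\<^esub> y \<in> carrier (L n)" by (rule D(1))
  have d0: "(x \<ominus>\<^bsub>L n\<^esub> y) ! 0 \<in> carrier_mat 1 1" "y ! 0 \<in> carrier_mat 1 1"
    by (rule pair_nth(1)[OF d], rule pair_nth(1)[OF y])
  show s: "scal x = scal (x \<ominus>\<^bsub>L n\<^esub> y) + scal y"
    unfolding scal_def using arg_cong[OF D(2), of "\<lambda>Y. Y $$ (0, 0)"] d0 by simp
  have r: "r n x = r n (x \<ominus>\<^bsub>L n\<^esub> y) + r n y"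
    using r_star_hom(3)[OF d y] unfolding alg.minus_add_cancel[OF x y] .
  show "off n x = off n (x \<ominus>\<^bsub>L n\<^esub> y) + off n y"
    unfolding off_def r s using r_closed[OF d] r_closed[OF y] by (intro eq_matI) (auto simp: algebra_simps)
qed

lemma scal_le:
  assumes b: "b \<in> carrier (L n)" shows "cmod (scal b) \<le> nrm (L n) b"
proof -
  have "cmod (scal b) \<le> op_norm (b ! 0)"
    unfolding scal_def by (rule op_norm_entry[OF pair_nth(1)[OF b]]) simp_all
  then show ?thesis using op_norm_le_multimatrix_nrm[OF b len] by linarith
qed

lemma off_le:
  assumes b: "b \<in> carrier (L n)" shows "op_norm (off n b) \<le> 2 * nrm (L n) b"
proof -
  have "op_norm (off n b) \<le> op_norm (r n b) + op_norm ((- scal b) \<cdot>\<^sub>m 1\<^sub>m (Suc n))"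
    unfolding off_def by (rule op_norm_add[OF r_closed[OF b]]) simp
  moreover have "op_norm ((- scal b) \<cdot>\<^sub>m 1\<^sub>m (Suc n)) \<le> cmod (scal b) * 1"
    using op_norm_smult[of "- scal b" "1\<^sub>m (Suc n)"] mult_left_mono[OF op_norm_one[of "Suc n"] norm_ge_zero[of "scal b"]] by simp
  ultimately show ?thesis using r_nrm[OF b] scal_le[OF b] by linarith
qed

lemma mat_op_off_near:
  assumes x: "x \<in> carrier (L n)" and y: "y \<in> carrier (L n)" and \<xi>: "\<xi> \<in> carrier H"
  shows "hnorm H (mat_op (Suc n) (off n x) \<xi> \<ominus>\<^bsub>H\<^esub> mat_op (Suc n) (off n y) \<xi>) \<le> 2 * nrm (L n) (x \<ominus>\<^bsub>L n\<^esub> y) * hnorm H \<xi>"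
proof -
  have d: "x \<ominus>\<^bsub>L n\<^esub> y \<in> carrier (L n)" by (rule alg.minus_closed[OF x y])
  note c = mat_op_closed[OF dJ off_closed]
  have "mat_op (Suc n) (off n x) \<xi> \<ominus>\<^bsub>H\<^esub> mat_op (Suc n) (off n y) \<xi> = mat_op (Suc n) (off n (x \<ominus>\<^bsub>L n\<^esub> y)) \<xi>"
    unfolding scal_off_minus(2)[OF x y] mat_op_add_mat[OF dJ off_closed[OF d] off_closed[OF y]]
    by (rule h_add_minus_cancel[OF c[OF d] c[OF y]])
  then show ?thesis
    using mat_op_nrm[OF dJ off_closed[OF d] \<xi>] mult_right_mono[OF off_le[OF d] hnorm_nonneg[OF \<xi>]] by simp
qed

lemma trunc_eq:
  assumes "x \<in> cauchy_seqs L f"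
  shows "trunc x n \<xi> = mat_op (Suc n) (off n (x n)) \<xi> \<oplus>\<^bsub>H\<^esub> scal (x n) \<odot>\<^bsub>H\<^esub> proj n \<xi>"
  unfolding trunc_def by (rule mat_op_r[OF cauchy_closed[OF assms]])

text \<open>Since the connecting maps fix the operator of \<open>off\<close>, no projection error
  occurs there, and the truncations are close to the operator of \<open>off N (x N)\<close>
  uniformly in \<xi>, that is in norm. The errors are 2 \<epsilon>/4 for \<open>off\<close> and
  \<epsilon>/4 for the vanishing scalar.\<close>

lemma rep_compact:
  assumes x: "x \<in> cauchy_seqs L f" and lim: "(\<lambda>n. scal (x n)) \<longlonglongrightarrow> 0"
  shows "rep x \<in> compact_operators H"
proof (rule compact_operatorsI[OF refl rep_bounded[OF x]])
  fix \<epsilon> :: real assume "0 < \<epsilon>"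
  then have "0 < \<epsilon> / 4" by simp
  obtain N where N: "\<And>m n. N \<le> m \<Longrightarrow> m \<le> n \<Longrightarrow> nrm (L n) (x n \<ominus>\<^bsub>L n\<^esub> connect f m n (x m)) < \<epsilon> / 4"
    using cauchyD[OF x \<open>0 < \<epsilon> / 4\<close>] by blast
  obtain M where M: "\<And>n. M \<le> n \<Longrightarrow> cmod (scal (x n)) < \<epsilon> / 4"
    using order_tendstoD(2)[OF tendsto_norm_zero[OF lim] \<open>0 < \<epsilon> / 4\<close>] unfolding eventually_sequentially by blast
  note cx = cauchy_closed[OF x]
  let ?Y = "off N (x N)"
  show "\<exists>n. \<exists>Y\<in>carrier_mat n n. \<forall>\<xi>\<in>carrier H. hnorm H (rep x \<xi> \<ominus>\<^bsub>H\<^esub> mat_op n Y \<xi>) \<le> \<epsilon> * hnorm H \<xi>"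
  proof (rule exI, rule bexI[OF _ off_closed[OF cx]], rule ballI)
    fix \<xi> assume \<xi>: "\<xi> \<in> carrier H"
    let ?z = "mat_op (Suc N) ?Y \<xi>"
    have z: "?z \<in> carrier H" by (rule mat_op_closed[OF dJ off_closed[OF cx]])
    have t: "trunc x n \<xi> \<in> carrier H" for n by (rule trunc_closed[OF cauchy_bounded[OF x]])
    have bound: "hnorm H (trunc x n \<xi> \<ominus>\<^bsub>H\<^esub> ?z) \<le> \<epsilon> * hnorm H \<xi>" if n: "max N M \<le> n" for n
    proof -
      have nN: "N \<le> n" and nM: "M \<le> n" using n by simp_all
      let ?a = "mat_op (Suc n) (off n (x n)) \<xi>" and ?b = "scal (x n) \<odot>\<^bsub>H\<^esub> proj n \<xi>"
      have a: "?a \<in> carrier H" by (rule mat_op_closed[OF dJ off_closed[OF cx]])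
      have b: "?b \<in> carrier H" by (rule sm_closed[OF proj_closed])
      have y: "connect f N n (x N) \<in> carrier (L n)" by (rule connect_closed[OF nN cx])
      have "hnorm H (?a \<ominus>\<^bsub>H\<^esub> ?z) \<le> 2 * nrm (L n) (x n \<ominus>\<^bsub>L n\<^esub> connect f N n (x N)) * hnorm H \<xi>"
        using mat_op_off_near[OF cx y \<xi>] unfolding mat_op_off_connect[OF nN cx] .
      moreover have "2 * nrm (L n) (x n \<ominus>\<^bsub>L n\<^esub> connect f N n (x N)) * hnorm H \<xi> \<le> 2 * (\<epsilon> / 4) * hnorm H \<xi>"
        using N[OF order_refl nN] \<xi> by (intro mult_right_mono) simp_all
      moreover have "hnorm H ?b \<le> \<epsilon> / 4 * hnorm H \<xi>"
        unfolding hnorm_smult[OF proj_closed]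
        using M[OF nM] P_nrm[OF refl \<xi>, of "Suc n"] proj_closed \<open>0 < \<epsilon>\<close> by (intro mult_mono) simp_all
      moreover have "trunc x n \<xi> \<ominus>\<^bsub>H\<^esub> ?z = (?a \<ominus>\<^bsub>H\<^esub> ?z) \<oplus>\<^bsub>H\<^esub> ?b"
        unfolding trunc_eq[OF x] using a b z by (simp add: M.minus_eq M.a_ac)
      moreover have "0 \<le> \<epsilon> * hnorm H \<xi>" using \<open>0 < \<epsilon>\<close> \<xi> by simp
      ultimately show ?thesis
        using hnorm_triangle[OF M.minus_closed[OF a z] b] by simp
    qed
    have "tends (\<lambda>n. trunc x n \<xi> \<ominus>\<^bsub>H\<^esub> ?z) (rep x \<xi> \<ominus>\<^bsub>H\<^esub> ?z)"
      using tends_add[OF rep_tends[OF x \<xi>] tends_const[OF M.a_inv_closed[OF z]]] by (simp add: M.minus_eq)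
    from LIMSEQ_le_const2[OF tends_hnorm[OF this]] bound
    show "hnorm H (rep x \<xi> \<ominus>\<^bsub>H\<^esub> ?z) \<le> \<epsilon> * hnorm H \<xi>" by blast
  qed
qed

text \<open>The scalars of \<open>x\<close> converge, by \<open>corner_tends\<close>, to some
  \<open>l\<close>. Subtracting \<open>l\<close> times the unit leaves a sequence with null scalars,
  whose representation is compact.\<close>

lemma rep_unitized:
  assumes x: "x \<in> cauchy_seqs L f"
  shows "rep x \<in> carrier (unitized_compacts H)"
proof -
  define l where "l = corner 1 x $$ (0, 0)"
  define u where "u = (\<lambda>n. \<one>\<^bsub>L n\<^esub>)"
  define v where "v = (\<lambda>n. (- l) \<odot>\<^bsub>L n\<^esub> u n)"
  define y where "y = (\<lambda>n. x n \<oplus>\<^bsub>L n\<^esub> v n)"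
  have u: "u \<in> cauchy_seqs L f" using cauchy_one unfolding u_def bounded_prod_simps .
  have v: "v \<in> cauchy_seqs L f" using cauchy_smult[OF u] unfolding v_def bounded_prod_simps .
  have y: "y \<in> cauchy_seqs L f" using cauchy_add[OF x v] unfolding y_def bounded_prod_simps .
  note hom = star_homD(4-6)[OF rep_hom, unfolded cauchy_alg_simps bounded_prod_simps operator_alg_simps]
  have ru: "rep u = (\<lambda>x\<in>carrier H. x)" using hom(2) unfolding u_def .
  have rv: "rep v = (\<lambda>x\<in>carrier H. (- l) \<odot>\<^bsub>H\<^esub> rep u x)" using hom(3)[OF u] unfolding v_def .
  have ry: "rep y = (\<lambda>\<xi>\<in>carrier H. rep x \<xi> \<oplus>\<^bsub>H\<^esub> rep v \<xi>)" using hom(1)[OF x v] unfolding y_def .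
  have "scal (y n) = scal (x n) + - l" for n
  proof -
    have h: "(\<lambda>xs. xs ! 0) \<in> star_hom (L n) (matrix_alg 1)"
      using contractive_hom_hom[OF nth_contractive[OF len]] by simp
    have un: "u n ! 0 = 1\<^sub>m 1" using star_hom_one[OF h] unfolding u_def by simp
    have "v n ! 0 = (- l) \<cdot>\<^sub>m 1\<^sub>m 1" using star_hom_smult[OF h cauchy_closed[OF u]] unfolding v_def un by simp
    then have "y n ! 0 = x n ! 0 + (- l) \<cdot>\<^sub>m 1\<^sub>m 1"
      using star_hom_add[OF h cauchy_closed[OF x] cauchy_closed[OF v]] unfolding y_def by simp
    then show ?thesis unfolding scal_def by simp
  qed
  moreover have "(\<lambda>n. scal (x n)) \<longlonglongrightarrow> l"
    unfolding scal_def l_def by (rule corner_tends[OF x]) simp_all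
  ultimately have "(\<lambda>n. scal (y n)) \<longlonglongrightarrow> 0"
    using tendsto_add[OF _ tendsto_const[of "- l"], of "\<lambda>n. scal (x n)" l] by simp
  then have K: "rep y \<in> compact_operators H" by (rule rep_compact[OF y])
  have "rep x = (\<lambda>\<xi>\<in>carrier H. (\<lambda>\<xi>\<in>carrier H. l \<odot>\<^bsub>H\<^esub> (\<lambda>\<xi>\<in>carrier H. \<xi>) \<xi>) \<xi> \<oplus>\<^bsub>H\<^esub> rep y \<xi>)"
  proof (rule extensionalityI[OF bounded_operatorsD(1)[OF rep_bounded[OF x]] restrict_extensional])
    fix \<xi> assume \<xi>: "\<xi> \<in> carrier H"
    have c: "rep x \<xi> \<in> carrier H" "l \<odot>\<^bsub>H\<^esub> \<xi> \<in> carrier H" "(- l) \<odot>\<^bsub>H\<^esub> \<xi> \<in> carrier H"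
      using rep_closed[OF x \<xi>] sm_closed[OF \<xi>] by blast+
    have "(- l) \<odot>\<^bsub>H\<^esub> \<xi> = \<ominus>\<^bsub>H\<^esub> (l \<odot>\<^bsub>H\<^esub> \<xi>)"
      using sm_minus_one[OF c(2)] smult_assoc1[of "- 1" l \<xi>] \<xi> by simp
    then have "l \<odot>\<^bsub>H\<^esub> \<xi> \<oplus>\<^bsub>H\<^esub> (rep x \<xi> \<oplus>\<^bsub>H\<^esub> (- l) \<odot>\<^bsub>H\<^esub> \<xi>) = rep x \<xi>"
      using h_minus_add_cancel[OF c(1,2)] c by (simp add: M.minus_eq M.a_ac)
    then show "rep x \<xi> = (\<lambda>\<xi>\<in>carrier H. (\<lambda>\<xi>\<in>carrier H. l \<odot>\<^bsub>H\<^esub> (\<lambda>\<xi>\<in>carrier H. \<xi>) \<xi>) \<xi> \<oplus>\<^bsub>H\<^esub> rep y \<xi>) \<xi>"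
      unfolding ry rv ru using \<xi> by simp
  qed
  then show ?thesis
    unfolding unitized_compacts_def using K by (simp add: operator_alg_simps) blast
qed

text \<open>A preimage of c 1 + K consists of the finite sections of K plus the scalar
  \<open>c\<close>. It is Cauchy because the sections converge to K in norm, which is where
  compactness is used.\<close>

lemma unitized_rep:
  assumes T: "T \<in> carrier (unitized_compacts H)"
  shows "\<exists>x\<in>cauchy_seqs L f. rep x = T"
proof -
  obtain c K where K: "K \<in> compact_operators H"
    and T_eq: "T = c \<odot>\<^bsub>operator_alg H\<^esub> \<one>\<^bsub>operator_alg H\<^esub> \<oplus>\<^bsub>operator_alg H\<^esub> K"
    using T unfolding unitized_compacts_def by auto
  have Kb: "K \<in> bounded_operators H" using K unfolding compact_operator_iff by blast
  obtain C where C: "0 \<le> C" "\<And>\<xi>. \<xi> \<in> carrier H \<Longrightarrow> hnorm H (K \<xi>) \<le> C * hnorm H \<xi>"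
    using bounded_operatorsD(5)[OF Kb] by blast
  define Z where "Z n = compress (Suc n) K" for n
  have Z: "Z n \<in> carrier_mat (Suc n) (Suc n)" for n by (simp add: Z_def compress_def[OF refl])
  note mZ = mat_op_compress[OF refl Kb, of _ "Suc n" for n, folded Z_def]
  \<comment> \<open>The second summand is stored in reversed order because \<open>tail_rep\<close>
    reverses it again.\<close>
  define x where "x n = [c \<cdot>\<^sub>m 1\<^sub>m 1, perm_mat (flip (Suc n)) (Z n + c \<cdot>\<^sub>m 1\<^sub>m (Suc n))]" for n
  have cx: "x n \<in> carrier (L n)" for n
    unfolding multimatrix_carrier using Z[of n] by (auto simp: x_def less_Suc_eq numeral_2_eq_2 One_nat_def)
  have scal: "scal (x n) = c" for n by (simp add: scal_def x_def)
  have W: "Z n + c \<cdot>\<^sub>m 1\<^sub>m (Suc n) \<in> carrier_mat (Suc n) (Suc n)" for n using Z[of n] by simp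
  have r: "r n (x n) = Z n + c \<cdot>\<^sub>m 1\<^sub>m (Suc n)" for n
    using perm_mat_flip_flip[OF W] by (simp add: tail_rep_def x_def One_nat_def)
  have off: "off n (x n) = Z n" for n
    unfolding off_def r scal using Z[of n] by (intro eq_matI) auto
  have Z_le: "op_norm (Z n) \<le> C" for n
  proof (rule op_norm_le_mat_op[OF refl Z C(1)])
    fix \<xi> assume \<xi>: "\<xi> \<in> carrier H"
    have Pc: "proj n \<xi> \<in> carrier H" by (rule proj_closed)
    show "hnorm H (mat_op (Suc n) (Z n) \<xi>) \<le> C * hnorm H \<xi>"
      unfolding mZ[OF \<xi>]
      using P_nrm[OF refl bounded_operatorsD(2)[OF Kb Pc], of "Suc n"] C(2)[OF Pc]
        mult_left_mono[OF P_nrm[OF refl \<xi>, of "Suc n"] C(1)] by linarith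
  qed
  have xb: "x \<in> carrier (bounded_prod L)"
  proof (rule bounded_prodI[OF cx])
    fix n
    have c1: "op_norm (c \<cdot>\<^sub>m 1\<^sub>m m) \<le> cmod c" for m
      using op_norm_smult[of c "1\<^sub>m m"] mult_left_mono[OF op_norm_one[of m] norm_ge_zero[of c]] by simp
    have "op_norm (Z n + c \<cdot>\<^sub>m 1\<^sub>m (Suc n)) \<le> C + cmod c"
      using op_norm_add[OF Z[of n], of "c \<cdot>\<^sub>m 1\<^sub>m (Suc n)"] Z_le[of n] c1[of "Suc n"] by simp
    then show "nrm (L n) (x n) \<le> C + cmod c"
      unfolding multimatrix_simps x_def using op_norm_perm_mat[OF flip_permutes W[of n]] c1[of 1] C(1) by simp
  qed
  have x: "x \<in> cauchy_seqs L f"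
  proof (rule cauchy_seqsI[OF xb])
    fix \<epsilon> :: real assume "0 < \<epsilon>"
    then have "0 < \<epsilon> / 3" by simp
    obtain N where N: "\<And>n \<xi>. N \<le> n \<Longrightarrow> \<xi> \<in> carrier H \<Longrightarrow>
        hnorm H (K \<xi> \<ominus>\<^bsub>H\<^esub> synth (coords n (K (synth (coords n \<xi>))))) \<le> \<epsilon> / 3 * hnorm H \<xi>"
      using compact_operator_approx[OF refl K \<open>0 < \<epsilon> / 3\<close>] unfolding eventually_sequentially by blast
    have "nrm (L n) (x n \<ominus>\<^bsub>L n\<^esub> connect f N n (x N)) < \<epsilon>" if n: "N \<le> n" for n
    proof -
      let ?y = "connect f N n (x N)"
      let ?D = "x n \<ominus>\<^bsub>L n\<^esub> ?y"
      have y: "?y \<in> carrier (L n)" by (rule connect_closed[OF n cx])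
      have D: "?D \<in> carrier (L n)" by (rule alg.minus_closed[OF cx y])
      have "scal ?y = c" unfolding scal_def pair_connect_nth_0 by (rule scal[unfolded scal_def])
      then have sD: "scal ?D = 0" using scal_off_minus(1)[OF cx y] scal by simp
      have D0: "?D ! 0 \<in> carrier_mat 1 1" by (rule pair_nth(1)[OF D])
      have "?D ! 0 = 0\<^sub>m 1 1" using D0 sD unfolding scal_def by (intro eq_matI) auto
      then have n0: "op_norm (?D ! 0) = 0" by simp
      have rD: "r n ?D = off n ?D" unfolding r_eq[OF D] sD using off_closed[OF D] by (intro eq_matI) auto
      \<comment> \<open>The scalars agree, so the difference acts as section \<open>n\<close> minus
        section \<open>N\<close>; each is within \<epsilon>/3 of K.\<close>
      have "op_norm (r n ?D) \<le> 2 * (\<epsilon> / 3)"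
        unfolding rD
      proof (rule op_norm_le_mat_op[OF refl off_closed[OF D]])
        fix \<xi> assume \<xi>: "\<xi> \<in> carrier H"
        note c = mat_op_closed[OF dJ off_closed]
        have "mat_op (Suc n) (Z n) \<xi> = mat_op (Suc n) (off n ?D) \<xi> \<oplus>\<^bsub>H\<^esub> mat_op (Suc N) (Z N) \<xi>"
          using mat_op_add_mat[OF dJ off_closed[OF D] off_closed[OF y], of \<xi>]
          unfolding scal_off_minus(2)[OF cx y, symmetric] mat_op_off_connect[OF n cx] off .
        then have eq: "mat_op (Suc n) (off n ?D) \<xi> = mat_op (Suc n) (Z n) \<xi> \<ominus>\<^bsub>H\<^esub> mat_op (Suc N) (Z N) \<xi>"
          using h_add_minus_cancel[OF c[OF D] mat_op_closed[OF dJ Z]] by simp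
        have Kc: "K \<xi> \<in> carrier H" by (rule bounded_operatorsD(2)[OF Kb \<xi>])
        have m: "mat_op (Suc k) (Z k) \<xi> \<in> carrier H" for k by (rule mat_op_closed[OF dJ Z])
        have near: "hnorm H (K \<xi> \<ominus>\<^bsub>H\<^esub> mat_op (Suc k) (Z k) \<xi>) \<le> \<epsilon> / 3 * hnorm H \<xi>" if "N \<le> k" for k
          unfolding mZ[OF \<xi>] by (rule N[OF le_SucI[OF that] \<xi>])
        show "hnorm H (mat_op (Suc n) (off n ?D) \<xi>) \<le> 2 * (\<epsilon> / 3) * hnorm H \<xi>"
          unfolding eq using hnorm_triangle_minus[OF m[of n] Kc m[of N]] near[OF n] near[OF order_refl]
            hnorm_minus_commute[OF Kc m[of n]] by simp
      qed (use \<open>0 < \<epsilon>\<close> in simp)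
      moreover have "op_norm (?D ! 1) = op_norm (r n ?D)"
        unfolding tail_rep_def by (rule op_norm_perm_mat[symmetric, OF flip_permutes]) (rule pair_nth(2)[OF D])
      ultimately have "op_norm (?D ! k) \<le> 2 * (\<epsilon> / 3)" if "k < 2" for k
        using n0 less_2_cases[OF that] \<open>0 < \<epsilon>\<close> by (auto simp: One_nat_def)
      then have "nrm (L n) ?D \<le> 2 * (\<epsilon> / 3)"
        by (subst multimatrix_nrm_le_iff[OF D]) (simp_all add: numeral_2_eq_2)
      then show ?thesis using \<open>0 < \<epsilon>\<close> by simp
    qed
    then show "\<exists>N. \<forall>n\<ge>N. nrm (L n) (x n \<ominus>\<^bsub>L n\<^esub> connect f N n (x N)) < \<epsilon>" by blast
  qed
  have "rep x = T"
    unfolding T_eq operator_alg_simps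
  proof (rule rep_extI[OF x restrict_extensional])
    fix \<xi> assume \<xi>: "\<xi> \<in> carrier H"
    have Kc: "K \<xi> \<in> carrier H" by (rule bounded_operatorsD(2)[OF Kb \<xi>])
    have m: "mat_op (Suc n) (Z n) \<xi> \<in> carrier H" for n by (rule mat_op_closed[OF dJ Z])
    have "tends (\<lambda>n. mat_op (Suc n) (Z n) \<xi>) (K \<xi>)"
      unfolding tends_def
    proof (intro conjI)
      show "(\<lambda>n. hnorm H (mat_op (Suc n) (Z n) \<xi> \<ominus>\<^bsub>H\<^esub> K \<xi>)) \<longlonglongrightarrow> 0"
      proof (rule LIMSEQ_I)
        fix \<epsilon> :: real assume "0 < \<epsilon>"
        define \<delta> where "\<delta> = \<epsilon> / (hnorm H \<xi> + 1)"
        have pos: "0 < hnorm H \<xi> + 1" using hnorm_nonneg[OF \<xi>] by linarith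
        then have "0 < \<delta>" using \<open>0 < \<epsilon>\<close> by (simp add: \<delta>_def)
        obtain N where N: "\<And>n \<xi>. N \<le> n \<Longrightarrow> \<xi> \<in> carrier H \<Longrightarrow>
            hnorm H (K \<xi> \<ominus>\<^bsub>H\<^esub> synth (coords n (K (synth (coords n \<xi>))))) \<le> \<delta> * hnorm H \<xi>"
          using compact_operator_approx[OF refl K \<open>0 < \<delta>\<close>] unfolding eventually_sequentially by blast
        have "hnorm H (mat_op (Suc n) (Z n) \<xi> \<ominus>\<^bsub>H\<^esub> K \<xi>) < \<epsilon>" if "N \<le> n" for n
        proof -
          have "hnorm H (mat_op (Suc n) (Z n) \<xi> \<ominus>\<^bsub>H\<^esub> K \<xi>) \<le> \<delta> * hnorm H \<xi>"
            unfolding hnorm_minus_commute[OF m Kc] unfolding mZ[OF \<xi>] by (rule N[OF le_SucI[OF that] \<xi>])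
          also have "\<dots> < \<delta> * (hnorm H \<xi> + 1)" using \<open>0 < \<delta>\<close> by simp
          also have "\<dots> = \<epsilon>" using pos by (simp add: \<delta>_def)
          finally show ?thesis .
        qed
        then have "\<forall>n\<ge>N. norm (hnorm H (mat_op (Suc n) (Z n) \<xi> \<ominus>\<^bsub>H\<^esub> K \<xi>) - 0) < \<epsilon>"
          using hnorm_nonneg[OF M.minus_closed[OF m Kc]] by simp
        then show "\<exists>N. \<forall>n\<ge>N. norm (hnorm H (mat_op (Suc n) (Z n) \<xi> \<ominus>\<^bsub>H\<^esub> K \<xi>) - 0) < \<epsilon>" by blast
      qed
    qed (use m Kc in blast)+
    then have "tends (\<lambda>n. trunc x n \<xi>) (K \<xi> \<oplus>\<^bsub>H\<^esub> c \<odot>\<^bsub>H\<^esub> \<xi>)"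
      unfolding trunc_eq[OF x] off scal by (rule tends_add[OF _ tends_smult[OF proj_tends[OF \<xi>]]])
    then show "tends (\<lambda>n. trunc x n \<xi>) ((\<lambda>x\<in>carrier H. (\<lambda>x\<in>carrier H. c \<odot>\<^bsub>H\<^esub> (\<lambda>x\<in>carrier H. x) x) x \<oplus>\<^bsub>H\<^esub> K x) \<xi>)"
      using \<xi> M.a_comm[OF Kc sm_closed[OF \<xi>, of c]] by simp
  qed
  then show ?thesis using x by blast
qed

end

section \<open>Primitive ideals\<close>

lemma (in unit_tail) unitized_hom:
  "\<exists>t\<in>star_hom (pair_algebra 1 1) (unitized_compacts H).
    t ` carrier (pair_algebra 1 1) = carrier (unitized_compacts H) \<and>
    (\<forall>b\<in>carrier (pair_algebra 1 1). t b = \<zero>\<^bsub>unitized_compacts H\<^esub> \<longleftrightarrow> b = \<zero>\<^bsub>pair_algebra 1 1\<^esub>)"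
proof -
  obtain t where t: "t \<in> star_hom (cstar_limit L f) (operator_alg H)"
    and t_rep: "\<And>x. x \<in> cauchy_seqs L f \<Longrightarrow> t (limit_class L x) = rep x"
    using limit_rep by blast
  have image: "t ` carrier (cstar_limit L f) = carrier (unitized_compacts H)"
  proof (rule subset_antisym)
    show "t ` carrier (cstar_limit L f) \<subseteq> carrier (unitized_compacts H)"
      unfolding limit_carrier image_image
      by (rule image_subsetI) (simp only: t_rep rep_unitized)
    show "carrier (unitized_compacts H) \<subseteq> t ` carrier (cstar_limit L f)"
    proof
      fix T assume "T \<in> carrier (unitized_compacts H)"
      then obtain x where x: "x \<in> cauchy_seqs L f" "rep x = T" using unitized_rep by blast
      then have "t (limit_class L x) = T" using t_rep by simp
      then show "T \<in> t ` carrier (cstar_limit L f)" unfolding limit_carrier using x(1) by blast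
    qed
  qed
  have ops: "mult (unitized_compacts H) = mult (operator_alg H)" "one (unitized_compacts H) = one (operator_alg H)"
    "zero (unitized_compacts H) = zero (operator_alg H)" "add (unitized_compacts H) = add (operator_alg H)"
    "smult (unitized_compacts H) = smult (operator_alg H)" "star (unitized_compacts H) = star (operator_alg H)"
    by (simp_all add: unitized_compacts_def)
  have "t \<in> star_hom (cstar_limit L f) (unitized_compacts H)"
  proof (rule star_homI, unfold ops)
    show "t b \<in> carrier (unitized_compacts H)" if "b \<in> carrier (cstar_limit L f)" for b
      using imageI[OF that, of t] unfolding image .
  qed (rule star_homD(3-)[OF t]; assumption)+
  moreover have "t b = \<zero>\<^bsub>unitized_compacts H\<^esub> \<longleftrightarrow> b = \<zero>\<^bsub>cstar_limit L f\<^esub>" if b: "b \<in> carrier (cstar_limit L f)" for b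
  proof -
    obtain x where x: "x \<in> cauchy_seqs L f" and b: "b = limit_class L x"
      using b unfolding limit_carrier by (rule imageE)
    show ?thesis unfolding b t_rep[OF x] ops by (rule rep_faithful[OF tail_faithful x])
  qed
  ultimately show ?thesis unfolding pair_algebra_def af_algebra_def using image by blast
qed

lemma unit_tail:
  assumes "onb_space H e UNIV"
  shows "unit_tail H e"
proof -
  have U: "(\<Union>n. {..<1 + n * 1}) = (UNIV :: nat set)" by auto
  have d: "(\<lambda>n. 1 + n * 1) = Suc" by auto
  show ?thesis
    using tail_limit_rep[of H e 1 1] assms unfolding unit_tail_def U d by blast
qed

lemma pair_star_algebra: "star_algebra (pair_algebra q q')"
  unfolding pair_algebra_def af_algebra_def by (rule star_system.limit_algebra[OF pair_system])

lemma pair_faithful_rep: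
  assumes "0 < q'"
  shows "\<exists>(H :: (nat \<Rightarrow> complex mat list) set hilbert) \<pi>. irreducible_rep (pair_algebra q q') H \<pi> \<and>
    (\<forall>b\<in>carrier (pair_algebra q q'). \<pi> b = \<zero>\<^bsub>operator_alg H\<^esub> \<longleftrightarrow> b = \<zero>\<^bsub>pair_algebra q q'\<^esub>)"
  unfolding pair_algebra_def af_algebra_def
proof (rule exI, rule limit_rep.faithful_irreducible[OF tail_limit_rep[OF model_onb]])
  have "0 \<in> (\<Union>n. {..<q' + n * q})" using assms by auto
  then show "(\<Union>n. {..<q' + n * q}) \<noteq> {}" by blast
qed (rule tail_faithful)

text \<open>The first summand gives a \<open>limit_rep\<close> of constant size \<open>q\<close>.
  Its kernel is that of \<open>corner\<close>: both vanish exactly if the entries of the first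
  summand tend to 0.\<close>

lemma pair_corner_rep:
  assumes "0 < q"
  shows "\<exists>(H :: (nat \<Rightarrow> complex mat list) set hilbert) \<pi>. \<exists>t\<in>star_hom (pair_algebra q q') (matrix_alg q).
    irreducible_rep (pair_algebra q q') H \<pi> \<and> t ` carrier (pair_algebra q q') = carrier (matrix_alg q) \<and>
    (\<forall>b\<in>carrier (pair_algebra q q'). \<pi> b = \<zero>\<^bsub>operator_alg H\<^esub> \<longleftrightarrow> t b = \<zero>\<^bsub>matrix_alg q\<^esub>)"
proof -
  let ?A = "pair_level q q'" and ?\<phi> = "pair_map q q'"
  let ?H = "model_space {..<q}" and ?e = "\<lambda>j. {seq_embed (\<lambda>i. of_bool (i = j))}"
  note sys = pair_system[of q q']
  have len: "0 < length (dims (pair_diagram q q') n)" for n by simp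
  have nth: "dims (pair_diagram q q') n ! 0 = q" for n by simp
  have lr: "limit_rep ?A ?\<phi> ?H ?e {..<q} (\<lambda>_. q) (\<lambda>_ b. b ! 0)"
  proof (rule limit_rep.intro[OF sys model_onb], rule limit_rep_axioms.intro)
    show "mono (\<lambda>_ :: nat. q)" by (rule monoI) simp
    show "{..<q} = (\<Union>n :: nat. {..<q})" by simp
    show "(\<lambda>b. b ! 0) \<in> contractive_hom (?A n) (matrix_alg q)" for n
      using nth_contractive[OF len[of n]] unfolding nth .
    show "\<exists>b\<in>carrier (?A n). b ! 0 = Y \<and> nrm (?A n) b \<le> op_norm Y" if "Y \<in> carrier_mat q q" for n Y
      using nth_lift[OF len[of n], of Y] that unfolding nth .
    show "?\<phi> n b ! 0 $$ (i, j) = (if i < q then b ! 0 $$ (i, j) else 0)" if "i < q" for n b i j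
      using that by (simp add: pair_map_nth)
  qed
  obtain \<pi> where \<pi>: "\<pi> \<in> star_hom (cstar_limit ?A ?\<phi>) (operator_alg ?H)"
    and \<pi>_rep: "\<And>x. x \<in> cauchy_seqs ?A ?\<phi> \<Longrightarrow> \<pi> (limit_class ?A x) = limit_rep.rep ?H ?e (\<lambda>_. q) (\<lambda>_ b. b ! 0) x"
    using limit_rep.limit_rep[OF lr] by blast
  have "{..<q} \<noteq> {}" using assms by auto
  then have irr: "irreducible_rep (cstar_limit ?A ?\<phi>) ?H \<pi>" by (rule limit_rep.rep_irreducible[OF lr _ \<pi> \<pi>_rep])
  have "\<exists>t\<in>star_hom (cstar_limit ?A ?\<phi>) (matrix_alg q). \<forall>x\<in>cauchy_seqs ?A ?\<phi>. t (limit_class ?A x) = corner q x"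
  proof (rule star_system.limit_lift[OF sys corner_hom corner_null])
    fix t assume t: "t \<in> star_hom (cstar_limit ?A ?\<phi>) (matrix_alg q)"
      and corner: "\<And>x. x \<in> cauchy_seqs ?A ?\<phi> \<Longrightarrow> t (limit_class ?A x) = corner q x"
    show ?thesis by (rule bexI[OF _ t]) (rule ballI[OF corner])
  qed
  then obtain t where t: "t \<in> star_hom (cstar_limit ?A ?\<phi>) (matrix_alg q)"
    and t_corner: "\<And>x. x \<in> cauchy_seqs ?A ?\<phi> \<Longrightarrow> t (limit_class ?A x) = corner q x"
    by blast
  note carrier = star_system.limit_carrier[OF sys]
  have surj: "t ` carrier (cstar_limit ?A ?\<phi>) = carrier (matrix_alg q)"
  proof (rule subset_antisym)
    show "t ` carrier (cstar_limit ?A ?\<phi>) \<subseteq> carrier (matrix_alg q)"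
      by (rule image_subsetI) (rule star_hom_closed[OF t])
    show "carrier (matrix_alg q) \<subseteq> t ` carrier (cstar_limit ?A ?\<phi>)"
    proof
      fix Y assume "Y \<in> carrier (matrix_alg q)"
      then have Y: "Y \<in> carrier_mat q q" by simp
      obtain b where b: "b \<in> carrier (?A 0)" "b ! 0 = Y"
        using nth_lift[OF len[of 0], of Y] Y unfolding nth by blast
      let ?x = "star_system.thread ?A ?\<phi> 0 b"
      have x: "?x \<in> cauchy_seqs ?A ?\<phi>" by (rule star_system.thread_cauchy[OF sys b(1)])
      have "?x n ! 0 = Y" for n 
        unfolding star_system.thread_def[OF sys] by (simp add: pair_connect_nth_0 b(2) del: pair_dims)
      then have "corner q ?x = Y" by (intro corner_eqI[OF x Y]) simp
      then have "t (limit_class ?A ?x) = Y" using t_corner[OF x] by simp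
      then show "Y \<in> t ` carrier (cstar_limit ?A ?\<phi>)" unfolding carrier using x by blast
    qed
  qed
  have kernel: "\<pi> b = \<zero>\<^bsub>operator_alg ?H\<^esub> \<longleftrightarrow> t b = \<zero>\<^bsub>matrix_alg q\<^esub>" if b: "b \<in> carrier (cstar_limit ?A ?\<phi>)" for b
  proof -
    obtain x where x: "x \<in> cauchy_seqs ?A ?\<phi>" and b: "b = limit_class ?A x"
      using b unfolding carrier by (rule imageE)
    have "(\<forall>i<q. \<forall>j<q. (\<lambda>n. x n ! 0 $$ (i, j)) \<longlonglongrightarrow> 0) \<longleftrightarrow> corner q x = 0\<^sub>m q q"
    proof
      assume "\<forall>i<q. \<forall>j<q. (\<lambda>n. x n ! 0 $$ (i, j)) \<longlonglongrightarrow> 0"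
      then show "corner q x = 0\<^sub>m q q" by (intro corner_eqI[OF x]) simp_all
    next
      assume 0: "corner q x = 0\<^sub>m q q"
      show "\<forall>i<q. \<forall>j<q. (\<lambda>n. x n ! 0 $$ (i, j)) \<longlonglongrightarrow> 0"
        using corner_tends[OF x] unfolding 0 by simp
    qed
    then show ?thesis
      unfolding b \<pi>_rep[OF x] t_corner[OF x] limit_rep.rep_eq_zero_iff[OF lr x] matrix_alg_simps
        op_norm_tendsto_zero_iff[OF pair_nth(1)[OF star_system.cauchy_closed[OF sys x]]] .
  qed
  show ?thesis
    unfolding pair_algebra_def af_algebra_def
    by (rule exI[of _ ?H], rule exI[of _ \<pi>], rule bexI[OF _ t]) (intro conjI ballI irr surj kernel)
qed

lemma primitive_quotient_faithful:
  fixes A :: "'a star_alg" and H :: "'a hilbert"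
  assumes "star_algebra A" "star_algebra B" "h \<in> star_hom A B" "h ` carrier A = carrier B" "irreducible_rep B H \<pi>"
    and "\<And>b. b \<in> carrier B \<Longrightarrow> \<pi> b = \<zero>\<^bsub>operator_alg H\<^esub> \<longleftrightarrow> b = \<zero>\<^bsub>B\<^esub>"
  shows "\<exists>I. primitive_ideal A I \<and> star_quot A I \<simeq>\<^sub>* B"
  by (rule primitive_quotient[OF assms(1) star_algebra_ring[OF assms(2)] assms(3-5) star_hom_id]) (simp_all add: assms(6))

theorem pascal_effros_shen_quotient:
  assumes "\<And>n. 1 \<le> a n"
  shows "\<exists>I. primitive_ideal pascal_algebra I \<and> star_quot pascal_algebra I \<simeq>\<^sub>* af_algebra (es_diagram a)"
proof -
  obtain h where h: "h \<in> star_hom pascal_algebra (af_algebra (es_diagram a))"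
    "h ` carrier pascal_algebra = carrier (af_algebra (es_diagram a))"
    using pascal_onto_effros_shen[of a, OF assms] by blast
  from effros_shen_rep[of a, OF assms]
  obtain H :: "(nat \<Rightarrow> complex mat list) set hilbert" and \<pi> where \<pi>: "irreducible_rep (af_algebra (es_diagram a)) H \<pi>"
    and faithful: "\<forall>b\<in>carrier (af_algebra (es_diagram a)).
      \<pi> b = \<zero>\<^bsub>operator_alg H\<^esub> \<longleftrightarrow> b = \<zero>\<^bsub>af_algebra (es_diagram a)\<^esub>"
    by (elim exE conjE)
  have "star_algebra (af_algebra (es_diagram a))"
    unfolding af_algebra_def by (rule star_system.limit_algebra[OF es_system])
  then show ?thesis by (rule primitive_quotient_faithful[OF pascal_star_algebra _ h \<pi> bspec[OF faithful]])
qed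

theorem pascal_pair_quotient:
  assumes q: "0 < q" "0 < q'" "coprime q q'"
  shows "\<exists>I. primitive_ideal pascal_algebra I \<and> star_quot pascal_algebra I \<simeq>\<^sub>* pair_algebra q q'"
proof -
  obtain h where h: "h \<in> star_hom pascal_algebra (pair_algebra q q')"
    "h ` carrier pascal_algebra = carrier (pair_algebra q q')"
    using pascal_onto_pair[OF q] by blast
  obtain H :: "(nat \<Rightarrow> complex mat list) set hilbert" and \<pi> where \<pi>: "irreducible_rep (pair_algebra q q') H \<pi>"
    "\<And>b. b \<in> carrier (pair_algebra q q') \<Longrightarrow> \<pi> b = \<zero>\<^bsub>operator_alg H\<^esub> \<longleftrightarrow> b = \<zero>\<^bsub>pair_algebra q q'\<^esub>"
    using pair_faithful_rep[OF q(2), of q] by blast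
  show ?thesis by (rule primitive_quotient_faithful[OF pascal_star_algebra pair_star_algebra h \<pi>])
qed

text \<open>Every \<open>pair_algebra q q'\<close> has this quotient; the partner 1 is taken because
  it is coprime to every \<open>q\<close>.\<close>

theorem pascal_matrix_quotient:
  assumes "0 < q"
  shows "\<exists>I. primitive_ideal pascal_algebra I \<and> star_quot pascal_algebra I \<simeq>\<^sub>* matrix_alg q"
proof -
  obtain h where h: "h \<in> star_hom pascal_algebra (pair_algebra q 1)"
    "h ` carrier pascal_algebra = carrier (pair_algebra q 1)"
    using pascal_onto_pair[OF assms, of 1] by auto
  obtain H :: "(nat \<Rightarrow> complex mat list) set hilbert" and \<pi> t where
    t: "t \<in> star_hom (pair_algebra q 1) (matrix_alg q)" and \<pi>: "irreducible_rep (pair_algebra q 1) H \<pi>"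
    and surj: "t ` carrier (pair_algebra q 1) = carrier (matrix_alg q)"
    and kernel: "\<And>b. b \<in> carrier (pair_algebra q 1) \<Longrightarrow> \<pi> b = \<zero>\<^bsub>operator_alg H\<^esub> \<longleftrightarrow> t b = \<zero>\<^bsub>matrix_alg q\<^esub>"
    using pair_corner_rep[OF assms, of 1] by blast
  have "t \<zero>\<^bsub>pair_algebra q 1\<^esub> = \<zero>\<^bsub>matrix_alg q\<^esub>"
    using star_hom_matrix_zero[OF pair_star_algebra t] by simp
  then show ?thesis
    by (rule primitive_quotient[OF pascal_star_algebra star_algebra_ring[OF pair_star_algebra] h \<pi> t surj _ kernel])
qed

text \<open>Primitivity comes from the faithful representation on the model space, the isomorphism
  from the representation on \<open>K\<close>; both have kernel zero on
  \<open>pair_algebra 1 1\<close>.\<close>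

theorem pascal_unitized_quotient:
  assumes "onb_space K e UNIV"
  shows "\<exists>I. primitive_ideal pascal_algebra I \<and> star_quot pascal_algebra I \<simeq>\<^sub>* unitized_compacts K"
proof -
  obtain h where h: "h \<in> star_hom pascal_algebra (pair_algebra 1 1)"
    "h ` carrier pascal_algebra = carrier (pair_algebra 1 1)"
    using pascal_onto_pair[of 1 1] by auto
  obtain H :: "(nat \<Rightarrow> complex mat list) set hilbert" and \<pi> where \<pi>: "irreducible_rep (pair_algebra 1 1) H \<pi>"
    and faithful: "\<And>b. b \<in> carrier (pair_algebra 1 1) \<Longrightarrow> \<pi> b = \<zero>\<^bsub>operator_alg H\<^esub> \<longleftrightarrow> b = \<zero>\<^bsub>pair_algebra 1 1\<^esub>"
    using pair_faithful_rep[of 1 1] by auto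
  obtain t where t: "t \<in> star_hom (pair_algebra 1 1) (unitized_compacts K)"
    and surj: "t ` carrier (pair_algebra 1 1) = carrier (unitized_compacts K)"
    and kernel: "\<And>b. b \<in> carrier (pair_algebra 1 1) \<Longrightarrow> t b = \<zero>\<^bsub>unitized_compacts K\<^esub> \<longleftrightarrow> b = \<zero>\<^bsub>pair_algebra 1 1\<^esub>"
    using unit_tail.unitized_hom[OF unit_tail[OF assms]] by blast
  note ring = star_algebra_ring[OF pair_star_algebra[of 1 1]]
  have "t \<zero>\<^bsub>pair_algebra 1 1\<^esub> = \<zero>\<^bsub>unitized_compacts K\<^esub>"
    using kernel[OF ring.ring_simprules(2)[OF ring]] by simp
  then show ?thesis
    by (rule primitive_quotient[OF pascal_star_algebra ring h \<pi> t surj]) (simp only: faithful kernel)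
qed

theorem proposition4:
  fixes H :: "'h hilbert"
  assumes "hilbert_space H"
    and "separable_space (htopology H)"
    and "\<not> vectorspace.fin_dim class_ring H"
  shows
    "(\<forall>\<theta>::real. 0 < \<theta> \<and> \<theta> < 1 \<and> \<theta> \<notin> \<rat> \<longrightarrow>
        (\<exists>I. primitive_ideal pascal_algebra I \<and>
             star_quot pascal_algebra I \<simeq>\<^sub>* effros_shen \<theta>)) \<and>
     (\<forall>p q pbar :: nat. 0 < p \<and> p < q \<and> coprime p q \<and>
          pbar \<in> {1..q - 1} \<and> [p * pbar = 1] (mod q) \<longrightarrow>
        (\<exists>I Iplus Iminus.
           primitive_ideal pascal_algebra I \<and>
           primitive_ideal pascal_algebra Iplus \<and>
           primitive_ideal pascal_algebra Iminus \<and>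
           star_quot pascal_algebra I \<simeq>\<^sub>* matrix_alg q \<and>
           star_quot pascal_algebra Iminus \<simeq>\<^sub>* pair_algebra q pbar \<and>
           star_quot pascal_algebra Iplus \<simeq>\<^sub>* pair_algebra q (q - pbar))) \<and>
     (\<exists>I0 I0plus I1 I1minus.
        primitive_ideal pascal_algebra I0 \<and>
        primitive_ideal pascal_algebra I0plus \<and>
        primitive_ideal pascal_algebra I1 \<and>
        primitive_ideal pascal_algebra I1minus \<and>
        star_quot pascal_algebra I0 \<simeq>\<^sub>* complex_alg \<and>
        star_quot pascal_algebra I1 \<simeq>\<^sub>* complex_alg \<and>
        star_quot pascal_algebra I0plus \<simeq>\<^sub>* unitized_compacts H \<and>
        star_quot pascal_algebra I1minus \<simeq>\<^sub>* unitized_compacts H)"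
proof (intro conjI allI impI)
  fix \<theta> :: real assume \<theta>: "0 < \<theta> \<and> \<theta> < 1 \<and> \<theta> \<notin> \<rat>"
  then have "1 \<le> cf_digit \<theta> n" for n by (intro cf_digit_pos) simp_all
  then show "\<exists>I. primitive_ideal pascal_algebra I \<and> star_quot pascal_algebra I \<simeq>\<^sub>* effros_shen \<theta>"
    unfolding effros_shen_def es_diagram_eq by (rule pascal_effros_shen_quotient)
next
  fix p q pbar :: nat
  assume "0 < p \<and> p < q \<and> coprime p q \<and> pbar \<in> {1..q - 1} \<and> [p * pbar = 1] (mod q)"
  then have q: "0 < q" and pbar: "0 < pbar" "pbar < q" and inverse: "[pbar * p = Suc 0] (mod q)"
    by (auto simp: mult.commute One_nat_def)
  \<comment> \<open>Being invertible modulo \<open>q\<close>, \<open>pbar\<close> is coprime to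
    \<open>q\<close>; so is its difference from \<open>q\<close>, and both pairs occur as
    neighbours.\<close>
  have "coprime pbar q" using inverse coprime_iff_invertible_nat by blast
  then have "coprime q pbar" and "coprime q (q - pbar)"
    using pbar gcd_diff2_nat[of pbar q] by (simp_all add: coprime_iff_gcd_eq_1 gcd.commute)
  moreover obtain I where "primitive_ideal pascal_algebra I" "star_quot pascal_algebra I \<simeq>\<^sub>* matrix_alg q"
    using pascal_matrix_quotient[OF q] by blast
  moreover obtain Iminus where "primitive_ideal pascal_algebra Iminus" "star_quot pascal_algebra Iminus \<simeq>\<^sub>* pair_algebra q pbar"
    using pascal_pair_quotient[OF q pbar(1)] \<open>coprime q pbar\<close> by blast
  moreover have "0 < q - pbar" using pbar(2) by simp
  then obtain Iplus where "primitive_ideal pascal_algebra Iplus" "star_quot pascal_algebra Iplus \<simeq>\<^sub>* pair_algebra q (q - pbar)"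
    using pascal_pair_quotient[OF q _ \<open>coprime q (q - pbar)\<close>] by blast
  ultimately show "\<exists>I Iplus Iminus.
      primitive_ideal pascal_algebra I \<and>
      primitive_ideal pascal_algebra Iplus \<and>
      primitive_ideal pascal_algebra Iminus \<and>
      star_quot pascal_algebra I \<simeq>\<^sub>* matrix_alg q \<and>
      star_quot pascal_algebra Iminus \<simeq>\<^sub>* pair_algebra q pbar \<and>
      star_quot pascal_algebra Iplus \<simeq>\<^sub>* pair_algebra q (q - pbar)"
    by blast
next
  have pos: "(0 :: nat) < 1" by simp
  \<comment> \<open>The ideals at the two endpoints may coincide, so one ideal with one-dimensional
    quotient and one with quotient the unitized compacts serve for both.\<close>
  obtain I where I: "primitive_ideal pascal_algebra I" "star_quot pascal_algebra I \<simeq>\<^sub>* matrix_alg 1"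
    using pascal_matrix_quotient[OF pos] by blast
  note I1 = star_isomorphic_trans[OF I(2) matrix_alg_1_complex]
  obtain e where "onb_space H e UNIV"
    using hilbert_space.separable_onb[OF assms] by blast
  then obtain K where K: "primitive_ideal pascal_algebra K" "star_quot pascal_algebra K \<simeq>\<^sub>* unitized_compacts H"
    using pascal_unitized_quotient by blast
  show "\<exists>I0 I0plus I1 I1minus.
      primitive_ideal pascal_algebra I0 \<and>
      primitive_ideal pascal_algebra I0plus \<and>
      primitive_ideal pascal_algebra I1 \<and>
      primitive_ideal pascal_algebra I1minus \<and>
      star_quot pascal_algebra I0 \<simeq>\<^sub>* complex_alg \<and>
      star_quot pascal_algebra I1 \<simeq>\<^sub>* complex_alg \<and>
      star_quot pascal_algebra I0plus \<simeq>\<^sub>* unitized_compacts H \<and>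
      star_quot pascal_algebra I1minus \<simeq>\<^sub>* unitized_compacts H"
    using I(1) I1 K by blast
qed

end
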